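(* (Nullstellensatz for PDE) Let $P$ be an $A$-submodule of $A^k$. (i) If $\mathcal{F}=\mathcal{D}'$ or $\mathcal{F}=\mathcal{C}^\infty$, then $P$ is closed with respect to $\mathcal{F}$. In (ii)–(iv) let $P=P_1\cap\cdots\cap P_r$ be an irredundant primary decomposition of $P$ in $A^k$, where $P_i$ is $p_i$-primary, and let $\mathcal{V}(p_i)\subset\mathbb{C}^n$ be the variety of the prime ideal $p_i$. (ii) Let $\mathcal{F}=\mathcal{S}'$. Suppose $\mathcal{V}(p_i)$ contains real points (points of $\mathbb{R}^n$) for $i=1,\ldots,q$ and not for $i=q+1,\ldots,r$. Then $\bar{P}_{\mathcal{F}}=P_1\cap\cdots\cap P_q$. Thus $P$ is closed with respect to $\mathcal{S}'$ if and only if every $\mathcal{V}(p_i)$ contains real points. (iii) Let $\mathcal{F}=\mathcal{C}^\infty(\mathsf{PT})[x_1,\ldots,x_n]$. Suppose $\mathcal{V}(p_i)$ contains rational points (points of $\mathbb{Q}^n$) for $i=1,\ldots,q$ and not for $i=q+1,\ldots,r$. Then $\bar{P}_{\mathcal{F}}=P_1\cap\cdots\cap P_q$. Thus $P$ is closed with respect to $\mathcal{F}$ if and only if every $\mathcal{V}(p_i)$ contains rational points. (iv) Let $\mathcal{F}=\mathcal{C}^\infty(\mathsf{T})[x_1,\ldots,x_n]$. Suppose $\mathcal{V}(p_i)$ contains integral points (points of $\mathbb{Z}^n$) for $i=1,\ldots,q$ and not for $i=q+1,\ldots,r$. Then $\bar{P}_{\mathcal{F}}=P_1\cap\cdots\cap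 P_q$. Thus $P$ is closed with respect to $\mathcal{F}$ if and only if every $\mathcal{V}(p_i)$ contains integral points. (v) Let $\mathcal{F}$ be $\mathcal{D}$, $\mathcal{E}'$ or $\mathcal{S}$. Let $P=P_0\cap P_1\cap\cdots\cap P_r$ be an irredundant primary decomposition of $P$ in $A^k$, where $P_0$ is a $0$-primary submodule of $A^k$ (with $P_0=A^k$ if $P$ has no $0$-primary component) and, for $i\geq 1$, $P_i$ is $p_i$-primary with $p_i$ a nonzero prime. Then $\bar{P}_{\mathcal{F}}=P_0$. Thus $P$ is closed with respect to $\mathcal{F}$ if and only if $A^k/P$ is torsion free.
   Context: $A=\mathbb{C}[D_1,\ldots,D_n]$, $D_j=\frac{1}{\imath}\partial_j$, is the ring of constant coefficient partial differential operators on $\mathbb{R}^n$, acting by differentiation on the space $\mathcal{D}'$ of distributions on $\mathbb{R}^n$. Elements of $A$ are identified with polynomials in $\mathbb{C}[x_1,\ldots,x_n]$ via $D_j\leftrightarrow x_j$, so that an ideal of $A$ has a variety in $\mathbb{C}^n$. $\mathcal{C}^\infty$, $\mathcal{S}'$, $\mathcal{S}$, $\mathcal{E}'$, $\mathcal{D}$ denote respectively the smooth functions, tempered distributions, Schwartz functions, compactly supported distributions and compactly supported smooth functions on $\mathbb{R}^n$. $\mathcal{C}^\infty(\mathsf{T})$ is the space of smooth functions $\mathbb{R}^n\to\mathbb{C}$ periodic with respect to the lattice $2\pi\mathbb{Z}^n$. $\mathcal{C}^\infty(\mathsf{PT})=\bigcup_{N\geq 1}\mathcal{C}^\infty(\mathbb{R}^n/2\pi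 N\mathbb{Z}^n)$ is the space of smooth functions on $\mathbb{R}^n$ periodic with respect to $2\pi N\mathbb{Z}^n$ for some integer $N\ge 1$. $\mathcal{C}^\infty(\mathsf{T})[x_1,\ldots,x_n]$ and $\mathcal{C}^\infty(\mathsf{PT})[x_1,\ldots,x_n]$ are the subalgebras of $\mathcal{C}^\infty(\mathbb{R}^n)$ obtained by adjoining the coordinate functions $x_1,\ldots,x_n$; all are $A$-submodules of $\mathcal{D}'$. For an $A$-submodule $\mathcal{F}\subset\mathcal{D}'$ and a submodule $P\subset A^k$, $\mathrm{Ker}_{\mathcal{F}}(P)=\{f\in\mathcal{F}^k : \sum_j p_j(D)f_j=0 \text{ for all } (p_1,\ldots,p_k)\in P\}$. The closure $\bar{P}_{\mathcal{F}}$ of $P$ with respect to $\mathcal{F}$ is the submodule of all $p(D)\in A^k$ with $p(D)f=0$ for all $f\in\mathrm{Ker}_{\mathcal{F}}(P)$; $P$ is closed with respect to $\mathcal{F}$ if $P=\bar{P}_{\mathcal{F}}$. A submodule $N$ of $A^k$ is $p$-primary if $\mathrm{Ass}(A^k/N)=\{p\}$. An irredundant primary decomposition is one in which the primes $p_i$ are distinct and no component can be omitted. An empty intersection of submodules of $A^k$ is $A^k$. *)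

theory Defs
  imports "HOL-Analysis.Analysis" "HOL-Library.Poly_Mapping"
begin

text \<open>
  The ring $A = \mathbb{C}[D_1, \ldots, D_n]$, identified with $\mathbb{C}[x_1, \ldots, x_n]$:
  finitely supported maps from multi-indices to coefficients, with the convolution product.
  The index type \<^typ>\<open>'n\<close> plays the role of $\{1, \ldots, n\}$, and \<^typ>\<open>'k\<close> below that of
  $\{1, \ldots, k\}$; the module $A^k$ is \<open>('n pdo)^'k\<close> with the scalar product \<open>*s\<close>.
\<close>

type_synonym 'n pdo = "('n \<Rightarrow>\<^sub>0 nat) \<Rightarrow>\<^sub>0 complex"

definition poly_eval :: "'n::finite pdo \<Rightarrow> complex^'n \<Rightarrow> complex" where
  "poly_eval p z =
    (\<Sum>\<alpha>\<in>Poly_Mapping.keys p. Poly_Mapping.lookup p \<alpha> * (\<Prod>i\<in>UNIV. (z $ i) ^ Poly_Mapping.lookup \<alpha> i))"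

definition variety :: "'n::finite pdo set \<Rightarrow> (complex^'n) set" where
  "variety I = {z. \<forall>p\<in>I. poly_eval p z = 0}"

definition real_points :: "(complex^'n::finite) set" where
  "real_points = {z. \<forall>i. z $ i \<in> \<real>}"

definition rational_points :: "(complex^'n::finite) set" where
  "rational_points = {z. \<forall>i. z $ i \<in> \<rat>}"

definition integral_points :: "(complex^'n::finite) set" where
  "integral_points = {z. \<forall>i. z $ i \<in> \<int>}"

definition prime_ideal :: "'a::comm_ring_1 set \<Rightarrow> bool" where
  "prime_ideal I \<longleftrightarrow> module.subspace (*) I \<and> I \<noteq> UNIV \<and>
     (\<forall>a b. a * b \<in> I \<longrightarrow> a \<in> I \<or> b \<in> I)"

text \<open>
  The set $\mathrm{Ass}(A^k/N)$: the set \<open>{a. a *s m \<in> N}\<close> is the annihilator of the class of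
  \<open>m\<close> in the quotient.
\<close>

definition Ass_quotient :: "('a::comm_ring_1^'k::finite) set \<Rightarrow> 'a set set" where
  "Ass_quotient N = {I. prime_ideal I \<and> (\<exists>m. I = {a. a *s m \<in> N})}"

definition primary_submodule :: "'a::comm_ring_1 set \<Rightarrow> ('a^'k::finite) set \<Rightarrow> bool" where
  "primary_submodule \<pp> N \<longleftrightarrow> module.subspace (*s) N \<and> Ass_quotient N = {\<pp>}"

text \<open>The index set \<open>I\<close> may be empty, in which case \<open>P\<close> is the whole module.\<close>

definition irredundant_primary_decomposition ::
    "('a::comm_ring_1^'k::finite) set \<Rightarrow> nat set \<Rightarrow> (nat \<Rightarrow> ('a^'k) set) \<Rightarrow> (nat \<Rightarrow> 'a set) \<Rightarrow> bool"
  where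
  "irredundant_primary_decomposition P I Q \<pp> \<longleftrightarrow>
     finite I \<and>
     (\<forall>i\<in>I. primary_submodule (\<pp> i) (Q i)) \<and>
     P = (\<Inter>i\<in>I. Q i) \<and>
     inj_on \<pp> I \<and>
     (\<forall>j\<in>I. (\<Inter>i\<in>I - {j}. Q i) \<noteq> P)"

definition torsion_free_quotient :: "('a::comm_ring_1^'k::finite) set \<Rightarrow> bool" where
  "torsion_free_quotient P \<longleftrightarrow> (\<forall>a m. a \<noteq> 0 \<and> a *s m \<in> P \<longrightarrow> m \<in> P)"

definition D_fun :: "'n::finite \<Rightarrow> (real^'n \<Rightarrow> complex) \<Rightarrow> (real^'n \<Rightarrow> complex)" where
  "D_fun j f = (\<lambda>x. (1 / \<i>) * frechet_derivative f (at x) (axis j 1))"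

definition smooth :: "(real^'n::finite \<Rightarrow> complex) \<Rightarrow> bool" where
  "smooth f \<longleftrightarrow> (\<forall>js. foldr D_fun js f differentiable_on UNIV)"

text \<open>
  For a family of operators \<open>d j\<close> that commute on the argument, the iterate $d^\alpha$, in
  which \<open>d j\<close> occurs $\alpha_j$ times. As \<^typ>\<open>'n\<close> carries no order, the order of the
  factors is an arbitrary choice; it is irrelevant for partial derivatives of smooth functions
  and of distributions.
\<close>

definition iterate_multi ::
    "('n::finite \<Rightarrow> 'f \<Rightarrow> 'f) \<Rightarrow> ('n \<Rightarrow>\<^sub>0 nat) \<Rightarrow> 'f \<Rightarrow> 'f" where
  "iterate_multi d \<alpha> = foldr d (SOME js. \<forall>j. count_list js j = Poly_Mapping.lookup \<alpha> j)"

definition mdeg :: "('n::finite \<Rightarrow>\<^sub>0 nat) \<Rightarrow> nat" where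
  "mdeg \<alpha> = (\<Sum>i\<in>UNIV. Poly_Mapping.lookup \<alpha> i)"

definition supp :: "(real^'n::finite \<Rightarrow> complex) \<Rightarrow> (real^'n) set" where
  "supp f = closure {x. f x \<noteq> 0}"

definition test_functions :: "(real^'n::finite \<Rightarrow> complex) set" where
  "test_functions = {f. smooth f \<and> compact (supp f)}"

definition monomial_fun :: "('n::finite \<Rightarrow>\<^sub>0 nat) \<Rightarrow> real^'n \<Rightarrow> real" where
  "monomial_fun \<beta> x = (\<Prod>i\<in>UNIV. (x $ i) ^ Poly_Mapping.lookup \<beta> i)"

definition schwartz_functions :: "(real^'n::finite \<Rightarrow> complex) set" where
  "schwartz_functions = {f. smooth f \<and>
     (\<forall>\<alpha> \<beta>. bounded (range (\<lambda>x. of_real (monomial_fun \<beta> x) * iterate_multi D_fun \<alpha> f x)))}"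

definition schwartz_seminorm :: "nat \<Rightarrow> (real^'n::finite \<Rightarrow> complex) \<Rightarrow> real" where
  "schwartz_seminorm N f =
     (\<Sum>\<alpha> | mdeg \<alpha> \<le> N. \<Sum>\<beta> | mdeg \<beta> \<le> N.
        (SUP x. norm (of_real (monomial_fun \<beta> x) * iterate_multi D_fun \<alpha> f x)))"

definition C_seminorm :: "nat \<Rightarrow> (real^'n::finite \<Rightarrow> complex) \<Rightarrow> real" where
  "C_seminorm N f = (\<Sum>\<alpha> | mdeg \<alpha> \<le> N. (SUP x. norm (iterate_multi D_fun \<alpha> f x)))"

definition linear_functional_on ::
    "(real^'n::finite \<Rightarrow> complex) set \<Rightarrow> ((real^'n \<Rightarrow> complex) \<Rightarrow> complex) \<Rightarrow> bool" where
  "linear_functional_on V u \<longleftrightarrow>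
     (\<forall>\<phi>\<in>V. \<forall>\<psi>\<in>V. u (\<lambda>x. \<phi> x + \<psi> x) = u \<phi> + u \<psi>) \<and>
     (\<forall>c. \<forall>\<phi>\<in>V. u (\<lambda>x. c * \<phi> x) = c * u \<phi>)"

text \<open>
  A distribution is a functional on test functions, made total by the value \<open>0\<close> elsewhere.
  Continuity for the inductive limit topology is expressed by the usual seminorm estimates on
  each compact set.
\<close>

type_synonym 'n distr = "(real^'n \<Rightarrow> complex) \<Rightarrow> complex"

definition distributions :: "'n::finite distr set" where
  "distributions = {u.
     (\<forall>\<phi>. \<phi> \<notin> test_functions \<longrightarrow> u \<phi> = 0) \<and>
     linear_functional_on test_functions u \<and>
     (\<forall>K. compact K \<longrightarrow>
        (\<exists>C N. \<forall>\<phi>\<in>test_functions. supp \<phi> \<subseteq> K \<longrightarrow> norm (u \<phi>) \<le> C * C_seminorm N \<phi>))}"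

definition distr_of :: "(real^'n::finite \<Rightarrow> complex) \<Rightarrow> 'n distr" where
  "distr_of f = (\<lambda>\<phi>. if \<phi> \<in> test_functions then (LINT x|lborel. f x * \<phi> x) else 0)"

text \<open>$D_j$ on distributions, the transpose of $-D_j$ on test functions.\<close>

definition D_distr :: "'n::finite \<Rightarrow> 'n distr \<Rightarrow> 'n distr" where
  "D_distr j u = (\<lambda>\<phi>. if \<phi> \<in> test_functions then - u (D_fun j \<phi>) else 0)"

definition pdo_apply :: "'n::finite pdo \<Rightarrow> 'n distr \<Rightarrow> 'n distr" where
  "pdo_apply p u =
    (\<lambda>\<phi>. \<Sum>\<alpha>\<in>Poly_Mapping.keys p. Poly_Mapping.lookup p \<alpha> * iterate_multi D_distr \<alpha> u \<phi>)"

definition system_apply ::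
    "('n::finite pdo)^'k::finite \<Rightarrow> ('n distr)^'k \<Rightarrow> 'n distr" where
  "system_apply p f = (\<lambda>\<phi>. \<Sum>j\<in>UNIV. pdo_apply (p $ j) (f $ j) \<phi>)"

definition Ker ::
    "'n::finite distr set \<Rightarrow> (('n pdo)^'k::finite) set \<Rightarrow> (('n distr)^'k) set" where
  "Ker F P = {f. (\<forall>j. f $ j \<in> F) \<and> (\<forall>p\<in>P. system_apply p f = (\<lambda>_. 0))}"

definition closure_wrt ::
    "'n::finite distr set \<Rightarrow> (('n pdo)^'k::finite) set \<Rightarrow> (('n pdo)^'k) set" where
  "closure_wrt F P = {p. \<forall>f\<in>Ker F P. system_apply p f = (\<lambda>_. 0)}"

definition closed_wrt :: "'n::finite distr set \<Rightarrow> (('n pdo)^'k::finite) set \<Rightarrow> bool" where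
  "closed_wrt F P \<longleftrightarrow> P = closure_wrt F P"

definition smooth_distributions :: "'n::finite distr set" where
  "smooth_distributions = distr_of ` {f. smooth f}"

definition test_distributions :: "'n::finite distr set" where
  "test_distributions = distr_of ` test_functions"

definition schwartz_distributions :: "'n::finite distr set" where
  "schwartz_distributions = distr_of ` schwartz_functions"

text \<open>Restrictions to test functions of continuous linear functionals on the Schwartz space.\<close>

definition tempered_distributions :: "'n::finite distr set" where
  "tempered_distributions = {u \<in> distributions.
     \<exists>v. linear_functional_on schwartz_functions v \<and>
         (\<exists>C N. \<forall>\<phi>\<in>schwartz_functions. norm (v \<phi>) \<le> C * schwartz_seminorm N \<phi>) \<and>
         (\<forall>\<phi>\<in>test_functions. u \<phi> = v \<phi>)}"

definition compactly_supported_distributions :: "'n::finite distr set" where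
  "compactly_supported_distributions = {u \<in> distributions.
     \<exists>K. compact K \<and> (\<forall>\<phi>\<in>test_functions. supp \<phi> \<inter> K = {} \<longrightarrow> u \<phi> = 0)}"

definition periodic_smooth :: "nat \<Rightarrow> (real^'n::finite \<Rightarrow> complex) set" where
  "periodic_smooth N = {f. smooth f \<and>
     (\<forall>(m :: 'n \<Rightarrow> int) x. f (x + (\<chi> i. 2 * pi * real N * of_int (m i))) = f x)}"

definition smooth_T :: "(real^'n::finite \<Rightarrow> complex) set" where
  "smooth_T = periodic_smooth 1"

definition smooth_PT :: "(real^'n::finite \<Rightarrow> complex) set" where
  "smooth_PT = (\<Union>N\<in>{1..}. periodic_smooth N)"

text \<open>
  The subalgebra generated by \<open>B\<close> and the coordinate functions; \<open>B\<close> is meant to be an algebra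
  containing the constants, so that no separate rule for scalars is needed.
\<close>

inductive_set adjoin_coordinates ::
    "(real^'n::finite \<Rightarrow> complex) set \<Rightarrow> (real^'n \<Rightarrow> complex) set"
  for B :: "(real^'n \<Rightarrow> complex) set" where
  base: "f \<in> B \<Longrightarrow> f \<in> adjoin_coordinates B"
| coord: "(\<lambda>x. of_real (x $ i)) \<in> adjoin_coordinates B"
| add: "f \<in> adjoin_coordinates B \<Longrightarrow> g \<in> adjoin_coordinates B \<Longrightarrow>
    (\<lambda>x. f x + g x) \<in> adjoin_coordinates B"
| mult: "f \<in> adjoin_coordinates B \<Longrightarrow> g \<in> adjoin_coordinates B \<Longrightarrow>
    (\<lambda>x. f x * g x) \<in> adjoin_coordinates B"

definition T_poly_distributions :: "'n::finite distr set" where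
  "T_poly_distributions = distr_of ` adjoin_coordinates smooth_T"

definition PT_poly_distributions :: "'n::finite distr set" where
  "PT_poly_distributions = distr_of ` adjoin_coordinates smooth_PT"

end

theory Submission
  imports Defs "HOL-Computational_Algebra.Primes" "HOL-Computational_Algebra.Fundamental_Theorem_Algebra"
    "HOL-Probability.Sinc_Integral" "HOL-Probability.Characteristic_Functions"
begin

text \<open>
  For \<open>p\<close> and a point \<open>\<xi>\<close> consider whether \<open>(P : p)\<close> contains an operator whose symbol does not vanish
  at \<open>\<xi>\<close>. If it does not, a Krull argument at \<open>\<xi>\<close> yields a functional on \<open>A\<^sup>k\<close> that vanishes on \<open>P\<close> and
  on some power of the maximal ideal of \<open>\<xi>\<close>, but not on \<open>p\<close>; it is represented by an exponential polynomial
  with frequency \<open>\<xi>\<close>, which solves \<open>P\<close> and is not annihilated by \<open>p\<close>. Conversely, regularising a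
  solution and passing to the Fourier transform, \<open>p f\<close> is annihilated by the symbols of \<open>(P : p)\<close> and, for
  polynomials with periodic coefficients, by powers of \<open>e\<^bsup>2 \<pi> i N \<xi>\<^sub>j\<^esup> - 1\<close>. If these have no common
  real zero, then \<open>p f = 0\<close>. So in (i)--(iv) the closure is governed by the zeros of \<open>(P : p)\<close> among the
  admissible frequencies, which the primary decomposition turns into the components whose varieties
  contain such a frequency. In (v), nonzero operators are injective on rapidly decreasing functions,
  which shows that torsion lies in the closure; a row \<open>q\<close> with \<open>q P = 0\<close> and \<open>q p \<noteq> 0\<close>, applied to
  a test function, excludes everything else.
\<close>

subsection \<open>Polynomials\<close>

text \<open>Solutions may grow, so they are never transformed themselves. Regularisation replaces a
  distribution by the functions \<open>reg u \<phi>\<close>, which solve the same equations because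
  every translate of \<open>\<phi>\<close> is again a test function. These functions are paired with
  transforms of test functions on the frequency side, where an operator acts as its symbol and a
  translation as an exponential. The symbols of (P : p) have no uniform lower bound and could not be
  divided by globally. Against a test function this is harmless: finitely many multipliers have no
  common zero on its compact support, and division by the sum of their squared moduli is a smooth
  operation there. This is why only common real zeros count. All finiteness comes from the ascending
  chain condition for submodules of \<open>A\<^sup>k\<close>. Passing to a submodule that is maximal
  without \<open>p\<close> takes the place of localisation and completion: the class of
  \<open>p\<close> then generates a simple module, its annihilator is a maximal ideal, and the
  uncountability of the complex numbers identifies that ideal with a point.\<close>

definition lin :: "('a \<Rightarrow>\<^sub>0 complex) \<Rightarrow> ('a \<Rightarrow> complex) \<Rightarrow> complex" where
  "lin p F = (\<Sum>\<alpha>\<in>Poly_Mapping.keys p. Poly_Mapping.lookup p \<alpha> * F \<alpha>)"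

lemma lin_superset:
  assumes "finite S" "Poly_Mapping.keys p \<subseteq> S"
  shows "lin p F = (\<Sum>\<alpha>\<in>S. Poly_Mapping.lookup p \<alpha> * F \<alpha>)"
  unfolding lin_def using assms
  by (intro sum.mono_neutral_left) (auto simp: in_keys_iff)

lemma lin_add: "lin (p + q) F = lin p F + lin q F"
proof -
  let ?S = "Poly_Mapping.keys p \<union> Poly_Mapping.keys q"
  have "lin (p + q) F = (\<Sum>\<alpha>\<in>?S. Poly_Mapping.lookup (p + q) \<alpha> * F \<alpha>)"
    by (rule lin_superset) (use Poly_Mapping.keys_add[of p q] in auto)
  also have "\<dots> = lin p F + lin q F"
    by (subst (1 2) lin_superset[of ?S]) (auto simp: lookup_add distrib_right sum.distrib)
  finally show ?thesis .
qed

lemma lin_0 [simp]: "lin 0 F = 0"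
  by (simp add: lin_def)

lemma lin_sum: "lin (\<Sum>i\<in>I. p i) F = (\<Sum>i\<in>I. lin (p i) F)"
  by (induction I rule: infinite_finite_induct) (auto simp: lin_add)

lemma lin_single [simp]: "lin (Poly_Mapping.single \<alpha> c) F = c * F \<alpha>"
  by (cases "c = 0") (auto simp: lin_def)

lemma lin_cmult_right: "lin p (\<lambda>\<alpha>. c * F \<alpha>) = c * lin p F"
  by (simp add: lin_def sum_distrib_left algebra_simps)

lemma lin_sum_right: "lin p (\<lambda>\<alpha>. \<Sum>i\<in>I. F i \<alpha>) = (\<Sum>i\<in>I. lin p (F i))"
  unfolding lin_def sum_distrib_left by (rule sum.swap)

lemma pm_sum_single:
  fixes p :: "'a \<Rightarrow>\<^sub>0 'b::comm_monoid_add"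
  shows "p = (\<Sum>\<alpha>\<in>Poly_Mapping.keys p. Poly_Mapping.single \<alpha> (Poly_Mapping.lookup p \<alpha>))"
proof (rule poly_mapping_eqI)
  fix k
  have "(\<Sum>\<alpha>\<in>Poly_Mapping.keys p. Poly_Mapping.lookup (Poly_Mapping.single \<alpha> (Poly_Mapping.lookup p \<alpha>)) k)
      = (\<Sum>\<alpha>\<in>Poly_Mapping.keys p. if \<alpha> = k then Poly_Mapping.lookup p k else 0)"
    by (intro sum.cong) (auto simp: lookup_single)
  also have "\<dots> = Poly_Mapping.lookup p k"
    by (simp add: in_keys_iff)
  finally show "Poly_Mapping.lookup p k =
      Poly_Mapping.lookup (\<Sum>\<alpha>\<in>Poly_Mapping.keys p. Poly_Mapping.single \<alpha> (Poly_Mapping.lookup p \<alpha>)) k"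
    by (simp add: lookup_sum)
qed

text \<open>Evaluation at a point and application to a function are both of the form
  \<open>lin p F\<close>. When \<open>F\<close> turns sums of exponents into products or
  compositions, this rule makes evaluation multiplicative and lets a product of operators act
  successively.\<close>

lemma lin_mult:
  fixes p q :: "('a::comm_monoid_add) \<Rightarrow>\<^sub>0 complex"
  shows "lin (p * q) F = lin p (\<lambda>\<alpha>. lin q (\<lambda>\<beta>. F (\<alpha> + \<beta>)))"
proof -
  have "lin (p * q) F = lin ((\<Sum>\<alpha>\<in>Poly_Mapping.keys p. Poly_Mapping.single \<alpha> (Poly_Mapping.lookup p \<alpha>)) *
      (\<Sum>\<beta>\<in>Poly_Mapping.keys q. Poly_Mapping.single \<beta> (Poly_Mapping.lookup q \<beta>))) F"
    by (metis pm_sum_single)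
  also have "\<dots> = lin p (\<lambda>\<alpha>. lin q (\<lambda>\<beta>. F (\<alpha> + \<beta>)))"
    unfolding sum_product lin_sum mult_single lin_single
    by (simp add: lin_def sum_distrib_left mult.assoc)
  finally show ?thesis .
qed

definition pconst :: "complex \<Rightarrow> 'n pdo" where
  "pconst c = Poly_Mapping.single 0 c"

definition pvar :: "'n \<Rightarrow> 'n pdo" where
  "pvar i = Poly_Mapping.single (Poly_Mapping.single i 1) 1"

lemma pconst_simps [simp]: "pconst 0 = 0" "pconst 1 = 1"
  "pconst c + pconst d = pconst (c + d)" "pconst c * pconst d = pconst (c * d)"
  by (auto simp: pconst_def mult_single single_add)

lemma lookup_pconst_mult [simp]: "Poly_Mapping.lookup (pconst c * p) \<alpha> = c * Poly_Mapping.lookup p \<alpha>"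
proof -
  have "Poly_Mapping.lookup (pconst c * p) \<alpha> = Poly_Mapping.lookup
      (pconst c * (\<Sum>\<beta>\<in>Poly_Mapping.keys p. Poly_Mapping.single \<beta> (Poly_Mapping.lookup p \<beta>))) \<alpha>"
    by (metis pm_sum_single)
  also have "\<dots> = (\<Sum>\<beta>\<in>Poly_Mapping.keys p. if \<beta> = \<alpha> then c * Poly_Mapping.lookup p \<alpha> else 0)"
    unfolding sum_distrib_left pconst_def mult_single lookup_sum lookup_single when_def
    by (auto intro!: sum.cong)
  finally show ?thesis by (simp add: in_keys_iff)
qed

lemma single_power:
  "Poly_Mapping.single \<alpha> (1::complex) ^ n = Poly_Mapping.single (\<Sum>i<n. \<alpha>) 1"
  by (induction n) (auto simp: mult_single add.commute)

lemma single_prod: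
  "finite I \<Longrightarrow> (\<Prod>i\<in>I. Poly_Mapping.single (f i) (1::complex)) = Poly_Mapping.single (\<Sum>i\<in>I. f i) 1"
  by (induction I rule: finite_induct) (auto simp: mult_single)

lemma multi_index_sum:
  fixes \<alpha> :: "'n::finite \<Rightarrow>\<^sub>0 nat"
  shows "(\<Sum>i\<in>UNIV. \<Sum>j<Poly_Mapping.lookup \<alpha> i. Poly_Mapping.single i 1) = \<alpha>"
proof (rule poly_mapping_eqI)
  fix k
  have "(\<Sum>i\<in>UNIV. Poly_Mapping.lookup \<alpha> i * (if i = k then 1 else 0)) =
      (\<Sum>i\<in>UNIV. if i = k then Poly_Mapping.lookup \<alpha> k else 0)"
    by (intro sum.cong) auto
  then show "Poly_Mapping.lookup (\<Sum>i\<in>UNIV. \<Sum>j<Poly_Mapping.lookup \<alpha> i. Poly_Mapping.single i 1) k =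
      Poly_Mapping.lookup \<alpha> k"
    by (simp add: lookup_sum lookup_single when_def del: One_nat_def)
qed

lemma single_eq_prod_pvar:
  fixes \<alpha> :: "'n::finite \<Rightarrow>\<^sub>0 nat"
  shows "Poly_Mapping.single \<alpha> c = pconst c * (\<Prod>i\<in>UNIV. pvar i ^ Poly_Mapping.lookup \<alpha> i)"
  by (simp add: pvar_def single_power single_prod multi_index_sum pconst_def mult_single
      del: One_nat_def)

text \<open>Reduces statements on operators to constants, single derivatives, sums and products, so
  that iterated derivatives can stay folded.\<close>

lemma pdo_induct [case_names const var add mult]:
  fixes p :: "'n::finite pdo"
  assumes "\<And>c. Q (pconst c)" "\<And>i. Q (pvar i)"
    "\<And>p q. Q p \<Longrightarrow> Q q \<Longrightarrow> Q (p + q)" "\<And>p q. Q p \<Longrightarrow> Q q \<Longrightarrow> Q (p * q)"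
  shows "Q p"
proof -
  have Q0: "Q 0" "Q 1" using assms(1)[of 0] assms(1)[of 1] by auto
  have pow: "Q (pvar i ^ n)" for i n by (induction n) (use assms Q0 in auto)
  have "Q (\<Prod>i\<in>I. pvar i ^ Poly_Mapping.lookup \<alpha> i)" if "finite I" for I and \<alpha> :: "'n \<Rightarrow>\<^sub>0 nat"
    using that by (induction I rule: finite_induct) (use assms Q0 pow in auto)
  then have s: "Q (Poly_Mapping.single \<alpha> c)" for \<alpha> c
    unfolding single_eq_prod_pvar using assms by auto
  have "Q (\<Sum>\<alpha>\<in>I. Poly_Mapping.single \<alpha> (f \<alpha>))" if "finite I" for I f
    using that by (induction I rule: finite_induct) (use assms Q0 s in auto)
  then show ?thesis by (subst pm_sum_single) auto
qed

section \<open>Evaluation of polynomials at points\<close>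

lemma poly_eval_lin: "poly_eval p z = lin p (\<lambda>\<alpha>. \<Prod>i\<in>UNIV. (z $ i) ^ Poly_Mapping.lookup \<alpha> i)"
  by (simp add: poly_eval_def lin_def)

lemma poly_eval_add [simp]: "poly_eval (p + q) z = poly_eval p z + poly_eval q z"
  by (simp add: poly_eval_lin lin_add)

lemma poly_eval_pconst [simp]: "poly_eval (pconst c) z = c"
  by (simp add: poly_eval_lin pconst_def)

lemma poly_eval_0 [simp]: "poly_eval 0 z = 0" and poly_eval_1 [simp]: "poly_eval 1 z = 1"
  using poly_eval_pconst[of 0 z] poly_eval_pconst[of 1 z] by auto

lemma poly_eval_pvar [simp]: "poly_eval (pvar i) z = z $ i"
proof -
  have "(\<Prod>j\<in>UNIV. z $ j ^ Poly_Mapping.lookup (Poly_Mapping.single i 1) j) =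
      (\<Prod>j\<in>UNIV. if j = i then z $ i else 1)"
    by (intro prod.cong) (auto simp: lookup_single when_def)
  then show ?thesis by (simp add: poly_eval_lin pvar_def)
qed

lemma poly_eval_mult [simp]: "poly_eval (p * q) z = poly_eval p z * poly_eval q z"
  by (simp add: poly_eval_lin lin_mult lookup_add power_add prod.distrib lin_cmult_right)
     (simp add: lin_def sum_distrib_right mult.assoc)

lemma poly_eval_uminus [simp]: "poly_eval (- p) z = - poly_eval p z"
  using poly_eval_add[of p "- p" z] by (simp add: add_eq_0_iff)

lemma poly_eval_diff [simp]: "poly_eval (p - q) z = poly_eval p z - poly_eval q z"
  using poly_eval_add[of p "- q" z] by simp

lemma poly_eval_prod [simp]: "poly_eval (\<Prod>i\<in>I. p i) z = (\<Prod>i\<in>I. poly_eval (p i) z)"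
  by (induction I rule: infinite_finite_induct) auto

lemma poly_eval_power [simp]: "poly_eval (p ^ n) z = poly_eval p z ^ n"
  by (induction n) auto

subsection \<open>The monomial code\<close>

definition prime_at :: "'a::finite \<Rightarrow> nat" where
  "prime_at = (SOME f. inj f \<and> (\<forall>i. prime (f i)))"

lemma prime_at: "inj (prime_at :: 'a::finite \<Rightarrow> nat)" "prime (prime_at (i::'a))"
proof -
  obtain g :: "'a \<Rightarrow> nat" where g: "inj g"
    using finite_imp_inj_to_nat_seg[of "UNIV::'a set"] by auto
  let ?f = "enumerate {p::nat. prime p} \<circ> g"
  have "inj ?f"
    using g strict_mono_imp_inj_on[OF strict_mono_enumerate[OF primes_infinite]]
    by (auto intro: inj_compose)
  moreover have "\<forall>i. prime (?f i)"
    using enumerate_in_set[OF primes_infinite] by auto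
  ultimately have "\<exists>f::'a\<Rightarrow>nat. inj f \<and> (\<forall>i. prime (f i))" by blast
  from someI_ex[OF this] show "inj (prime_at :: 'a \<Rightarrow> nat)" "prime (prime_at (i::'a))"
    by (auto simp: prime_at_def)
qed

text \<open>Unique factorisation makes this injective, and it turns sums of exponent vectors into
  products. Comparing codes is therefore a monomial order, and a well-founded one because codes are
  natural numbers.\<close>

definition code :: "('a::finite \<Rightarrow> nat) \<Rightarrow> nat" where
  "code f = (\<Prod>i\<in>UNIV. prime_at i ^ f i)"

lemma code_pos: "code f > 0"
  unfolding code_def by (rule prod_pos) (simp add: prime_at(2) prime_gt_0_nat)

lemma code_add: "code (\<lambda>i. f i + g i) = code f * code g"
  by (simp add: code_def power_add prod.distrib)

lemma inj_code: "inj (code :: ('a::finite \<Rightarrow> nat) \<Rightarrow> nat)"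
proof (rule injI, rule ext)
  fix f g :: "'a \<Rightarrow> nat" and i :: 'a
  assume eq: "code f = code g"
  have "multiplicity (prime_at i) (code h) = h i" for h :: "'a \<Rightarrow> nat"
  proof -
    have "code h = (\<Prod>p\<in>range (prime_at::'a\<Rightarrow>nat). p ^ h (the_inv prime_at p))"
      by (subst prod.reindex) (auto simp: code_def prime_at(1) the_inv_f_f)
    then have "multiplicity (prime_at i) (code h) =
        multiplicity (prime_at i) (\<Prod>p\<in>range (prime_at::'a\<Rightarrow>nat). p ^ h (the_inv prime_at p))" by simp
    also have "\<dots> = h (the_inv prime_at (prime_at i))"
      by (subst multiplicity_prod_prime_powers) (auto simp: prime_at(2))
    finally show ?thesis by (simp add: the_inv_f_f prime_at(1))
  qed
  with eq show "f i = g i" by metis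
qed

text \<open>At the points \<open>(p\<^sub>1\<^sup>t, \<dots>, p\<^sub>n\<^sup>t)\<close> with distinct primes \<open>p\<^sub>i\<close>, the values of distinct monomials
  are \<open>t\<close>-th powers of distinct integers, so the one with the largest code dominates.\<close>

definition prime_point :: "nat \<Rightarrow> complex^'n::finite" where
  "prime_point t = (\<chi> i. of_nat (prime_at i ^ t))"

lemma poly_eval_prime_point:
  "poly_eval p (prime_point t) = lin p (\<lambda>\<alpha>. of_nat (code (Poly_Mapping.lookup \<alpha>)) ^ t)"
  by (simp add: poly_eval_lin prime_point_def code_def of_nat_prod prod_power_distrib
      flip: power_mult) (simp add: mult.commute)

lemma poly_eval_prime_point_nonzero:
  fixes p :: "'n::finite pdo"
  assumes "p \<noteq> 0"
  shows "eventually (\<lambda>t. poly_eval p (prime_point t) \<noteq> 0) sequentially"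
proof -
  let ?c = "\<lambda>\<alpha>::'n\<Rightarrow>\<^sub>0nat. code (Poly_Mapping.lookup \<alpha>)"
  have inj: "?c \<alpha> = ?c \<beta> \<longleftrightarrow> \<alpha> = \<beta>" for \<alpha> \<beta>
    by (simp add: inj_eq[OF inj_code] lookup_inject)
  have ne: "Poly_Mapping.keys p \<noteq> {}" using assms by simp
  then obtain \<alpha> where \<alpha>: "\<alpha> \<in> Poly_Mapping.keys p" "\<And>\<beta>. \<beta> \<in> Poly_Mapping.keys p \<Longrightarrow> ?c \<beta> \<le> ?c \<alpha>"
  proof -
    have "Max (?c ` Poly_Mapping.keys p) \<in> ?c ` Poly_Mapping.keys p"
      using ne by (intro Max_in) auto
    then obtain \<alpha> where "\<alpha> \<in> Poly_Mapping.keys p" "?c \<alpha> = Max (?c ` Poly_Mapping.keys p)" by auto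
    then show ?thesis by (intro that[of \<alpha>]) auto
  qed
  let ?a = "\<lambda>\<beta>. Poly_Mapping.lookup p \<beta>"
  \<comment> \<open>Divided by the \<open>t\<close>-th power of the largest code, every other term
    is geometric with ratio below 1, so only the coefficient of \<open>\<alpha>\<close>
    survives.\<close>
  have lim: "(\<lambda>t. \<Sum>\<beta>\<in>Poly_Mapping.keys p. ?a \<beta> * (of_nat (?c \<beta>) / of_nat (?c \<alpha>)) ^ t)
      \<longlonglongrightarrow> (\<Sum>\<beta>\<in>Poly_Mapping.keys p. if \<beta> = \<alpha> then ?a \<alpha> else 0)"
  proof (rule tendsto_sum)
    fix \<beta> assume \<beta>: "\<beta> \<in> Poly_Mapping.keys p"
    show "(\<lambda>t. ?a \<beta> * (of_nat (?c \<beta>) / of_nat (?c \<alpha>)) ^ t) \<longlonglongrightarrow> (if \<beta> = \<alpha> then ?a \<alpha> else 0)"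
    proof (cases "\<beta> = \<alpha>")
      case True
      then show ?thesis using code_pos[of "Poly_Mapping.lookup \<alpha>"] by simp
    next
      case False
      then have "?c \<beta> < ?c \<alpha>" using \<alpha>(2)[OF \<beta>] inj[of \<beta> \<alpha>] by linarith
      then have "norm (of_nat (?c \<beta>) / of_nat (?c \<alpha>) :: complex) < 1"
        using code_pos[of "Poly_Mapping.lookup \<alpha>"] by (simp add: norm_divide)
      then have "(\<lambda>t. ?a \<beta> * (of_nat (?c \<beta>) / of_nat (?c \<alpha>)) ^ t) \<longlonglongrightarrow> ?a \<beta> * 0"
        by (intro tendsto_mult tendsto_const LIMSEQ_power_zero)
      with False show ?thesis by simp
    qed
  qed
  have "?a \<alpha> \<noteq> 0" using \<alpha>(1) by (simp add: in_keys_iff)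
  with lim \<alpha>(1) have "eventually (\<lambda>t. (\<Sum>\<beta>\<in>Poly_Mapping.keys p. ?a \<beta> * (of_nat (?c \<beta>) / of_nat (?c \<alpha>)) ^ t) \<noteq> 0) sequentially"
    by (intro tendsto_imp_eventually_ne) auto
  then show ?thesis
  proof eventually_elim
    case (elim t)
    have "poly_eval p (prime_point t) = of_nat (?c \<alpha>) ^ t *
        (\<Sum>\<beta>\<in>Poly_Mapping.keys p. ?a \<beta> * (of_nat (?c \<beta>) / of_nat (?c \<alpha>)) ^ t)"
      using code_pos[of "Poly_Mapping.lookup \<alpha>"]
      by (simp add: poly_eval_prime_point lin_def sum_distrib_left power_divide)
    with elim show ?case using code_pos[of "Poly_Mapping.lookup \<alpha>"] by simp
  qed
qed

lemma poly_eval_nonzero_real: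
  fixes p :: "'n::finite pdo"
  assumes "p \<noteq> 0"
  obtains x :: "real^'n" where "poly_eval p (\<chi> i. of_real (x $ i)) \<noteq> 0"
proof -
  obtain t where "poly_eval p (prime_point t) \<noteq> 0"
    using eventually_happens[OF poly_eval_prime_point_nonzero[OF assms]] by auto
  then show ?thesis by (intro that[of "\<chi> i. of_nat (prime_at i ^ t)"]) (simp add: prime_point_def)
qed

text \<open>Nonvanishing at all late prime points, rather than at some point, yields a common point
  where both factors are nonzero.\<close>

lemma pdo_mult_eq_0:
  fixes p q :: "'n::finite pdo"
  assumes "p * q = 0"
  shows "p = 0 \<or> q = 0"
proof (rule ccontr)
  assume "\<not> ?thesis"
  then have "eventually (\<lambda>t. poly_eval p (prime_point t) \<noteq> 0 \<and> poly_eval q (prime_point t) \<noteq> 0) sequentially"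
    using poly_eval_prime_point_nonzero[of p] poly_eval_prime_point_nonzero[of q]
    by (auto intro: eventually_conj)
  then obtain t where "poly_eval (p * q) (prime_point t) \<noteq> 0"
    using eventually_happens by fastforce
  with assms show False by simp
qed

lemma pdo_prod_nonzero:
  fixes a :: "'i \<Rightarrow> 'n::finite pdo"
  assumes "finite I" "\<And>i. i \<in> I \<Longrightarrow> a i \<noteq> 0"
  shows "(\<Prod>i\<in>I. a i) \<noteq> 0"
  using assms
proof (induction I rule: finite_induct)
  case empty
  show ?case using poly_eval_1[where 'a='n] by (metis poly_eval_0 prod.empty zero_neq_one)
next
  case (insert i I)
  then show ?case using pdo_mult_eq_0 by auto
qed

lemma pdo_power_nonzero:
  fixes a :: "'n::finite pdo"
  shows "a \<noteq> 0 \<Longrightarrow> a ^ n \<noteq> 0"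
  using pdo_prod_nonzero[of "{..<n}" "\<lambda>_. a"] by simp

subsection \<open>Submodules of a free module and the ascending chain condition\<close>

lemma module_smult_vec: "module ((*s) :: 'a::comm_ring_1 \<Rightarrow> 'a^'k \<Rightarrow> 'a^'k)"
  by unfold_locales (auto simp: vec_eq_iff algebra_simps)

lemma module_times: "module ((*) :: 'a::comm_ring_1 \<Rightarrow> 'a \<Rightarrow> 'a)"
  by unfold_locales (auto simp: algebra_simps)

abbreviation submodule :: "('a::comm_ring_1^'k) set \<Rightarrow> bool" where
  "submodule \<equiv> module.subspace (*s)"

lemma submodule_iff: "submodule N \<longleftrightarrow>
    0 \<in> N \<and> (\<forall>x\<in>N. \<forall>y\<in>N. x + y \<in> N) \<and> (\<forall>c. \<forall>x\<in>N. c *s x \<in> N)"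
  by (simp add: module.subspace_def[OF module_smult_vec])

lemma ideal_iff: "module.subspace (*) (N :: 'a::comm_ring_1 set) \<longleftrightarrow>
    0 \<in> N \<and> (\<forall>x\<in>N. \<forall>y\<in>N. x + y \<in> N) \<and> (\<forall>c. \<forall>x\<in>N. c * x \<in> N)"
  by (simp add: module.subspace_def[OF module_times])

lemma submoduleD:
  assumes "submodule N"
  shows "0 \<in> N" "x \<in> N \<Longrightarrow> y \<in> N \<Longrightarrow> x + y \<in> N" "x \<in> N \<Longrightarrow> c *s x \<in> N"
    "x \<in> N \<Longrightarrow> y \<in> N \<Longrightarrow> x - y \<in> N"
proof -
  show 1: "0 \<in> N" "x \<in> N \<Longrightarrow> y \<in> N \<Longrightarrow> x + y \<in> N" "x \<in> N \<Longrightarrow> c *s x \<in> N" for x y c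
    using assms by (auto simp: submodule_iff)
  assume "x \<in> N" "y \<in> N"
  then have "x + (-1) *s y \<in> N" by (intro 1)
  moreover have "(-1) *s y = - y" by (simp add: vec_eq_iff)
  ultimately show "x - y \<in> N" by simp
qed

text \<open>The exponent of the monomial \<open>x\<^sup>\<alpha> e\<^sub>j\<close>: the second component becomes one
  further block of exponents, so that both Dickson's lemma and the monomial order are only needed
  for plain exponent vectors.\<close>

definition mexp :: "('n \<Rightarrow>\<^sub>0 nat) \<Rightarrow> 'k \<Rightarrow> ('n + 'k) \<Rightarrow> nat" where
  "mexp \<alpha> j = case_sum (Poly_Mapping.lookup \<alpha>) (\<lambda>l. if l = j then 1 else 0)"

text \<open>The leading exponents of Groebner basis theory, for the order given by
  \<open>code\<close>. Both the monomial and the basis vector enter the exponent.\<close>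

definition lead_exps :: "(('n::finite pdo)^'k::finite) set \<Rightarrow> (('n + 'k) \<Rightarrow> nat) set" where
  "lead_exps N = {mexp \<alpha> j | \<alpha> j. \<exists>v\<in>N. Poly_Mapping.lookup (v $ j) \<alpha> \<noteq> 0 \<and>
     (\<forall>\<beta> l. Poly_Mapping.lookup (v $ l) \<beta> \<noteq> 0 \<longrightarrow> code (mexp \<beta> l) \<le> code (mexp \<alpha> j))}"

lemma mexp_inj: "mexp \<alpha> j = mexp \<beta> l \<longleftrightarrow> \<alpha> = \<beta> \<and> j = l"
proof
  assume eq: "mexp \<alpha> j = mexp \<beta> l"
  have "mexp \<alpha> j (Inl i) = mexp \<beta> l (Inl i)" "mexp \<alpha> j (Inr j) = mexp \<beta> l (Inr j)" for i
    by (simp_all add: eq)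
  then show "\<alpha> = \<beta> \<and> j = l"
    by (auto simp: mexp_def intro!: poly_mapping_eqI split: if_splits)
qed auto

lemma code_mexp_inj:
  "code (mexp \<alpha> j :: ('n::finite + 'k::finite) \<Rightarrow> nat) = code (mexp \<beta> l) \<longleftrightarrow> \<alpha> = \<beta> \<and> j = l"
  by (simp only: inj_eq[OF inj_code] mexp_inj)

lemma code_mexp_add:
  fixes \<alpha> \<gamma> :: "'n::finite \<Rightarrow>\<^sub>0 nat" and j :: "'k::finite"
  shows "code (mexp (\<gamma> + \<alpha>) j) =
    code (case_sum (Poly_Mapping.lookup \<gamma>) (\<lambda>l::'k. 0)) * code (mexp \<alpha> j)"
proof -
  have "mexp (\<gamma> + \<alpha>) j = (\<lambda>i. case_sum (Poly_Mapping.lookup \<gamma>) (\<lambda>l::'k. 0) i + mexp \<alpha> j i)"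
    by (auto simp: mexp_def lookup_add fun_eq_iff split: sum.splits)
  then show ?thesis by (simp only: code_add)
qed

lemma lookup_single_mult:
  fixes p :: "('n::finite) pdo"
  shows "Poly_Mapping.lookup (Poly_Mapping.single \<gamma> c * p) (\<gamma> + \<alpha>) = c * Poly_Mapping.lookup p \<alpha>"
    "Poly_Mapping.lookup (Poly_Mapping.single \<gamma> c * p) \<delta> \<noteq> 0 \<Longrightarrow> \<exists>\<beta>. \<delta> = \<gamma> + \<beta> \<and> Poly_Mapping.lookup p \<beta> \<noteq> 0"
proof -
  have eq: "Poly_Mapping.lookup (Poly_Mapping.single \<gamma> c * p) \<delta> =
      (\<Sum>\<beta>\<in>Poly_Mapping.keys p. if \<gamma> + \<beta> = \<delta> then c * Poly_Mapping.lookup p \<beta> else 0)" for \<delta>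
  proof -
    have "Poly_Mapping.lookup (Poly_Mapping.single \<gamma> c * p) \<delta> = Poly_Mapping.lookup (Poly_Mapping.single \<gamma> c *
        (\<Sum>\<beta>\<in>Poly_Mapping.keys p. Poly_Mapping.single \<beta> (Poly_Mapping.lookup p \<beta>))) \<delta>"
      by (metis pm_sum_single)
    also have "\<dots> = (\<Sum>\<beta>\<in>Poly_Mapping.keys p. if \<gamma> + \<beta> = \<delta> then c * Poly_Mapping.lookup p \<beta> else 0)"
      unfolding sum_distrib_left mult_single lookup_sum lookup_single when_def ..
    finally show ?thesis .
  qed
  show "Poly_Mapping.lookup (Poly_Mapping.single \<gamma> c * p) (\<gamma> + \<alpha>) = c * Poly_Mapping.lookup p \<alpha>"
    by (simp add: eq in_keys_iff)
  assume "Poly_Mapping.lookup (Poly_Mapping.single \<gamma> c * p) \<delta> \<noteq> 0"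
  then obtain \<beta> where "(if \<gamma> + \<beta> = \<delta> then c * Poly_Mapping.lookup p \<beta> else 0) \<noteq> 0"
    unfolding eq by (rule sum.not_neutral_contains_not_neutral)
  then show "\<exists>\<beta>. \<delta> = \<gamma> + \<beta> \<and> Poly_Mapping.lookup p \<beta> \<noteq> 0" by (auto split: if_splits)
qed

lemma lead_exists:
  fixes v :: "('n::finite pdo)^'k::finite"
  assumes "v \<noteq> 0"
  obtains \<alpha> j where "Poly_Mapping.lookup (v $ j) \<alpha> \<noteq> 0"
    "\<And>\<beta> l. Poly_Mapping.lookup (v $ l) \<beta> \<noteq> 0 \<Longrightarrow> code (mexp \<beta> l) \<le> code (mexp \<alpha> j)"
proof -
  let ?S = "SIGMA j:UNIV. Poly_Mapping.keys (v $ j)"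
  let ?c = "\<lambda>(j, \<alpha>). code (mexp \<alpha> j :: 'n + 'k \<Rightarrow> nat)"
  from assms obtain i where "v $ i \<noteq> 0" by (auto simp: vec_eq_iff)
  then obtain \<beta> where "\<beta> \<in> Poly_Mapping.keys (v $ i)" by (metis all_not_in_conv keys_eq_empty)
  then have "?S \<noteq> {}" by auto
  then have "Max (?c ` ?S) \<in> ?c ` ?S" by (intro Max_in) auto
  then obtain j \<alpha> where ja: "(j, \<alpha>) \<in> ?S" "Max (?c ` ?S) = ?c (j, \<alpha>)" by auto
  show ?thesis
  proof (rule that[of j \<alpha>])
    show "Poly_Mapping.lookup (v $ j) \<alpha> \<noteq> 0" using ja by (auto simp: in_keys_iff)
    fix \<beta> l assume "Poly_Mapping.lookup (v $ l) \<beta> \<noteq> 0"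
    then have "?c (l, \<beta>) \<in> ?c ` ?S" by (intro imageI) (auto simp: in_keys_iff)
    then have "?c (l, \<beta>) \<le> Max (?c ` ?S)" by (intro Max_ge) auto
    then show "code (mexp \<beta> l) \<le> code (mexp \<alpha> j)" using ja(2) by simp
  qed
qed

lemma lead_exps_mono: "N \<subseteq> N' \<Longrightarrow> lead_exps N \<subseteq> lead_exps N'"
  by (auto simp: lead_exps_def)

text \<open>Multiplication by a monomial shifts the leading exponent. The comparison fixes the basis
  vector: in the second block each exponent has a single 1, so \<open>e \<le> mexp \<beta> l\<close>
  forces the two indices to agree.\<close>

lemma lead_exps_upward:
  assumes "submodule N" "e \<in> lead_exps N" "e \<le> mexp \<beta> l"
  shows "mexp \<beta> l \<in> lead_exps N"
proof -
  from assms(2) obtain \<alpha> j v where v: "e = mexp \<alpha> j" "v \<in> N" "Poly_Mapping.lookup (v $ j) \<alpha> \<noteq> 0"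
    "\<And>\<beta> l. Poly_Mapping.lookup (v $ l) \<beta> \<noteq> 0 \<Longrightarrow> code (mexp \<beta> l) \<le> code (mexp \<alpha> j)"
    by (auto simp: lead_exps_def)
  have "mexp \<alpha> j (Inl i) \<le> mexp \<beta> l (Inl i)" "mexp \<alpha> j (Inr j) \<le> mexp \<beta> l (Inr j)" for i
    using assms(3) v(1) by (auto simp: le_fun_def)
  then have le: "Poly_Mapping.lookup \<alpha> i \<le> Poly_Mapping.lookup \<beta> i" and jl: "j = l" for i
    by (auto simp: mexp_def split: if_splits)
  define \<gamma> where "\<gamma> = \<beta> - \<alpha>"
  have \<beta>: "\<beta> = \<gamma> + \<alpha>" using le by (intro poly_mapping_eqI) (simp add: \<gamma>_def lookup_add lookup_minus)
  let ?w = "Poly_Mapping.single \<gamma> 1 *s v"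
  have "?w \<in> N" by (intro submoduleD assms v)
  moreover have "Poly_Mapping.lookup (?w $ l) \<beta> \<noteq> 0" using v(3) by (simp add: \<beta> lookup_single_mult jl)
  moreover have "code (mexp \<beta>' l') \<le> code (mexp \<beta> l)" if nz: "Poly_Mapping.lookup (?w $ l') \<beta>' \<noteq> 0" for \<beta>' l'
  proof -
    obtain \<delta> where "\<beta>' = \<gamma> + \<delta>" "Poly_Mapping.lookup (v $ l') \<delta> \<noteq> 0"
      using nz lookup_single_mult(2)[of \<gamma> 1 "v $ l'" \<beta>'] by auto
    then show ?thesis using v(4)[of l' \<delta>] by (simp add: \<beta> jl code_mexp_add)
  qed
  ultimately show ?thesis unfolding lead_exps_def by blast
qed

text \<open>Division without remainder: subtracting a scalar multiple of an element of
  \<open>N\<close> with the same leading exponent lowers the leading code of \<open>v\<close>, and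
  this descent ends at 0.\<close>

lemma submodule_eq_if_lead_exps:
  fixes N :: "(('n::finite pdo)^'k::finite) set"
  assumes N: "submodule N" and N': "submodule N'" and sub: "N \<subseteq> N'" and lead: "lead_exps N' \<subseteq> lead_exps N"
  shows "N' = N"
proof -
  have "v \<in> N" if "v \<in> N'" "\<And>\<beta> l. Poly_Mapping.lookup (v $ l) \<beta> \<noteq> 0 \<Longrightarrow> code (mexp \<beta> l) < c" for v c
    using that
  proof (induction c arbitrary: v rule: less_induct)
    case (less c)
    show ?case
    proof (cases "v = 0")
      case True
      then show ?thesis by (simp add: submoduleD[OF N])
    next
      case False
      then obtain \<alpha> j where v: "Poly_Mapping.lookup (v $ j) \<alpha> \<noteq> 0"
        "\<And>\<beta> l. Poly_Mapping.lookup (v $ l) \<beta> \<noteq> 0 \<Longrightarrow> code (mexp \<beta> l) \<le> code (mexp \<alpha> j)"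
        using lead_exists by metis
      then have "mexp \<alpha> j \<in> lead_exps N'" using less.prems(1) unfolding lead_exps_def by blast
      with lead have "mexp \<alpha> j \<in> lead_exps N" by blast
      then obtain w where w: "w \<in> N" "Poly_Mapping.lookup (w $ j) \<alpha> \<noteq> 0"
        "\<And>\<beta> l. Poly_Mapping.lookup (w $ l) \<beta> \<noteq> 0 \<Longrightarrow> code (mexp \<beta> l) \<le> code (mexp \<alpha> j)"
        by (auto simp: lead_exps_def mexp_inj)
      let ?a = "Poly_Mapping.lookup (v $ j) \<alpha> / Poly_Mapping.lookup (w $ j) \<alpha>"
      let ?u = "v - pconst ?a *s w"
      have lu: "Poly_Mapping.lookup (?u $ l) \<beta> = Poly_Mapping.lookup (v $ l) \<beta> - ?a * Poly_Mapping.lookup (w $ l) \<beta>" for l \<beta>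
        by (simp add: lookup_minus)
      have "code (mexp \<beta> l) < code (mexp \<alpha> j)" if nz: "Poly_Mapping.lookup (?u $ l) \<beta> \<noteq> 0" for \<beta> l
      proof -
        have "code (mexp \<beta> l) \<le> code (mexp \<alpha> j)"
          using nz v(2)[of l \<beta>] w(3)[of l \<beta>] unfolding lu by fastforce
        moreover have "\<not> (\<beta> = \<alpha> \<and> l = j)" using nz w(2) unfolding lu by auto
        ultimately show ?thesis using code_mexp_inj[of \<beta> l \<alpha> j] by linarith
      qed
      moreover have "?u \<in> N'" using sub w(1) less.prems(1) by (intro submoduleD[OF N']) auto
      ultimately have "?u \<in> N"
        using less.IH[of "code (mexp \<alpha> j)" ?u] less.prems(2)[OF v(1)] by blast
      then have "?u + pconst ?a *s w \<in> N" by (rule submoduleD(2)[OF N _ submoduleD(3)[OF N w(1)]])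
      then show ?thesis by (simp only: diff_add_cancel)
    qed
  qed
  moreover have "\<exists>c. \<forall>\<beta> l. Poly_Mapping.lookup (v $ l) \<beta> \<noteq> 0 \<longrightarrow> code (mexp \<beta> l :: 'n + 'k \<Rightarrow> nat) < c" for v :: "('n pdo)^'k"
  proof (cases "v = 0")
    case False
    then show ?thesis using lead_exists[OF False] by (metis less_Suc_eq_le)
  qed auto
  ultimately show ?thesis using sub by blast
qed

section \<open>Dickson's lemma and the ascending chain condition\<close>

lemma dickson_subseq:
  fixes f :: "nat \<Rightarrow> 'a \<Rightarrow> nat"
  assumes "finite S"
  shows "\<exists>r::nat\<Rightarrow>nat. strict_mono r \<and> (\<forall>i\<in>S. mono (\<lambda>m. f (r m) i))"
  using assms
proof (induction S rule: finite_induct)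
  case empty
  then show ?case by (intro exI[of _ id]) (auto simp: strict_mono_def)
next
  case (insert i S)
  then obtain r :: "nat \<Rightarrow> nat" where r: "strict_mono r" "\<And>l. l \<in> S \<Longrightarrow> mono (\<lambda>m. f (r m) l)" by auto
  let ?X = "\<lambda>m. f (r m) i"
  \<comment> \<open>Thinning the sequence once more keeps the coordinates treated so far
    monotone.\<close>
  obtain s :: "nat \<Rightarrow> nat" where s: "strict_mono s" "mono (\<lambda>m. ?X (s m))"
  proof -
    obtain s :: "nat \<Rightarrow> nat" where s: "strict_mono s" "monoseq (\<lambda>m. ?X (s m))"
      using seq_monosub[of ?X] by auto
    from s(2) consider "\<forall>m. \<forall>n\<ge>m. ?X (s m) \<le> ?X (s n)" | "\<forall>m. \<forall>n\<ge>m. ?X (s n) \<le> ?X (s m)"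
      unfolding monoseq_def by blast
    then show ?thesis
    proof cases
      case 1
      then show ?thesis using that s(1) by (auto simp: mono_def)
    next
      case 2
      \<comment> \<open>A decreasing sequence of natural numbers is constant from the place where it
        attains its minimum.\<close>
      define M where "M = (LEAST y. y \<in> range (\<lambda>m. ?X (s m)))"
      have "M \<in> range (\<lambda>m. ?X (s m))" unfolding M_def by (rule LeastI_ex) auto
      then obtain m0 where m0: "M = ?X (s m0)" by auto
      have "?X (s (m0 + m)) = M" for m
        using 2 m0 Least_le[of "\<lambda>y. y \<in> range (\<lambda>m. ?X (s m))"] by (intro antisym) (auto simp: M_def)
      then show ?thesis
        using that[of "\<lambda>m. s (m0 + m)"] s(1) by (auto simp: mono_def strict_mono_def)
    qed
  qed
  show ?case
  proof (intro exI[of _ "r \<circ> s"] conjI ballI)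
    show "strict_mono (r \<circ> s)" using r(1) s(1) by (simp add: strict_mono_def)
    fix l assume "l \<in> insert i S"
    then consider "l = i" | "l \<in> S" by auto
    then show "mono (\<lambda>m. f ((r \<circ> s) m) l)"
    proof cases
      case 1 then show ?thesis using s(2) by simp
    next
      case 2
      from r(2)[OF this] s(1) show ?thesis by (simp add: mono_def strict_mono_less_eq)
    qed
  qed
qed

lemma dickson:
  fixes f :: "nat \<Rightarrow> 'a::finite \<Rightarrow> nat"
  shows "\<exists>i j. i < j \<and> f i \<le> f j"
proof -
  obtain r :: "nat \<Rightarrow> nat" where r: "strict_mono r" "\<And>i. mono (\<lambda>m. f (r m) i)"
    using dickson_subseq[OF finite[of UNIV], of f] by auto
  have "r 0 < r 1" using r(1) by (simp add: strict_mono_def)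
  moreover have "f (r 0) \<le> f (r 1)" using r(2) by (simp add: le_fun_def mono_def)
  ultimately show ?thesis by blast
qed

text \<open>If no step were stationary, each would contribute a new leading exponent
  \<open>e s\<close>. Dickson's lemma gives \<open>e i \<le> e j\<close> with \<open>i < j\<close>,
  and upward closure then puts \<open>e j\<close> among the exponents of \<open>N j\<close>, where
  it is not new.\<close>

lemma submodule_chain_stops:
  fixes N :: "nat \<Rightarrow> (('n::finite pdo)^'k::finite) set"
  assumes sub: "\<And>s. submodule (N s)" and inc: "\<And>s. N s \<subseteq> N (Suc s)"
  shows "\<exists>s. N (Suc s) = N s"
proof (rule ccontr)
  assume "\<not> ?thesis"
  then have "\<not> lead_exps (N (Suc s)) \<subseteq> lead_exps (N s)" for s
    using submodule_eq_if_lead_exps[OF sub sub inc, of s] by blast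
  then have "\<forall>s. \<exists>e. e \<in> lead_exps (N (Suc s)) \<and> e \<notin> lead_exps (N s)" by blast
  then obtain e where e: "\<And>s. e s \<in> lead_exps (N (Suc s))" "\<And>s. e s \<notin> lead_exps (N s)" by metis
  obtain i j where ij: "i < j" "e i \<le> e j" using dickson[of e] by blast
  have "N (Suc i) \<subseteq> N j" using ij(1) inc by (simp add: lift_Suc_mono_le)
  then have "e i \<in> lead_exps (N j)" using e(1)[of i] lead_exps_mono by blast
  moreover obtain \<beta> l where "e j = mexp \<beta> l" using e(1)[of j] by (auto simp: lead_exps_def)
  ultimately have "e j \<in> lead_exps (N j)" using lead_exps_upward[OF sub, of "e i" j \<beta> l] ij(2) by simp
  with e(2) show False by blast
qed

lemma maximal_submodule:
  fixes F :: "(('n::finite pdo)^'k::finite) set set"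
  assumes "N0 \<in> F" "\<And>N. N \<in> F \<Longrightarrow> submodule N"
  shows "\<exists>L\<in>F. \<forall>L'\<in>F. L \<subseteq> L' \<longrightarrow> L' = L"
proof (rule ccontr)
  assume "\<not> ?thesis"
  then have "\<forall>L. L \<in> F \<longrightarrow> (\<exists>L'. L' \<in> F \<and> L \<subset> L')" by blast
  then obtain g where g: "\<And>L. L \<in> F \<Longrightarrow> g L \<in> F \<and> L \<subset> g L" by metis
  have "(g ^^ s) N0 \<in> F" for s by (induction s) (use assms g in auto)
  then have "\<exists>s. (g ^^ Suc s) N0 = (g ^^ s) N0"
    by (intro submodule_chain_stops) (use assms g in auto)
  then show False using g \<open>\<And>s. (g ^^ s) N0 \<in> F\<close> by (metis funpow.simps(2) o_apply psubset_eq)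
qed

subsection \<open>Primary submodules\<close>

lemma submodule_colon:
  assumes L: "submodule L"
  shows "submodule {z. (a :: 'a::comm_ring_1) *s z \<in> L}"
  unfolding submodule_iff
proof (intro conjI ballI allI)
  fix c x assume "x \<in> {z. a *s z \<in> L}"
  then have "c *s (a *s x) \<in> L" using submoduleD(3)[OF L, of "a *s x"] by simp
  then show "c *s x \<in> {z. a *s z \<in> L}" by (simp add: vector_smult_assoc mult.commute)
qed (simp_all add: submoduleD[OF L] vector_add_ldistrib)

text \<open>One stationary step in the increasing chain of the submodules
  \<open>{z. a ^ s *s z \<in> L}\<close> is all that later cancellations of a factor
  \<open>a\<close> use.\<close>

lemma power_stabilises:
  fixes L :: "(('n::finite pdo)^'k::finite) set"
  assumes L: "submodule L"
  shows "\<exists>s. \<forall>z. a ^ Suc s *s z \<in> L \<longrightarrow> a ^ s *s z \<in> L"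
proof -
  define N where "N = (\<lambda>s. {z. a ^ s *s z \<in> L})"
  have 1: "submodule (N s)" for s
    unfolding N_def by (rule submodule_colon[OF L])
  have 2: "N s \<subseteq> N (Suc s)" for s
    using submoduleD(3)[OF L, of _ a] by (force simp: N_def vector_smult_assoc)
  obtain s where "N (Suc s) = N s" using submodule_chain_stops[of N, OF 1 2] by blast
  then show ?thesis by (auto simp: N_def)
qed

lemma idealD:
  assumes "module.subspace (*) (J :: 'a::comm_ring_1 set)"
  shows "0 \<in> J" "x \<in> J \<Longrightarrow> y \<in> J \<Longrightarrow> x + y \<in> J" "x \<in> J \<Longrightarrow> c * x \<in> J"
    "x \<in> J \<Longrightarrow> y \<in> J \<Longrightarrow> x - y \<in> J"
proof -
  show 1: "0 \<in> J" "x \<in> J \<Longrightarrow> y \<in> J \<Longrightarrow> x + y \<in> J" "x \<in> J \<Longrightarrow> c * x \<in> J" for x y c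
    using assms by (auto simp: ideal_iff)
  assume "x \<in> J" "y \<in> J"
  then have "x + (-1) * y \<in> J" by (intro 1)
  then show "x - y \<in> J" by simp
qed

lemma colon_ideal:
  assumes "submodule N"
  shows "module.subspace (*) {a. a *s p \<in> N}"
  unfolding ideal_iff
  by (auto intro: submoduleD[OF assms] simp: vector_sadd_rdistrib simp flip: vector_smult_assoc)

lemma submodule_of_ideal:
  fixes J :: "'a::comm_ring_1 set"
  assumes "module.subspace (*) J"
  shows "submodule {v::'a^'k. \<forall>j. v $ j \<in> J}"
  by (auto simp: submodule_iff intro: idealD[OF assms])

text \<open>An annihilator that is maximal among those of the elements \<open>m'\<close> outside
  \<open>N\<close> with \<open>a *s m' \<in> N\<close> is prime: if \<open>b * c\<close> kills
  \<open>m'\<close> and \<open>c\<close> does not, then \<open>c *s m'\<close> has the same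
  annihilator, and \<open>b\<close> lies in it.\<close>

lemma zero_divisor_in_Ass:
  fixes N :: "(('n::finite pdo)^'k::finite) set"
  assumes N: "submodule N" and m: "a *s m \<in> N" "m \<notin> N"
  obtains I where "I \<in> Ass_quotient N" "a \<in> I"
proof -
  let ?ann = "\<lambda>m. {c. c *s m \<in> N}"
  \<comment> \<open>The chain condition is available for submodules of the free module, so an ideal
    is encoded as the vectors all of whose entries lie in it.\<close>
  define F where "F = {{v::('n pdo)^'k. \<forall>j. v $ j \<in> ?ann m'} | m'. m' \<notin> N \<and> a *s m' \<in> N}"
  have subF: "submodule M" if M: "M \<in> F" for M
  proof -
    from M obtain m' where "M = {v. \<forall>j. v $ j \<in> ?ann m'}" unfolding F_def by blast
    then show ?thesis by (simp only: submodule_of_ideal[OF colon_ideal[OF N]])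
  qed
  have "{v. \<forall>j. v $ j \<in> ?ann m} \<in> F" using m unfolding F_def by blast
  from maximal_submodule[OF this subF]
  obtain M where M: "M \<in> F" and "\<forall>M'\<in>F. M \<subseteq> M' \<longrightarrow> M' = M" by (rule bexE)
  then have Mmax: "\<And>M'. M' \<in> F \<Longrightarrow> M \<subseteq> M' \<Longrightarrow> M' = M" by metis
  obtain m' where m': "m' \<notin> N" "a *s m' \<in> N" "M = {v. \<forall>j. v $ j \<in> ?ann m'}"
    using M unfolding F_def by blast
  \<comment> \<open>A larger annihilator still contains \<open>a\<close>, so \<open>m''\<close> is a
    competitor of \<open>m'\<close>.\<close>
  have max: "?ann m'' \<subseteq> ?ann m'" if "m'' \<notin> N" "?ann m' \<subseteq> ?ann m''" for m''
  proof
    fix b assume b: "b \<in> ?ann m''"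
    have "{v. \<forall>j. v $ j \<in> ?ann m''} = M"
    proof (rule Mmax)
      show "{v. \<forall>j. v $ j \<in> ?ann m''} \<in> F" using that m'(2) unfolding F_def by blast
      show "M \<subseteq> {v. \<forall>j. v $ j \<in> ?ann m''}" using that(2) unfolding m'(3) by blast
    qed
    moreover have "(\<chi> j. b) \<in> {v::('n pdo)^'k. \<forall>j. v $ j \<in> ?ann m''}" using b by simp
    ultimately have "(\<chi> j. b) \<in> M" by (simp only:)
    then show "b \<in> ?ann m'" unfolding m'(3) by simp
  qed
  have "prime_ideal (?ann m')"
    unfolding prime_ideal_def ideal_iff
  proof (intro conjI ballI allI impI)
    show "0 \<in> ?ann m'" by (simp add: submoduleD[OF N])
    show "x + y \<in> ?ann m'" if "x \<in> ?ann m'" "y \<in> ?ann m'" for x y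
      using that by (auto simp: vector_sadd_rdistrib intro: submoduleD[OF N])
    show "c * x \<in> ?ann m'" if "x \<in> ?ann m'" for c x
      using that by (auto simp flip: vector_smult_assoc intro: submoduleD[OF N])
    show "?ann m' \<noteq> UNIV" using m'(1) by (metis UNIV_I mem_Collect_eq vector_smult_lid)
    fix b c assume bc: "b * c \<in> ?ann m'"
    show "b \<in> ?ann m' \<or> c \<in> ?ann m'"
    proof (rule disjCI)
      assume c: "c \<notin> ?ann m'"
      have "?ann m' \<subseteq> ?ann (c *s m')"
      proof
        fix d assume "d \<in> ?ann m'"
        then have "c *s (d *s m') \<in> N" using submoduleD(3)[OF N, of "d *s m'"] by simp
        then show "d \<in> ?ann (c *s m')" by (simp add: vector_smult_assoc mult.commute)
      qed
      then have "?ann (c *s m') \<subseteq> ?ann m'" using c by (intro max) auto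
      then show "b \<in> ?ann m'" using bc by (auto simp: vector_smult_assoc)
    qed
  qed
  then show ?thesis using that[of "?ann m'"] m' by (auto simp: Ass_quotient_def)
qed

lemma primary_zero_divisor:
  fixes Q :: "(('n::finite pdo)^'k::finite) set"
  assumes "primary_submodule \<pp> Q" "a *s m \<in> Q" "m \<notin> Q"
  shows "a \<in> \<pp>"
  using zero_divisor_in_Ass[of Q a m] assms by (auto simp: primary_submodule_def)

text \<open>Primary is defined through associated primes; this recovers the description by powers.
  At a stable exponent \<open>s\<close>, every associated prime of \<open>L\<close>, the submodule
  of all \<open>z\<close> with \<open>a ^ s *s z \<in> Q\<close>, is one of \<open>Q\<close>. If
  \<open>L\<close> were proper, \<open>a\<close> would lie in such a prime, and stability would make
  that prime the whole ring.\<close>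

lemma primary_power:
  fixes Q :: "(('n::finite pdo)^'k::finite) set"
  assumes prim: "primary_submodule \<pp> Q" and a: "a \<in> \<pp>"
  shows "\<exists>s. \<forall>z. a ^ s *s z \<in> Q"
proof -
  have Q: "submodule Q" and Ass: "Ass_quotient Q = {\<pp>}" using prim by (auto simp: primary_submodule_def)
  obtain s where s: "\<And>z. a ^ Suc s *s z \<in> Q \<Longrightarrow> a ^ s *s z \<in> Q" using power_stabilises[OF Q] by blast
  have "a ^ s *s z \<in> Q" for z
  proof (rule ccontr)
    assume z: "a ^ s *s z \<notin> Q"
    define L where "L = {z. a ^ s *s z \<in> Q}"
    have L: "submodule L"
      unfolding L_def by (rule submodule_colon[OF Q])
    have "0 *s z \<in> L" "z \<notin> L" using z submoduleD(1)[OF L] by (auto simp: L_def)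
    then obtain I where "I \<in> Ass_quotient L" using zero_divisor_in_Ass[OF L] by metis
    then obtain m where I: "prime_ideal I" "I = {b. b *s m \<in> L}" by (auto simp: Ass_quotient_def)
    have "I = {b. b *s (a ^ s *s m) \<in> Q}" unfolding I(2) by (simp add: L_def vector_smult_assoc mult.commute)
    with I(1) have "I \<in> Ass_quotient Q" unfolding Ass_quotient_def by blast
    with Ass a have "a \<in> I" by auto
    then have "a ^ Suc s *s m \<in> Q" using I(2) by (simp add: L_def vector_smult_assoc mult.commute)
    then have "m \<in> L" using s by (simp add: L_def)
    then have "c \<in> I" for c using I(2) submoduleD(3)[OF L] by auto
    then show False using I(1) by (auto simp: prime_ideal_def)
  qed
  then show ?thesis by blast
qed

text \<open>A component whose variety misses \<xi> absorbs the whole module after multiplication by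
  a power of some element of its prime that is nonzero at \<xi>; the product over these components
  is the required multiplier. Conversely, a multiplier that is nonzero at a point of the variety
  lies outside the prime and is no zero divisor modulo the component.\<close>

lemma inter_components_iff:
  fixes P :: "(('n::finite pdo)^'k::finite) set"
  assumes dec: "irredundant_primary_decomposition P I Q \<pp>"
  shows "p \<in> (\<Inter>i\<in>{i \<in> I. variety (\<pp> i) \<inter> X \<noteq> {}}. Q i) \<longleftrightarrow>
    (\<forall>\<xi>\<in>X. \<exists>a. a *s p \<in> P \<and> poly_eval a \<xi> \<noteq> 0)"
proof -
  have fin: "finite I" and prim: "\<And>i. i \<in> I \<Longrightarrow> primary_submodule (\<pp> i) (Q i)" and P: "P = (\<Inter>i\<in>I. Q i)"
    using dec by (auto simp: irredundant_primary_decomposition_def)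
  have sub: "submodule (Q i)" if "i \<in> I" for i using prim[OF that] by (simp add: primary_submodule_def)
  show ?thesis
  proof (intro iffI ballI INT_I)
    fix \<xi> assume p: "p \<in> (\<Inter>i\<in>{i \<in> I. variety (\<pp> i) \<inter> X \<noteq> {}}. Q i)" and \<xi>: "\<xi> \<in> X"
    define B where "B = {i \<in> I. \<xi> \<notin> variety (\<pp> i)}"
    have "\<exists>a. poly_eval a \<xi> \<noteq> 0 \<and> (\<forall>z. a *s z \<in> Q i)" if i: "i \<in> B" for i
    proof -
      obtain a where a: "a \<in> \<pp> i" "poly_eval a \<xi> \<noteq> 0" using i by (auto simp: B_def variety_def)
      obtain s where "\<forall>z. a ^ s *s z \<in> Q i" using primary_power[OF prim a(1)] i by (auto simp: B_def)
      then show ?thesis using a(2) by (intro exI[of _ "a ^ s"]) simp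
    qed
    then obtain a where a: "\<And>i. i \<in> B \<Longrightarrow> poly_eval (a i) \<xi> \<noteq> 0" "\<And>i z. i \<in> B \<Longrightarrow> a i *s z \<in> Q i" by metis
    have finB: "finite B" using fin by (simp add: B_def)
    have "(\<Prod>i\<in>B. a i) *s p \<in> Q i" if "i \<in> I" for i
    proof (cases "i \<in> B")
      case True
      then have "(\<Prod>i\<in>B. a i) *s p = a i *s ((\<Prod>i\<in>B - {i}. a i) *s p)"
        using finB by (simp add: prod.remove vector_smult_assoc)
      then show ?thesis using a(2)[OF True] by metis
    next
      case False
      then have "p \<in> Q i" using p \<xi> that by (auto simp: B_def)
      then show ?thesis by (intro submoduleD(3) sub that)
    qed
    then show "\<exists>a. a *s p \<in> P \<and> poly_eval a \<xi> \<noteq> 0"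
      using a(1) finB by (intro exI[of _ "\<Prod>i\<in>B. a i"]) (auto simp: P)
  next
    fix i assume *: "\<forall>\<xi>\<in>X. \<exists>a. a *s p \<in> P \<and> poly_eval a \<xi> \<noteq> 0"
      and "i \<in> {i \<in> I. variety (\<pp> i) \<inter> X \<noteq> {}}"
    then obtain \<xi> where i: "i \<in> I" "\<xi> \<in> variety (\<pp> i)" "\<xi> \<in> X" by auto
    with * obtain a where "a *s p \<in> P" "poly_eval a \<xi> \<noteq> 0" by auto
    then show "p \<in> Q i" using primary_zero_divisor[OF prim[OF i(1)], of a p] i by (auto simp: P variety_def)
  qed
qed

text \<open>An index missing from \<open>J\<close> could be omitted from the whole
  decomposition.\<close>

lemma irredundant_inter_eq:
  assumes dec: "irredundant_primary_decomposition P I Q \<pp>" and J: "J \<subseteq> I" "P = (\<Inter>i\<in>J. Q i)"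
  shows "J = I"
proof (rule ccontr)
  assume "J \<noteq> I"
  then obtain j where j: "j \<in> I" "j \<notin> J" using J by auto
  have "P = (\<Inter>i\<in>I. Q i)" and ne: "(\<Inter>i\<in>I - {j}. Q i) \<noteq> P"
    using dec j by (auto simp: irredundant_primary_decomposition_def)
  then show False using j J by blast
qed

subsection \<open>The Nullstellensatz\<close>

lemma ideal_sum:
  assumes "module.subspace (*) J" "\<And>i. i \<in> I \<Longrightarrow> f i \<in> J"
  shows "sum f I \<in> J"
  using assms(2) by (induction I rule: infinite_finite_induct) (auto intro: idealD[OF assms(1)])

lemma pconst_diff: "pconst (c - d) = pconst c - pconst d"
  by (simp add: pconst_def single_diff)

section \<open>Univariate polynomials in one of the variables\<close>

definition insert_var :: "'n \<Rightarrow> complex poly \<Rightarrow> 'n::finite pdo" where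
  "insert_var i h = poly (map_poly pconst h) (pvar i)"

lemma insert_var_0 [simp]: "insert_var i 0 = 0"
  and insert_var_pCons [simp]: "insert_var i (pCons a h) = pconst a + pvar i * insert_var i h"
  by (simp_all add: insert_var_def map_poly_pCons)

lemma insert_var_add: "insert_var i (g + h) = insert_var i g + insert_var i h"
proof (induction g h rule: poly_induct2)
  case (pCons a g b h)
  then show ?case by (simp add: algebra_simps flip: pconst_simps(3))
qed simp

lemma insert_var_smult: "insert_var i (smult c h) = pconst c * insert_var i h"
  by (induction h) (auto simp: algebra_simps simp flip: pconst_simps(4))

lemma insert_var_mult: "insert_var i (g * h) = insert_var i g * insert_var i h"
  by (induction g) (auto simp: insert_var_add insert_var_smult algebra_simps)

lemma insert_var_sum: "insert_var i (\<Sum>j\<in>S. h j) = (\<Sum>j\<in>S. insert_var i (h j))"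
  by (induction S rule: infinite_finite_induct) (auto simp: insert_var_add)

lemma insert_var_prod: "insert_var i (\<Prod>j\<in>S. h j) = (\<Prod>j\<in>S. insert_var i (h j))"
  by (induction S rule: infinite_finite_induct) (auto simp: insert_var_mult one_pCons)

lemma insert_var_linear: "insert_var i [:- c, 1:] = pvar i - pconst c"
  using pconst_diff[of 0 c] by (simp add: algebra_simps)

text \<open>\<open>h\<close> splits into linear factors, each invertible modulo \<open>J\<close>
  with inverse given by \<open>u\<close>. Cancelling them one by one leaves a nonzero constant,
  which a proper ideal does not contain.\<close>

lemma insert_var_notin:
  fixes J :: "'n::finite pdo set"
  assumes J: "module.subspace (*) J" "1 \<notin> J"
    and u: "\<And>c. u c * (pvar i - pconst c) - 1 \<in> J" and h: "h \<noteq> 0"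
  shows "insert_var i h \<notin> J"
  using h
proof (induction "degree h" arbitrary: h)
  case 0
  then obtain a where a: "h = [:a:]" "a \<noteq> 0" by (metis degree_eq_zeroE pCons_0_0)
  show ?case
  proof
    assume "insert_var i h \<in> J"
    then have "pconst (1 / a) * insert_var i h \<in> J" by (intro idealD J)
    with a J show False by simp
  qed
next
  case (Suc n)
  then have "\<not> constant (poly h)" by (simp add: constant_degree)
  then obtain r where "poly h r = 0" using fundamental_theorem_of_algebra by blast
  then obtain g where g: "h = [:- r, 1:] * g" by (metis dvdE poly_eq_0_iff_dvd)
  with Suc have "g \<noteq> 0" by auto
  have "degree h = degree [:- r, 1:] + degree g"
    unfolding g by (rule degree_mult_eq) (use \<open>g \<noteq> 0\<close> in auto)
  then have "degree h = Suc (degree g)" by simp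
  with Suc \<open>g \<noteq> 0\<close> have notin: "insert_var i g \<notin> J" by auto
  show ?case
  proof
    assume "insert_var i h \<in> J"
    then have "u r * insert_var i h - insert_var i g * (u r * (pvar i - pconst r) - 1) \<in> J"
      by (intro idealD[OF J(1)] u)
    moreover have "u r * insert_var i h - insert_var i g * (u r * (pvar i - pconst r) - 1) = insert_var i g"
      by (simp only: g insert_var_mult insert_var_linear) (simp add: algebra_simps)
    ultimately show False using notin by simp
  qed
qed

text \<open>If \<open>x\<^sub>i - c\<close> were invertible modulo \<open>J\<close> for every \<open>c\<close>, the inverses would form an uncountable
  family in a space of countable dimension; a linear relation between them, multiplied by the
  denominators, is a nonzero polynomial in \<open>x\<^sub>i\<close> in \<open>J\<close>.\<close>

lemma exists_noninvertible_shift: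
  fixes J :: "'n::finite pdo set"
  assumes J: "module.subspace (*) J" "1 \<notin> J"
  shows "\<exists>c. \<forall>u. u * (pvar i - pconst c) - 1 \<notin> J"
proof (rule ccontr)
  assume "\<not> ?thesis"
  then obtain u where u: "\<And>c. u c * (pvar i - pconst c) - 1 \<in> J" by metis
  \<comment> \<open>Equal inverses at \<open>c \<noteq> d\<close> would put
    \<open>(d - c) u(c)\<close>, and thus \<open>u(c)\<close>, into \<open>J\<close>, hence also
    1.\<close>
  have inj_u: "inj u"
  proof (rule injI, rule ccontr)
    fix c d assume eq: "u c = u d" and ne: "c \<noteq> d"
    have "(u c * (pvar i - pconst c) - 1) - (u d * (pvar i - pconst d) - 1) \<in> J"
      by (intro idealD[OF J(1)] u)
    then have 1: "pconst (d - c) * u c \<in> J" by (simp add: eq pconst_diff algebra_simps)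
    have "pconst (1 / (d - c)) * (pconst (d - c) * u c) \<in> J" by (intro idealD[OF J(1)] 1)
    moreover have "pconst (1 / (d - c)) * (pconst (d - c) * u c) = u c"
      using ne by (simp flip: mult.assoc)
    ultimately have "u c \<in> J" by simp
    then have "(pvar i - pconst c) * u c - (u c * (pvar i - pconst c) - 1) \<in> J"
      by (intro idealD[OF J(1)] u)
    with J(2) show False by (simp add: mult.commute)
  qed
  let ?key = "\<lambda>p::'n pdo. (\<lambda>\<alpha>. code (Poly_Mapping.lookup \<alpha>)) ` Poly_Mapping.keys p"
  \<comment> \<open>Only countably many finite sets of monomials are available for uncountably many
    \<open>c\<close>, so infinitely many inverses share one set and lie in a finite-dimensional
    space.\<close>
  have "\<exists>K. infinite {c. ?key (u c) = K}"
  proof (rule ccontr)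
    assume "\<nexists>K. infinite {c. ?key (u c) = K}"
    then have fin: "finite {c. ?key (u c) = K}" for K by blast
    have "countable (\<Union>K\<in>Collect finite. {c. ?key (u c) = K})"
      using countable_finite[OF fin] by (rule countable_UN[OF countable_Collect_finite])
    moreover have "(\<Union>K\<in>Collect finite. {c. ?key (u c) = K}) = UNIV"
    proof (intro equalityI subsetI UNIV_I)
      fix c
      show "c \<in> (\<Union>K\<in>Collect finite. {c. ?key (u c) = K})"
        by (rule UN_I[of "?key (u c)"]) simp_all
    qed
    ultimately show False using uncountable_UNIV_complex by (simp only:)
  qed
  then obtain K where K: "infinite {c. ?key (u c) = K}" by blast
  define S where "S = {c. ?key (u c) = K}"
  have "S \<noteq> {}" using K unfolding S_def by (metis finite.emptyI)
  then obtain c0 where c0: "c0 \<in> S" by auto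
  have inj: "inj (\<lambda>\<alpha>::'n \<Rightarrow>\<^sub>0 nat. code (Poly_Mapping.lookup \<alpha>))"
    by (rule injI) (simp add: inj_eq[OF inj_code] lookup_inject)
  have keys: "Poly_Mapping.keys (u c) = Poly_Mapping.keys (u c0)" if "c \<in> S" for c
  proof -
    have "?key (u c) = ?key (u c0)" using that c0 by (simp add: S_def)
    then show ?thesis by (simp only: inj_image_eq_iff[OF inj])
  qed
  interpret V: vector_space "\<lambda>c p. pconst c * p :: 'n pdo"
    by unfold_locales (simp_all add: algebra_simps flip: pconst_simps(3,4))
  let ?T = "(\<lambda>\<alpha>. Poly_Mapping.single \<alpha> (1::complex)) ` Poly_Mapping.keys (u c0)"
  have "u c \<in> V.span ?T" if "c \<in> S" for c
  proof -
    have "u c = (\<Sum>\<alpha>\<in>Poly_Mapping.keys (u c). pconst (Poly_Mapping.lookup (u c) \<alpha>) * Poly_Mapping.single \<alpha> 1)"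
      using pm_sum_single[of "u c"] by (simp add: pconst_def mult_single)
    also have "\<dots> \<in> V.span ?T"
      using keys[OF that] by (intro V.span_sum V.span_scale V.span_base) auto
    finally show ?thesis .
  qed
  then have "u ` S \<subseteq> V.span ?T" by auto
  moreover have "infinite (u ` S)"
    using K inj_u by (metis S_def finite_imageD inj_on_subset subset_UNIV)
  ultimately have "V.dependent (u ` S)" using V.independent_span_bound[of ?T "u ` S"] by auto
  then obtain t w where t: "finite t" "t \<subseteq> u ` S" "(\<Sum>v\<in>t. pconst (w v) * v) = 0" "\<exists>v\<in>t. w v \<noteq> 0"
    unfolding V.dependent_explicit by blast
  define c where "c = the_inv u"
  have uc: "u (c v) = v" if "v \<in> t" for v
    using that t(2) inj_u by (auto simp: c_def the_inv_f_f)
  \<comment> \<open>The numerator of the sum of the fractions \<open>w v / (x - c v)\<close> over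
    their common denominator. At \<open>c v0\<close> all summands but one vanish, so it is not the
    zero polynomial.\<close>
  define h where "h = (\<Sum>v\<in>t. smult (w v) (\<Prod>v'\<in>t - {v}. [:- c v', 1:]))"
  obtain v0 where v0: "v0 \<in> t" "w v0 \<noteq> 0" using t(4) by blast
  have "poly h (c v0) = (\<Sum>v\<in>t. if v = v0 then w v0 * (\<Prod>v'\<in>t - {v0}. c v0 - c v') else 0)"
    unfolding h_def poly_sum using t(1) v0(1) by (intro sum.cong) (auto simp: poly_prod)
  also have "\<dots> = w v0 * (\<Prod>v'\<in>t - {v0}. c v0 - c v')" using t(1) v0(1) by simp
  also have "\<dots> \<noteq> 0" using v0 t(1) uc by (auto simp: prod_zero_iff) (metis)
  finally have "h \<noteq> 0" by auto
  then have notin: "insert_var i h \<notin> J" by (intro insert_var_notin[OF J u])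
  let ?X = "\<lambda>v. pvar i - pconst (c v)"
  have "(\<Sum>v\<in>t. (pconst (w v) * (\<Prod>v'\<in>t - {v}. ?X v')) * (u (c v) * ?X v - 1)) \<in> J"
    by (intro ideal_sum[OF J(1)] idealD[OF J(1)] u)
  moreover have "(\<Sum>v\<in>t. (pconst (w v) * (\<Prod>v'\<in>t - {v}. ?X v')) * (u (c v) * ?X v - 1)) =
      (\<Sum>v\<in>t. pconst (w v) * v * (\<Prod>v'\<in>t. ?X v')) - insert_var i h"
    unfolding h_def insert_var_sum insert_var_smult insert_var_prod insert_var_linear sum_subtractf[symmetric]
  proof (rule sum.cong)
    fix v assume v: "v \<in> t"
    then show "(pconst (w v) * (\<Prod>v'\<in>t - {v}. ?X v')) * (u (c v) * ?X v - 1) =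
        pconst (w v) * v * (\<Prod>v'\<in>t. ?X v') - pconst (w v) * (\<Prod>v'\<in>t - {v}. ?X v')"
      unfolding prod.remove[OF t(1) v] uc[OF v] by (simp add: algebra_simps)
  qed auto
  moreover have "(\<Sum>v\<in>t. pconst (w v) * v * (\<Prod>v'\<in>t. ?X v')) = 0"
    using t(3) by (simp flip: sum_distrib_right)
  ultimately have "- insert_var i h \<in> J" by simp
  then have "0 - (- insert_var i h) \<in> J" by (rule idealD(4)[OF J(1) idealD(1)[OF J(1)]])
  with notin show False by simp
qed

lemma poly_eval_mod_ideal:
  fixes J :: "'n::finite pdo set"
  assumes J: "module.subspace (*) J" and X: "\<And>i. pvar i - pconst (\<xi> $ i) \<in> J"
  shows "a - pconst (poly_eval a \<xi>) \<in> J"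
proof (induction a rule: pdo_induct)
  case (add p q)
  have "(p - pconst (poly_eval p \<xi>)) + (q - pconst (poly_eval q \<xi>)) \<in> J" by (intro idealD[OF J] add)
  then show ?case by (simp add: algebra_simps flip: pconst_simps(3))
next
  case (mult p q)
  have "pconst (poly_eval q \<xi>) * (p - pconst (poly_eval p \<xi>)) + p * (q - pconst (poly_eval q \<xi>)) \<in> J"
    by (intro idealD[OF J] mult)
  then show ?case by (simp add: algebra_simps flip: pconst_simps(4))
qed (auto simp: idealD[OF J] X)

section \<open>Submodules that are maximal without a given element\<close>

lemma submodule_adjoin:
  assumes L: "submodule L" and J: "module.subspace (*) J"
  shows "submodule {l + b *s p | l b. l \<in> L \<and> b \<in> J}"
  unfolding submodule_iff
proof (intro conjI ballI allI)
  show "0 \<in> {l + b *s p | l b. l \<in> L \<and> b \<in> J}"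
    using submoduleD(1)[OF L] idealD(1)[OF J] by force
next
  fix x y assume "x \<in> {l + b *s p | l b. l \<in> L \<and> b \<in> J}" "y \<in> {l + b *s p | l b. l \<in> L \<and> b \<in> J}"
  then obtain l b l' b' where *: "x = l + b *s p" "y = l' + b' *s p" "l \<in> L" "b \<in> J" "l' \<in> L" "b' \<in> J" by blast
  then have "x + y = (l + l') + (b + b') *s p" "l + l' \<in> L" "b + b' \<in> J"
    by (auto simp: vector_sadd_rdistrib intro: submoduleD[OF L] idealD[OF J])
  then show "x + y \<in> {l + b *s p | l b. l \<in> L \<and> b \<in> J}" by blast
next
  fix c x assume "x \<in> {l + b *s p | l b. l \<in> L \<and> b \<in> J}"
  then obtain l b where *: "x = l + b *s p" "l \<in> L" "b \<in> J" by blast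
  then have "c *s x = c *s l + (c * b) *s p" "c *s l \<in> L" "c * b \<in> J"
    by (auto simp: vector_add_ldistrib vector_smult_assoc intro: submoduleD[OF L] idealD[OF J])
  then show "c *s x \<in> {l + b *s p | l b. l \<in> L \<and> b \<in> J}" by blast
qed

text \<open>By maximality \<open>p\<close> enters as soon as any \<open>x\<close> outside
  \<open>L\<close> is adjoined. In the quotient by \<open>L\<close>, the class of \<open>p\<close>
  thus lies in every nonzero submodule.\<close>

lemma maximal_avoiding:
  fixes N :: "(('n::finite pdo)^'k::finite) set"
  assumes "submodule N" "p \<notin> N"
  shows "\<exists>L. submodule L \<and> N \<subseteq> L \<and> p \<notin> L \<and> (\<forall>x. x \<notin> L \<longrightarrow> (\<exists>b. p - b *s x \<in> L))"
proof -
  define F where "F = {L. submodule L \<and> N \<subseteq> L \<and> p \<notin> L}"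
  have "N \<in> F" using assms by (simp add: F_def)
  moreover have "submodule N'" if "N' \<in> F" for N' using that by (simp add: F_def)
  ultimately obtain L where L: "L \<in> F" "\<And>L'. L' \<in> F \<Longrightarrow> L \<subseteq> L' \<Longrightarrow> L' = L"
    using maximal_submodule[of N F] by blast
  then have sub: "submodule L" by (simp add: F_def)
  show ?thesis
  proof (intro exI[of _ L] conjI allI impI)
    show "submodule L" "N \<subseteq> L" "p \<notin> L" using L(1) by (auto simp: F_def)
    fix x assume x: "x \<notin> L"
    define L' where "L' = {l + b *s x | l b. l \<in> L \<and> b \<in> UNIV}"
    have sub': "submodule L'" unfolding L'_def by (intro submodule_adjoin sub) (simp add: ideal_iff)
    have inc: "L \<subseteq> L'"
    proof
      fix l assume "l \<in> L"
      then show "l \<in> L'" unfolding L'_def by (intro CollectI exI[of _ l] exI[of _ 0]) simp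
    qed
    have "x \<in> L'" using submoduleD(1)[OF sub] unfolding L'_def by (intro CollectI exI[of _ 0] exI[of _ 1]) simp
    then have "L' \<noteq> L" using x by blast
    then have "L' \<notin> F" using L(2) inc by blast
    then have "p \<in> L'" using L(1) inc sub' unfolding F_def by blast
    then obtain l b where "p = l + b *s x" "l \<in> L" unfolding L'_def by blast
    then show "\<exists>b. p - b *s x \<in> L" by (intro exI[of _ b]) simp
  qed
qed

text \<open>In the quotient by \<open>L\<close> the class of \<open>p\<close> generates a simple
  module, so a shift \<open>x\<^sub>i - c\<close> outside its annihilator \<open>J\<close> is
  invertible modulo \<open>J\<close>. A shift that is not invertible therefore lies in
  \<open>J\<close>, and the constants of these shifts are the coordinates of the point.\<close>

lemma nullstellensatz:
  fixes N :: "(('n::finite pdo)^'k::finite) set"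
  assumes "submodule N" "p \<notin> N"
  shows "\<exists>\<xi>. \<forall>a. a *s p \<in> N \<longrightarrow> poly_eval a \<xi> = 0"
proof -
  obtain L where L: "submodule L" "N \<subseteq> L" "p \<notin> L" "\<And>x. x \<notin> L \<Longrightarrow> \<exists>b. p - b *s x \<in> L"
    using maximal_avoiding[OF assms] by blast
  define J where "J = {a. a *s p \<in> L}"
  have J: "module.subspace (*) J" unfolding J_def by (rule colon_ideal[OF L(1)])
  have J1: "1 \<notin> J" using L(3) by (simp add: J_def)
  have "\<exists>c. pvar i - pconst c \<in> J" for i
  proof -
    obtain c where c: "\<And>u. u * (pvar i - pconst c) - 1 \<notin> J"
      using exists_noninvertible_shift[OF J J1] by blast
    have "pvar i - pconst c \<in> J"
    proof (rule ccontr)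
      assume "pvar i - pconst c \<notin> J"
      then obtain b where "p - b *s ((pvar i - pconst c) *s p) \<in> L"
        using L(4)[of "(pvar i - pconst c) *s p"] unfolding J_def by blast
      then have "1 - b * (pvar i - pconst c) \<in> J"
        by (simp add: J_def vector_smult_assoc vec_eq_iff algebra_simps vector_sub_rdistrib)
      then have "0 - (1 - b * (pvar i - pconst c)) \<in> J" by (rule idealD(4)[OF J idealD(1)[OF J]])
      with c[of b] show False by simp
    qed
    then show ?thesis by blast
  qed
  then obtain f where f: "\<And>i. pvar i - pconst (f i) \<in> J" by metis
  let ?\<xi> = "\<chi> i. f i"
  have "poly_eval a ?\<xi> = 0" if "a *s p \<in> N" for a
  proof (rule ccontr)
    let ?c = "poly_eval a ?\<xi>"
    assume nz: "?c \<noteq> 0"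
    have "a \<in> J" using that L(2) by (auto simp: J_def)
    moreover have "a - pconst ?c \<in> J" using f by (intro poly_eval_mod_ideal[OF J]) auto
    ultimately have "pconst (1 / ?c) * (a - (a - pconst ?c)) \<in> J"
      by (rule idealD(3)[OF J idealD(4)[OF J]])
    with J1 nz show False by simp
  qed
  then show ?thesis by blast
qed

text \<open>A submodule that is maximal among those containing \<open>N + \<mm> p\<close> but not \<open>p\<close> contains a power of each
  \<open>x\<^sub>i - \<xi>\<^sub>i\<close> times the whole module. This replaces Krull's intersection theorem.\<close>

lemma krull_separation:
  fixes N :: "(('n::finite pdo)^'k::finite) set"
  assumes N: "submodule N" and van: "\<And>a. a *s p \<in> N \<Longrightarrow> poly_eval a \<xi> = 0"
  obtains L s where "submodule L" "N \<subseteq> L" "p \<notin> L"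
    "\<And>i v. (pvar i - pconst (\<xi> $ i)) ^ s *s v \<in> L"
proof -
  let ?m = "{b. poly_eval b \<xi> = 0}"
  let ?N = "{l + b *s p | l b. l \<in> N \<and> b \<in> ?m}"
  have m: "module.subspace (*) ?m" by (simp add: ideal_iff)
  have N': "submodule ?N" by (rule submodule_adjoin[OF N m])
  \<comment> \<open>If \<open>p\<close> were \<open>l + b *s p\<close>, then \<open>1 - b\<close>
    would carry \<open>p\<close> into \<open>N\<close>, although its value at \<xi> is 1.\<close>
  have pN: "p \<notin> ?N"
  proof
    assume "p \<in> ?N"
    then obtain l b where lb: "p = l + b *s p" "l \<in> N" "poly_eval b \<xi> = 0" by blast
    have "(1 - b) *s p = p - b *s p" by (simp add: vec_eq_iff algebra_simps)
    also have "\<dots> = l" using lb(1) by (simp add: algebra_simps)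
    finally have "poly_eval (1 - b) \<xi> = 0" using lb(2) by (intro van) simp
    with lb(3) show False by simp
  qed
  from maximal_avoiding[OF N' pN]
  obtain L where L0: "submodule L \<and> ?N \<subseteq> L \<and> p \<notin> L \<and> (\<forall>x. x \<notin> L \<longrightarrow> (\<exists>b. p - b *s x \<in> L))"
    by (rule exE)
  then have L: "submodule L" "?N \<subseteq> L" "p \<notin> L" "\<And>x. x \<notin> L \<Longrightarrow> \<exists>b. p - b *s x \<in> L"
    by metis+
  have NL: "N \<subseteq> L"
  proof
    fix x assume "x \<in> N"
    then have "x + 0 *s p \<in> ?N" by (intro CollectI exI[of _ x] exI[of _ 0]) auto
    with L(2) show "x \<in> L" by auto
  qed
  have mL: "b *s p \<in> L" if "poly_eval b \<xi> = 0" for b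
  proof -
    have "0 + b *s p \<in> ?N" using that submoduleD(1)[OF N] by blast
    with L(2) show ?thesis by auto
  qed
  let ?X = "\<lambda>i. pvar i - pconst (\<xi> $ i)"
  have "\<exists>s. \<forall>v. ?X i ^ s *s v \<in> L" for i
  proof -
    \<comment> \<open>Suppose \<open>X^s v\<close> is outside \<open>L\<close>; then
      \<open>p\<close> equals some \<open>b X^s v\<close> modulo \<open>L\<close>. As
      \<open>X p\<close> lies in \<open>L\<close>, so does \<open>X^(s+1) b v\<close>, and stability
      brings \<open>X^s b v\<close>, hence \<open>p\<close>, into \<open>L\<close>.\<close>
    obtain s where s: "\<And>z. ?X i ^ Suc s *s z \<in> L \<Longrightarrow> ?X i ^ s *s z \<in> L"
      using power_stabilises[OF L(1)] by blast
    have "?X i ^ s *s v \<in> L" for v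
    proof (rule ccontr)
      assume "?X i ^ s *s v \<notin> L"
      then obtain b where b: "p - b *s (?X i ^ s *s v) \<in> L" using L(4) by blast
      have "?X i *s p - ?X i *s (p - b *s (?X i ^ s *s v)) \<in> L"
        by (intro submoduleD[OF L(1)] b mL) simp
      moreover have "?X i *s p - ?X i *s (p - b *s (?X i ^ s *s v)) = ?X i ^ Suc s *s (b *s v)"
        by (simp add: vec_eq_iff algebra_simps)
      ultimately have "?X i ^ Suc s *s (b *s v) \<in> L" by (simp only:)
      then have "?X i ^ s *s (b *s v) \<in> L" by (rule s)
      then have "b *s (?X i ^ s *s v) \<in> L" by (simp add: vector_smult_assoc mult.commute)
      with b have "(p - b *s (?X i ^ s *s v)) + b *s (?X i ^ s *s v) \<in> L" by (rule submoduleD(2)[OF L(1)])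
      with L(3) show False by simp
    qed
    then show ?thesis by blast
  qed
  then obtain s where s: "\<And>i v. ?X i ^ s i *s v \<in> L" by metis
  \<comment> \<open>Adding the exponents gives one that serves all variables at once.\<close>
  have "?X i ^ (\<Sum>i\<in>UNIV. s i) *s v \<in> L" for i v
  proof -
    have "?X i ^ (\<Sum>i\<in>UNIV. s i) = ?X i ^ s i * ?X i ^ (\<Sum>i\<in>UNIV - {i}. s i)"
      by (simp add: sum.remove[of UNIV i] power_add)
    then show ?thesis using s by (simp flip: vector_smult_assoc)
  qed
  then show ?thesis using that L NL by blast
qed

text \<open>Linear over the complex numbers only: its values on all multiples of the basis vectors
  are the data from which an exponential polynomial is built.\<close>

lemma separating_functional:
  fixes L :: "(('n::finite pdo)^'k::finite) set"
  assumes L: "submodule L" "p \<notin> L"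
  obtains \<phi> :: "('n pdo)^'k \<Rightarrow> complex" where
    "\<And>x y. \<phi> (x + y) = \<phi> x + \<phi> y" "\<And>c x. \<phi> (pconst c *s x) = c * \<phi> x"
    "\<And>x. x \<in> L \<Longrightarrow> \<phi> x = 0" "\<phi> p \<noteq> 0"
proof -
  interpret V: vector_space_pair "\<lambda>c x. pconst c *s x :: ('n pdo)^'k" "(*) :: complex \<Rightarrow> complex \<Rightarrow> complex"
    by unfold_locales (simp_all add: algebra_simps vec_eq_iff flip: pconst_simps(3,4))
  have Ls: "V.vs1.subspace L" using L(1) by (auto simp: V.vs1.subspace_def submodule_iff)
  obtain B where B: "B \<subseteq> L" "V.vs1.independent B" "L \<subseteq> V.vs1.span B" by (rule V.vs1.basis_exists)
  have span: "V.vs1.span B = L" by (rule V.vs1.span_subspace[OF B(1,3) Ls])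
  then have "V.vs1.independent (insert p B)" using L(2) B(2) by (intro V.vs1.independent_insertI) auto
  then obtain \<phi> where \<phi>: "Vector_Spaces.linear (\<lambda>c x. pconst c *s x :: ('n pdo)^'k) (*) \<phi>"
    "\<And>x. x \<in> insert p B \<Longrightarrow> \<phi> x = (if x = p then 1 else 0)"
    using V.linear_independent_extend[of "insert p B" "\<lambda>x. if x = p then 1 else 0"] by blast
  show ?thesis
  proof (rule that[of \<phi>])
    show "\<phi> (x + y) = \<phi> x + \<phi> y" for x y by (rule V.linear_add[OF \<phi>(1)])
    show "\<phi> (pconst c *s x) = c * \<phi> x" for c x by (rule V.linear_scale[OF \<phi>(1)])
    show "\<phi> p \<noteq> 0" using \<phi>(2) by simp
    fix x assume "x \<in> L"
    then have "x \<in> V.vs1.span B" by (simp only: span)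
    moreover have "\<phi> y = 0" if y: "y \<in> B" for y
    proof -
      have "y \<noteq> p" using y B(1) L(2) by blast
      with y \<phi>(2)[of y] show ?thesis by simp
    qed
    ultimately show "\<phi> x = 0" using V.linear_eq_0_on_span[OF \<phi>(1), of B x] by blast
  qed
qed

subsection \<open>Torsion-free quotients\<close>

text \<open>Over the field of fractions \<open>p\<close> lies outside the span of \<open>N\<close>,
  so a linear form separates them. The proof is Gaussian elimination without fractions;
  \<open>S\<close> holds the coordinates that are still in use.\<close>

lemma separating_row:
  fixes N :: "(('n::finite pdo)^'k::finite) set"
  assumes "finite S" "submodule N" "\<And>v j. v \<in> N \<Longrightarrow> j \<notin> S \<Longrightarrow> v $ j = 0"
    "\<And>j. j \<notin> S \<Longrightarrow> p $ j = 0" "\<And>a. a \<noteq> 0 \<Longrightarrow> a *s p \<notin> N"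
  shows "\<exists>q::('n pdo)^'k. (\<forall>v\<in>N. (\<Sum>j\<in>UNIV. q $ j * v $ j) = 0) \<and> (\<Sum>j\<in>UNIV. q $ j * p $ j) \<noteq> 0"
  using assms
proof (induction S arbitrary: N p rule: finite_psubset_induct)
  case (psubset S N p)
  note N = psubset.prems(1)
  show ?case
  proof (cases "\<forall>v\<in>N. v = 0")
    case True
    have "p \<notin> N" using psubset.prems(4)[of 1] pdo_prod_nonzero[of "{}"] by simp
    then have "p \<noteq> 0" using submoduleD(1)[OF N] by auto
    then obtain l where l: "p $ l \<noteq> 0" by (auto simp: vec_eq_iff)
    have "(\<Sum>j\<in>UNIV. axis l 1 $ j * p $ j) = (\<Sum>j\<in>UNIV. if j = l then p $ l else 0)"
      by (intro sum.cong) (auto simp: axis_def)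
    with l True show ?thesis by (intro exI[of _ "axis l 1"]) auto
  next
    case False
    then obtain w l where w: "w \<in> N" "w $ l \<noteq> 0" by (auto simp: vec_eq_iff)
    then have lS: "l \<in> S" using psubset.prems(2) by blast
    \<comment> \<open>Elimination of coordinate \<open>l\<close> with pivot \<open>w\<close>,
      cross-multiplied to stay inside the ring.\<close>
    define e where "e = (\<lambda>v. w $ l *s v - v $ l *s w)"
    have eN: "e v \<in> N" if "v \<in> N" for v using that w(1) by (auto simp: e_def intro: submoduleD[OF N])
    have el: "e v $ l = 0" for v by (simp add: e_def mult.commute)
    define N' where "N' = {v \<in> N. v $ l = 0}"
    have "\<exists>q::('n pdo)^'k. (\<forall>v\<in>N'. (\<Sum>j\<in>UNIV. q $ j * v $ j) = 0) \<and> (\<Sum>j\<in>UNIV. q $ j * e p $ j) \<noteq> 0"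
    proof (rule psubset.IH)
      show "S - {l} \<subset> S" using lS by auto
      show "submodule N'" using N unfolding N'_def submodule_iff by auto
      show "v $ j = 0" if "v \<in> N'" "j \<notin> S - {l}" for v j using that psubset.prems(2)[of v j] by (auto simp: N'_def)
      show "e p $ j = 0" if "j \<notin> S - {l}" for j
        using that psubset.prems(2)[OF w(1)] psubset.prems(3) by (cases "j = l") (auto simp: el, simp add: e_def)
      fix a :: "'n pdo" assume a: "a \<noteq> 0"
      show "a *s e p \<notin> N'"
      proof
        assume "a *s e p \<in> N'"
        then have "a *s e p \<in> N" by (simp add: N'_def)
        then have "a *s e p + (a * p $ l) *s w \<in> N" using w(1) by (metis submoduleD(2,3)[OF N])
        moreover have "a *s e p + (a * p $ l) *s w = (a * w $ l) *s p"
          by (simp add: e_def vec_eq_iff algebra_simps)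
        ultimately show False using psubset.prems(4)[of "a * w $ l"] pdo_mult_eq_0[of a "w $ l"] a w(2) by auto
      qed
    qed
    then obtain q :: "('n pdo)^'k" where q: "\<And>v. v \<in> N' \<Longrightarrow> (\<Sum>j\<in>UNIV. q $ j * v $ j) = 0"
      "(\<Sum>j\<in>UNIV. q $ j * e p $ j) \<noteq> 0" by blast
    \<comment> \<open>The transposed elimination: pairing \<open>?q\<close> with \<open>v\<close> is
      pairing \<open>q\<close> with \<open>e v\<close>.\<close>
    let ?q = "w $ l *s q - (\<Sum>j\<in>UNIV. q $ j * w $ j) *s axis l 1"
    have eq: "(\<Sum>j\<in>UNIV. ?q $ j * v $ j) = (\<Sum>j\<in>UNIV. q $ j * e v $ j)" for v
    proof -
      have "(\<Sum>j\<in>UNIV. ?q $ j * v $ j) = (\<Sum>j\<in>UNIV. w $ l * q $ j * v $ j) -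
          (\<Sum>j\<in>UNIV. (\<Sum>j\<in>UNIV. q $ j * w $ j) * axis l 1 $ j * v $ j)"
        by (simp add: algebra_simps sum_subtractf)
      also have "(\<Sum>j\<in>UNIV. (\<Sum>j\<in>UNIV. q $ j * w $ j) * axis l 1 $ j * v $ j) =
          (\<Sum>j\<in>UNIV. if j = l then (\<Sum>j\<in>UNIV. q $ j * w $ j) * v $ l else 0)"
        by (intro sum.cong) (auto simp: axis_def)
      finally show ?thesis
        by (simp add: e_def algebra_simps sum_subtractf sum_distrib_left sum_distrib_right)
    qed
    have "e v \<in> N'" if "v \<in> N" for v using eN[OF that] el by (simp add: N'_def)
    then have "\<forall>v\<in>N. (\<Sum>j\<in>UNIV. ?q $ j * v $ j) = 0" unfolding eq using q(1) by blast
    moreover have "(\<Sum>j\<in>UNIV. ?q $ j * p $ j) \<noteq> 0" unfolding eq by (rule q(2))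
    ultimately show ?thesis by blast
  qed
qed

subsection \<open>Smooth functions\<close>

lemma D_fun_eq:
  assumes "(f has_derivative f') (at x)"
  shows "D_fun j f x = (1 / \<i>) * f' (axis j 1)"
  using frechet_derivative_at[OF assms] by (simp add: D_fun_def)

text \<open>Smoothness is shown by exhibiting a class of differentiable functions closed under
  \<open>D_fun\<close>, which avoids formulas for higher derivatives.\<close>

lemma smooth_coinduct:
  assumes "f \<in> S" "\<And>g. g \<in> S \<Longrightarrow> g differentiable_on UNIV" "\<And>g j. g \<in> S \<Longrightarrow> D_fun j g \<in> S"
  shows "smooth f"
proof -
  have "foldr D_fun js f \<in> S" for js by (induction js) (auto intro: assms)
  then show ?thesis by (auto simp: smooth_def intro: assms)
qed

lemma smooth_D_fun:
  assumes "smooth f" shows "smooth (D_fun j f)"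
proof -
  have "foldr D_fun js (D_fun j f) = foldr D_fun (js @ [j]) f" for js by simp
  with assms show ?thesis unfolding smooth_def by (simp only: simp_thms)
qed

lemma smooth_foldr: "smooth f \<Longrightarrow> smooth (foldr D_fun js f)"
  by (induction js) (auto intro: smooth_D_fun)

lemma smooth_differentiable: "smooth f \<Longrightarrow> f differentiable (at x)"
  unfolding smooth_def by (drule spec[of _ "[]"]) (simp add: differentiable_on_def)

text \<open>The factor \<i> undoes the one in \<open>D_fun\<close>.\<close>

lemma smooth_has_derivative:
  assumes "smooth f"
  shows "(f has_derivative (\<lambda>h. \<Sum>j\<in>UNIV. \<i> * D_fun j f x * of_real (h $ j))) (at x)"
proof -
  let ?f' = "frechet_derivative f (at x)"
  have d: "(f has_derivative ?f') (at x)"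
    using smooth_differentiable[OF assms] by (simp add: frechet_derivative_works)
  interpret linear ?f' using d has_derivative_linear by blast
  have "?f' h = (\<Sum>j\<in>UNIV. \<i> * D_fun j f x * of_real (h $ j))" for h
  proof -
    have "?f' h = ?f' (\<Sum>j\<in>UNIV. h $ j *\<^sub>R axis j 1)"
      by (subst basis_expansion[of h, unfolded scalar_mult_eq_scaleR, symmetric]) simp
    also have "\<dots> = (\<Sum>j\<in>UNIV. \<i> * D_fun j f x * of_real (h $ j))"
      unfolding sum scale D_fun_def by (intro sum.cong) (simp_all add: scaleR_conv_of_real)
    finally show ?thesis .
  qed
  then have "?f' = (\<lambda>h. \<Sum>j\<in>UNIV. \<i> * D_fun j f x * of_real (h $ j))" by auto
  with d show ?thesis by metis
qed

lemma smooth_continuous_on: "smooth f \<Longrightarrow> continuous_on S f"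
  by (intro continuous_at_imp_continuous_on ballI differentiable_imp_continuous_within smooth_differentiable)

lemma smooth_measurable: "smooth f \<Longrightarrow> f \<in> borel_measurable borel"
  by (intro borel_measurable_continuous_onI smooth_continuous_on)

lemma D_fun_add:
  assumes "f differentiable (at x)" "g differentiable (at x)"
  shows "D_fun j (\<lambda>x. f x + g x) x = D_fun j f x + D_fun j g x"
  using has_derivative_add[OF assms[unfolded frechet_derivative_works]]
  by (subst D_fun_eq) (auto simp: D_fun_def algebra_simps)

lemma D_fun_mult:
  assumes "f differentiable (at x)" "g differentiable (at x)"
  shows "D_fun j (\<lambda>x. f x * g x) x = D_fun j f x * g x + f x * D_fun j g x"
  using has_derivative_mult[OF assms[unfolded frechet_derivative_works]]
  by (subst D_fun_eq) (auto simp: D_fun_def algebra_simps)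

lemma D_fun_const [simp]: "D_fun j (\<lambda>x. c) = (\<lambda>x. 0)"
  by (rule ext) (subst D_fun_eq[OF has_derivative_const], simp)

lemma smooth_const [intro, simp]: "smooth (\<lambda>x. c)"
  by (rule smooth_coinduct[of _ "{(\<lambda>x. c), (\<lambda>x. 0)}"]) auto

lemma smooth_add [intro]:
  assumes "smooth f" "smooth g"
  shows "smooth (\<lambda>x. f x + g x)"
proof (rule smooth_coinduct[of _ "{\<lambda>x. f x + g x | f g. smooth f \<and> smooth g}"])
  fix h j assume "h \<in> {\<lambda>x. f x + g x | f g. smooth f \<and> smooth g}"
  then obtain f g where h: "h = (\<lambda>x. f x + g x)" "smooth f" "smooth g" by blast
  have "(\<lambda>x. f x + g x) differentiable (at x)" for x
    by (rule differentiable_add; rule smooth_differentiable; rule h)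
  then show "h differentiable_on UNIV" by (simp add: h(1) differentiable_on_def)
  have "D_fun j h = (\<lambda>x. D_fun j f x + D_fun j g x)"
    unfolding h(1) by (rule ext, rule D_fun_add; intro smooth_differentiable h)
  then show "D_fun j h \<in> {\<lambda>x. f x + g x | f g. smooth f \<and> smooth g}"
    using h smooth_D_fun by blast
qed (use assms in blast)

text \<open>A derivative of a product is no longer a single product, but finite sums of products are
  closed under \<open>D_fun\<close> by the Leibniz rule.\<close>

inductive_set smooth_products :: "(real^'n::finite \<Rightarrow> complex) set" where
  prod: "smooth f \<Longrightarrow> smooth g \<Longrightarrow> (\<lambda>x. f x * g x) \<in> smooth_products"
| add: "h \<in> smooth_products \<Longrightarrow> k \<in> smooth_products \<Longrightarrow> (\<lambda>x. h x + k x) \<in> smooth_products"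

lemma smooth_products_D:
  assumes "h \<in> smooth_products"
  shows "h differentiable (at x) \<and> D_fun j h \<in> smooth_products"
  using assms
proof (induction arbitrary: x j)
  case (prod f g)
  have "D_fun j (\<lambda>x. f x * g x) = (\<lambda>x. D_fun j f x * g x + f x * D_fun j g x)"
    by (rule ext, rule D_fun_mult; intro smooth_differentiable prod)
  moreover have "(\<lambda>x. f x * g x) differentiable (at x)"
    by (rule differentiable_mult; intro smooth_differentiable prod)
  ultimately show ?case using prod by (auto intro!: smooth_products.intros smooth_D_fun)
next
  case (add h k)
  have "D_fun j (\<lambda>x. h x + k x) = (\<lambda>x. D_fun j h x + D_fun j k x)"
    by (rule ext, rule D_fun_add) (use add in auto)
  with add show ?case by (auto intro!: differentiable_add smooth_products.intros)
qed

lemma smooth_mult [intro]: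
  assumes "smooth f" "smooth g"
  shows "smooth (\<lambda>x. f x * g x)"
proof (rule smooth_coinduct[of _ smooth_products])
  show "h differentiable_on UNIV" if "h \<in> smooth_products" for h :: "real^'a \<Rightarrow> complex"
    using smooth_products_D[OF that] by (auto simp: differentiable_on_def)
qed (use assms smooth_products_D in \<open>auto intro: smooth_products.intros\<close>)

lemma smooth_sum [intro]: "(\<And>i. i \<in> I \<Longrightarrow> smooth (f i)) \<Longrightarrow> smooth (\<lambda>x. \<Sum>i\<in>I. f i x)"
  by (induction I rule: infinite_finite_induct) auto

lemma smooth_prod [intro]: "(\<And>i. i \<in> I \<Longrightarrow> smooth (f i)) \<Longrightarrow> smooth (\<lambda>x. \<Prod>i\<in>I. f i x)"
  by (induction I rule: infinite_finite_induct) auto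

lemma smooth_power [intro]: "smooth f \<Longrightarrow> smooth (\<lambda>x. f x ^ n)"
  by (induction n) auto

lemma smooth_uminus [intro]: "smooth f \<Longrightarrow> smooth (\<lambda>x. - f x)"
  using smooth_mult[of "\<lambda>_. -1" f] by simp

lemma smooth_diff [intro]: "smooth f \<Longrightarrow> smooth g \<Longrightarrow> smooth (\<lambda>x. f x - g x)"
  using smooth_add[of f "\<lambda>x. - g x"] by auto

lemma D_fun_cmult: "smooth f \<Longrightarrow> D_fun j (\<lambda>x. c * f x) = (\<lambda>x. c * D_fun j f x)"
  by (rule ext, subst D_fun_mult) (auto intro: smooth_differentiable)

lemma D_fun_sum:
  "(\<And>i. i \<in> I \<Longrightarrow> smooth (f i)) \<Longrightarrow> D_fun j (\<lambda>x. \<Sum>i\<in>I. f i x) = (\<lambda>x. \<Sum>i\<in>I. D_fun j (f i) x)"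
proof (induction I rule: infinite_finite_induct)
  case (insert i I)
  have "D_fun j (\<lambda>x. f i x + (\<Sum>i\<in>I. f i x)) = (\<lambda>x. D_fun j (f i) x + D_fun j (\<lambda>x. \<Sum>i\<in>I. f i x) x)"
    by (rule ext, rule D_fun_add) (use insert in \<open>auto intro!: smooth_differentiable\<close>)
  with insert show ?case by simp
qed auto

lemma foldr_D_fun_sum:
  assumes "\<And>i. i \<in> I \<Longrightarrow> smooth (f i)"
  shows "foldr D_fun js (\<lambda>x. \<Sum>i\<in>I. c i * f i x) = (\<lambda>x. \<Sum>i\<in>I. c i * foldr D_fun js (f i) x)"
proof (induction js)
  case (Cons j js)
  have "D_fun j (\<lambda>x. \<Sum>i\<in>I. c i * foldr D_fun js (f i) x) = (\<lambda>x. \<Sum>i\<in>I. D_fun j (\<lambda>x. c i * foldr D_fun js (f i) x) x)"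
    by (intro D_fun_sum smooth_mult smooth_const smooth_foldr assms)
  also have "\<dots> = (\<lambda>x. \<Sum>i\<in>I. c i * D_fun j (foldr D_fun js (f i)) x)"
    by (rule ext, rule sum.cong) (auto simp: D_fun_cmult smooth_foldr assms)
  finally show ?case using Cons by simp
qed simp

lemma has_derivative_coord: "((\<lambda>x::real^'n::finite. complex_of_real (x $ i)) has_derivative (\<lambda>h. of_real (h $ i))) (at x)"
  by (intro has_derivative_of_real bounded_linear_imp_has_derivative bounded_linear_vec_nth)

lemma D_fun_coord: "D_fun j (\<lambda>x. of_real (x $ i)) = (\<lambda>x. if i = j then 1 / \<i> else 0)"
  by (rule ext, subst D_fun_eq[OF has_derivative_coord]) (auto simp: axis_def)

lemma smooth_coord [intro, simp]: "smooth (\<lambda>x. of_real (x $ i))"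
proof (rule smooth_coinduct[of _ "insert (\<lambda>x. of_real (x $ i)) {f. smooth f}"])
  fix g j assume "g \<in> insert (\<lambda>x. complex_of_real (x $ i)) {f. smooth f}"
  then show "g differentiable_on UNIV" "D_fun j g \<in> insert (\<lambda>x. complex_of_real (x $ i)) {f. smooth f}"
    using has_derivative_coord[of i]
    by (auto simp: differentiable_on_def D_fun_coord intro: smooth_differentiable smooth_D_fun differentiableI)
qed simp

section \<open>Exponentials, translations and locality of derivatives\<close>

definition cis_dot :: "real^'n::finite \<Rightarrow> complex^'n \<Rightarrow> complex" where
  "cis_dot x \<xi> = exp (\<i> * (\<Sum>j\<in>UNIV. of_real (x $ j) * \<xi> $ j))"

lemma has_derivative_cis_dot:
  "((\<lambda>x. cis_dot x \<xi>) has_derivative (\<lambda>h. cis_dot x \<xi> * (\<i> * (\<Sum>j\<in>UNIV. of_real (h $ j) * \<xi> $ j)))) (at x)"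
proof -
  have "((\<lambda>x::real^'a. \<Sum>j\<in>UNIV. of_real (x $ j) * \<xi> $ j) has_derivative (\<lambda>h. \<Sum>j\<in>UNIV. of_real (h $ j) * \<xi> $ j)) (at x)"
    by (intro has_derivative_sum has_derivative_mult_left has_derivative_coord)
  from has_derivative_mult_right[OF this, of \<i>]
  have "((\<lambda>x::real^'a. \<i> * (\<Sum>j\<in>UNIV. of_real (x $ j) * \<xi> $ j)) has_derivative (\<lambda>h. \<i> * (\<Sum>j\<in>UNIV. of_real (h $ j) * \<xi> $ j))) (at x)" .
  from has_derivative_compose[OF this DERIV_exp[unfolded has_field_derivative_def]] show ?thesis
    unfolding cis_dot_def by (simp add: mult.commute)
qed

lemma D_fun_cis_dot: "D_fun j (\<lambda>x. cis_dot x \<xi>) = (\<lambda>x. \<xi> $ j * cis_dot x \<xi>)"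
proof
  fix x
  have "(\<Sum>l\<in>UNIV. of_real (axis j 1 $ l) * \<xi> $ l) = (\<Sum>l\<in>UNIV. if l = j then \<xi> $ j else 0)"
    by (intro sum.cong) (auto simp: axis_def)
  then show "D_fun j (\<lambda>x. cis_dot x \<xi>) x = \<xi> $ j * cis_dot x \<xi>"
    by (subst D_fun_eq[OF has_derivative_cis_dot]) (simp add: ac_simps)
qed

lemma smooth_cis_dot [intro, simp]: "smooth (\<lambda>x. cis_dot x \<xi>)"
proof (rule smooth_coinduct[of _ "range (\<lambda>c x. c * cis_dot x \<xi>)"])
  show "(\<lambda>x. cis_dot x \<xi>) \<in> range (\<lambda>c x. c * cis_dot x \<xi>)" by (intro range_eqI[of _ _ 1]) simp
  fix g j assume "g \<in> range (\<lambda>c x. c * cis_dot x \<xi>)"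
  then obtain c where g: "g = (\<lambda>x. c * cis_dot x \<xi>)" by auto
  have d: "(\<lambda>x. cis_dot x \<xi>) differentiable (at x)" for x
    using has_derivative_cis_dot differentiableI by blast
  show "g differentiable_on UNIV" unfolding g differentiable_on_def using d by (auto intro!: differentiable_mult)
  have "D_fun j g = (\<lambda>x. (c * \<xi> $ j) * cis_dot x \<xi>)"
    unfolding g by (rule ext, subst D_fun_mult) (auto simp: d D_fun_cis_dot)
  then show "D_fun j g \<in> range (\<lambda>c x. c * cis_dot x \<xi>)" by blast
qed

lemma D_fun_shift: "D_fun j (\<lambda>x. f (x + v)) = (\<lambda>x. D_fun j f (x + v))" if "smooth f"
proof
  fix x
  have "((\<lambda>x. f (x + v)) has_derivative (frechet_derivative f (at (x + v)))) (at x)"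
    using smooth_differentiable[OF that, of "x + v"] unfolding frechet_derivative_works
    by (auto intro!: has_derivative_compose[of "\<lambda>x. x + v" _ x UNIV f, simplified] derivative_eq_intros)
  then show "D_fun j (\<lambda>x. f (x + v)) x = D_fun j f (x + v)" by (subst D_fun_eq) (auto simp: D_fun_def)
qed

lemma smooth_shift [intro]:
  assumes "smooth f" shows "smooth (\<lambda>x. f (x + v))"
proof (rule smooth_coinduct[of _ "{\<lambda>x. f (x + v) | f. smooth f}"])
  fix g j assume "g \<in> {\<lambda>x. f (x + v) | f. smooth f}"
  then obtain f where f: "g = (\<lambda>x. f (x + v))" "smooth f" by blast
  have "f differentiable (at (x + v))" for x using smooth_differentiable[OF f(2)] by simp
  then show "g differentiable_on UNIV"
    unfolding f(1) differentiable_on_def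
    by (intro ballI differentiable_compose[of f "\<lambda>x. x + v"]) (auto simp: intro!: derivative_intros)
  show "D_fun j g \<in> {\<lambda>x. f (x + v) | f. smooth f}"
    unfolding f(1) D_fun_shift[OF f(2)] using smooth_D_fun[OF f(2)] by blast
qed (use assms in blast)

lemma foldr_D_fun_shift: "smooth f \<Longrightarrow> foldr D_fun js (\<lambda>x. f (x + v)) = (\<lambda>x. foldr D_fun js f (x + v))"
  by (induction js) (auto simp: D_fun_shift smooth_foldr)

lemma D_fun_local:
  assumes "open U" "x \<in> U" "\<And>y. y \<in> U \<Longrightarrow> f y = g y"
  shows "D_fun j f x = D_fun j g x"
proof -
  have "(f has_derivative F) (at x) \<longleftrightarrow> (g has_derivative F) (at x)" for F
    using has_derivative_transform_within_open[OF _ assms(1,2), of f F UNIV g]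
      has_derivative_transform_within_open[OF _ assms(1,2), of g F UNIV f] assms(3) by auto
  then show ?thesis by (simp add: D_fun_def frechet_derivative_def)
qed

lemma differentiable_local:
  assumes "open U" "x \<in> U" "\<And>y. y \<in> U \<Longrightarrow> f y = g y" "g differentiable (at x)"
  shows "f differentiable (at x)"
  using has_derivative_transform_within_open[OF _ assms(1,2), of g _ UNIV f] assms(3,4)
  unfolding differentiable_def by auto

subsection \<open>Partial derivatives commute\<close>

text \<open>The mean value theorem twice: along \<open>a\<close>, for the difference in direction
  \<open>b\<close>, and then along \<open>b\<close>.\<close>

lemma second_difference:
  fixes u :: "'a::real_normed_vector \<Rightarrow> real"
  assumes t: "t > 0"
    and a: "\<And>y. ((\<lambda>s. u (y + s *\<^sub>R a)) has_real_derivative ua y) (at 0)"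
    and b: "\<And>y. ((\<lambda>s. ua (y + s *\<^sub>R b)) has_real_derivative uab y) (at 0)"
  shows "\<exists>s r. 0 < s \<and> s < t \<and> 0 < r \<and> r < t \<and>
    u (x + t *\<^sub>R a + t *\<^sub>R b) - u (x + t *\<^sub>R a) - u (x + t *\<^sub>R b) + u x = t * t * uab (x + s *\<^sub>R a + r *\<^sub>R b)"
proof -
  have along: "((\<lambda>s. w (y + s *\<^sub>R c)) has_real_derivative wc (y + s *\<^sub>R c)) (at s)"
    if "\<And>y. ((\<lambda>s. w (y + s *\<^sub>R c)) has_real_derivative wc y) (at 0)" for w wc :: "'a \<Rightarrow> real" and c y s
  proof -
    have "((\<lambda>r. w ((y + s *\<^sub>R c) + r *\<^sub>R c)) has_real_derivative wc (y + s *\<^sub>R c)) (at (s - s))"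
      using that[of "y + s *\<^sub>R c"] by simp
    then have "((\<lambda>r. w ((y + s *\<^sub>R c) + (r - s) *\<^sub>R c)) has_real_derivative wc (y + s *\<^sub>R c) * 1) (at s)"
      by (rule DERIV_chain2[where g="\<lambda>r. r - s"]) (auto intro!: derivative_eq_intros)
    then show ?thesis by (simp add: algebra_simps)
  qed
  let ?g = "\<lambda>s. u (x + t *\<^sub>R b + s *\<^sub>R a) - u (x + s *\<^sub>R a)"
  have "(?g has_real_derivative (ua (x + t *\<^sub>R b + s *\<^sub>R a) - ua (x + s *\<^sub>R a))) (at s)" for s
    by (rule DERIV_diff[OF along[OF a] along[OF a]])
  from MVT2[OF t this] obtain s where s: "0 < s" "s < t"
    "?g t - ?g 0 = (t - 0) * (ua (x + t *\<^sub>R b + s *\<^sub>R a) - ua (x + s *\<^sub>R a))" by blast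
  have "((\<lambda>r. ua (x + s *\<^sub>R a + r *\<^sub>R b)) has_real_derivative uab (x + s *\<^sub>R a + r *\<^sub>R b)) (at r)" for r
    by (rule along[OF b])
  from MVT2[OF t this] obtain r where r: "0 < r" "r < t"
    "ua (x + s *\<^sub>R a + t *\<^sub>R b) - ua (x + s *\<^sub>R a + 0 *\<^sub>R b) = (t - 0) * uab (x + s *\<^sub>R a + r *\<^sub>R b)" by blast
  show ?thesis
    using s r by (intro exI[of _ s] exI[of _ r]) (simp add: algebra_simps)
qed

text \<open>The second difference does not depend on the order of \<open>a\<close> and
  \<open>b\<close>, so \<open>uab\<close> and \<open>uba\<close> take a common value at two points
  arbitrarily near \<open>x\<close>; continuity does the rest.\<close>

lemma symmetric_second_derivative:
  fixes u :: "'a::real_normed_vector \<Rightarrow> real"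
  assumes a: "\<And>y. ((\<lambda>s. u (y + s *\<^sub>R a)) has_real_derivative ua y) (at 0)"
    and b: "\<And>y. ((\<lambda>s. u (y + s *\<^sub>R b)) has_real_derivative ub y) (at 0)"
    and ab: "\<And>y. ((\<lambda>s. ua (y + s *\<^sub>R b)) has_real_derivative uab y) (at 0)"
    and ba: "\<And>y. ((\<lambda>s. ub (y + s *\<^sub>R a)) has_real_derivative uba y) (at 0)"
    and cont: "isCont uab x" "isCont uba x"
  shows "uab x = uba x"
proof -
  have "\<exists>p q. norm (p - x) \<le> t * (norm a + norm b) \<and> norm (q - x) \<le> t * (norm a + norm b) \<and> uab p = uba q"
    if t: "t > 0" for t
  proof -
    obtain s r where sr: "0 < s" "s < t" "0 < r" "r < t"
      "u (x + t *\<^sub>R a + t *\<^sub>R b) - u (x + t *\<^sub>R a) - u (x + t *\<^sub>R b) + u x = t * t * uab (x + s *\<^sub>R a + r *\<^sub>R b)"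
      using second_difference[OF t a ab] by blast
    obtain s' r' where sr': "0 < s'" "s' < t" "0 < r'" "r' < t"
      "u (x + t *\<^sub>R b + t *\<^sub>R a) - u (x + t *\<^sub>R b) - u (x + t *\<^sub>R a) + u x = t * t * uba (x + s' *\<^sub>R b + r' *\<^sub>R a)"
      using second_difference[OF t b ba] by blast
    have "t * t * uab (x + s *\<^sub>R a + r *\<^sub>R b) = t * t * uba (x + s' *\<^sub>R b + r' *\<^sub>R a)"
      unfolding sr(5)[symmetric] sr'(5)[symmetric] by (simp add: algebra_simps)
    moreover have "norm (s *\<^sub>R c + r *\<^sub>R d) \<le> t * (norm c + norm d)" if "0 < s" "s < t" "0 < r" "r < t" for s r and c d :: 'a
    proof -
      have "norm (s *\<^sub>R c + r *\<^sub>R d) \<le> s * norm c + r * norm d"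
        using norm_triangle_ineq[of "s *\<^sub>R c" "r *\<^sub>R d"] that by simp
      also have "\<dots> \<le> t * norm c + t * norm d" using that by (intro add_mono mult_right_mono) auto
      finally show ?thesis by (simp add: algebra_simps)
    qed
    from this[OF sr(1-4), of a b] this[OF sr'(1-4), of b a]
    have "norm (x + s *\<^sub>R a + r *\<^sub>R b - x) \<le> t * (norm a + norm b)" "norm (x + s' *\<^sub>R b + r' *\<^sub>R a - x) \<le> t * (norm a + norm b)"
      by (simp_all add: algebra_simps)
    ultimately show ?thesis using t by (metis mult_cancel_left mult_pos_pos less_irrefl)
  qed
  then have "\<forall>n. \<exists>p q. norm (p - x) \<le> inverse (real (Suc n)) * (norm a + norm b) \<and>
      norm (q - x) \<le> inverse (real (Suc n)) * (norm a + norm b) \<and> uab p = uba q"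
    by simp
  then obtain p q where pq: "\<And>n. norm (p n - x) \<le> inverse (real (Suc n)) * (norm a + norm b)"
    "\<And>n. norm (q n - x) \<le> inverse (real (Suc n)) * (norm a + norm b)" "\<And>n. uab (p n) = uba (q n)" by metis
  have z: "(\<lambda>n. inverse (real (Suc n)) * (norm a + norm b)) \<longlonglongrightarrow> 0 * (norm a + norm b)"
    by (intro tendsto_mult LIMSEQ_inverse_real_of_nat tendsto_const)
  have "p \<longlonglongrightarrow> x" "q \<longlonglongrightarrow> x"
    by (rule LIM_zero_cancel, rule Lim_null_comparison[OF always_eventually[OF allI]], rule pq, use z in simp)+
  then have "(\<lambda>n. uab (p n)) \<longlonglongrightarrow> uab x" "(\<lambda>n. uba (q n)) \<longlonglongrightarrow> uba x"
    using cont by (auto intro: isCont_tendsto_compose)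
  then show ?thesis using pq(3) LIMSEQ_unique by simp
qed

lemma D_fun_commute:
  assumes "smooth f"
  shows "D_fun i (D_fun j f) = D_fun j (D_fun i f)"
proof
  fix x
  have along: "((\<lambda>s. Re (c * g (y + s *\<^sub>R axis l 1))) has_real_derivative Re (c * \<i> * D_fun l g y)) (at 0)"
    if g: "smooth g" for g :: "real^'a \<Rightarrow> complex" and c l y
  proof -
    have "((\<lambda>s::real. y + s *\<^sub>R axis l 1) has_derivative (\<lambda>s. s *\<^sub>R axis l 1)) (at 0)"
      by (auto intro!: derivative_eq_intros)
    moreover have "(g has_derivative (\<lambda>h. \<Sum>j\<in>UNIV. \<i> * D_fun j g y * of_real (h $ j))) (at (y + 0 *\<^sub>R axis l 1))"
      using smooth_has_derivative[OF g] by simp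
    ultimately have "((\<lambda>s::real. g (y + s *\<^sub>R axis l 1)) has_derivative
        (\<lambda>s. \<Sum>j\<in>UNIV. \<i> * D_fun j g y * of_real ((s *\<^sub>R axis l 1) $ j))) (at 0)"
      by (rule has_derivative_compose)
    moreover have "(\<Sum>j\<in>UNIV. \<i> * D_fun j g y * of_real ((s *\<^sub>R axis l 1) $ j)) = \<i> * D_fun l g y * of_real s" for s
    proof -
      have "(\<Sum>j\<in>UNIV. \<i> * D_fun j g y * of_real ((s *\<^sub>R axis l 1) $ j)) =
          (\<Sum>j\<in>UNIV. if j = l then \<i> * D_fun l g y * of_real s else 0)"
        by (intro sum.cong) (auto simp: axis_def)
      then show ?thesis by simp
    qed
    ultimately have "((\<lambda>s::real. g (y + s *\<^sub>R axis l 1)) has_derivative (\<lambda>s. \<i> * D_fun l g y * of_real s)) (at 0)"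
      by simp
    from bounded_linear.has_derivative[OF bounded_linear_Re has_derivative_mult_right[OF this, of c]]
    have "((\<lambda>s::real. Re (c * g (y + s *\<^sub>R axis l 1))) has_derivative (\<lambda>s. Re (c * (\<i> * D_fun l g y * of_real s)))) (at 0)" .
    moreover have "(\<lambda>s::real. Re (c * (\<i> * D_fun l g y * of_real s))) = (*) (Re (c * \<i> * D_fun l g y))"
    proof
      fix s :: real
      have "c * (\<i> * D_fun l g y * of_real s) = s *\<^sub>R (c * \<i> * D_fun l g y)"
        by (simp add: scaleR_conv_of_real)
      then show "Re (c * (\<i> * D_fun l g y * of_real s)) = Re (c * \<i> * D_fun l g y) * s" by simp
    qed
    ultimately show ?thesis by (simp only: has_field_derivative_def)
  qed
  have cont: "isCont (\<lambda>y. Re (c * D_fun l (D_fun k f) y)) x" for c l k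
    using smooth_continuous_on[OF smooth_D_fun[OF smooth_D_fun[OF assms]], of UNIV l k]
    by (auto simp: continuous_on_eq_continuous_at intro!: continuous_intros isCont_Re)
  \<comment> \<open>The mean value theorem needs real functions. The real parts for
    \<open>c = 1\<close> and \<open>c = - \<i>\<close> recover the complex identity, and the sign in
    \<open>- c\<close> compensates the two factors \<i> from differentiation.\<close>
  have "Re (c * D_fun i (D_fun j f) x) = Re (c * D_fun j (D_fun i f) x)" for c
  proof -
    have "Re ((- c * \<i>) * \<i> * D_fun i (D_fun j f) x) = Re ((- c * \<i>) * \<i> * D_fun j (D_fun i f) x)"
      by (rule symmetric_second_derivative[of "\<lambda>y. Re ((- c) * f y)" "axis j 1" "\<lambda>y. Re ((- c) * \<i> * D_fun j f y)" "axis i 1"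
          "\<lambda>y. Re ((- c) * \<i> * D_fun i f y)" "\<lambda>y. Re ((- c * \<i>) * \<i> * D_fun i (D_fun j f) y)"
          "\<lambda>y. Re ((- c * \<i>) * \<i> * D_fun j (D_fun i f) y)"])
        (rule along assms smooth_D_fun cont)+
    moreover have "(- c * \<i>) * \<i> = c" by (simp add: mult.assoc)
    ultimately show ?thesis by simp
  qed
  from this[of 1] this[of "- \<i>"] show "D_fun i (D_fun j f) x = D_fun j (D_fun i f) x"
    by (intro complex_eqI) auto
qed

lemma foldr_D_fun_move:
  assumes "smooth f"
  shows "foldr D_fun (as @ j # bs) f = D_fun j (foldr D_fun (as @ bs) f)"
proof (induction as)
  case (Cons a as)
  have "foldr D_fun ((a # as) @ j # bs) f = D_fun a (D_fun j (foldr D_fun (as @ bs) f))"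
    using Cons by simp
  also have "\<dots> = D_fun j (D_fun a (foldr D_fun (as @ bs) f))"
    by (rule D_fun_commute) (rule smooth_foldr[OF assms])
  finally show ?case by simp
qed simp

lemma foldr_D_fun_perm:
  assumes "smooth f" "mset js = mset ks"
  shows "foldr D_fun js f = foldr D_fun ks f"
  using assms(2)
proof (induction js arbitrary: ks)
  case (Cons j js)
  then have "j \<in> set ks" by (metis list.set_intros(1) set_mset_mset)
  then obtain as bs where ks: "ks = as @ j # bs" by (meson split_list)
  then have "mset js = mset (as @ bs)" using Cons.prems by simp
  from Cons.IH[OF this] show ?case by (simp only: ks foldr_D_fun_move[OF assms(1)]) simp
qed simp

text \<open>A name for the list chosen by \<open>iterate_multi\<close>. Since the derivatives
  commute, only its multiplicities matter.\<close>

definition multi_list :: "('n::finite \<Rightarrow>\<^sub>0 nat) \<Rightarrow> 'n list" where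
  "multi_list \<alpha> = (SOME js. \<forall>j. count_list js j = Poly_Mapping.lookup \<alpha> j)"

lemma count_multi_list: "count_list (multi_list \<alpha>) j = Poly_Mapping.lookup \<alpha> j"
proof -
  obtain js where js: "mset js = (\<Sum>i\<in>UNIV. replicate_mset (Poly_Mapping.lookup \<alpha> i) i)"
    using ex_mset by blast
  have "count_list js j = Poly_Mapping.lookup \<alpha> j" for j
    by (simp flip: count_mset add: js count_sum)
  then have "\<exists>js. \<forall>j. count_list js j = Poly_Mapping.lookup \<alpha> j" by blast
  from someI_ex[OF this] show ?thesis by (simp add: multi_list_def)
qed

lemma iterate_multi_eq: "iterate_multi d \<alpha> = foldr d (multi_list \<alpha>)"
  by (simp add: iterate_multi_def multi_list_def)

lemma mset_multi_list_iff: "mset js = mset (multi_list \<alpha>) \<longleftrightarrow> (\<forall>j. count_list js j = Poly_Mapping.lookup \<alpha> j)"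
  by (auto simp: multiset_eq_iff count_mset count_multi_list)

lemma multi_list_0 [simp]: "multi_list 0 = []"
proof -
  have "mset [] = mset (multi_list (0 :: 'a \<Rightarrow>\<^sub>0 nat))" unfolding mset_multi_list_iff by simp
  then show ?thesis by simp
qed

lemma iterate_multi_0 [simp]: "iterate_multi d 0 f = f"
  by (simp add: iterate_multi_eq)

lemma iterate_multi_D_fun_add:
  assumes "smooth f"
  shows "iterate_multi D_fun (\<alpha> + \<beta>) f = iterate_multi D_fun \<alpha> (iterate_multi D_fun \<beta> f)"
proof -
  have "mset (multi_list \<alpha> @ multi_list \<beta>) = mset (multi_list (\<alpha> + \<beta>))"
    unfolding mset_multi_list_iff by (simp add: count_multi_list lookup_add)
  from foldr_D_fun_perm[OF assms this] show ?thesis by (simp add: iterate_multi_eq)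
qed

lemma iterate_multi_D_fun_single:
  assumes "smooth f"
  shows "iterate_multi D_fun (Poly_Mapping.single j 1) f = D_fun j f"
proof -
  have "mset [j] = mset (multi_list (Poly_Mapping.single j 1))"
    unfolding mset_multi_list_iff by (auto simp: lookup_single when_def)
  from foldr_D_fun_perm[OF assms this] show ?thesis by (simp add: iterate_multi_eq)
qed

lemma smooth_iterate_multi: "smooth f \<Longrightarrow> smooth (iterate_multi D_fun \<alpha> f)"
  by (simp add: iterate_multi_eq smooth_foldr)

definition pdo_fun :: "'n::finite pdo \<Rightarrow> (real^'n \<Rightarrow> complex) \<Rightarrow> real^'n \<Rightarrow> complex" where
  "pdo_fun p f = (\<lambda>x. lin p (\<lambda>\<alpha>. iterate_multi D_fun \<alpha> f x))"

lemma smooth_pdo_fun: "smooth f \<Longrightarrow> smooth (pdo_fun p f)"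
  unfolding pdo_fun_def lin_def by (intro smooth_sum smooth_mult smooth_const smooth_iterate_multi)

lemma pdo_fun_add: "pdo_fun (p + q) f x = pdo_fun p f x + pdo_fun q f x"
  by (simp add: pdo_fun_def lin_add)

lemma pdo_fun_mult:
  assumes "smooth f"
  shows "pdo_fun (p * q) f = pdo_fun p (pdo_fun q f)"
proof
  fix x
  have "iterate_multi D_fun \<alpha> (pdo_fun q f) x = lin q (\<lambda>\<beta>. iterate_multi D_fun (\<alpha> + \<beta>) f x)" for \<alpha>
    unfolding pdo_fun_def lin_def iterate_multi_D_fun_add[OF assms]
    unfolding iterate_multi_eq[of _ \<alpha>]
    by (subst foldr_D_fun_sum) (auto intro: smooth_iterate_multi assms)
  then show "pdo_fun (p * q) f x = pdo_fun p (pdo_fun q f) x"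
    by (simp add: pdo_fun_def[of "p * q"] pdo_fun_def[of p] lin_mult)
qed

lemma pdo_fun_sum:
  assumes "\<And>i. i \<in> I \<Longrightarrow> smooth (f i)"
  shows "pdo_fun p (\<lambda>x. \<Sum>i\<in>I. f i x) = (\<lambda>x. \<Sum>i\<in>I. pdo_fun p (f i) x)"
  using foldr_D_fun_sum[of I f _ "\<lambda>_. 1", OF assms]
  by (simp add: pdo_fun_def iterate_multi_eq lin_sum_right)

subsection \<open>Test functions\<close>

text \<open>The polynomial factor makes the class closed under differentiation: with
  \<open>u = 1 / t\<close>, the derivative of \<open>p(u) e^(-u)\<close> in \<open>t\<close> is
  \<open>u^2 (p(u) - p'(u)) e^(-u)\<close>.\<close>

definition bump_poly :: "real poly \<Rightarrow> real \<Rightarrow> real" where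
  "bump_poly p t = (if t \<le> 0 then 0 else poly p (1 / t) * exp (- (1 / t)))"

text \<open>The free power \<open>u ^ k\<close> takes up the factor that each induction step over
  the coefficients of \<open>p\<close> splits off.\<close>

lemma tendsto_power_poly_exp: "((\<lambda>u::real. u ^ k * poly p u * exp (- u)) \<longlongrightarrow> 0) at_top"
proof (induction p arbitrary: k)
  case (pCons a p)
  have "((\<lambda>u::real. a * (u ^ k / exp u) + u ^ Suc k * poly p u * exp (- u)) \<longlongrightarrow> a * 0 + 0) at_top"
    by (intro tendsto_intros tendsto_power_div_exp_0 pCons)
  then show ?case by (simp add: exp_minus field_simps)
qed simp

lemma tendsto_bump_poly_0: "(bump_poly p \<longlongrightarrow> 0) (at 0)"
proof -
  have "((\<lambda>u::real. poly p u * exp (- u)) \<longlongrightarrow> 0) at_top"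
    using tendsto_power_poly_exp[of 0 p] by simp
  from filterlim_compose[OF this filterlim_inverse_at_top_right]
  have "((\<lambda>t. poly p (inverse t) * exp (- inverse t)) \<longlongrightarrow> 0) (at_right 0)" .
  moreover have "\<forall>\<^sub>F t::real in at_right 0. poly p (inverse t) * exp (- inverse t) = bump_poly p t"
    unfolding eventually_at_right_field by (intro exI[of _ 1]) (auto simp: bump_poly_def field_simps)
  ultimately have "(bump_poly p \<longlongrightarrow> 0) (at_right 0)" by (rule Lim_transform_eventually)
  moreover have "(bump_poly p \<longlongrightarrow> 0) (at_left 0)"
  proof (rule Lim_transform_eventually)
    show "\<forall>\<^sub>F t::real in at_left 0. 0 = bump_poly p t"
      unfolding eventually_at_left_field by (intro exI[of _ "-1"]) (auto simp: bump_poly_def)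
  qed simp
  ultimately show ?thesis by (intro filterlim_split_at)
qed

lemma has_real_derivative_bump_poly:
  "(bump_poly p has_real_derivative bump_poly ([:0, 0, 1:] * (p - pderiv p)) t) (at t)"
proof -
  consider "t < 0" | "t = 0" | "t > 0" by linarith
  then show ?thesis
  proof cases
    case 1
    have "((\<lambda>t. 0) has_real_derivative 0) (at t)" by simp
    then have "(bump_poly p has_real_derivative 0) (at t)"
      by (rule DERIV_cong_ev[THEN iffD1, rotated -1])
         (use 1 in \<open>auto simp: bump_poly_def eventually_nhds intro!: exI[of _ "{..<0}"]\<close>)
    with 1 show ?thesis by (simp add: bump_poly_def)
  next
    \<comment> \<open>At 0 the difference quotient is itself a \<open>bump_poly\<close>, with
      polynomial \<open>u p(u)\<close>, and tends to 0.\<close>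
    case 2
    have "\<forall>\<^sub>F s in at (0::real). bump_poly ([:0, 1:] * p) s = (bump_poly p s - bump_poly p 0) / (s - 0)"
      by (auto simp: eventually_at_filter bump_poly_def field_simps)
    from Lim_transform_eventually[OF tendsto_bump_poly_0 this]
    have "(bump_poly p has_real_derivative 0) (at 0)" by (simp add: has_field_derivative_iff)
    with 2 show ?thesis by (simp add: bump_poly_def)
  next
    case 3
    have "((\<lambda>t. poly p (1 / t) * exp (- (1 / t))) has_real_derivative
        poly (pderiv p) (1 / t) * (- (1 / t\<^sup>2)) * exp (- (1 / t)) + poly p (1 / t) * (exp (- (1 / t)) * (1 / t\<^sup>2))) (at t)"
      using 3 by (auto intro!: derivative_eq_intros DERIV_chain2[OF poly_DERIV] simp: power2_eq_square)
    then have "(bump_poly p has_real_derivative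
        poly (pderiv p) (1 / t) * (- (1 / t\<^sup>2)) * exp (- (1 / t)) + poly p (1 / t) * (exp (- (1 / t)) * (1 / t\<^sup>2))) (at t)"
      by (rule DERIV_cong_ev[THEN iffD1, rotated -1])
         (use 3 in \<open>auto simp: bump_poly_def eventually_nhds intro!: exI[of _ "{0<..}"]\<close>)
    moreover have "poly (pderiv p) (1 / t) * (- (1 / t\<^sup>2)) * exp (- (1 / t)) + poly p (1 / t) * (exp (- (1 / t)) * (1 / t\<^sup>2)) =
        bump_poly ([:0, 0, 1:] * (p - pderiv p)) t"
      using 3 by (simp add: bump_poly_def power2_eq_square field_simps)
    ultimately show ?thesis by simp
  qed
qed

text \<open>\<open>r\<close> is the square of the radius of the ball around
  \<open>a\<close>.\<close>

definition bump :: "real poly \<Rightarrow> real^'n::finite \<Rightarrow> real \<Rightarrow> real^'n \<Rightarrow> complex" where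
  "bump p a r x = of_real (bump_poly p (r - (x - a) \<bullet> (x - a)))"

lemma has_derivative_bump:
  "(bump p a r has_derivative (\<lambda>h. of_real (bump_poly ([:0, 0, 1:] * (p - pderiv p)) (r - (x - a) \<bullet> (x - a)) * (- 2 * ((x - a) \<bullet> h))))) (at x)"
proof -
  have "((\<lambda>x. r - (x - a) \<bullet> (x - a)) has_derivative (\<lambda>h. - 2 * ((x - a) \<bullet> h))) (at x)"
    by (auto intro!: derivative_eq_intros simp: inner_commute)
  from has_derivative_of_real[OF has_derivative_compose[OF this
    has_real_derivative_bump_poly[unfolded has_field_derivative_def]]]
  show ?thesis unfolding bump_def .
qed

lemma D_fun_bump:
  "D_fun j (bump p a r) = (\<lambda>x. (1 / \<i> * (- 2) * (of_real (x $ j) - of_real (a $ j))) * bump ([:0, 0, 1:] * (p - pderiv p)) a r x)"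
  by (rule ext, subst D_fun_eq[OF has_derivative_bump])
     (simp add: bump_def inner_axis algebra_simps)

inductive_set bump_multiples :: "real^'n::finite \<Rightarrow> real \<Rightarrow> (real^'n \<Rightarrow> complex) set" for a r where
  mult: "smooth q \<Longrightarrow> (\<lambda>x. q x * bump p a r x) \<in> bump_multiples a r"
| add: "h \<in> bump_multiples a r \<Longrightarrow> k \<in> bump_multiples a r \<Longrightarrow> (\<lambda>x. h x + k x) \<in> bump_multiples a r"

lemma bump_multiples_D:
  assumes "h \<in> bump_multiples a r"
  shows "h differentiable (at x) \<and> D_fun j h \<in> bump_multiples a r"
  using assms
proof (induction arbitrary: x j)
  case (mult q p)
  have d: "bump p a r differentiable (at x)" for x using has_derivative_bump differentiableI by blast
  have eq: "D_fun j (\<lambda>x. q x * bump p a r x) = (\<lambda>x. D_fun j q x * bump p a r x +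
      (q x * (1 / \<i> * (- 2) * (of_real (x $ j) - of_real (a $ j)))) * bump ([:0, 0, 1:] * (p - pderiv p)) a r x)"
    by (rule ext, subst D_fun_mult) (auto simp: smooth_differentiable mult d D_fun_bump)
  have "D_fun j (\<lambda>x. q x * bump p a r x) \<in> bump_multiples a r"
    unfolding eq by (intro bump_multiples.intros smooth_D_fun smooth_mult smooth_const smooth_diff smooth_coord mult)
  moreover have "(\<lambda>x. q x * bump p a r x) differentiable (at x)"
    by (rule differentiable_mult[OF smooth_differentiable[OF mult] d])
  ultimately show ?case by blast
next
  case (add h k)
  have "D_fun j (\<lambda>x. h x + k x) = (\<lambda>x. D_fun j h x + D_fun j k x)"
    by (rule ext, rule D_fun_add) (use add in auto)
  with add show ?case by (auto intro!: differentiable_add bump_multiples.intros)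
qed

lemma smooth_bump: "smooth (bump p a r)"
proof (rule smooth_coinduct[of _ "bump_multiples a r"])
  show "bump p a r \<in> bump_multiples a r" using bump_multiples.mult[of "\<lambda>_. 1" p a r] by simp
  fix g j assume "g \<in> bump_multiples a r"
  from bump_multiples_D[OF this]
  show "g differentiable_on UNIV" "D_fun j g \<in> bump_multiples a r"
    by (auto simp: differentiable_on_def)
qed

lemma test_functionsI:
  assumes "smooth f" "compact K" "\<And>x. f x \<noteq> 0 \<Longrightarrow> x \<in> K"
  shows "f \<in> test_functions" "supp f \<subseteq> K"
proof -
  show "supp f \<subseteq> K" unfolding supp_def using assms by (intro closure_minimal compact_imp_closed) auto
  then have "compact (supp f)"
    using closed_Int_compact[of "supp f" K] assms(2) by (simp add: supp_def Int_absorb2)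
  with assms(1) show "f \<in> test_functions" by (simp add: test_functions_def)
qed

lemma in_supp: "f x \<noteq> 0 \<Longrightarrow> x \<in> supp f"
  unfolding supp_def using closure_subset[of "{x. f x \<noteq> 0}"] by auto

lemma test_functionsD: "f \<in> test_functions \<Longrightarrow> smooth f" "f \<in> test_functions \<Longrightarrow> compact (supp f)"
  by (auto simp: test_functions_def)

lemma bump_test:
  assumes "r > 0"
  shows "bump 1 a (r\<^sup>2) \<in> test_functions" "supp (bump 1 a (r\<^sup>2)) \<subseteq> cball a r"
proof -
  have "x \<in> cball a r" if "bump 1 a (r\<^sup>2) x \<noteq> 0" for x
  proof -
    have "r\<^sup>2 > (x - a) \<bullet> (x - a)" using that by (auto simp: bump_def bump_poly_def split: if_splits)
    then have "(norm (x - a))\<^sup>2 \<le> r\<^sup>2" by (simp add: power2_norm_eq_inner)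
    then have "norm (x - a) \<le> r" using assms by (rule power2_le_imp_le[OF _ less_imp_le])
    then show ?thesis by (simp add: dist_norm norm_minus_commute)
  qed
  from test_functionsI[OF smooth_bump compact_cball this]
  show "bump 1 a (r\<^sup>2) \<in> test_functions" "supp (bump 1 a (r\<^sup>2)) \<subseteq> cball a r" by blast+
qed

lemma bump_center: "r > 0 \<Longrightarrow> bump 1 a (r\<^sup>2) a \<noteq> 0"
  by (simp add: bump_def bump_poly_def)

lemma bump_real: "bump 1 a r x = of_real (bump_poly 1 (r - (x - a) \<bullet> (x - a)))" "bump_poly 1 t \<ge> 0"
  by (simp_all add: bump_def bump_poly_def)

lemma D_fun_outside_supp:
  assumes "x \<notin> supp f" shows "D_fun j f x = 0"
proof -
  have "D_fun j f x = D_fun j (\<lambda>_. 0) x"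
    by (rule D_fun_local[of "- supp f"]) (use assms in_supp in \<open>auto simp: supp_def\<close>)
  then show ?thesis by simp
qed

lemma test_D_fun:
  assumes "f \<in> test_functions"
  shows "D_fun j f \<in> test_functions" "supp (D_fun j f) \<subseteq> supp f"
  using test_functionsI[of "D_fun j f" "supp f"] D_fun_outside_supp[of _ f j] assms
  by (auto simp: test_functions_def smooth_D_fun)

lemma test_foldr:
  assumes "f \<in> test_functions"
  shows "foldr D_fun js f \<in> test_functions" "supp (foldr D_fun js f) \<subseteq> supp f"
proof -
  have "foldr D_fun js f \<in> test_functions \<and> supp (foldr D_fun js f) \<subseteq> supp f"
  proof (induction js)
    case (Cons j js)
    then show ?case
      using test_D_fun[of "foldr D_fun js f" j] by (metis foldr_Cons comp_apply order_trans)
  qed (use assms in simp)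
  then show "foldr D_fun js f \<in> test_functions" "supp (foldr D_fun js f) \<subseteq> supp f" by blast+
qed

lemma test_mult:
  assumes "f \<in> test_functions" "smooth g"
  shows "(\<lambda>x. g x * f x) \<in> test_functions"
  by (rule test_functionsI[of _ "supp f"]) (use assms in_supp[of f] in \<open>auto simp: test_functions_def\<close>)

lemma test_add:
  assumes "f \<in> test_functions" "g \<in> test_functions"
  shows "(\<lambda>x. f x + g x) \<in> test_functions" "supp (\<lambda>x. f x + g x) \<subseteq> supp f \<union> supp g"
proof -
  have sm: "smooth (\<lambda>x. f x + g x)" and c: "compact (supp f \<union> supp g)"
    using assms by (auto simp: test_functions_def)
  have "x \<in> supp f \<union> supp g" if "f x + g x \<noteq> 0" for x
    using that in_supp[of f x] in_supp[of g x] by (cases "f x = 0") auto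
  from test_functionsI[OF sm c this]
  show "(\<lambda>x. f x + g x) \<in> test_functions" "supp (\<lambda>x. f x + g x) \<subseteq> supp f \<union> supp g" by blast+
qed

lemma test_zero [simp]: "(\<lambda>x. 0) \<in> test_functions"
  by (rule test_functionsI[of _ "{}"]) auto

lemma test_cmult: "f \<in> test_functions \<Longrightarrow> (\<lambda>x. c * f x) \<in> test_functions"
  by (rule test_mult) auto

lemma test_sum: "(\<And>i. i \<in> I \<Longrightarrow> f i \<in> test_functions) \<Longrightarrow> (\<lambda>x. \<Sum>i\<in>I. f i x) \<in> test_functions"
  by (induction I rule: infinite_finite_induct) (auto intro: test_add)

lemma test_shift:
  assumes "f \<in> test_functions"
  shows "(\<lambda>x. f (x + v)) \<in> test_functions" "supp (\<lambda>x. f (x + v)) \<subseteq> (\<lambda>x. x - v) ` supp f"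
proof -
  have c: "compact ((\<lambda>x. x - v) ` supp f)"
    using assms by (intro compact_continuous_image continuous_intros) (auto simp: test_functions_def)
  have "x \<in> (\<lambda>x. x - v) ` supp f" if "f (x + v) \<noteq> 0" for x
    using in_supp[of f "x + v"] that by (intro image_eqI[of _ _ "x + v"]) auto
  from test_functionsI[OF smooth_shift[OF test_functionsD(1)[OF assms]] c this]
  show "(\<lambda>x. f (x + v)) \<in> test_functions" "supp (\<lambda>x. f (x + v)) \<subseteq> (\<lambda>x. x - v) ` supp f" by blast+
qed

text \<open>Locally the quotient is either zero, off the support of \<open>f\<close>, or of the form
  \<open>q / s^k\<close> with \<open>s\<close> nonzero. The quotient rule preserves this
  alternative, raising the exponent by 1. Where \<open>s\<close> vanishes, so does \<open>f\<close>,
  and the quotient is 0.\<close>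

lemma smooth_divide_supported:
  fixes f s :: "real^'n::finite \<Rightarrow> complex"
  assumes "smooth f" "smooth s" "\<And>x. x \<in> supp f \<Longrightarrow> s x \<noteq> 0"
  shows "smooth (\<lambda>x. f x / s x)"
proof -
  define S where "S = {g::real^'n \<Rightarrow> complex. \<forall>x. \<exists>U. open U \<and> x \<in> U \<and>
    ((\<forall>y\<in>U. g y = 0) \<or> (\<exists>k q. smooth q \<and> (\<forall>y\<in>U. s y \<noteq> 0 \<and> g y = q y * inverse (s y) ^ k)))}"
  have inv: "((\<lambda>y. inverse (s y)) has_derivative (\<lambda>h. - (inverse (s x) * (\<Sum>j\<in>UNIV. \<i> * D_fun j s x * of_real (h $ j)) * inverse (s x)))) (at x)"
    if "s x \<noteq> 0" for x
    by (rule Deriv.has_derivative_inverse[OF that smooth_has_derivative[OF assms(2)]])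
  then have dinv: "(\<lambda>y. inverse (s y)) differentiable (at x)" if "s x \<noteq> 0" for x
    using that differentiableI by blast
  have Dinv: "D_fun j (\<lambda>y. inverse (s y)) x = - D_fun j s x * inverse (s x) ^ 2" if "s x \<noteq> 0" for x j
  proof -
    have "(\<Sum>l\<in>UNIV. \<i> * D_fun l s x * of_real (axis j 1 $ l)) = (\<Sum>l\<in>UNIV. if l = j then \<i> * D_fun j s x else 0)"
      by (intro sum.cong) (auto simp: axis_def)
    then show ?thesis by (subst D_fun_eq[OF inv[OF that]]) (simp add: power2_eq_square field_simps)
  qed
  have dpow: "(\<lambda>y. inverse (s y) ^ k) differentiable (at x) \<and>
      D_fun j (\<lambda>y. inverse (s y) ^ k) x = - of_nat k * D_fun j s x * inverse (s x) ^ Suc k" if "s x \<noteq> 0" for x k j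
  proof (induction k)
    case (Suc k)
    then show ?case using that dinv[OF that]
      by (simp add: D_fun_mult Dinv power2_eq_square differentiable_mult algebra_simps del: power_inverse inverse_mult_distrib)
  qed simp
  show ?thesis
  proof (rule smooth_coinduct[of _ S])
    show "(\<lambda>x. f x / s x) \<in> S"
      unfolding S_def
    proof (intro CollectI allI)
      fix x
      show "\<exists>U. open U \<and> x \<in> U \<and> ((\<forall>y\<in>U. f y / s y = 0) \<or>
          (\<exists>k q. smooth q \<and> (\<forall>y\<in>U. s y \<noteq> 0 \<and> f y / s y = q y * inverse (s y) ^ k)))"
      proof (cases "x \<in> supp f")
        case True
        have "open {y. s y \<noteq> 0}"
          using open_Collect_neq[of s "\<lambda>_. 0"] smooth_continuous_on[OF assms(2)] by simp
        with True assms(1,3) show ?thesis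
          by (intro exI[of _ "{y. s y \<noteq> 0}"] conjI disjI2 exI[of _ "1::nat"] exI[of _ f]) (auto simp: divide_inverse)
      next
        case False
        then show ?thesis using in_supp[of f]
          by (intro exI[of _ "- supp f"]) (auto simp: supp_def)
      qed
    qed
    fix g j assume "g \<in> S"
    then have g: "\<exists>U. open U \<and> x \<in> U \<and>
      ((\<forall>y\<in>U. g y = 0) \<or> (\<exists>k q. smooth q \<and> (\<forall>y\<in>U. s y \<noteq> 0 \<and> g y = q y * inverse (s y) ^ k)))" for x
      unfolding S_def by blast
    have "g differentiable (at x) \<and> (\<exists>U. open U \<and> x \<in> U \<and> ((\<forall>y\<in>U. D_fun j g y = 0) \<or>
        (\<exists>k q. smooth q \<and> (\<forall>y\<in>U. s y \<noteq> 0 \<and> D_fun j g y = q y * inverse (s y) ^ k))))" for x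
    proof -
      obtain U where U: "open U" "x \<in> U"
        "(\<forall>y\<in>U. g y = 0) \<or> (\<exists>k q. smooth q \<and> (\<forall>y\<in>U. s y \<noteq> 0 \<and> g y = q y * inverse (s y) ^ k))"
        using g[of x] by blast
      from U(3) show ?thesis
      proof
        assume z: "\<forall>y\<in>U. g y = 0"
        have "g differentiable (at x)" by (rule differentiable_local[OF U(1,2), of g "\<lambda>_. 0"]) (use z in auto)
        moreover have "D_fun j g y = 0" if "y \<in> U" for y
          using D_fun_local[OF U(1) that, of g "\<lambda>_. 0" j] z by simp
        ultimately show ?thesis using U(1,2) by blast
      next
        assume "\<exists>k q. smooth q \<and> (\<forall>y\<in>U. s y \<noteq> 0 \<and> g y = q y * inverse (s y) ^ k)"
        then obtain k q where q: "smooth q" "\<And>y. y \<in> U \<Longrightarrow> s y \<noteq> 0" "\<And>y. y \<in> U \<Longrightarrow> g y = q y * inverse (s y) ^ k"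
          by blast
        have dq: "(\<lambda>y. q y * inverse (s y) ^ k) differentiable (at x)"
          by (rule differentiable_mult[OF smooth_differentiable[OF q(1)] conjunct1[OF dpow[OF q(2)[OF U(2)]]]])
        have "g differentiable (at x)"
          by (rule differentiable_local[OF U(1,2) _ dq]) (rule q(3))
        moreover have "D_fun j g y = (D_fun j q y * s y - of_nat k * q y * D_fun j s y) * inverse (s y) ^ Suc k"
          if y: "y \<in> U" for y
        proof -
          have "D_fun j g y = D_fun j (\<lambda>y. q y * inverse (s y) ^ k) y"
            by (rule D_fun_local[OF U(1) y q(3)])
          also have "\<dots> = D_fun j q y * inverse (s y) ^ k + q y * (- of_nat k * D_fun j s y * inverse (s y) ^ Suc k)"
            using dpow[OF q(2)[OF y], of k j] by (subst D_fun_mult) (auto simp: smooth_differentiable q)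
          also have "D_fun j q y * inverse (s y) ^ k = D_fun j q y * s y * inverse (s y) ^ Suc k"
            using q(2)[OF y] by simp
          finally show ?thesis by (simp add: algebra_simps del: power_Suc power_inverse)
        qed
        moreover have "smooth (\<lambda>y. D_fun j q y * s y - of_nat k * q y * D_fun j s y)"
          by (intro smooth_diff smooth_mult smooth_D_fun smooth_const q assms)
        ultimately show ?thesis using U(1,2) q(2) by blast
      qed
    qed
    then show "g differentiable_on UNIV" "D_fun j g \<in> S"
      unfolding differentiable_on_def S_def by blast+
  qed
qed

lemma test_divide:
  assumes "f \<in> test_functions" "smooth s" "\<And>x. x \<in> supp f \<Longrightarrow> s x \<noteq> 0"
  shows "(\<lambda>x. f x / s x) \<in> test_functions"
  by (rule test_functionsI(1)[OF smooth_divide_supported test_functionsD(2)[OF assms(1)]])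
     (use assms in_supp[of f] in \<open>auto simp: test_functions_def\<close>)

lemma test_bounded:
  assumes "f \<in> test_functions"
  shows "\<exists>B\<ge>0. \<forall>x. norm (f x) \<le> B"
proof -
  have "compact (f ` supp f)"
    using assms by (intro compact_continuous_image smooth_continuous_on) (auto simp: test_functions_def)
  then obtain B where B: "\<And>x. x \<in> supp f \<Longrightarrow> norm (f x) \<le> B"
    by (meson bounded_iff compact_imp_bounded imageI)
  have "norm (f x) \<le> max B 0" for x using B[of x] in_supp[of f x] by (cases "f x = 0") auto
  then show ?thesis by (intro exI[of _ "max B 0"]) simp
qed

lemma norm_derivative_le:
  fixes h :: "real^'n::finite" and c :: "'n \<Rightarrow> complex"
  assumes "\<And>j. norm (c j) \<le> B j"
  shows "norm (\<Sum>j\<in>UNIV. \<i> * c j * of_real (h $ j)) \<le> (\<Sum>j\<in>UNIV. B j) * norm h"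
proof -
  have "norm (\<Sum>j\<in>UNIV. \<i> * c j * of_real (h $ j)) \<le> (\<Sum>j\<in>UNIV. norm (\<i> * c j * of_real (h $ j)))"
    by (rule norm_sum)
  also have "\<dots> \<le> (\<Sum>j\<in>UNIV. B j * norm h)"
  proof (rule sum_mono)
    fix j
    have "0 \<le> B j" using assms[of j] norm_ge_zero order_trans by blast
    then show "norm (\<i> * c j * of_real (h $ j)) \<le> B j * norm h"
      using assms[of j] component_le_norm_cart[of h j] by (auto simp: norm_mult intro!: mult_mono)
  qed
  finally show ?thesis by (simp add: sum_distrib_right)
qed

lemma test_lipschitz:
  assumes "f \<in> test_functions"
  shows "\<exists>M\<ge>0. \<forall>x y. norm (f x - f y) \<le> M * norm (x - y)"
proof -
  obtain B where B: "\<And>j. B j \<ge> 0" "\<And>j x. norm (D_fun j f x) \<le> B j"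
    using test_bounded[OF test_D_fun(1)[OF assms]] by metis
  show ?thesis
  proof (intro exI[of _ "\<Sum>j\<in>UNIV. B j"] conjI allI)
    show "(\<Sum>j\<in>UNIV. B j) \<ge> 0" by (intro sum_nonneg B)
    fix x y
    show "norm (f x - f y) \<le> (\<Sum>j\<in>UNIV. B j) * norm (x - y)"
    proof (rule differentiable_bound[OF convex_UNIV])
      show "(f has_derivative (\<lambda>h. \<Sum>j\<in>UNIV. \<i> * D_fun j f z * of_real (h $ j))) (at z)" for z
        by (rule smooth_has_derivative[OF test_functionsD(1)[OF assms]])
      show "onorm (\<lambda>h::real^'a. \<Sum>j\<in>UNIV. \<i> * D_fun j f z * of_real (h $ j)) \<le> (\<Sum>j\<in>UNIV. B j)" for z
        by (rule onorm_bound[OF sum_nonneg[OF B(1)] norm_derivative_le[OF B(2)]])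
    qed auto
  qed
qed

text \<open>Applied to all derivatives of a test function, this uniform Taylor estimate makes the
  remainder of a translation quadratically small in every seminorm.\<close>

lemma test_quadratic:
  assumes "f \<in> test_functions"
  shows "\<exists>M\<ge>0. \<forall>x h. norm (f (x + h) - f x - (\<Sum>j\<in>UNIV. \<i> * D_fun j f x * of_real (h $ j))) \<le> M * norm h ^ 2"
proof -
  obtain B where B: "\<And>j. B j \<ge> 0" "\<And>j x y. norm (D_fun j f x - D_fun j f y) \<le> B j * norm (x - y)"
    using test_lipschitz[OF test_D_fun(1)[OF assms]] by metis
  show ?thesis
  proof (intro exI[of _ "\<Sum>j\<in>UNIV. B j"] conjI allI)
    show "(\<Sum>j\<in>UNIV. B j) \<ge> 0" by (intro sum_nonneg B)
    fix x h
    let ?L = "\<lambda>z h. \<Sum>j\<in>UNIV. \<i> * D_fun j f z * of_real (h $ j)"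
    have lin: "(?L x has_derivative ?L x) (at z within S)" for z S
      by (intro has_derivative_sum has_derivative_mult_right has_derivative_at_withinI[OF has_derivative_coord])
    \<comment> \<open>After subtraction of the linear part at \<open>x\<close>, the derivative is of
      the size of \<open>norm h\<close> on the ball, and the mean value inequality supplies a second
      factor \<open>norm h\<close>.\<close>
    have "norm ((f (x + h) - ?L x (x + h)) - (f x - ?L x x)) \<le> ((\<Sum>j\<in>UNIV. B j) * norm h) * norm (x + h - x)"
    proof (rule differentiable_bound[OF convex_cball[of x "norm h"]])
      show "((\<lambda>z. f z - ?L x z) has_derivative (\<lambda>k. ?L z k - ?L x k)) (at z within cball x (norm h))" for z
        by (intro has_derivative_diff lin has_derivative_at_withinI[OF smooth_has_derivative[OF test_functionsD(1)[OF assms]]])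
      fix z assume "z \<in> cball x (norm h)"
      then have "norm (z - x) \<le> norm h" by (simp add: dist_norm norm_minus_commute)
      then have "norm (D_fun j f z - D_fun j f x) \<le> B j * norm h" for j
        using B(2)[of j z x] mult_left_mono[OF _ B(1), of _ _ j] order_trans by blast
      from norm_derivative_le[of "\<lambda>j. D_fun j f z - D_fun j f x" "\<lambda>j. B j * norm h", OF this]
      have "norm (\<Sum>j\<in>UNIV. \<i> * (D_fun j f z - D_fun j f x) * of_real (k $ j)) \<le> ((\<Sum>j\<in>UNIV. B j) * norm h) * norm k" for k
        by (simp add: sum_distrib_right)
      moreover have "(\<Sum>j\<in>UNIV. \<i> * (D_fun j f z - D_fun j f x) * of_real (k $ j)) = ?L z k - ?L x k" for k
        by (simp add: sum_subtractf algebra_simps)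
      ultimately have "norm (?L z k - ?L x k) \<le> ((\<Sum>j\<in>UNIV. B j) * norm h) * norm k" for k by (simp only:)
      moreover have "0 \<le> (\<Sum>j\<in>UNIV. B j) * norm h" by (intro mult_nonneg_nonneg sum_nonneg B) auto
      ultimately show "onorm (\<lambda>k. ?L z k - ?L x k) \<le> (\<Sum>j\<in>UNIV. B j) * norm h"
        by (intro onorm_bound)
    qed (auto simp: dist_norm)
    then show "norm (f (x + h) - f x - ?L x h) \<le> (\<Sum>j\<in>UNIV. B j) * norm h ^ 2"
      by (simp add: algebra_simps sum.distrib power2_eq_square)
  qed
qed

subsection \<open>Integration by parts\<close>

text \<open>The exponent is two per coordinate: \<open>(1 + norm x)^2\<close> dominates 1 plus the
  square of each coordinate, and the resulting product integrates to a product of arctangent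
  integrals.\<close>

lemma integrable_weight: "integrable lborel (\<lambda>x::real^'n::finite. 1 / (1 + norm x) ^ (2 * CARD('n)))"
proof (rule integrableI_bounded)
  let ?B = "Basis :: (real^'n) set"
  have card: "card ?B = CARD('n)" by (simp flip: dim_UNIV add: DIM_cart)
  have le: "1 / (1 + norm x) ^ (2 * CARD('n)) \<le> (\<Prod>b\<in>?B. 1 / (1 + (x \<bullet> b)\<^sup>2))" for x :: "real^'n"
  proof -
    have "1 / (1 + norm x) ^ (2 * CARD('n)) = (\<Prod>b\<in>?B. 1 / (1 + norm x)\<^sup>2)"
      by (simp add: card power_mult power_divide)
    also have "\<dots> \<le> (\<Prod>b\<in>?B. 1 / (1 + (x \<bullet> b)\<^sup>2))"
    proof (intro prod_mono conjI frac_le)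
      fix b assume "b \<in> ?B"
      then have "\<bar>x \<bullet> b\<bar> \<le> norm x" by (rule Basis_le_norm)
      then have "(x \<bullet> b)\<^sup>2 \<le> (norm x)\<^sup>2" by (metis abs_le_square_iff abs_norm_cancel)
      moreover have "(1 + norm x)\<^sup>2 = 1 + 2 * norm x + (norm x)\<^sup>2" by (simp add: power2_eq_square algebra_simps)
      ultimately show "1 + (x \<bullet> b)\<^sup>2 \<le> (1 + norm x)\<^sup>2" using norm_ge_zero[of x] by linarith
      show "0 < 1 + (x \<bullet> b)\<^sup>2" by (simp add: add_pos_nonneg)
    qed auto
    finally show ?thesis .
  qed
  have "integrable lborel (\<lambda>x::real. 1 / (1 + x\<^sup>2))"
    using integrable_inverse_1_plus_square by (simp add: set_integrable_def inverse_eq_divide)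
  then have fin: "(\<integral>\<^sup>+x. ennreal (1 / (1 + x\<^sup>2)) \<partial>lborel) < \<infinity>"
    by (simp add: integrable_iff_bounded)
  have "(\<integral>\<^sup>+x. ennreal (norm (1 / (1 + norm (x::real^'n)) ^ (2 * CARD('n)))) \<partial>lborel) \<le>
      (\<integral>\<^sup>+x. (\<Prod>b\<in>?B. ennreal (1 / (1 + (x \<bullet> b)\<^sup>2))) \<partial>lborel)"
    by (intro nn_integral_mono) (subst prod_ennreal, simp_all add: ennreal_leI le)
  also have "\<dots> = (\<Prod>b\<in>?B. (\<integral>\<^sup>+x. ennreal (1 / (1 + x\<^sup>2)) \<partial>lborel))"
    by (intro nn_integral_lborel_prod) auto
  also have "\<dots> < \<infinity>" using fin by (simp add: power_less_top_ennreal)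
  finally show "(\<integral>\<^sup>+x. ennreal (norm (1 / (1 + norm (x::real^'n)) ^ (2 * CARD('n)))) \<partial>lborel) < \<infinity>" .
qed simp

lemma integrable_decay:
  fixes f :: "real^'n::finite \<Rightarrow> complex"
  assumes "f \<in> borel_measurable borel" "\<And>x. norm (f x) * (1 + norm x) ^ (2 * CARD('n)) \<le> C"
  shows "integrable lborel f"
proof (rule Bochner_Integration.integrable_bound[OF integrable_mult_right[OF integrable_weight, of C]])
  have "norm (f 0) \<le> C" using assms(2)[of 0] by simp
  then have "0 \<le> C" using norm_ge_zero[of "f 0"] by linarith
  then have "norm (C * (1 / (1 + norm x) ^ (2 * CARD('n)))) = C / (1 + norm x) ^ (2 * CARD('n))" for x :: "real^'n"
    by (simp add: abs_mult)
  moreover have "norm (f x) \<le> C / (1 + norm x) ^ (2 * CARD('n))" for x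
    using assms(2)[of x] by (subst pos_le_divide_eq) (auto intro!: zero_less_power add_pos_nonneg)
  ultimately show "AE x in lborel. norm (f x) \<le> norm (C * (1 / (1 + norm x) ^ (2 * CARD('n))))"
    by (intro AE_I2) (simp only:)
qed (use assms(1) in simp)

lemma lborel_integral_affine:
  fixes f :: "real^'n::finite \<Rightarrow> complex"
  assumes "f \<in> borel_measurable borel" "c \<noteq> 0"
  shows "(LINT x|lborel. f x) = of_real (\<bar>c\<bar> ^ CARD('n)) * (LINT x|lborel. f (t + c *\<^sub>R x))"
proof -
  have [measurable]: "f \<in> borel_measurable borel" by fact
  have "(LINT x|lborel. f x) = (LINT x|density (distr lborel borel (\<lambda>x. t + c *\<^sub>R x)) (\<lambda>_. \<bar>c\<bar> ^ CARD('n)). f x)"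
    using lborel_affine[OF assms(2), of t] by (simp add: DIM_cart)
  also have "\<dots> = (LINT x|distr lborel borel (\<lambda>x. t + c *\<^sub>R x). (\<bar>c\<bar> ^ CARD('n)) *\<^sub>R f x)"
    by (subst integral_density) auto
  also have "\<dots> = (LINT x|lborel. (\<bar>c\<bar> ^ CARD('n)) *\<^sub>R f (t + c *\<^sub>R x))"
    by (subst integral_distr) auto
  finally show ?thesis by (simp add: scaleR_conv_of_real)
qed

lemma lborel_integral_shift:
  fixes f :: "real^'n::finite \<Rightarrow> complex"
  assumes "f \<in> borel_measurable borel"
  shows "(LINT x|lborel. f (x + t)) = (LINT x|lborel. f x)"
  using lborel_integral_affine[OF assms, of 1 t] by (simp add: add.commute)

text \<open>A form of Peetre's inequality: a weight can be moved by \<open>y\<close> at the cost of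
  the weight of \<open>y\<close>.\<close>

lemma weight_shift: "1 + norm (x::'a::real_normed_vector) \<le> (1 + norm (x + y)) * (1 + norm y)"
proof -
  have "norm x \<le> norm (x + y) + norm y" using norm_triangle_ineq4[of "x + y" y] by simp
  moreover have "(1 + norm (x + y)) * (1 + norm y) = 1 + norm (x + y) + norm y + norm (x + y) * norm y"
    by (simp add: algebra_simps)
  moreover have "0 \<le> norm (x + y) * norm y" by simp
  ultimately show ?thesis by linarith
qed

lemma weight_shift_power: "(1 + norm (x::'a::real_normed_vector)) ^ k \<le> (1 + norm (x + y)) ^ k * (1 + norm y) ^ k"
  using power_mono[OF weight_shift, of x k y] by (simp add: power_mult_distrib)

text \<open>Translation invariance makes the integrals of the difference quotients vanish.\<close>

lemma integral_D_fun:
  fixes f :: "real^'n::finite \<Rightarrow> complex"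
  assumes f: "smooth f"
    and B: "\<And>x. norm (f x) * (1 + norm x) ^ (2 * CARD('n)) \<le> C"
    and B': "\<And>x. norm (D_fun j f x) * (1 + norm x) ^ (2 * CARD('n)) \<le> C"
  shows "(LINT x|lborel. D_fun j f x) = 0"
proof -
  let ?N = "2 * CARD('n)" and ?e = "axis j 1 :: real^'n"
  \<comment> \<open>Steps of length at most 1 change the weight by at most the factor
    \<open>2 ^ ?N\<close>, which provides a common dominating function.\<close>
  define t where "t k = inverse (real (Suc k))" for k
  have t: "0 < t k" "t k \<le> 1" for k by (auto simp: t_def field_simps)
  have t0: "t \<longlonglongrightarrow> 0" unfolding t_def by (rule LIMSEQ_inverse_real_of_nat)
  have "norm (f 0) \<le> C" using B[of 0] by simp
  then have C0: "0 \<le> C" using norm_ge_zero[of "f 0"] by linarith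
  have [measurable]: "f \<in> borel_measurable borel" "D_fun j f \<in> borel_measurable borel"
    using f by (auto intro: smooth_measurable smooth_D_fun)
  have int: "integrable lborel f" by (rule integrable_decay[OF _ B]) measurable
  define q where "q k x = (f (x + t k *\<^sub>R ?e) - f x) / (\<i> * of_real (t k))" for k x
  have line: "((\<lambda>s. f (x + s *\<^sub>R ?e)) has_vector_derivative \<i> * D_fun j f (x + s *\<^sub>R ?e)) (at s)" for x s
  proof -
    have g: "((\<lambda>s::real. x + s *\<^sub>R ?e) has_derivative (\<lambda>s. s *\<^sub>R ?e)) (at s)"
      by (auto intro!: derivative_eq_intros)
    have "(\<Sum>l\<in>UNIV. \<i> * D_fun l f y * of_real ((r *\<^sub>R ?e) $ l)) = r *\<^sub>R (\<i> * D_fun j f y)" for r y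
    proof -
      have "(\<Sum>l\<in>UNIV. \<i> * D_fun l f y * of_real ((r *\<^sub>R ?e) $ l)) =
          (\<Sum>l\<in>UNIV. if l = j then of_real r * (\<i> * D_fun j f y) else 0)"
        by (intro sum.cong) (auto simp: axis_def)
      then show ?thesis by (simp flip: scaleR_conv_of_real)
    qed
    with has_derivative_compose[OF g smooth_has_derivative[OF f]] show ?thesis
      by (simp add: has_vector_derivative_def)
  qed
  have "(\<lambda>k. LINT x|lborel. q k x) \<longlonglongrightarrow> (LINT x|lborel. D_fun j f x)"
  proof (rule integral_dominated_convergence[where w="\<lambda>x. C * 2 ^ ?N * (1 / (1 + norm x) ^ ?N)"])
    show "integrable lborel (\<lambda>x::real^'n. C * 2 ^ ?N * (1 / (1 + norm x) ^ ?N))"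
      by (intro integrable_mult_right integrable_weight)
    show "q k \<in> borel_measurable lborel" for k unfolding q_def by measurable
    show "AE x in lborel. (\<lambda>k. q k x) \<longlonglongrightarrow> D_fun j f x"
    proof (intro AE_I2)
      fix x
      let ?L = "\<i> * D_fun j f x"
      have "((\<lambda>s. ((f (x + s *\<^sub>R ?e) - f x) - s *\<^sub>R ?L) /\<^sub>R norm s) \<longlongrightarrow> 0) (at 0)"
        using line[of x 0] by (simp add: has_vector_derivative_def has_derivative_def)
      moreover have "filterlim t (at 0) sequentially"
        using t0 t by (auto simp: filterlim_at less_imp_neq[symmetric] intro!: always_eventually)
      ultimately have "(\<lambda>k. ((f (x + t k *\<^sub>R ?e) - f x) - t k *\<^sub>R ?L) /\<^sub>R norm (t k)) \<longlonglongrightarrow> 0"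
        by (rule filterlim_compose)
      from tendsto_add[OF this tendsto_const[of ?L]]
      have "(\<lambda>k. ((f (x + t k *\<^sub>R ?e) - f x) - t k *\<^sub>R ?L) /\<^sub>R norm (t k) + ?L) \<longlonglongrightarrow> ?L" by simp
      moreover have "((f (x + t k *\<^sub>R ?e) - f x) - t k *\<^sub>R ?L) /\<^sub>R norm (t k) + ?L = (f (x + t k *\<^sub>R ?e) - f x) / of_real (t k)" for k
        using t(1)[of k] by (simp add: scaleR_conv_of_real field_simps)
      ultimately have "(\<lambda>k. (f (x + t k *\<^sub>R ?e) - f x) / of_real (t k)) \<longlonglongrightarrow> ?L" by (simp only:)
      from tendsto_divide[OF this tendsto_const[of \<i>]]
      show "(\<lambda>k. q k x) \<longlonglongrightarrow> D_fun j f x"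
        unfolding q_def by (simp only: divide_divide_eq_left mult.commute[of _ \<i>]) simp
    qed
    fix k
    show "AE x in lborel. norm (q k x) \<le> C * 2 ^ ?N * (1 / (1 + norm x) ^ ?N)"
    proof (intro AE_I2)
      fix x :: "real^'n"
      let ?b = "C * 2 ^ ?N * (1 / (1 + norm x) ^ ?N)"
      have bd: "norm (D_fun j f (x + s *\<^sub>R ?e)) \<le> ?b" if s: "s \<in> {0..t k}" for s
      proof -
        have "norm (s *\<^sub>R ?e) \<le> 1" using s t[of k] by (simp add: norm_axis_1)
        then have "(1 + norm (s *\<^sub>R ?e)) ^ ?N \<le> 2 ^ ?N" by (intro power_mono) auto
        then have "(1 + norm x) ^ ?N \<le> (1 + norm (x + s *\<^sub>R ?e)) ^ ?N * 2 ^ ?N"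
          using weight_shift_power[of x ?N "s *\<^sub>R ?e"] mult_left_mono[of _ "2 ^ ?N" "(1 + norm (x + s *\<^sub>R ?e)) ^ ?N"]
          by (smt (verit, best) norm_ge_zero zero_le_power)
        then have "norm (D_fun j f (x + s *\<^sub>R ?e)) * (1 + norm x) ^ ?N \<le>
            norm (D_fun j f (x + s *\<^sub>R ?e)) * ((1 + norm (x + s *\<^sub>R ?e)) ^ ?N * 2 ^ ?N)"
          by (intro mult_left_mono) auto
        also have "\<dots> \<le> C * 2 ^ ?N"
          using mult_right_mono[OF B'[of "x + s *\<^sub>R ?e"], of "2 ^ ?N"] by (simp add: mult.assoc)
        finally show ?thesis by (simp add: field_simps add_pos_nonneg)
      qed
      have "norm (f (x + t k *\<^sub>R ?e) - f (x + 0 *\<^sub>R ?e)) \<le> ?b * norm (t k - 0)"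
      proof (rule differentiable_bound[where S="{0..t k}" and f="\<lambda>s. f (x + s *\<^sub>R ?e)"])
        show "((\<lambda>s. f (x + s *\<^sub>R ?e)) has_derivative (\<lambda>r. r *\<^sub>R (\<i> * D_fun j f (x + s *\<^sub>R ?e)))) (at s within {0..t k})" for s
          using line[of x s] unfolding has_vector_derivative_def by (rule has_derivative_at_withinI)
        show "onorm (\<lambda>r. r *\<^sub>R (\<i> * D_fun j f (x + s *\<^sub>R ?e))) \<le> ?b" if s: "s \<in> {0..t k}" for s
        proof (rule onorm_bound)
          show "0 \<le> ?b" using C0 by simp
          fix r :: real
          have "norm (r *\<^sub>R (\<i> * D_fun j f (x + s *\<^sub>R ?e))) = norm (D_fun j f (x + s *\<^sub>R ?e)) * norm r"
            by (simp add: norm_mult mult.commute)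
          also have "\<dots> \<le> ?b * norm r" by (rule mult_right_mono[OF bd[OF s]]) simp
          finally show "norm (r *\<^sub>R (\<i> * D_fun j f (x + s *\<^sub>R ?e))) \<le> ?b * norm r" .
        qed
      qed (use t[of k] in auto)
      then show "norm (q k x) \<le> ?b"
        using t(1)[of k] by (simp add: q_def norm_divide norm_mult field_simps)
    qed
  qed measurable
  moreover have "(LINT x|lborel. q k x) = 0" for k
  proof -
    have "integrable lborel (\<lambda>x. f (x + t k *\<^sub>R ?e))"
    proof (rule integrable_decay)
      fix x :: "real^'n"
      have "norm (f (x + t k *\<^sub>R ?e)) * (1 + norm x) ^ ?N \<le>
          norm (f (x + t k *\<^sub>R ?e)) * ((1 + norm (x + t k *\<^sub>R ?e)) ^ ?N * (1 + norm (t k *\<^sub>R ?e)) ^ ?N)"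
        by (intro mult_left_mono weight_shift_power) auto
      also have "\<dots> \<le> C * (1 + norm (t k *\<^sub>R ?e)) ^ ?N"
        using mult_right_mono[OF B[of "x + t k *\<^sub>R ?e"], of "(1 + norm (t k *\<^sub>R ?e)) ^ ?N"] by (simp add: mult.assoc)
      finally show "norm (f (x + t k *\<^sub>R ?e)) * (1 + norm x) ^ ?N \<le> C * (1 + norm (t k *\<^sub>R ?e)) ^ ?N" .
    qed measurable
    then have "(LINT x|lborel. f (x + t k *\<^sub>R ?e) - f x) = 0"
      by (subst Bochner_Integration.integral_diff) (simp_all add: int lborel_integral_shift)
    then show ?thesis by (simp add: q_def)
  qed
  ultimately show ?thesis using LIMSEQ_unique[OF _ tendsto_const] by fastforce
qed

subsection \<open>Slowly growing and rapidly decreasing functions\<close>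

text \<open>\<open>slow\<close> functions are the multipliers of the Schwartz space and
  \<open>rapid\<close> functions its elements. Lists of directions replace multi-indices because
  they can be extended by one \<open>D_fun\<close> at a time.\<close>

definition slow :: "(real^'n::finite \<Rightarrow> complex) \<Rightarrow> bool" where
  "slow f \<longleftrightarrow> smooth f \<and> (\<forall>js. \<exists>C k. \<forall>x. norm (foldr D_fun js f x) \<le> C * (1 + norm x) ^ k)"

definition rapid :: "(real^'n::finite \<Rightarrow> complex) \<Rightarrow> bool" where
  "rapid f \<longleftrightarrow> smooth f \<and> (\<forall>js k. \<exists>C. \<forall>x. norm (foldr D_fun js f x) * (1 + norm x) ^ k \<le> C)"

lemma slowD: "slow f \<Longrightarrow> smooth f" and rapidD: "rapid f \<Longrightarrow> smooth f"
  by (auto simp: slow_def rapid_def)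

lemma slow_bound: "slow f \<Longrightarrow> \<exists>C k. \<forall>x. norm (f x) \<le> C * (1 + norm x) ^ k"
  unfolding slow_def by (metis foldr_Nil id_apply)

lemma rapid_bound: "rapid f \<Longrightarrow> \<exists>C. \<forall>x. norm (f x) * (1 + norm x) ^ k \<le> C"
  unfolding rapid_def by (metis foldr_Nil id_apply)

lemma slow_D_fun: assumes "slow f" shows "slow (D_fun j f)"
proof -
  have "foldr D_fun js (D_fun j f) = foldr D_fun (js @ [j]) f" for js by simp
  with assms show ?thesis unfolding slow_def by (metis smooth_D_fun)
qed

lemma rapid_D_fun: assumes "rapid f" shows "rapid (D_fun j f)"
proof -
  have "foldr D_fun js (D_fun j f) = foldr D_fun (js @ [j]) f" for js by simp
  with assms show ?thesis unfolding rapid_def by (metis smooth_D_fun)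
qed

lemma foldr_D_fun_cmult: "smooth f \<Longrightarrow> foldr D_fun js (\<lambda>x. c * f x) = (\<lambda>x. c * foldr D_fun js f x)"
  using foldr_D_fun_sum[of "{()}" "\<lambda>_. f" js "\<lambda>_. c"] by simp

lemma foldr_D_fun_add:
  assumes "smooth f" "smooth g"
  shows "foldr D_fun js (\<lambda>x. f x + g x) = (\<lambda>x. foldr D_fun js f x + foldr D_fun js g x)"
proof (induction js)
  case (Cons j js)
  have "D_fun j (\<lambda>x. foldr D_fun js f x + foldr D_fun js g x) = (\<lambda>x. D_fun j (foldr D_fun js f) x + D_fun j (foldr D_fun js g) x)"
    by (rule ext, rule D_fun_add) (intro smooth_differentiable smooth_foldr assms)+
  with Cons show ?case by simp
qed simp

lemma rapid_add: assumes "rapid f" "rapid g" shows "rapid (\<lambda>x. f x + g x)"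
  unfolding rapid_def
proof (intro conjI allI)
  show "smooth (\<lambda>x. f x + g x)" using assms by (auto simp: rapid_def)
  fix js k
  obtain C1 C2 where "\<And>x. norm (foldr D_fun js f x) * (1 + norm x) ^ k \<le> C1"
    "\<And>x. norm (foldr D_fun js g x) * (1 + norm x) ^ k \<le> C2" using assms unfolding rapid_def by metis
  moreover have "norm (foldr D_fun js f x + foldr D_fun js g x) * (1 + norm x) ^ k \<le>
      norm (foldr D_fun js f x) * (1 + norm x) ^ k + norm (foldr D_fun js g x) * (1 + norm x) ^ k" for x
    unfolding distrib_right[symmetric] by (intro mult_right_mono norm_triangle_ineq) simp
  ultimately have "norm (foldr D_fun js f x + foldr D_fun js g x) * (1 + norm x) ^ k \<le> C1 + C2" for x
    using add_mono order_trans by blast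
  then show "\<exists>C. \<forall>x. norm (foldr D_fun js (\<lambda>x. f x + g x) x) * (1 + norm x) ^ k \<le> C"
    using assms by (subst foldr_D_fun_add) (auto simp: rapid_def)
qed

text \<open>The induction peels off the derivative that is applied first, so that the Leibniz rule
  yields two products of the same kind; hence \<open>f\<close> and \<open>g\<close> vary in the
  induction.\<close>

lemma rapid_mult_slow:
  assumes "rapid f" "slow g"
  shows "rapid (\<lambda>x. f x * g x)"
proof -
  have "\<exists>C. \<forall>x. norm (foldr D_fun js (\<lambda>x. f x * g x) x) * (1 + norm x) ^ k \<le> C"
    if "rapid f" "slow g" for js k and f g :: "real^'a \<Rightarrow> complex"
    using that
  proof (induction js arbitrary: f g rule: rev_induct)
    case Nil
    obtain C l where g: "\<And>x. norm (g x) \<le> C * (1 + norm x) ^ l" using slow_bound[OF Nil(2)] by blast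
    obtain C' where f: "\<And>x. norm (f x) * (1 + norm x) ^ (l + k) \<le> C'" using rapid_bound[OF Nil(1)] by blast
    have C: "0 \<le> C" using g[of 0] by simp (metis norm_ge_zero order_trans)
    have "norm (f x * g x) * (1 + norm x) ^ k \<le> C * C'" for x
    proof -
      have "norm (f x * g x) * (1 + norm x) ^ k \<le> norm (f x) * (C * (1 + norm x) ^ l) * (1 + norm x) ^ k"
        unfolding norm_mult by (intro mult_right_mono mult_left_mono g) auto
      also have "\<dots> = C * (norm (f x) * (1 + norm x) ^ (l + k))" by (simp add: power_add)
      also have "\<dots> \<le> C * C'" by (intro mult_left_mono f C)
      finally show ?thesis .
    qed
    then show ?case by auto
  next
    case (snoc j js)
    have sm: "smooth f" "smooth g" using snoc.prems by (auto simp: rapid_def slow_def)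
    have "D_fun j (\<lambda>x. f x * g x) = (\<lambda>x. D_fun j f x * g x + f x * D_fun j g x)"
      by (rule ext, rule D_fun_mult) (intro smooth_differentiable sm)+
    then have eq: "foldr D_fun (js @ [j]) (\<lambda>x. f x * g x) =
        (\<lambda>x. foldr D_fun js (\<lambda>x. D_fun j f x * g x) x + foldr D_fun js (\<lambda>x. f x * D_fun j g x) x)"
      by (simp add: foldr_D_fun_add smooth_mult smooth_D_fun sm)
    obtain C1 where C1: "\<And>x. norm (foldr D_fun js (\<lambda>x. D_fun j f x * g x) x) * (1 + norm x) ^ k \<le> C1"
      using snoc.IH[OF rapid_D_fun[OF snoc.prems(1)] snoc.prems(2)] by blast
    obtain C2 where C2: "\<And>x. norm (foldr D_fun js (\<lambda>x. f x * D_fun j g x) x) * (1 + norm x) ^ k \<le> C2"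
      using snoc.IH[OF snoc.prems(1) slow_D_fun[OF snoc.prems(2)]] by blast
    have "norm (foldr D_fun (js @ [j]) (\<lambda>x. f x * g x) x) * (1 + norm x) ^ k \<le> C1 + C2" for x
    proof -
      have "norm (foldr D_fun (js @ [j]) (\<lambda>x. f x * g x) x) * (1 + norm x) ^ k \<le>
          norm (foldr D_fun js (\<lambda>x. D_fun j f x * g x) x) * (1 + norm x) ^ k +
          norm (foldr D_fun js (\<lambda>x. f x * D_fun j g x) x) * (1 + norm x) ^ k"
        unfolding eq distrib_right[symmetric] by (intro mult_right_mono norm_triangle_ineq) simp
      with C1[of x] C2[of x] show ?thesis by linarith
    qed
    then show ?case by blast
  qed
  with assms show ?thesis unfolding rapid_def slow_def by blast
qed

lemma test_rapid: assumes "f \<in> test_functions" shows "rapid f"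
  unfolding rapid_def
proof (intro conjI allI)
  show "smooth f" using assms by (rule test_functionsD)
  fix js k
  let ?g = "foldr D_fun js f"
  have g: "?g \<in> test_functions" by (rule test_foldr[OF assms])
  obtain B where B: "B \<ge> 0" "\<And>x. norm (?g x) \<le> B" using test_bounded[OF g] by blast
  obtain R where R: "\<And>x. x \<in> supp ?g \<Longrightarrow> norm x \<le> R"
    using compact_imp_bounded[OF test_functionsD(2)[OF g]] by (auto simp: bounded_iff)
  have "norm (?g x) * (1 + norm x) ^ k \<le> B * (1 + \<bar>R\<bar>) ^ k" for x
  proof (cases "?g x = 0")
    case False
    then have "norm x \<le> \<bar>R\<bar>" using R[OF in_supp] by force
    then show ?thesis by (intro mult_mono B power_mono) (use B in auto)
  qed (use B in simp)
  then show "\<exists>C. \<forall>x. norm (?g x) * (1 + norm x) ^ k \<le> C" by blast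
qed

lemma slow_const: "slow (\<lambda>x. c)"
proof -
  have "\<exists>d. foldr D_fun js (\<lambda>x::real^'a. c) = (\<lambda>x. d)" for js by (induction js) auto
  then have "\<exists>C k. \<forall>x. norm (foldr D_fun js (\<lambda>x::real^'a. c) x) \<le> C * (1 + norm x) ^ k" for js
    by (metis mult.right_neutral order_refl power_0)
  then show ?thesis by (auto simp: slow_def)
qed

lemma slow_coord: "slow (\<lambda>x. of_real (x $ i))"
  unfolding slow_def
proof (intro conjI allI)
  fix js
  show "\<exists>C k. \<forall>x. norm (foldr D_fun js (\<lambda>x. complex_of_real (x $ i)) x) \<le> C * (1 + norm x) ^ k"
  proof (cases js rule: rev_cases)
    case Nil
    have "norm (complex_of_real (x $ i)) \<le> 1 * (1 + norm x) ^ 1" for x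
      using component_le_norm_cart[of x i] by simp
    with Nil show ?thesis by (intro exI[of _ 1] exI[of _ "1::nat"]) simp
  next
    case (snoc ks j)
    have "foldr D_fun js (\<lambda>x. complex_of_real (x $ i)) = foldr D_fun ks (\<lambda>x. if i = j then 1 / \<i> else 0)"
      by (simp add: snoc D_fun_coord)
    then show ?thesis using slow_const[of "if i = j then 1 / \<i> else 0"] unfolding slow_def by metis
  qed
qed simp

text \<open>The Fourier kernel with real arguments. Its symmetry lets facts in one variable serve in
  the other; its sign is opposite to that of \<open>cis_dot\<close>.\<close>

definition wave :: "real^'n::finite \<Rightarrow> real^'n \<Rightarrow> complex" where
  "wave x \<xi> = exp (\<i> * of_real (- (x \<bullet> \<xi>)))"

lemma wave_commute: "wave x \<xi> = wave \<xi> x"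
  by (simp add: wave_def inner_commute)

lemma wave_cis_dot: "wave x \<xi> = cis_dot x (\<chi> j. of_real (- \<xi> $ j))"
  by (simp add: wave_def cis_dot_def inner_vec_def sum_negf)

lemma norm_wave [simp]: "norm (wave x \<xi>) = 1"
  unfolding wave_def by (rule norm_exp_i_times)

lemma wave_add: "wave (x + y) \<xi> = wave x \<xi> * wave y \<xi>" "wave x (\<xi> + \<eta>) = wave x \<xi> * wave x \<eta>"
  by (simp_all add: wave_def inner_add exp_add[symmetric] algebra_simps)

lemma wave_0 [simp]: "wave 0 \<xi> = 1" "wave x 0 = 1"
  by (simp_all add: wave_def)

lemma smooth_wave [intro, simp]: "smooth (\<lambda>x. wave x \<xi>)"
  unfolding wave_cis_dot by (rule smooth_cis_dot)

lemma smooth_wave' [intro, simp]: "smooth (wave x)"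
proof -
  have "wave x = (\<lambda>\<xi>. wave \<xi> x)" by (rule ext) (rule wave_commute)
  then show ?thesis using smooth_wave[of x] by metis
qed

lemma D_fun_wave: "D_fun j (\<lambda>x. wave x \<xi>) = (\<lambda>x. of_real (- \<xi> $ j) * wave x \<xi>)"
  unfolding wave_cis_dot D_fun_cis_dot by simp

lemma slow_wave: "slow (\<lambda>x. wave x \<xi>)"
proof -
  have "\<exists>c. foldr D_fun js (\<lambda>x. wave x \<xi>) = (\<lambda>x. c * wave x \<xi>)" for js
  proof (induction js)
    case (Cons j js)
    then obtain c where "foldr D_fun js (\<lambda>x. wave x \<xi>) = (\<lambda>x. c * wave x \<xi>)" by blast
    then have "foldr D_fun (j # js) (\<lambda>x. wave x \<xi>) = (\<lambda>x. (c * of_real (- \<xi> $ j)) * wave x \<xi>)"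
      by (simp add: D_fun_cmult D_fun_wave mult.assoc)
    then show ?case by blast
  qed (auto intro: exI[of _ 1])
  then have "\<exists>C k. \<forall>x. norm (foldr D_fun js (\<lambda>x. wave x \<xi>) x) \<le> C * (1 + norm x) ^ k" for js
    by (metis mult.right_neutral norm_mult norm_wave order_refl power_0)
  then show ?thesis by (simp add: slow_def)
qed

lemma rapid_integrable: "rapid f \<Longrightarrow> integrable lborel f"
  using rapid_bound[of f "2 * CARD('a)"] integrable_decay[of f] smooth_measurable[OF rapidD[of f]] by blast

lemma rapid_integral_D_fun:
  fixes f :: "real^'n::finite \<Rightarrow> complex"
  assumes "rapid f" shows "(LINT x|lborel. D_fun j f x) = 0"
proof -
  obtain C C' where "\<And>x. norm (f x) * (1 + norm x) ^ (2 * CARD('n)) \<le> C"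
    "\<And>x. norm (D_fun j f x) * (1 + norm x) ^ (2 * CARD('n)) \<le> C'"
    using rapid_bound[OF assms] rapid_bound[OF rapid_D_fun[OF assms]] by metis
  then show ?thesis
    by (intro integral_D_fun[OF rapidD[OF assms], of "max C C'"]) (auto intro: max.coboundedI1 max.coboundedI2)
qed

lemma integral_by_parts:
  assumes "rapid f" "slow g"
  shows "(LINT x|lborel. D_fun j f x * g x) = - (LINT x|lborel. f x * D_fun j g x)"
proof -
  have "D_fun j (\<lambda>x. f x * g x) = (\<lambda>x. D_fun j f x * g x + f x * D_fun j g x)"
    by (rule ext, rule D_fun_mult) (intro smooth_differentiable rapidD slowD assms)+
  then have "(LINT x|lborel. D_fun j f x * g x + f x * D_fun j g x) = 0"
    using rapid_integral_D_fun[OF rapid_mult_slow[OF assms], of j] by simp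
  moreover have "(LINT x|lborel. D_fun j f x * g x + f x * D_fun j g x) =
      (LINT x|lborel. D_fun j f x * g x) + (LINT x|lborel. f x * D_fun j g x)"
    by (intro Bochner_Integration.integral_add rapid_integrable rapid_mult_slow assms rapid_D_fun slow_D_fun)
  ultimately show ?thesis by (simp add: eq_neg_iff_add_eq_0)
qed

subsection \<open>The Fourier transform\<close>

text \<open>Unnormalised, as only the vanishing of integrals is ever concluded. Test functions are
  usually placed on the \<xi> side, so that their transforms can be paired with solutions in
  \<open>x\<close>.\<close>

definition FT :: "(real^'n::finite \<Rightarrow> complex) \<Rightarrow> real^'n \<Rightarrow> complex" where
  "FT f x = (LINT \<xi>|lborel. f \<xi> * wave x \<xi>)"

lemma wave_fun_commute: "wave x = (\<lambda>\<xi>. wave \<xi> x)"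
  by (rule ext) (rule wave_commute)

lemma slow_wave': "slow (wave x)"
  by (subst wave_fun_commute) (rule slow_wave)

lemma D_fun_wave': "D_fun j (wave x) = (\<lambda>\<xi>. of_real (- x $ j) * wave x \<xi>)"
  unfolding wave_fun_commute[of x] by (rule D_fun_wave)

lemma FT_integrable: "rapid f \<Longrightarrow> integrable lborel (\<lambda>\<xi>. f \<xi> * wave x \<xi>)"
  by (intro rapid_integrable rapid_mult_slow slow_wave')

lemma FT_bound: "rapid f \<Longrightarrow> norm (FT f x) \<le> (LINT \<xi>|lborel. norm (f \<xi>))"
  unfolding FT_def using integral_norm_bound[of lborel "\<lambda>\<xi>. f \<xi> * wave x \<xi>"] by (simp add: norm_mult)

lemma FT_D_fun: "rapid f \<Longrightarrow> FT (D_fun j f) x = of_real (x $ j) * FT f x"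
  unfolding FT_def integral_by_parts[OF _ slow_wave'] D_fun_wave'
  by (simp add: mult.left_commute[of "f _" "of_real (x $ j)"])

lemma FT_cmult: "FT (\<lambda>\<xi>. c * f \<xi>) x = c * FT f x"
  unfolding FT_def by (simp add: mult.assoc)

lemma FT_add: "rapid f \<Longrightarrow> rapid g \<Longrightarrow> FT (\<lambda>\<xi>. f \<xi> + g \<xi>) x = FT f x + FT g x"
  unfolding FT_def by (simp add: distrib_right FT_integrable)

lemma rapid_cmult: assumes "rapid f" shows "rapid (\<lambda>x. c * f x)"
  using rapid_mult_slow[OF assms slow_const[of c]] by (simp add: mult.commute)

lemma rapid_coord_mult: assumes "rapid f" shows "rapid (\<lambda>x. of_real (x $ j) * f x)"
  using rapid_mult_slow[OF assms slow_coord[of j]] by (simp add: mult.commute)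

lemma rapid_0: "rapid (\<lambda>x. 0)"
  by (intro test_rapid test_zero)

lemma rapid_sum: "(\<And>i. i \<in> I \<Longrightarrow> rapid (f i)) \<Longrightarrow> rapid (\<lambda>x. \<Sum>i\<in>I. f i x)"
  by (induction I rule: infinite_finite_induct) (auto intro: rapid_add rapid_0)

lemma FT_sum: "(\<And>i. i \<in> I \<Longrightarrow> rapid (f i)) \<Longrightarrow> FT (\<lambda>\<xi>. \<Sum>i\<in>I. f i \<xi>) x = (\<Sum>i\<in>I. FT (f i) x)"
proof (induction I rule: infinite_finite_induct)
  case (insert i I)
  then show ?case by (simp add: FT_add rapid_sum)
qed (auto simp: FT_def)

text \<open>A quadratic remainder is what the Taylor estimates supply, both for \<open>FT\<close>
  and for \<open>reg\<close>.\<close>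

lemma has_derivative_quadratic:
  fixes f :: "'a::real_normed_vector \<Rightarrow> 'b::real_normed_vector"
  assumes L: "bounded_linear L" and M: "\<And>h. norm h \<le> 1 \<Longrightarrow> norm (f (x + h) - f x - L h) \<le> M * norm h ^ 2"
  shows "(f has_derivative L) (at x)"
  unfolding has_derivative_at
proof (intro conjI L)
  have M0: "norm (f (x + h) - f x - L h) / norm h \<le> \<bar>M\<bar> * norm h" if "norm h \<le> 1" for h
  proof (cases "h = 0")
    case False
    have "norm (f (x + h) - f x - L h) \<le> \<bar>M\<bar> * norm h ^ 2"
      using M[OF that] by (meson abs_ge_self mult_right_mono order_trans zero_le_power2)
    with False show ?thesis by (simp add: divide_le_eq power2_eq_square mult.assoc)
  qed simp
  show "(\<lambda>h. norm (f (x + h) - f x - L h) / norm h) \<midarrow>0\<rightarrow> 0"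
  proof (rule tendsto_sandwich[OF _ _ tendsto_const])
    show "\<forall>\<^sub>F h in at 0. norm (f (x + h) - f x - L h) / norm h \<le> \<bar>M\<bar> * norm h"
      unfolding eventually_at by (intro exI[of _ 1]) (auto simp: dist_norm intro!: M0)
    have "(\<lambda>h::'a. \<bar>M\<bar> * norm h) \<midarrow>0\<rightarrow> \<bar>M\<bar> * norm (0::'a)" by (intro tendsto_intros)
    then show "(\<lambda>h::'a. \<bar>M\<bar> * norm h) \<midarrow>0\<rightarrow> 0" by simp
  qed auto
qed

lemma bounded_linear_grad:
  "bounded_linear (\<lambda>h::real^'n::finite. \<Sum>j\<in>UNIV. \<i> * c j * complex_of_real (h $ j))"
  by (intro bounded_linear_sum bounded_linear_mult_right[THEN bounded_linear_compose] bounded_linear_of_real[THEN bounded_linear_compose] bounded_linear_vec_nth)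

lemma D_fun_of_gradient:
  assumes "(f has_derivative (\<lambda>h. \<Sum>j\<in>UNIV. \<i> * c j * complex_of_real (h $ j))) (at x)"
  shows "D_fun j f x = c j"
proof -
  have "(\<Sum>l\<in>UNIV. \<i> * c l * complex_of_real (axis j 1 $ l)) = (\<Sum>l\<in>UNIV. if l = j then \<i> * c j else 0)"
    by (intro sum.cong) (auto simp: axis_def)
  then show ?thesis by (subst D_fun_eq[OF assms]) simp
qed

text \<open>Differentiation under the integral: the second-order remainder of the exponential is
  bounded by the square of \<open>norm h * norm \<xi>\<close>, and \<open>f\<close> has a finite
  second moment.\<close>

lemma FT_has_derivative:
  fixes f :: "real^'n::finite \<Rightarrow> complex"
  assumes f: "rapid f"
  shows "(FT f has_derivative (\<lambda>h. \<Sum>j\<in>UNIV. \<i> * FT (\<lambda>\<xi>. - 1 * (of_real (\<xi> $ j) * f \<xi>)) x * of_real (h $ j))) (at x)"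
proof (rule has_derivative_quadratic[OF bounded_linear_grad])
  fix h :: "real^'n"
  \<comment> \<open>The squared norm is a sum of squares of coordinates, so this is the modulus of a
    rapidly decreasing function.\<close>
  have int2: "integrable lborel (\<lambda>\<xi>. norm (f \<xi>) * (norm \<xi>)\<^sup>2)"
  proof (rule Bochner_Integration.integrable_bound)
    have "rapid (\<lambda>\<xi>. \<Sum>j\<in>UNIV. of_real (\<xi> $ j) * (of_real (\<xi> $ j) * f \<xi>))"
      by (intro rapid_sum rapid_coord_mult f)
    then show "integrable lborel (\<lambda>\<xi>. \<Sum>j\<in>UNIV. of_real (\<xi> $ j) * (of_real (\<xi> $ j) * f \<xi>))"
      by (rule rapid_integrable)
    show "(\<lambda>\<xi>. norm (f \<xi>) * (norm \<xi>)\<^sup>2) \<in> borel_measurable lborel"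
      using smooth_measurable[OF rapidD[OF f]] by measurable
    have "norm (norm (f \<xi>) * (norm \<xi>)\<^sup>2) = norm (\<Sum>j\<in>UNIV. of_real (\<xi> $ j) * (of_real (\<xi> $ j) * f \<xi>))" for \<xi>
    proof -
      have "(\<Sum>j\<in>UNIV. of_real (\<xi> $ j) * (of_real (\<xi> $ j) * f \<xi>)) = of_real (\<xi> \<bullet> \<xi>) * f \<xi>"
        by (simp add: inner_vec_def sum_distrib_right mult.assoc)
      then show ?thesis by (simp add: norm_mult power2_norm_eq_inner mult.commute)
    qed
    then show "AE \<xi> in lborel. norm (norm (f \<xi>) * (norm \<xi>)\<^sup>2) \<le> norm (\<Sum>j\<in>UNIV. of_real (\<xi> $ j) * (of_real (\<xi> $ j) * f \<xi>))"
      by simp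
  qed
  have eq: "FT f (x + h) - FT f x - (\<Sum>j\<in>UNIV. \<i> * FT (\<lambda>\<xi>. - 1 * (of_real (\<xi> $ j) * f \<xi>)) x * of_real (h $ j)) =
      (LINT \<xi>|lborel. f \<xi> * wave x \<xi> * (wave h \<xi> - 1 + \<i> * of_real (h \<bullet> \<xi>)))"
  proof -
    have r: "rapid (\<lambda>\<xi>. (\<i> * of_real (h $ j)) * (- 1 * (of_real (\<xi> $ j) * f \<xi>)))" for j
      by (intro rapid_cmult rapid_coord_mult f)
    have "(\<Sum>j\<in>UNIV. \<i> * FT (\<lambda>\<xi>. - 1 * (of_real (\<xi> $ j) * f \<xi>)) x * of_real (h $ j)) =
        FT (\<lambda>\<xi>. \<Sum>j\<in>UNIV. (\<i> * of_real (h $ j)) * (- 1 * (of_real (\<xi> $ j) * f \<xi>))) x"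
      unfolding FT_sum[OF r]
    proof (rule sum.cong)
      fix j
      show "\<i> * FT (\<lambda>\<xi>. - 1 * (of_real (\<xi> $ j) * f \<xi>)) x * of_real (h $ j) =
          FT (\<lambda>\<xi>. (\<i> * of_real (h $ j)) * (- 1 * (of_real (\<xi> $ j) * f \<xi>))) x"
        unfolding FT_cmult[of "\<i> * of_real (h $ j)"] by (simp only: mult_ac)
    qed simp
    moreover have "rapid (\<lambda>\<xi>. \<Sum>j\<in>UNIV. (\<i> * of_real (h $ j)) * (- 1 * (of_real (\<xi> $ j) * f \<xi>)))"
      by (intro rapid_sum r)
    ultimately have "FT f (x + h) - FT f x - (\<Sum>j\<in>UNIV. \<i> * FT (\<lambda>\<xi>. - 1 * (of_real (\<xi> $ j) * f \<xi>)) x * of_real (h $ j)) =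
        (LINT \<xi>|lborel. f \<xi> * wave (x + h) \<xi> - f \<xi> * wave x \<xi> -
          (\<Sum>j\<in>UNIV. (\<i> * of_real (h $ j)) * (- 1 * (of_real (\<xi> $ j) * f \<xi>))) * wave x \<xi>)"
      unfolding FT_def
      by (simp only: Bochner_Integration.integral_diff Bochner_Integration.integrable_diff FT_integrable f)
    also have "\<dots> = (LINT \<xi>|lborel. f \<xi> * wave x \<xi> * (wave h \<xi> - 1 + \<i> * of_real (h \<bullet> \<xi>)))"
      by (intro Bochner_Integration.integral_cong)
        (simp_all add: wave_add inner_vec_def sum_distrib_left sum_distrib_right sum_negf algebra_simps)
    finally show ?thesis .
  qed
  have "norm (LINT \<xi>|lborel. f \<xi> * wave x \<xi> * (wave h \<xi> - 1 + \<i> * of_real (h \<bullet> \<xi>))) \<le>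
      (LINT \<xi>|lborel. norm h ^ 2 * (norm (f \<xi>) * (norm \<xi>)\<^sup>2))"
  proof (rule Bochner_Integration.integral_norm_bound_integral)
    show "integrable lborel (\<lambda>\<xi>. norm h ^ 2 * (norm (f \<xi>) * (norm \<xi>)\<^sup>2))"
      by (intro integrable_mult_right int2)
    have bd: "norm (f \<xi> * wave x \<xi> * (wave h \<xi> - 1 + \<i> * of_real (h \<bullet> \<xi>))) \<le> norm h ^ 2 * (norm (f \<xi>) * (norm \<xi>)\<^sup>2)" for \<xi>
    proof -
      have "norm (wave h \<xi> - 1 + \<i> * of_real (h \<bullet> \<xi>)) \<le> \<bar>- (h \<bullet> \<xi>)\<bar> ^ 2 / 2"
        using iexp_approx1[of "- (h \<bullet> \<xi>)" 1] by (simp add: wave_def algebra_simps power2_eq_square)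
      also have "\<dots> \<le> (norm h * norm \<xi>) ^ 2"
        using power_mono[OF Cauchy_Schwarz_ineq2[of h \<xi>], of 2] by simp (use zero_le_power2[of "h \<bullet> \<xi>"] in linarith)
      finally have "norm (f \<xi>) * norm (wave h \<xi> - 1 + \<i> * of_real (h \<bullet> \<xi>)) \<le> norm (f \<xi>) * (norm h * norm \<xi>) ^ 2"
        by (intro mult_left_mono) auto
      then show ?thesis by (simp add: norm_mult power_mult_distrib mult.commute mult.left_commute)
    qed
    then show "\<And>\<xi>. \<xi> \<in> space lborel \<Longrightarrow> norm (f \<xi> * wave x \<xi> * (wave h \<xi> - 1 + \<i> * of_real (h \<bullet> \<xi>))) \<le> norm h ^ 2 * (norm (f \<xi>) * (norm \<xi>)\<^sup>2)"
      by simp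
    show "integrable lborel (\<lambda>\<xi>. f \<xi> * wave x \<xi> * (wave h \<xi> - 1 + \<i> * of_real (h \<bullet> \<xi>)))"
    proof (rule Bochner_Integration.integrable_bound[OF integrable_mult_right[OF int2, of "norm h ^ 2"]])
      show "(\<lambda>\<xi>. f \<xi> * wave x \<xi> * (wave h \<xi> - 1 + \<i> * of_real (h \<bullet> \<xi>))) \<in> borel_measurable lborel"
        using smooth_measurable[OF rapidD[OF f]] smooth_measurable[OF smooth_wave'] by measurable
      show "AE \<xi> in lborel. norm (f \<xi> * wave x \<xi> * (wave h \<xi> - 1 + \<i> * of_real (h \<bullet> \<xi>))) \<le>
          norm (norm h ^ 2 * (norm (f \<xi>) * (norm \<xi>)\<^sup>2))"
        using bd by (intro AE_I2) (metis abs_ge_self order_trans real_norm_def)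
    qed
  qed
  then show "norm (FT f (x + h) - FT f x - (\<Sum>j\<in>UNIV. \<i> * FT (\<lambda>\<xi>. - 1 * (of_real (\<xi> $ j) * f \<xi>)) x * of_real (h $ j))) \<le>
      (LINT \<xi>|lborel. norm (f \<xi>) * (norm \<xi>)\<^sup>2) * norm h ^ 2"
    unfolding eq by (simp add: mult.commute)
qed

lemma D_fun_FT: "rapid f \<Longrightarrow> D_fun j (FT f) = FT (\<lambda>\<xi>. - 1 * (of_real (\<xi> $ j) * f \<xi>))"
  by (rule ext) (rule D_fun_of_gradient[OF FT_has_derivative])

lemma smooth_FT: assumes "rapid f" shows "smooth (FT f)"
proof (rule smooth_coinduct[of _ "{FT f | f. rapid f}"])
  fix g j assume "g \<in> {FT f | f :: real^'a \<Rightarrow> complex. rapid f}"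
  then obtain f where f: "g = FT f" "rapid f" by blast
  show "g differentiable_on UNIV"
    using FT_has_derivative[OF f(2)] unfolding f(1) differentiable_on_def differentiable_def by auto
  show "D_fun j g \<in> {FT f | f. rapid f}"
    unfolding f(1) D_fun_FT[OF f(2)] using rapid_cmult[OF rapid_coord_mult[OF f(2)]] by blast
qed (use assms in blast)

text \<open>One more factor \<open>1 + norm x\<close> is at most 1 plus the sum of the moduli of the
  coordinates, and a coordinate times \<open>FT f\<close> is the transform of a derivative of
  \<open>f\<close>.\<close>

lemma FT_decay:
  fixes f :: "real^'n::finite \<Rightarrow> complex"
  assumes "rapid f"
  shows "\<exists>C. \<forall>x. norm (FT f x) * (1 + norm x) ^ k \<le> C"
  using assms
proof (induction k arbitrary: f)
  case 0
  then show ?case using FT_bound by auto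
next
  case (Suc k)
  obtain C where C: "\<And>x. norm (FT f x) * (1 + norm x) ^ k \<le> C" using Suc by blast
  have "\<forall>j. \<exists>C. \<forall>x. norm (FT (D_fun j f) x) * (1 + norm x) ^ k \<le> C"
    using Suc rapid_D_fun by blast
  then obtain C' where C': "\<And>j x. norm (FT (D_fun j f) x) * (1 + norm x) ^ k \<le> C' j" by metis
  have "norm (FT f x) * (1 + norm x) ^ Suc k \<le> C + (\<Sum>j\<in>UNIV. C' j)" for x
  proof -
    have "norm (FT f x) * (1 + norm x) ^ Suc k = norm (FT f x) * (1 + norm x) ^ k * (1 + norm x)" by simp
    also have "\<dots> \<le> norm (FT f x) * (1 + norm x) ^ k * (1 + (\<Sum>j\<in>UNIV. \<bar>x $ j\<bar>))"
      by (intro mult_left_mono add_left_mono norm_le_l1_cart) auto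
    also have "\<dots> = norm (FT f x) * (1 + norm x) ^ k + (\<Sum>j\<in>UNIV. norm (FT (D_fun j f) x) * (1 + norm x) ^ k)"
      by (simp add: FT_D_fun Suc.prems norm_mult distrib_left sum_distrib_left mult_ac)
    also have "\<dots> \<le> C + (\<Sum>j\<in>UNIV. C' j)" by (intro add_mono sum_mono C C')
    finally show ?thesis .
  qed
  then show ?case by blast
qed

lemma rapid_FT: assumes "rapid f" shows "rapid (FT f)"
proof -
  have "\<exists>g. rapid g \<and> foldr D_fun js (FT f) = FT g" for js
  proof (induction js)
    case (Cons j js)
    then obtain g where "rapid g" "foldr D_fun js (FT f) = FT g" by blast
    then show ?case using D_fun_FT[of g j] rapid_cmult[OF rapid_coord_mult[of g j], of "- 1"] by auto
  qed (use assms in auto)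
  then have "\<exists>C. \<forall>x. norm (foldr D_fun js (FT f) x) * (1 + norm x) ^ k \<le> C" for js k
    using FT_decay by metis
  then show ?thesis unfolding rapid_def using smooth_FT[OF assms] by blast
qed

text \<open>The multiplication formula; Fubini applies because \<open>wave\<close> has modulus 1 and
  both functions are integrable.\<close>

lemma FT_swap:
  fixes f g :: "real^'n::finite \<Rightarrow> complex"
  assumes "rapid f" "rapid g"
  shows "(LINT x|lborel. FT f x * g x) = (LINT \<xi>|lborel. f \<xi> * FT g \<xi>)"
proof -
  have [measurable]: "f \<in> borel_measurable borel" "g \<in> borel_measurable borel"
    using assms by (auto intro: smooth_measurable rapidD)
  have [measurable]: "(\<lambda>p. wave (fst p) (snd p) :: complex) \<in> borel_measurable (borel \<Otimes>\<^sub>M borel)"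
    unfolding wave_def by measurable
  let ?F = "\<lambda>(x, \<xi>). g x * (f \<xi> * wave x \<xi>)"
  have "integrable (lborel \<Otimes>\<^sub>M lborel) ?F"
  proof (rule lborel_pair.Fubini_integrable)
    show "?F \<in> borel_measurable (lborel \<Otimes>\<^sub>M lborel)" by measurable
    have "(LINT \<xi>|lborel. norm (?F (x, \<xi>))) = norm (g x) * (LINT \<xi>|lborel. norm (f \<xi>))" for x
      by (simp add: norm_mult)
    then show "integrable lborel (\<lambda>x. LINT \<xi>|lborel. norm (?F (x, \<xi>)))"
      using rapid_integrable[OF assms(2)] by simp
    show "AE x in lborel. integrable lborel (\<lambda>\<xi>. ?F (x, \<xi>))"
      using FT_integrable[OF assms(1)] by simp
  qed
  from lborel_pair.Fubini_integral[OF this]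
  have "(LINT \<xi>|lborel. LINT x|lborel. g x * (f \<xi> * wave x \<xi>)) = (LINT x|lborel. LINT \<xi>|lborel. g x * (f \<xi> * wave x \<xi>))"
    by simp
  moreover have "(LINT x|lborel. g x * (f \<xi> * wave x \<xi>)) = f \<xi> * FT g \<xi>" for \<xi>
    unfolding FT_def wave_commute[of \<xi>] by (simp add: mult.left_commute)
  ultimately show ?thesis by (simp add: FT_def mult.commute)
qed

section \<open>Nonvanishing transforms and approximate identities\<close>

lemma continuous_integral_zero:
  fixes f :: "real^'n::finite \<Rightarrow> real"
  assumes "continuous_on UNIV f" "\<And>x. f x \<ge> 0" "integrable lborel f" "(LINT x|lborel. f x) = 0"
  shows "f x = 0"
proof -
  have "AE x in lborel. f x = 0"
    using integral_nonneg_eq_0_iff_AE[OF assms(3)] assms(2,4) by simp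
  then have "AE x in lebesgue. x \<in> UNIV \<longrightarrow> x \<in> {x. f x = 0}"
    by (auto intro: AE_completion)
  moreover have "closed {x. f x = 0}"
    using assms(1) by (intro closed_Collect_eq) auto
  ultimately show ?thesis using mem_closed_if_AE_lebesgue_open[of UNIV "{x. f x = 0}" x] by auto
qed

lemma FT_translate:
  assumes "rapid f"
  shows "FT (\<lambda>\<xi>. f (\<xi> - \<eta>)) x = wave x \<eta> * FT f x"
proof -
  have [measurable]: "f \<in> borel_measurable borel" using assms by (auto intro: smooth_measurable rapidD)
  have [measurable]: "wave x \<in> borel_measurable borel" by (intro smooth_measurable smooth_wave')
  have "FT (\<lambda>\<xi>. f (\<xi> - \<eta>)) x = (LINT \<xi>|lborel. (\<lambda>\<xi>. f (\<xi> - \<eta>) * wave x \<xi>) (\<xi> + \<eta>))"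
    unfolding FT_def by (rule lborel_integral_shift[symmetric]) measurable
  also have "\<dots> = wave x \<eta> * FT f x" by (simp add: FT_def wave_add flip: mult.assoc)
  finally show ?thesis .
qed

text \<open>Takes the place of an inversion formula. If all these integrals vanished, translation
  would give \<open>FT (FT b) = 0\<close> for an even real bump \<open>b\<close>, so the integral of
  \<open>(FT b)^2\<close> would be 0. As \<open>FT b\<close> is real it would vanish, although
  \<open>FT b 0\<close> is the positive integral of \<open>b\<close>.\<close>

lemma exists_test_FT_integral_nonzero:
  "\<exists>\<phi>::real^'n::finite \<Rightarrow> complex. \<phi> \<in> test_functions \<and> (LINT x|lborel. FT \<phi> x) \<noteq> 0"
proof (rule ccontr)
  assume "\<not> ?thesis"
  then have z: "(LINT x|lborel. FT \<phi> x) = 0" if "\<phi> \<in> test_functions" for \<phi> :: "real^'n \<Rightarrow> complex"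
    using that by blast
  define b :: "real^'n \<Rightarrow> complex" where "b = bump 1 0 (1\<^sup>2)"
  have b: "b \<in> test_functions" unfolding b_def by (rule bump_test) simp
  have [measurable]: "b \<in> borel_measurable borel" "wave x \<in> borel_measurable borel" for x :: "real^'n"
    using b by (auto intro: smooth_measurable test_functionsD)
  have rb: "rapid b" by (rule test_rapid[OF b])
  have "FT (FT b) \<eta> = 0" for \<eta>
  proof -
    have "FT (FT b) \<eta> = (LINT x|lborel. FT (\<lambda>\<xi>. b (\<xi> - \<eta>)) x)"
      by (simp add: FT_translate[OF rb] FT_def[of "FT b"] wave_commute[of \<eta>] mult.commute)
    also have "\<dots> = 0" using test_shift(1)[OF b, of "- \<eta>"] by (intro z) simp
    finally show ?thesis .
  qed
  then have FF: "(LINT x|lborel. FT b x * FT b x) = 0"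
    using FT_swap[OF rb rapid_FT[OF rb]] by simp
  \<comment> \<open>Reflection exchanges the kernel with its conjugate and leaves the radial bump
    unchanged.\<close>
  have real: "cnj (FT b x) = FT b x" for x
  proof -
    have "cnj (FT b x) = (LINT \<xi>|lborel. cnj (b \<xi> * wave x \<xi>))"
      unfolding FT_def by (rule Bochner_Integration.integral_cnj[symmetric])
    also have "\<dots> = (LINT \<xi>|lborel. (\<lambda>\<xi>. b \<xi> * wave x \<xi>) (0 + (- 1) *\<^sub>R \<xi>))"
      by (intro Bochner_Integration.integral_cong) (simp_all add: b_def bump_def wave_def exp_cnj)
    also have "\<dots> = (LINT \<xi>|lborel. b \<xi> * wave x \<xi>)"
      by (subst lborel_integral_affine[of "\<lambda>\<xi>. b \<xi> * wave x \<xi>" "- 1" 0]) simp_all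
    finally show ?thesis by (simp add: FT_def)
  qed
  have sq: "FT b x * FT b x = of_real ((norm (FT b x))\<^sup>2)" for x
    using complex_norm_square[of "FT b x"] real[of x] by simp
  have intsq: "integrable lborel (\<lambda>x. complex_of_real ((norm (FT b x))\<^sup>2))"
  proof -
    have "norm (FT b x * FT b x) * (1 + norm x) ^ (2 * CARD('n)) \<le> C"
      if "\<And>x. norm (FT b x) * (1 + norm x) ^ (2 * CARD('n)) \<le> C'" "C = (LINT \<xi>|lborel. norm (b \<xi>)) * C'" for C C' x
      using mult_mono[OF FT_bound[OF rb, of x] that(1)[of x]] that(2) norm_ge_zero[of "FT b x"]
      by (smt (verit) Bochner_Integration.integral_nonneg mult.assoc mult_nonneg_nonneg norm_ge_zero norm_mult zero_le_power)
    moreover obtain C' where "\<And>x. norm (FT b x) * (1 + norm x) ^ (2 * CARD('n)) \<le> C'"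
      using FT_decay[OF rb] by blast
    ultimately have "\<exists>C. \<forall>x. norm (FT b x * FT b x) * (1 + norm x) ^ (2 * CARD('n)) \<le> C" by blast
    then show ?thesis unfolding sq[symmetric]
      using smooth_measurable[OF smooth_FT[OF rb]] by (auto intro!: integrable_decay)
  qed
  have "(norm (FT b 0))\<^sup>2 = 0"
  proof (rule continuous_integral_zero[of "\<lambda>x. (norm (FT b x))\<^sup>2"])
    show "continuous_on UNIV (\<lambda>x. (norm (FT b x))\<^sup>2)"
      by (intro continuous_intros smooth_continuous_on smooth_FT rb)
    show "integrable lborel (\<lambda>x. (norm (FT b x))\<^sup>2)" using intsq by (simp only: complex_of_real_integrable_eq)
    show "(LINT x|lborel. (norm (FT b x))\<^sup>2) = 0"
      using FF unfolding sq by (simp only: integral_complex_of_real of_real_eq_0_iff)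
  qed simp
  then have "(LINT \<xi>|lborel. b \<xi>) = 0" by (simp add: FT_def)
  moreover have "b = (\<lambda>\<xi>. of_real (norm (b \<xi>)))" by (auto simp: b_def bump_real)
  ultimately have "(LINT \<xi>|lborel. norm (b \<xi>)) = 0"
    by (metis integral_complex_of_real of_real_eq_0_iff)
  then have "norm (b 0) = 0"
    using rapid_integrable[OF rb]
    by (intro continuous_integral_zero[of "\<lambda>\<xi>. norm (b \<xi>)"]) (auto intro!: continuous_intros smooth_continuous_on rapidD rb)
  then show False using bump_center[of 1 "0::real^'n"] by (simp add: b_def)
qed

lemma smooth_scale:
  assumes "smooth f" shows "smooth (\<lambda>x. f (c *\<^sub>R x))"
proof (rule smooth_coinduct[of _ "{\<lambda>x. f (c *\<^sub>R x) | f. smooth f}"])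
  fix g j assume "g \<in> {\<lambda>x. f (c *\<^sub>R x) | f :: real^'a \<Rightarrow> complex. smooth f}"
  then obtain f where f: "g = (\<lambda>x. f (c *\<^sub>R x))" "smooth f" by blast
  have d: "(g has_derivative (\<lambda>h. \<Sum>j\<in>UNIV. \<i> * (of_real c * D_fun j f (c *\<^sub>R x)) * of_real (h $ j))) (at x)" for x
  proof -
    have "((\<lambda>x. c *\<^sub>R x) has_derivative (\<lambda>h. c *\<^sub>R h)) (at x)" by (auto intro!: derivative_eq_intros)
    from has_derivative_compose[OF this smooth_has_derivative[OF f(2)]]
    show ?thesis by (simp add: f(1) mult_ac)
  qed
  then show "g differentiable_on UNIV" by (auto simp: differentiable_on_def differentiable_def)
  have "D_fun j g = (\<lambda>x. of_real c * D_fun j f (c *\<^sub>R x))"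
    by (rule ext) (rule D_fun_of_gradient[OF d])
  then show "D_fun j g \<in> {\<lambda>x. f (c *\<^sub>R x) | f. smooth f}"
    using smooth_mult[OF smooth_const smooth_D_fun[OF f(2)], of "of_real c" j]
    by (intro CollectI exI[of _ "\<lambda>x. of_real c * D_fun j f x"]) simp
qed (use assms in blast)

lemma test_scale:
  assumes "f \<in> test_functions" "c \<noteq> 0"
  shows "(\<lambda>x. f (c *\<^sub>R x)) \<in> test_functions"
proof (rule test_functionsI(1))
  show "smooth (\<lambda>x. f (c *\<^sub>R x))" by (intro smooth_scale test_functionsD assms)
  show "compact ((\<lambda>x. (1 / c) *\<^sub>R x) ` supp f)"
    by (intro compact_continuous_image continuous_intros test_functionsD assms)
  show "x \<in> (\<lambda>x. (1 / c) *\<^sub>R x) ` supp f" if "f (c *\<^sub>R x) \<noteq> 0" for x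
    using in_supp[of f "c *\<^sub>R x", OF that] assms(2) by (intro image_eqI[of _ _ "c *\<^sub>R x"]) auto
qed

lemma integrable_weight_rapid:
  fixes f :: "real^'n::finite \<Rightarrow> complex"
  assumes "rapid f"
  shows "integrable lborel (\<lambda>x. (1 + norm x) ^ k * norm (f x))"
proof -
  obtain C where C: "\<And>x. norm (f x) * (1 + norm x) ^ (k + 2 * CARD('n)) \<le> C" using rapid_bound[OF assms] by blast
  have "integrable lborel (\<lambda>x. complex_of_real ((1 + norm x) ^ k) * f x)"
  proof (rule integrable_decay)
    show "norm (complex_of_real ((1 + norm x) ^ k) * f x) * (1 + norm x) ^ (2 * CARD('n)) \<le> C" for x
      using C[of x] by (simp add: norm_mult norm_power power_add mult_ac flip: of_real_add)
  qed (use smooth_measurable[OF rapidD[OF assms]] in measurable)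
  from integrable_norm[OF this] show ?thesis by (simp add: norm_mult norm_power flip: of_real_add)
qed

text \<open>Rescaling a test function whose Fourier transform has nonzero integral gives an approximate
  identity of Fourier transforms of test functions.\<close>

lemma zero_if_orthogonal_to_FT:
  fixes G :: "real^'n::finite \<Rightarrow> complex"
  assumes cont: "continuous_on UNIV G" and bound: "\<And>x. norm (G x) \<le> C * (1 + norm x) ^ k"
    and orth: "\<And>\<phi>. \<phi> \<in> test_functions \<Longrightarrow> (LINT x|lborel. G x * FT \<phi> x) = 0"
  shows "G y = 0"
proof -
  obtain \<phi> :: "real^'n \<Rightarrow> complex" where \<phi>: "\<phi> \<in> test_functions" "(LINT x|lborel. FT \<phi> x) \<noteq> 0"
    using exists_test_FT_integral_nonzero by blast
  have r: "rapid \<phi>" "rapid (FT \<phi>)" by (simp_all add: test_rapid rapid_FT \<phi>)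
  have [measurable]: "G \<in> borel_measurable borel" by (rule borel_measurable_continuous_onI[OF cont])
  have [measurable]: "\<phi> \<in> borel_measurable borel" "FT \<phi> \<in> borel_measurable borel" "wave x \<in> borel_measurable borel" for x :: "real^'n"
    using r by (auto intro: smooth_measurable rapidD)
  define t where "t m = inverse (real (Suc m))" for m
  have t: "0 < t m" "t m \<le> 1" for m by (auto simp: t_def field_simps)
  have C0: "0 \<le> C" using order_trans[OF norm_ge_zero bound[of 0]] by simp
  have "(LINT z|lborel. G (y + t m *\<^sub>R z) * FT \<phi> z) = 0" for m
  proof -
    \<comment> \<open>Modulation moves the transform of \<open>\<phi>\<close> to \<open>y\<close>
      and dilation contracts it by \<open>t m\<close>, so \<open>FT ?\<phi>\<close> is a rescaled
      copy of \<open>FT \<phi>\<close> around \<open>y\<close>.\<close>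
    let ?\<phi> = "\<lambda>\<xi>. wave (- y) \<xi> * \<phi> (t m *\<^sub>R \<xi>)"
    let ?c = "of_real (\<bar>t m\<bar> ^ CARD('n)) :: complex"
    have c: "?c \<noteq> 0" using t(1)[of m] by simp
    have "?\<phi> \<in> test_functions" using t(1)[of m] by (intro test_mult test_scale \<phi> smooth_wave') auto
    then have 0: "(LINT x|lborel. G x * FT ?\<phi> x) = 0" by (rule orth)
    have FT: "FT \<phi> ((1 / t m) *\<^sub>R (x - y)) = ?c * FT ?\<phi> x" for x
    proof -
      have "FT \<phi> ((1 / t m) *\<^sub>R (x - y)) =
          ?c * (LINT \<xi>|lborel. \<phi> (0 + t m *\<^sub>R \<xi>) * wave ((1 / t m) *\<^sub>R (x - y)) (0 + t m *\<^sub>R \<xi>))"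
        unfolding FT_def using t(1)[of m] by (intro lborel_integral_affine) auto
      moreover have "wave ((1 / t m) *\<^sub>R (x - y)) (0 + t m *\<^sub>R \<xi>) = wave (- y) \<xi> * wave x \<xi>" for \<xi>
        using t(1)[of m] by (simp add: wave_add(1)[symmetric]) (simp add: wave_def)
      ultimately show ?thesis by (simp add: FT_def mult_ac)
    qed
    have "(LINT x|lborel. G x * FT \<phi> ((1 / t m) *\<^sub>R (x - y))) = ?c * (LINT x|lborel. G x * FT ?\<phi> x)"
      by (simp only: FT mult.left_commute[of _ ?c] integral_mult_right_zero)
    moreover have "(LINT x|lborel. G x * FT \<phi> ((1 / t m) *\<^sub>R (x - y))) =
        ?c * (LINT z|lborel. G (y + t m *\<^sub>R z) * FT \<phi> ((1 / t m) *\<^sub>R ((y + t m *\<^sub>R z) - y)))"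
      using t(1)[of m] by (intro lborel_integral_affine) auto
    ultimately show ?thesis using 0 c t(1)[of m] by simp
  qed
  moreover have "(\<lambda>m. LINT z|lborel. G (y + t m *\<^sub>R z) * FT \<phi> z) \<longlonglongrightarrow> (LINT z|lborel. G y * FT \<phi> z)"
  proof (rule integral_dominated_convergence)
    show "integrable lborel (\<lambda>z. (C * (1 + norm y) ^ k) * ((1 + norm z) ^ k * norm (FT \<phi> z)))"
      by (intro integrable_mult_right integrable_weight_rapid r)
    show "AE z in lborel. norm (G (y + t m *\<^sub>R z) * FT \<phi> z) \<le> (C * (1 + norm y) ^ k) * ((1 + norm z) ^ k * norm (FT \<phi> z))" for m
    proof (intro AE_I2)
      fix z :: "real^'n"
      have "norm (t m *\<^sub>R z) \<le> 1 * norm z" using t[of m] by (simp add: mult_left_le_one_le)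
      then have "norm (y + t m *\<^sub>R z) \<le> norm y + norm z" using norm_triangle_ineq[of y "t m *\<^sub>R z"] by linarith
      moreover have "(1 + norm y) * (1 + norm z) = 1 + (norm y + norm z) + norm y * norm z" by (simp add: algebra_simps)
      moreover have "0 \<le> norm y * norm z" by simp
      ultimately have "1 + norm (y + t m *\<^sub>R z) \<le> (1 + norm y) * (1 + norm z)" by linarith
      then have "(1 + norm (y + t m *\<^sub>R z)) ^ k \<le> (1 + norm y) ^ k * (1 + norm z) ^ k"
        unfolding power_mult_distrib[symmetric] by (intro power_mono) auto
      then have "norm (G (y + t m *\<^sub>R z)) \<le> C * ((1 + norm y) ^ k * (1 + norm z) ^ k)"
        using bound[of "y + t m *\<^sub>R z"] mult_left_mono[OF _ C0] order_trans by blast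
      then show "norm (G (y + t m *\<^sub>R z) * FT \<phi> z) \<le> (C * (1 + norm y) ^ k) * ((1 + norm z) ^ k * norm (FT \<phi> z))"
        using mult_right_mono[OF _ norm_ge_zero[of "FT \<phi> z"]] by (fastforce simp: norm_mult mult.assoc)
    qed
    have t0: "t \<longlonglongrightarrow> 0" unfolding t_def by (rule LIMSEQ_inverse_real_of_nat)
    show "AE z in lborel. (\<lambda>m. G (y + t m *\<^sub>R z) * FT \<phi> z) \<longlonglongrightarrow> G y * FT \<phi> z"
    proof (intro AE_I2)
      fix z :: "real^'n"
      have "(\<lambda>m. y + t m *\<^sub>R z) \<longlonglongrightarrow> y + 0 *\<^sub>R z" by (intro tendsto_intros t0)
      then have "(\<lambda>m. G (y + t m *\<^sub>R z)) \<longlonglongrightarrow> G y"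
        using cont by (auto simp: continuous_on_eq_continuous_at intro: isCont_tendsto_compose)
      then show "(\<lambda>m. G (y + t m *\<^sub>R z) * FT \<phi> z) \<longlonglongrightarrow> G y * FT \<phi> z" by (intro tendsto_mult tendsto_const)
    qed
  qed measurable
  ultimately have "(LINT z|lborel. G y * FT \<phi> z) = 0" using LIMSEQ_unique[OF _ tendsto_const] by fastforce
  with \<phi>(2) show ?thesis by simp
qed

subsection \<open>Spectral multipliers\<close>

lemma slow_add: assumes "slow f" "slow g" shows "slow (\<lambda>x. f x + g x)"
  unfolding slow_def
proof (intro conjI allI)
  show "smooth (\<lambda>x. f x + g x)" using assms by (auto simp: slow_def)
  fix js
  obtain C k D l where b: "\<And>x. norm (foldr D_fun js f x) \<le> C * (1 + norm x) ^ k"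
    "\<And>x. norm (foldr D_fun js g x) \<le> D * (1 + norm x) ^ l" using assms unfolding slow_def by metis
  have "norm (foldr D_fun js f x + foldr D_fun js g x) \<le> (\<bar>C\<bar> + \<bar>D\<bar>) * (1 + norm x) ^ (k + l)" for x
  proof -
    have "C * (1 + norm x) ^ k \<le> \<bar>C\<bar> * (1 + norm x) ^ (k + l)" "D * (1 + norm x) ^ l \<le> \<bar>D\<bar> * (1 + norm x) ^ (k + l)"
      by (intro mult_mono power_increasing; simp)+
    with b[of x] norm_triangle_ineq[of "foldr D_fun js f x" "foldr D_fun js g x"]
    show ?thesis unfolding distrib_right by linarith
  qed
  then show "\<exists>C k. \<forall>x. norm (foldr D_fun js (\<lambda>x. f x + g x) x) \<le> C * (1 + norm x) ^ k"
    using assms by (subst foldr_D_fun_add) (auto simp: slow_def)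
qed

lemma slow_cmult: assumes "slow f" shows "slow (\<lambda>x. c * f x)"
  unfolding slow_def
proof (intro conjI allI)
  show "smooth (\<lambda>x. c * f x)" using assms by (auto simp: slow_def)
  fix js
  obtain C k where b: "\<And>x. norm (foldr D_fun js f x) \<le> C * (1 + norm x) ^ k" using assms unfolding slow_def by metis
  have "foldr D_fun js (\<lambda>x. c * f x) = (\<lambda>x. c * foldr D_fun js f x)"
    using assms by (intro foldr_D_fun_cmult) (simp add: slow_def)
  moreover have "norm (c * foldr D_fun js f x) \<le> (norm c * C) * (1 + norm x) ^ k" for x
    using mult_left_mono[OF b, of "norm c" x] by (simp add: norm_mult mult.assoc)
  ultimately show "\<exists>C k. \<forall>x. norm (foldr D_fun js (\<lambda>x. c * f x) x) \<le> C * (1 + norm x) ^ k" by metis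
qed

lemma slow_sum: "(\<And>i. i \<in> I \<Longrightarrow> slow (f i)) \<Longrightarrow> slow (\<lambda>x. \<Sum>i\<in>I. f i x)"
  by (induction I rule: infinite_finite_induct) (auto intro: slow_add slow_const)

lemma slow_shift: assumes "slow f" shows "slow (\<lambda>x. f (x + v))"
  unfolding slow_def
proof (intro conjI allI)
  show "smooth (\<lambda>x. f (x + v))" using assms by (auto simp: slow_def)
  fix js
  obtain C k where b: "\<And>x. norm (foldr D_fun js f x) \<le> C * (1 + norm x) ^ k" using assms unfolding slow_def by metis
  have C0: "0 \<le> C" using order_trans[OF norm_ge_zero b[of 0]] by simp
  have "norm (foldr D_fun js f (x + v)) \<le> (C * (1 + norm v) ^ k) * (1 + norm x) ^ k" for x
  proof -
    have "norm (foldr D_fun js f (x + v)) \<le> C * ((1 + norm x) ^ k * (1 + norm v) ^ k)"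
      using b[of "x + v"] mult_left_mono[OF weight_shift_power[of "x + v" k "- v"] C0] by simp
    then show ?thesis by (simp add: mult_ac)
  qed
  then show "\<exists>C k. \<forall>x. norm (foldr D_fun js (\<lambda>x. f (x + v)) x) \<le> C * (1 + norm x) ^ k"
    using assms by (subst foldr_D_fun_shift) (auto simp: slow_def)
qed

definition symb :: "'n::finite pdo \<Rightarrow> real^'n \<Rightarrow> complex" where
  "symb b \<xi> = poly_eval b (\<chi> i. of_real (\<xi> $ i))"

lemma smooth_symb: "smooth (symb b)"
proof (induction b rule: pdo_induct)
  case (const c) then show ?case by (simp add: symb_def[abs_def])
next
  case (var i) then show ?case by (simp add: symb_def[abs_def])
next
  case (add p q)
  then have "smooth (\<lambda>\<xi>. symb p \<xi> + symb q \<xi>)" by (rule smooth_add)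
  then show ?case by (simp add: symb_def[abs_def])
next
  case (mult p q)
  then have "smooth (\<lambda>\<xi>. symb p \<xi> * symb q \<xi>)" by (rule smooth_mult)
  then show ?case by (simp add: symb_def[abs_def])
qed

lemma rapid_symb_mult: "rapid f \<Longrightarrow> rapid (\<lambda>\<xi>. symb b \<xi> * f \<xi>)"
proof (induction b arbitrary: f rule: pdo_induct)
  case (const c) then show ?case by (simp add: symb_def rapid_cmult)
next
  case (var i) then show ?case by (simp add: symb_def rapid_coord_mult)
next
  case (add p q)
  then have "rapid (\<lambda>\<xi>. symb p \<xi> * f \<xi> + symb q \<xi> * f \<xi>)" by (intro rapid_add) auto
  then show ?case by (simp add: symb_def distrib_right)
next
  case (mult p q)
  then have "rapid (\<lambda>\<xi>. symb p \<xi> * (symb q \<xi> * f \<xi>))" by blast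
  then show ?case by (simp add: symb_def mult.assoc)
qed

lemma pdo_fun_pconst: "pdo_fun (pconst c) f = (\<lambda>x. c * f x)"
  by (simp add: pdo_fun_def pconst_def)

lemma pdo_fun_pvar: "smooth f \<Longrightarrow> pdo_fun (pvar j) f = D_fun j f"
  by (simp add: pdo_fun_def pvar_def iterate_multi_D_fun_single del: One_nat_def)

lemma slow_pdo_fun: "slow f \<Longrightarrow> slow (pdo_fun b f)"
proof (induction b arbitrary: f rule: pdo_induct)
  case (const c) then show ?case by (simp add: pdo_fun_pconst slow_cmult)
next
  case (var i) then show ?case by (simp add: pdo_fun_pvar slowD slow_D_fun)
next
  case (add p q)
  then have "slow (\<lambda>x. pdo_fun p f x + pdo_fun q f x)" by (intro slow_add) auto
  then show ?case by (simp add: pdo_fun_add[abs_def, symmetric] pdo_fun_add)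
next
  case (mult p q) then show ?case by (simp add: pdo_fun_mult slowD)
qed

lemma slow_rapid_integrable: "slow G \<Longrightarrow> rapid f \<Longrightarrow> integrable lborel (\<lambda>x. G x * f x)"
  using rapid_integrable[OF rapid_mult_slow[of f G]] by (simp add: mult.commute)

lemma pairing_D_fun:
  assumes "slow G" "rapid f"
  shows "(LINT x|lborel. D_fun j G x * FT f x) = (LINT x|lborel. G x * FT (\<lambda>\<xi>. of_real (\<xi> $ j) * f \<xi>) x)"
proof -
  have "(LINT x|lborel. D_fun j (FT f) x * G x) = - (LINT x|lborel. FT f x * D_fun j G x)"
    by (rule integral_by_parts[OF rapid_FT[OF assms(2)] assms(1)])
  then show ?thesis
    unfolding D_fun_FT[OF assms(2)] FT_cmult by (simp add: mult.commute)
qed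

text \<open>The sign from integration by parts cancels the one from differentiating the kernel. This
  is the action of the symbol on the distributional transform of \<open>G\<close>, expressed by
  pairings.\<close>

lemma pairing_pdo_fun:
  assumes "slow G" "rapid f"
  shows "(LINT x|lborel. pdo_fun b G x * FT f x) = (LINT x|lborel. G x * FT (\<lambda>\<xi>. symb b \<xi> * f \<xi>) x)"
  using assms
proof (induction b arbitrary: f G rule: pdo_induct)
  case (const c)
  then show ?case by (simp add: pdo_fun_pconst symb_def FT_cmult mult_ac)
next
  case (var i)
  then show ?case by (simp add: pdo_fun_pvar slowD symb_def pairing_D_fun)
next
  case (add p q)
  have "(LINT x|lborel. pdo_fun (p + q) G x * FT f x) =
      (LINT x|lborel. pdo_fun p G x * FT f x) + (LINT x|lborel. pdo_fun q G x * FT f x)"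
    by (subst Bochner_Integration.integral_add[symmetric])
       (auto intro!: slow_rapid_integrable slow_pdo_fun rapid_FT add.prems simp: pdo_fun_add distrib_right)
  also have "\<dots> = (LINT x|lborel. G x * FT (\<lambda>\<xi>. symb p \<xi> * f \<xi>) x) + (LINT x|lborel. G x * FT (\<lambda>\<xi>. symb q \<xi> * f \<xi>) x)"
    using add by simp
  also have "\<dots> = (LINT x|lborel. G x * FT (\<lambda>\<xi>. symb p \<xi> * f \<xi>) x + G x * FT (\<lambda>\<xi>. symb q \<xi> * f \<xi>) x)"
    by (subst Bochner_Integration.integral_add) (auto intro!: slow_rapid_integrable rapid_FT rapid_symb_mult add.prems)
  also have "\<dots> = (LINT x|lborel. G x * FT (\<lambda>\<xi>. symb p \<xi> * f \<xi> + symb q \<xi> * f \<xi>) x)"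
    by (simp add: FT_add rapid_symb_mult add.prems distrib_left)
  finally show ?case by (simp add: symb_def distrib_right)
next
  case (mult p q)
  have "(LINT x|lborel. pdo_fun (p * q) G x * FT f x) = (LINT x|lborel. G x * FT (\<lambda>\<xi>. symb q \<xi> * (symb p \<xi> * f \<xi>)) x)"
    using mult by (simp add: pdo_fun_mult slowD slow_pdo_fun rapid_symb_mult)
  then show ?case by (simp add: symb_def mult_ac)
qed

text \<open>Its multiplier is \<open>wave (- v) \<xi> - 1\<close>, the exponential of
  \<open>\<i> (v \<bullet> \<xi>)\<close> minus 1. A power of it annihilates any polynomial with
  \<open>v\<close>-periodic coefficients.\<close>

definition diff_shift :: "real^'n::finite \<Rightarrow> (real^'n \<Rightarrow> complex) \<Rightarrow> real^'n \<Rightarrow> complex" where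
  "diff_shift v f = (\<lambda>x. f (x + v) - f x)"

lemma slow_diff_shift: assumes "slow f" shows "slow (diff_shift v f)"
proof -
  have "slow (\<lambda>x. f (x + v) + (- 1) * f x)" by (intro slow_add slow_shift slow_cmult assms)
  then show ?thesis by (simp add: diff_shift_def)
qed

lemma pairing_diff_shift:
  assumes "slow G" "rapid f"
  shows "(LINT x|lborel. diff_shift v G x * FT f x) = (LINT x|lborel. G x * FT (\<lambda>\<xi>. (wave (- v) \<xi> - 1) * f \<xi>) x)"
proof -
  have w: "rapid (\<lambda>\<xi>. wave (- v) \<xi> * f \<xi>)"
    using rapid_mult_slow[OF assms(2) slow_wave'[of "- v"]] by (simp add: mult.commute)
  have FTw: "FT f (x - v) = FT (\<lambda>\<xi>. wave (- v) \<xi> * f \<xi>) x" for x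
    unfolding FT_def using wave_add(1)[of x "- v"] by (simp add: mult_ac)
  have [measurable]: "G \<in> borel_measurable borel" "FT f \<in> borel_measurable borel"
    using assms by (auto intro: smooth_measurable slowD rapidD rapid_FT)
  have "(LINT x|lborel. G (x + v) * FT f x) = (LINT x|lborel. (\<lambda>x. G x * FT f (x - v)) (x + v))" by simp
  also have "\<dots> = (LINT x|lborel. G x * FT f (x - v))" by (rule lborel_integral_shift) measurable
  finally have 1: "(LINT x|lborel. G (x + v) * FT f x) = (LINT x|lborel. G x * FT (\<lambda>\<xi>. wave (- v) \<xi> * f \<xi>) x)"
    unfolding FTw .
  have "(LINT x|lborel. diff_shift v G x * FT f x) = (LINT x|lborel. G (x + v) * FT f x) - (LINT x|lborel. G x * FT f x)"
    unfolding diff_shift_def left_diff_distrib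
    by (intro Bochner_Integration.integral_diff slow_rapid_integrable slow_shift rapid_FT assms)
  also have "\<dots> = (LINT x|lborel. G x * FT (\<lambda>\<xi>. wave (- v) \<xi> * f \<xi>) x - G x * FT f x)"
    unfolding 1 by (intro Bochner_Integration.integral_diff[symmetric] slow_rapid_integrable rapid_FT assms w)
  also have "\<dots> = (LINT x|lborel. G x * FT (\<lambda>\<xi>. wave (- v) \<xi> * f \<xi> + (- 1) * f \<xi>) x)"
    unfolding FT_add[OF w rapid_cmult[OF assms(2)]] FT_cmult[of "- 1"] by (simp add: right_diff_distrib)
  finally show ?thesis by (simp add: left_diff_distrib)
qed

lemma pairing_diff_shift_power:
  assumes "slow G" "rapid f"
  shows "(LINT x|lborel. (diff_shift v ^^ d) G x * FT f x) = (LINT x|lborel. G x * FT (\<lambda>\<xi>. (wave (- v) \<xi> - 1) ^ d * f \<xi>) x)"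
  using assms
proof (induction d arbitrary: G f)
  case (Suc d)
  have "rapid (\<lambda>\<xi>. f \<xi> * (wave (- v) \<xi> + (- 1)))"
    by (intro rapid_mult_slow Suc.prems slow_add slow_wave' slow_const)
  then have r: "rapid (\<lambda>\<xi>. (wave (- v) \<xi> - 1) * f \<xi>)" by (simp add: mult.commute)
  have s: "slow ((diff_shift v ^^ d) G)" by (induction d) (auto intro: Suc.prems slow_diff_shift)
  have "(LINT x|lborel. (diff_shift v ^^ Suc d) G x * FT f x) =
      (LINT x|lborel. (diff_shift v ^^ d) G x * FT (\<lambda>\<xi>. (wave (- v) \<xi> - 1) * f \<xi>) x)"
    using pairing_diff_shift[OF s Suc.prems(2)] by simp
  also have "\<dots> = (LINT x|lborel. G x * FT (\<lambda>\<xi>. (wave (- v) \<xi> - 1) ^ d * ((wave (- v) \<xi> - 1) * f \<xi>)) x)"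
    by (rule Suc.IH[OF Suc.prems(1) r])
  finally show ?case by (simp add: mult_ac)
qed simp

lemma smooth_cnj: assumes "smooth f" shows "smooth (\<lambda>x. cnj (f x))"
proof (rule smooth_coinduct[of _ "{\<lambda>x. cnj (f x) | f. smooth f}"])
  fix g j assume "g \<in> {\<lambda>x. cnj (f x) | f :: real^'a \<Rightarrow> complex. smooth f}"
  then obtain f where f: "g = (\<lambda>x. cnj (f x))" "smooth f" by blast
  have d: "(g has_derivative (\<lambda>h. \<Sum>j\<in>UNIV. \<i> * (- cnj (D_fun j f x)) * of_real (h $ j))) (at x)" for x
    using bounded_linear.has_derivative[OF bounded_linear_cnj smooth_has_derivative[OF f(2), of x]]
    by (simp add: f(1))
  then show "g differentiable_on UNIV" by (auto simp: differentiable_on_def differentiable_def)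
  have "D_fun j g = (\<lambda>x. cnj ((- 1) * D_fun j f x))"
    by (rule ext, subst D_fun_of_gradient[OF d]) simp
  then show "D_fun j g \<in> {\<lambda>x. cnj (f x) | f. smooth f}"
    using smooth_mult[OF smooth_const smooth_D_fun[OF f(2)], of "- 1" j]
    by (intro CollectI exI[of _ "\<lambda>x. (- 1) * D_fun j f x"]) simp
qed (use assms in blast)

text \<open>The sum \<open>s\<close> of the squared moduli of finitely many multipliers is nonzero
  on \<open>supp \<phi>\<close>, so \<open>\<phi>\<close> is the sum of the functions
  \<open>m * (cnj m * \<phi> / s)\<close>, and the pairing annihilates every summand.\<close>

lemma zero_if_multipliers_nonvanishing:
  fixes G :: "real^'n::finite \<Rightarrow> complex"
  assumes G: "slow G" and sm: "\<And>m. m \<in> M \<Longrightarrow> smooth m"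
    and kill: "\<And>m \<phi>. m \<in> M \<Longrightarrow> \<phi> \<in> test_functions \<Longrightarrow> (LINT x|lborel. G x * FT (\<lambda>\<xi>. m \<xi> * \<phi> \<xi>) x) = 0"
    and nz: "\<And>\<xi>. \<exists>m\<in>M. m \<xi> \<noteq> 0"
  shows "G y = 0"
proof -
  obtain C k where C: "\<And>x. norm (G x) \<le> C * (1 + norm x) ^ k" using slow_bound[OF G] by blast
  show ?thesis
  proof (rule zero_if_orthogonal_to_FT[OF smooth_continuous_on[OF slowD[OF G]] C])
    fix \<phi> :: "real^'n \<Rightarrow> complex" assume \<phi>: "\<phi> \<in> test_functions"
    have open_m: "open {\<xi>. m \<xi> \<noteq> 0}" if "m \<in> M" for m
      using open_Collect_neq[of m "\<lambda>_. 0"] smooth_continuous_on[OF sm[OF that]] by simp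
    have "supp \<phi> \<subseteq> (\<Union>m\<in>M. {\<xi>. m \<xi> \<noteq> 0})" using nz by auto
    then obtain M' where M': "M' \<subseteq> M" "finite M'" "supp \<phi> \<subseteq> (\<Union>m\<in>M'. {\<xi>. m \<xi> \<noteq> 0})"
      using compactE_image[OF test_functionsD(2)[OF \<phi>], of M "\<lambda>m. {\<xi>. m \<xi> \<noteq> 0}"] open_m by metis
    define s where "s = (\<lambda>\<xi>. \<Sum>m\<in>M'. m \<xi> * cnj (m \<xi>))"
    have s: "smooth s" unfolding s_def by (intro smooth_sum smooth_mult smooth_cnj sm) (use M' in auto)
    have s_nz: "s \<xi> \<noteq> 0" if \<xi>: "\<xi> \<in> supp \<phi>" for \<xi>
    proof -
      have "s \<xi> = of_real (\<Sum>m\<in>M'. (norm (m \<xi>))\<^sup>2)" by (simp only: s_def of_real_sum complex_norm_square)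
      moreover obtain m where "m \<in> M'" "m \<xi> \<noteq> 0" using M'(3) \<xi> by blast
      then have "(\<Sum>m\<in>M'. (norm (m \<xi>))\<^sup>2) > 0" using M'(2) by (intro sum_pos2[of _ m]) auto
      ultimately show ?thesis by (metis less_irrefl of_real_eq_0_iff)
    qed
    have t: "(\<lambda>\<xi>. cnj (m \<xi>) * (\<phi> \<xi> / s \<xi>)) \<in> test_functions" if "m \<in> M'" for m
      by (intro test_mult test_divide \<phi> s s_nz smooth_cnj sm) (use that M' in auto)
    have eq: "\<phi> = (\<lambda>\<xi>. \<Sum>m\<in>M'. m \<xi> * (cnj (m \<xi>) * (\<phi> \<xi> / s \<xi>)))"
    proof
      fix \<xi>
      have "(\<Sum>m\<in>M'. m \<xi> * (cnj (m \<xi>) * (\<phi> \<xi> / s \<xi>))) = s \<xi> * (\<phi> \<xi> / s \<xi>)"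
        unfolding mult.assoc[symmetric] sum_distrib_right[symmetric] by (simp add: s_def)
      also have "\<dots> = \<phi> \<xi>" using s_nz[of \<xi>] in_supp[of \<phi> \<xi>] by (cases "\<phi> \<xi> = 0") auto
      finally show "\<phi> \<xi> = (\<Sum>m\<in>M'. m \<xi> * (cnj (m \<xi>) * (\<phi> \<xi> / s \<xi>)))" by simp
    qed
    have r: "rapid (\<lambda>\<xi>. m \<xi> * (cnj (m \<xi>) * (\<phi> \<xi> / s \<xi>)))" if "m \<in> M'" for m
      using test_rapid[OF test_mult[OF t[OF that] sm]] that M' by blast
    have FT: "FT \<phi> x = (\<Sum>m\<in>M'. FT (\<lambda>\<xi>. m \<xi> * (cnj (m \<xi>) * (\<phi> \<xi> / s \<xi>))) x)" for x
      by (rule trans[OF arg_cong[OF eq, of "\<lambda>f. FT f x"] FT_sum[OF r]])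
    have "(LINT x|lborel. G x * FT \<phi> x) =
        (LINT x|lborel. (\<Sum>m\<in>M'. G x * FT (\<lambda>\<xi>. m \<xi> * (cnj (m \<xi>) * (\<phi> \<xi> / s \<xi>))) x))"
      unfolding FT sum_distrib_left ..
    also have "\<dots> = (\<Sum>m\<in>M'. (LINT x|lborel. G x * FT (\<lambda>\<xi>. m \<xi> * (cnj (m \<xi>) * (\<phi> \<xi> / s \<xi>))) x))"
      by (intro Bochner_Integration.integral_sum slow_rapid_integrable G rapid_FT r)
    also have "\<dots> = 0"
    proof (intro sum.neutral ballI)
      fix m assume "m \<in> M'"
      then show "(LINT x|lborel. G x * FT (\<lambda>\<xi>. m \<xi> * (cnj (m \<xi>) * (\<phi> \<xi> / s \<xi>))) x) = 0"
        using M'(1) by (intro kill t) auto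
    qed
    finally show "(LINT x|lborel. G x * FT \<phi> x) = 0" .
  qed
qed

subsection \<open>Injectivity on rapidly decreasing functions\<close>

lemma poly_eval_line: "\<exists>q. \<forall>t. poly_eval a (\<chi> i. z $ i + t * w $ i) = poly q t"
proof (induction a rule: pdo_induct)
  case (const c) show ?case by (intro exI[of _ "[:c:]"]) simp
next
  case (var i) show ?case by (intro exI[of _ "[:z $ i, w $ i:]"]) simp
next
  case (add a b)
  then obtain q r where "\<And>t. poly_eval a (\<chi> i. z $ i + t * w $ i) = poly q t"
    "\<And>t. poly_eval b (\<chi> i. z $ i + t * w $ i) = poly r t" by blast
  then show ?case by (intro exI[of _ "q + r"]) simp
next
  case (mult a b)
  then obtain q r where "\<And>t. poly_eval a (\<chi> i. z $ i + t * w $ i) = poly q t"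
    "\<And>t. poly_eval b (\<chi> i. z $ i + t * w $ i) = poly r t" by blast
  then show ?case by (intro exI[of _ "q * r"]) simp
qed

text \<open>On the line from \<open>y\<close> to a point where the symbol is nonzero, the symbol is
  a nonzero polynomial in \<open>t\<close> with finitely many zeros, whereas a nonzero
  \<open>g y\<close> would force a zero at every small positive \<open>t\<close>.\<close>

lemma zero_if_symb_mult_zero:
  fixes g :: "real^'n::finite \<Rightarrow> complex"
  assumes a: "a \<noteq> 0" and cont: "continuous_on UNIV g" and z: "\<And>x. symb a x * g x = 0"
  shows "g y = 0"
proof (rule ccontr)
  assume "g y \<noteq> 0"
  obtain x0 where x0: "symb a x0 \<noteq> 0" using poly_eval_nonzero_real[OF a] by (auto simp: symb_def)
  define v where "v = x0 - y"
  obtain q where q: "\<And>t. poly_eval a (\<chi> i. (\<chi> i. complex_of_real (y $ i)) $ i + t * (\<chi> i. complex_of_real (v $ i)) $ i) = poly q t"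
    using poly_eval_line by blast
  have sq: "symb a (y + t *\<^sub>R v) = poly q (of_real t)" for t
    unfolding q[symmetric] symb_def by simp
  have "q \<noteq> 0" using sq[of 1] x0 by (auto simp: v_def)
  then have fin: "finite {t::real. poly q (of_real t) = 0}"
    using finite_vimageI[OF poly_roots_finite, of q complex_of_real] by (auto simp: inj_on_def vimage_def)
  have "continuous_on UNIV (\<lambda>t. g (y + t *\<^sub>R v))"
    by (intro continuous_on_compose2[OF cont] continuous_intros) auto
  then have "isCont (\<lambda>t. g (y + t *\<^sub>R v)) 0" by (simp add: continuous_on_eq_continuous_at)
  then have "(\<lambda>t. g (y + t *\<^sub>R v)) \<midarrow>0\<rightarrow> g y" by (simp add: isCont_def)
  from tendsto_imp_eventually_ne[OF this \<open>g y \<noteq> 0\<close>]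
  obtain d where d: "d > 0" "\<And>t. t \<noteq> 0 \<Longrightarrow> \<bar>t\<bar> < d \<Longrightarrow> g (y + t *\<^sub>R v) \<noteq> 0"
    by (auto simp: eventually_at dist_real_def)
  have "{0<..<d} \<subseteq> {t. poly q (of_real t) = 0}"
  proof
    fix t assume "t \<in> {0<..<d}"
    then have "g (y + t *\<^sub>R v) \<noteq> 0" using d(2)[of t] by simp
    with z[of "y + t *\<^sub>R v"] show "t \<in> {t. poly q (of_real t) = 0}" by (simp add: sq)
  qed
  with fin have "finite {0<..<d}" by (rule finite_subset[rotated])
  with d(1) show False by (simp add: infinite_Ioo)
qed

lemma rapid_pdo_fun: "rapid f \<Longrightarrow> rapid (pdo_fun b f)"
proof (induction b arbitrary: f rule: pdo_induct)
  case (const c) then show ?case by (simp add: pdo_fun_pconst rapid_cmult)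
next
  case (var i) then show ?case by (simp add: pdo_fun_pvar rapidD rapid_D_fun)
next
  case (add p q)
  then have "rapid (\<lambda>x. pdo_fun p f x + pdo_fun q f x)" by (intro rapid_add) auto
  then show ?case by (simp add: pdo_fun_add[abs_def, symmetric] pdo_fun_add)
next
  case (mult p q) then show ?case by (simp add: pdo_fun_mult rapidD)
qed

lemma FT_pdo_fun: "rapid f \<Longrightarrow> FT (pdo_fun b f) x = symb b x * FT f x"
proof (induction b arbitrary: f rule: pdo_induct)
  case (const c) then show ?case by (simp add: pdo_fun_pconst FT_cmult symb_def)
next
  case (var i) then show ?case by (simp add: pdo_fun_pvar rapidD FT_D_fun symb_def)
next
  case (add p q)
  have "FT (\<lambda>x. pdo_fun p f x + pdo_fun q f x) x = symb (p + q) x * FT f x"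
    using add by (simp add: FT_add rapid_pdo_fun symb_def distrib_right)
  then show ?case by (simp add: pdo_fun_add[abs_def, symmetric] pdo_fun_add)
next
  case (mult p q) then show ?case by (simp add: pdo_fun_mult rapidD rapid_pdo_fun symb_def)
qed

lemma rapid_imp_slow: assumes "rapid f" shows "slow f"
proof -
  have "\<exists>C k. \<forall>x. norm (foldr D_fun js f x) \<le> C * (1 + norm x) ^ k" for js
  proof -
    obtain C where "\<And>x. norm (foldr D_fun js f x) * (1 + norm x) ^ 0 \<le> C" using assms unfolding rapid_def by metis
    then show ?thesis by (intro exI[of _ C] exI[of _ "0::nat"]) simp
  qed
  then show ?thesis using assms by (simp add: slow_def rapid_def)
qed

text \<open>The continuous transform of \<open>f\<close> is killed by a nonzero symbol and hence
  vanishes; \<open>FT_swap\<close> then makes \<open>f\<close> orthogonal to every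
  \<open>FT \<phi>\<close>.\<close>

lemma rapid_pdo_fun_injective:
  fixes f :: "real^'n::finite \<Rightarrow> complex"
  assumes "a \<noteq> 0" "rapid f" "\<And>x. pdo_fun a f x = 0"
  shows "f y = 0"
proof -
  have "pdo_fun a f = (\<lambda>_. 0)" using assms(3) by (rule ext)
  then have "symb a x * FT f x = 0" for x
    using FT_pdo_fun[OF assms(2), of a x] by (simp add: FT_def)
  then have FT0: "FT f x = 0" for x
    using zero_if_symb_mult_zero[OF assms(1) smooth_continuous_on[OF smooth_FT[OF assms(2)]]] by blast
  obtain C k where C: "\<And>x. norm (f x) \<le> C * (1 + norm x) ^ k"
    using slow_bound[OF rapid_imp_slow[OF assms(2)]] by blast
  show ?thesis
  proof (rule zero_if_orthogonal_to_FT[OF smooth_continuous_on[OF rapidD[OF assms(2)]] C])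
    fix \<phi> :: "real^'n \<Rightarrow> complex" assume "\<phi> \<in> test_functions"
    then show "(LINT x|lborel. f x * FT \<phi> x) = 0"
      using FT_swap[OF assms(2) test_rapid, of \<phi>] FT0 by simp
  qed
qed

subsection \<open>Regularisation of distributions\<close>

text \<open>Transposes compose in the opposite order, hence \<open>rev\<close>.\<close>

lemma foldr_D_distr:
  assumes "\<phi> \<in> test_functions"
  shows "foldr D_distr js u \<phi> = (- 1) ^ length js * u (foldr D_fun (rev js) \<phi>)"
  using assms
proof (induction js arbitrary: \<phi>)
  case (Cons j js)
  then show ?case using test_D_fun(1)[OF Cons.prems] by (simp add: D_distr_def)
qed simp

lemma finite_mdeg: "finite {\<alpha> :: 'n::finite \<Rightarrow>\<^sub>0 nat. mdeg \<alpha> \<le> N}"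
proof (rule finite_imageD)
  have "Poly_Mapping.lookup ` {\<alpha> :: 'n \<Rightarrow>\<^sub>0 nat. mdeg \<alpha> \<le> N} \<subseteq> PiE UNIV (\<lambda>_. {..N})"
  proof (intro image_subsetI)
    fix \<alpha> :: "'n \<Rightarrow>\<^sub>0 nat" assume "\<alpha> \<in> {\<alpha>. mdeg \<alpha> \<le> N}"
    then have "Poly_Mapping.lookup \<alpha> i \<le> N" for i
      using member_le_sum[of i UNIV "Poly_Mapping.lookup \<alpha>"] by (simp add: mdeg_def)
    then show "Poly_Mapping.lookup \<alpha> \<in> PiE UNIV (\<lambda>_. {..N})" by auto
  qed
  then show "finite (Poly_Mapping.lookup ` {\<alpha> :: 'n \<Rightarrow>\<^sub>0 nat. mdeg \<alpha> \<le> N})"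
    by (rule finite_subset) (simp add: finite_PiE)
qed (simp add: inj_on_def lookup_inject)

lemma C_seminorm_le:
  assumes "\<And>\<alpha> x. norm (iterate_multi D_fun \<alpha> f x) \<le> B \<alpha>"
  shows "C_seminorm N f \<le> (\<Sum>\<alpha> | mdeg \<alpha> \<le> N. B \<alpha>)"
  unfolding C_seminorm_def by (intro sum_mono cSUP_least assms) auto

lemma norm_le_C_seminorm:
  assumes "\<phi> \<in> test_functions"
  shows "norm (\<phi> x) \<le> C_seminorm 0 \<phi>"
proof -
  have bdd: "bdd_above (range (\<lambda>x. norm (iterate_multi D_fun \<alpha> \<phi> x)))" for \<alpha>
    using test_bounded[OF test_foldr(1)[OF assms, of "multi_list \<alpha>"]] by (auto simp: bdd_above_def iterate_multi_eq)
  have nn: "0 \<le> (SUP x. norm (iterate_multi D_fun \<alpha> \<phi> x))" for \<alpha>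
    by (rule cSUP_upper2[OF bdd UNIV_I norm_ge_zero])
  have "norm (\<phi> x) \<le> (SUP x. norm (iterate_multi D_fun 0 \<phi> x))"
    using cSUP_upper[OF UNIV_I bdd[of 0], of x] by simp
  also have "\<dots> \<le> C_seminorm 0 \<phi>"
    unfolding C_seminorm_def
    by (rule member_le_sum[of 0 _ "\<lambda>\<alpha>. SUP x. norm (iterate_multi D_fun \<alpha> \<phi> x)"])
       (use nn finite_mdeg[of 0] in \<open>auto simp: mdeg_def\<close>)
  finally show ?thesis .
qed

lemma distr_add:
  "u \<in> distributions \<Longrightarrow> \<phi> \<in> test_functions \<Longrightarrow> \<psi> \<in> test_functions \<Longrightarrow> u (\<lambda>x. \<phi> x + \<psi> x) = u \<phi> + u \<psi>"
  by (simp add: distributions_def linear_functional_on_def)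

lemma distr_cmult: "u \<in> distributions \<Longrightarrow> \<phi> \<in> test_functions \<Longrightarrow> u (\<lambda>x. c * \<phi> x) = c * u \<phi>"
  by (simp add: distributions_def linear_functional_on_def)

lemma distr_sum:
  assumes "u \<in> distributions" "\<And>i. i \<in> I \<Longrightarrow> \<phi> i \<in> test_functions"
  shows "u (\<lambda>x. \<Sum>i\<in>I. \<phi> i x) = (\<Sum>i\<in>I. u (\<phi> i))"
  using assms(2)
proof (induction I rule: infinite_finite_induct)
  case (insert i I)
  then show ?case by (simp add: distr_add[OF assms(1)] test_sum)
qed (use distr_cmult[OF assms(1) test_zero, of 0] in auto)

text \<open>The convolution of \<open>u\<close> with the reflection of
  \<open>\<phi>\<close>.\<close>

definition reg :: "'n::finite distr \<Rightarrow> (real^'n \<Rightarrow> complex) \<Rightarrow> real^'n \<Rightarrow> complex" where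
  "reg u \<phi> y = u (\<lambda>x. \<phi> (x - y))"

lemma test_translate: "\<phi> \<in> test_functions \<Longrightarrow> (\<lambda>x. \<phi> (x - y)) \<in> test_functions"
  using test_shift(1)[of \<phi> "- y"] by simp

text \<open>The increment minus its linear part is \<open>u\<close> applied to a Taylor remainder of
  \<open>\<phi>\<close>, which is quadratically small in \<open>h\<close> together with its
  derivatives and supported in a fixed compact set. The continuity estimate of \<open>u\<close> on
  that set carries the bound over.\<close>

lemma reg_has_derivative:
  fixes u :: "'n::finite distr"
  assumes u: "u \<in> distributions" and \<phi>: "\<phi> \<in> test_functions"
  shows "(reg u \<phi> has_derivative (\<lambda>h. \<Sum>j\<in>UNIV. \<i> * (- reg u (D_fun j \<phi>) y) * of_real (h $ j))) (at y)"
proof -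
  have sm: "smooth \<phi>" by (rule test_functionsD(1)[OF \<phi>])
  obtain r where r: "\<And>x. x \<in> supp \<phi> \<Longrightarrow> norm x \<le> r"
    using compact_imp_bounded[OF test_functionsD(2)[OF \<phi>]] by (auto simp: bounded_iff)
  \<comment> \<open>The extra 1 leaves room for all translations with
    \<open>norm h \<le> 1\<close>.\<close>
  define K where "K = cball (0::real^'n) (r + norm y + 1)"
  obtain C N where CN: "\<And>\<psi>. \<psi> \<in> test_functions \<Longrightarrow> supp \<psi> \<subseteq> K \<Longrightarrow> norm (u \<psi>) \<le> C * C_seminorm N \<psi>"
  proof -
    have "\<forall>K. compact K \<longrightarrow> (\<exists>C N. \<forall>\<psi>\<in>test_functions. supp \<psi> \<subseteq> K \<longrightarrow> norm (u \<psi>) \<le> C * C_seminorm N \<psi>)"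
      using u by (simp add: distributions_def)
    moreover have "compact K" by (simp add: K_def)
    ultimately have "\<exists>C N. \<forall>\<psi>\<in>test_functions. supp \<psi> \<subseteq> K \<longrightarrow> norm (u \<psi>) \<le> C * C_seminorm N \<psi>" by simp
    then show ?thesis using that by metis
  qed
  have "\<forall>\<alpha>. \<exists>M\<ge>0. \<forall>x h. norm (iterate_multi D_fun \<alpha> \<phi> (x + h) - iterate_multi D_fun \<alpha> \<phi> x -
      (\<Sum>j\<in>UNIV. \<i> * D_fun j (iterate_multi D_fun \<alpha> \<phi>) x * of_real (h $ j))) \<le> M * norm h ^ 2"
    using test_quadratic[OF test_foldr(1)[OF \<phi>]] by (simp add: iterate_multi_eq)
  from choice[OF this] obtain M where M: "\<forall>\<alpha>. M \<alpha> \<ge> 0 \<and> (\<forall>x h. norm (iterate_multi D_fun \<alpha> \<phi> (x + h) - iterate_multi D_fun \<alpha> \<phi> x -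
      (\<Sum>j\<in>UNIV. \<i> * D_fun j (iterate_multi D_fun \<alpha> \<phi>) x * of_real (h $ j))) \<le> M \<alpha> * norm h ^ 2)" by (rule exE)
  show ?thesis
  proof (rule has_derivative_quadratic[OF bounded_linear_grad])
    fix h :: "real^'n" assume h: "norm h \<le> 1"
    define \<psi> where "\<psi> = (\<lambda>x. \<phi> (x + (- y - h)) + ((- 1) * \<phi> (x + (- y)) + (\<Sum>j\<in>UNIV. (\<i> * of_real (h $ j)) * D_fun j \<phi> (x + (- y)))))"
    have t: "(\<lambda>x. \<phi> (x + (- y - h))) \<in> test_functions" "(\<lambda>x. (- 1) * \<phi> (x + (- y))) \<in> test_functions"
      "(\<lambda>x. (\<i> * of_real (h $ j)) * D_fun j \<phi> (x + (- y))) \<in> test_functions" for j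
      by (intro test_shift test_cmult test_D_fun \<phi>)+
    have ts: "(\<lambda>x. \<Sum>j\<in>UNIV. (\<i> * of_real (h $ j)) * D_fun j \<phi> (x + (- y))) \<in> test_functions"
      by (intro test_sum t)
    have \<psi>: "\<psi> \<in> test_functions" unfolding \<psi>_def by (intro test_add t ts)
    have u\<psi>: "u \<psi> = reg u \<phi> (y + h) - reg u \<phi> y - (\<Sum>j\<in>UNIV. \<i> * (- reg u (D_fun j \<phi>) y) * of_real (h $ j))"
    proof -
      have "u \<psi> = u (\<lambda>x. \<phi> (x + (- y - h))) + (u (\<lambda>x. (- 1) * \<phi> (x + (- y))) +
          (\<Sum>j\<in>UNIV. u (\<lambda>x. (\<i> * of_real (h $ j)) * D_fun j \<phi> (x + (- y)))))"
        unfolding \<psi>_def distr_add[OF u t(1) test_add(1)[OF t(2) ts]] distr_add[OF u t(2) ts] distr_sum[OF u t(3)] ..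
      also have "\<dots> = reg u \<phi> (y + h) + ((- 1) * reg u \<phi> y + (\<Sum>j\<in>UNIV. (\<i> * of_real (h $ j)) * reg u (D_fun j \<phi>) y))"
        unfolding distr_cmult[OF u test_shift(1)[OF \<phi>]] distr_cmult[OF u test_shift(1)[OF test_D_fun(1)[OF \<phi>]]]
        by (simp add: reg_def) (simp add: algebra_simps)
      finally show ?thesis by (simp add: sum_negf mult_ac)
    qed
    have supp\<psi>: "supp \<psi> \<subseteq> K"
    proof (rule test_functionsI(2)[OF test_functionsD(1)[OF \<psi>]])
      show "compact K" by (simp add: K_def)
      fix x assume nz: "\<psi> x \<noteq> 0"
      have "\<phi> (x + (- y - h)) \<noteq> 0 \<or> \<phi> (x + (- y)) \<noteq> 0 \<or> (\<exists>j. D_fun j \<phi> (x + (- y)) \<noteq> 0)"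
      proof (rule ccontr)
        assume "\<not> ?thesis"
        then have "\<psi> x = 0" by (simp add: \<psi>_def)
        with nz show False by simp
      qed
      then have "norm (x + (- y - h)) \<le> r \<or> norm (x + (- y)) \<le> r"
        using r in_supp[of \<phi>] D_fun_outside_supp[of _ \<phi>] by metis
      then have "norm x \<le> r + norm y + 1"
        using h norm_triangle_ineq[of "x + (- y - h)" "y + h"] norm_triangle_ineq[of "x + (- y)" y] norm_triangle_ineq[of y h]
        by auto
      then show "x \<in> K" by (simp add: K_def)
    qed
    have it: "iterate_multi D_fun \<alpha> \<psi> x = iterate_multi D_fun \<alpha> \<phi> ((x - y) + (- h)) - iterate_multi D_fun \<alpha> \<phi> (x - y) -
        (\<Sum>j\<in>UNIV. \<i> * D_fun j (iterate_multi D_fun \<alpha> \<phi>) (x - y) * of_real ((- h) $ j))" for \<alpha> x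
    proof -
      have com: "foldr D_fun (multi_list \<alpha>) (D_fun j \<phi>) = D_fun j (foldr D_fun (multi_list \<alpha>) \<phi>)" for j
        using foldr_D_fun_move[OF sm, of "multi_list \<alpha>" j "[]"] by simp
      have "foldr D_fun (multi_list \<alpha>) \<psi> x = foldr D_fun (multi_list \<alpha>) \<phi> (x + (- y - h)) +
          ((- 1) * foldr D_fun (multi_list \<alpha>) \<phi> (x + (- y)) +
          (\<Sum>j\<in>UNIV. (\<i> * of_real (h $ j)) * foldr D_fun (multi_list \<alpha>) (D_fun j \<phi>) (x + (- y))))"
        unfolding \<psi>_def
          foldr_D_fun_add[OF test_functionsD(1)[OF t(1)] test_functionsD(1)[OF test_add(1)[OF t(2) ts]]]
          foldr_D_fun_add[OF test_functionsD(1)[OF t(2)] test_functionsD(1)[OF ts]]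
          foldr_D_fun_sum[OF smooth_shift[OF smooth_D_fun[OF sm]]] foldr_D_fun_cmult[OF smooth_shift[OF sm]]
          foldr_D_fun_shift[OF sm] foldr_D_fun_shift[OF smooth_D_fun[OF sm]] ..
      then show ?thesis unfolding iterate_multi_eq com by (simp add: algebra_simps sum_negf)
    qed
    have "C_seminorm N \<psi> \<le> (\<Sum>\<alpha> | mdeg \<alpha> \<le> N. M \<alpha> * norm h ^ 2)"
    proof (rule C_seminorm_le)
      show "norm (iterate_multi D_fun \<alpha> \<psi> x) \<le> M \<alpha> * norm h ^ 2" for \<alpha> x
        unfolding it using conjunct2[OF spec[OF M, of \<alpha>], THEN spec, of "x - y", THEN spec, of "- h"] by simp
    qed
    moreover have "0 \<le> C_seminorm N \<psi>"
      unfolding C_seminorm_def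
    proof (intro sum_nonneg)
      fix \<alpha>
      have "bdd_above (range (\<lambda>x. norm (iterate_multi D_fun \<alpha> \<psi> x)))"
        using test_bounded[OF test_foldr(1)[OF \<psi>, of "multi_list \<alpha>"]] by (auto simp: bdd_above_def iterate_multi_eq)
      then show "0 \<le> (SUP x. norm (iterate_multi D_fun \<alpha> \<psi> x))"
        using cSUP_upper[OF UNIV_I, of "\<lambda>x. norm (iterate_multi D_fun \<alpha> \<psi> x)" 0] norm_ge_zero order_trans by blast
    qed
    \<comment> \<open>The sign of \<open>C\<close> is unknown, so the estimate passes through its
      modulus.\<close>
    ultimately have "\<bar>C\<bar> * C_seminorm N \<psi> \<le> \<bar>C\<bar> * (\<Sum>\<alpha> | mdeg \<alpha> \<le> N. M \<alpha> * norm h ^ 2)"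
      "C * C_seminorm N \<psi> \<le> \<bar>C\<bar> * C_seminorm N \<psi>"
      by (auto intro!: mult_left_mono mult_right_mono)
    with CN[OF \<psi> supp\<psi>] have "norm (u \<psi>) \<le> \<bar>C\<bar> * (\<Sum>\<alpha> | mdeg \<alpha> \<le> N. M \<alpha> * norm h ^ 2)" by linarith
    then show "norm (reg u \<phi> (y + h) - reg u \<phi> y - (\<Sum>j\<in>UNIV. \<i> * (- reg u (D_fun j \<phi>) y) * of_real (h $ j))) \<le>
        (\<bar>C\<bar> * (\<Sum>\<alpha> | mdeg \<alpha> \<le> N. M \<alpha>)) * norm h ^ 2"
      unfolding u\<psi> by (simp add: sum_distrib_right mult.assoc)
  qed
qed

lemma D_fun_reg:
  assumes "u \<in> distributions" "\<phi> \<in> test_functions"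
  shows "D_fun j (reg u \<phi>) = reg u (\<lambda>x. (- 1) * D_fun j \<phi> x)"
proof
  fix y
  have "D_fun j (reg u \<phi>) y = - reg u (D_fun j \<phi>) y"
    by (rule D_fun_of_gradient[OF reg_has_derivative[OF assms]])
  also have "\<dots> = reg u (\<lambda>x. (- 1) * D_fun j \<phi> x) y"
    unfolding reg_def distr_cmult[OF assms(1) test_translate[OF test_D_fun(1)[OF assms(2)]]] by simp
  finally show "D_fun j (reg u \<phi>) y = reg u (\<lambda>x. (- 1) * D_fun j \<phi> x) y" .
qed

lemma smooth_reg:
  assumes "u \<in> distributions" "\<phi> \<in> test_functions"
  shows "smooth (reg u \<phi>)"
proof (rule smooth_coinduct[of _ "reg u ` test_functions"])
  fix g j assume "g \<in> reg u ` test_functions"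
  then obtain \<psi> where g: "g = reg u \<psi>" "\<psi> \<in> test_functions" by blast
  show "g differentiable_on UNIV"
    using reg_has_derivative[OF assms(1) g(2)] unfolding g(1) by (auto simp: differentiable_on_def differentiable_def)
  show "D_fun j g \<in> reg u ` test_functions"
    unfolding g(1) D_fun_reg[OF assms(1) g(2)] by (intro imageI test_cmult test_D_fun g)
qed (use assms in blast)

lemma foldr_D_fun_reg:
  assumes "u \<in> distributions" "\<phi> \<in> test_functions"
  shows "foldr D_fun js (reg u \<phi>) = reg u (\<lambda>x. (- 1) ^ length js * foldr D_fun js \<phi> x)"
proof (induction js)
  case (Cons j js)
  have t: "foldr D_fun js \<phi> \<in> test_functions" by (rule test_foldr[OF assms(2)])
  have "foldr D_fun (j # js) (reg u \<phi>) = D_fun j (reg u (\<lambda>x. (- 1) ^ length js * foldr D_fun js \<phi> x))"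
    using Cons by simp
  also have "\<dots> = reg u (\<lambda>x. (- 1) * D_fun j (\<lambda>x. (- 1) ^ length js * foldr D_fun js \<phi> x) x)"
    by (rule D_fun_reg[OF assms(1) test_cmult[OF t]])
  also have "\<dots> = reg u (\<lambda>x. (- 1) ^ length (j # js) * foldr D_fun (j # js) \<phi> x)"
    by (simp add: D_fun_cmult[OF test_functionsD(1)[OF t]])
  finally show ?case .
qed simp

text \<open>Each transposed derivative contributes a sign, and so does each derivative of
  \<open>reg u \<phi>\<close> in \<open>y\<close>. They cancel, so regularisation commutes with
  operators.\<close>

lemma pdo_apply_translate:
  assumes u: "u \<in> distributions" and \<phi>: "\<phi> \<in> test_functions"
  shows "pdo_apply p u (\<lambda>x. \<phi> (x - y)) = pdo_fun p (reg u \<phi>) y"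
proof -
  have sm: "smooth \<phi>" by (rule test_functionsD(1)[OF \<phi>])
  have "iterate_multi D_distr \<alpha> u (\<lambda>x. \<phi> (x - y)) = iterate_multi D_fun \<alpha> (reg u \<phi>) y" for \<alpha>
  proof -
    let ?js = "multi_list \<alpha>"
    have "foldr D_fun (rev ?js) (\<lambda>x. \<phi> (x - y)) = (\<lambda>x. foldr D_fun (rev ?js) \<phi> (x - y))"
      using foldr_D_fun_shift[OF sm, of "rev ?js" "- y"] by simp
    also have "foldr D_fun (rev ?js) \<phi> = foldr D_fun ?js \<phi>"
      by (rule foldr_D_fun_perm[OF sm]) simp
    finally have "iterate_multi D_distr \<alpha> u (\<lambda>x. \<phi> (x - y)) = (- 1) ^ length ?js * u (\<lambda>x. foldr D_fun ?js \<phi> (x - y))"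
      unfolding iterate_multi_eq foldr_D_distr[OF test_translate[OF \<phi>]] by simp
    also have "\<dots> = u (\<lambda>x. (- 1) ^ length ?js * foldr D_fun ?js \<phi> (x - y))"
      by (rule distr_cmult[OF u test_translate[OF test_foldr(1)[OF \<phi>]], symmetric])
    also have "\<dots> = iterate_multi D_fun \<alpha> (reg u \<phi>) y"
      unfolding iterate_multi_eq foldr_D_fun_reg[OF u \<phi>] by (simp add: reg_def)
    finally show ?thesis .
  qed
  then show ?thesis by (simp add: pdo_apply_def pdo_fun_def lin_def)
qed

lemma pdo_apply_not_test:
  assumes "u \<in> distributions" "\<phi> \<notin> test_functions"
  shows "pdo_apply p u \<phi> = 0"
proof -
  have "foldr D_distr js u \<phi> = 0" for js
    using assms by (cases js) (auto simp: D_distr_def distributions_def)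
  then show ?thesis by (simp add: pdo_apply_def iterate_multi_eq)
qed

definition system_fun :: "('n::finite pdo)^'k::finite \<Rightarrow> ('k \<Rightarrow> real^'n \<Rightarrow> complex) \<Rightarrow> real^'n \<Rightarrow> complex" where
  "system_fun p G = (\<lambda>y. \<Sum>j\<in>UNIV. pdo_fun (p $ j) (G j) y)"

lemma system_fun_smult:
  assumes "\<And>j. smooth (G j)"
  shows "system_fun (a *s p) G = pdo_fun a (system_fun p G)"
  unfolding system_fun_def by (subst pdo_fun_sum) (auto simp: smooth_pdo_fun pdo_fun_mult assms)

lemma system_apply_translate:
  assumes "\<And>j. f $ j \<in> distributions" "\<phi> \<in> test_functions"
  shows "system_apply p f (\<lambda>x. \<phi> (x - y)) = system_fun p (\<lambda>j. reg (f $ j) \<phi>) y"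
  unfolding system_apply_def system_fun_def by (simp add: pdo_apply_translate assms)

text \<open>The value at 0 suffices because \<open>\<phi>\<close> ranges over all test functions,
  while the equations hold at every \<open>y\<close> because translates are test functions.\<close>

lemma closure_wrtI:
  assumes F: "F \<subseteq> distributions"
    and *: "\<And>f \<phi>. (\<And>j. f $ j \<in> F) \<Longrightarrow> \<phi> \<in> test_functions \<Longrightarrow>
      (\<And>m y. m \<in> P \<Longrightarrow> system_fun m (\<lambda>j. reg (f $ j) \<phi>) y = 0) \<Longrightarrow> system_fun p (\<lambda>j. reg (f $ j) \<phi>) 0 = 0"
  shows "p \<in> closure_wrt F P"
  unfolding closure_wrt_def
proof (intro CollectI ballI ext)
  fix f \<phi> assume "f \<in> Ker F P"
  then have f: "\<And>j. f $ j \<in> F" and P: "\<And>m. m \<in> P \<Longrightarrow> system_apply m f = (\<lambda>_. 0)" by (auto simp: Ker_def)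
  have fd: "f $ j \<in> distributions" for j using f F by blast
  show "system_apply p f \<phi> = 0"
  proof (cases "\<phi> \<in> test_functions")
    case True
    have "system_fun p (\<lambda>j. reg (f $ j) \<phi>) 0 = 0"
      using f True by (rule *) (simp add: system_apply_translate[OF fd True, symmetric] P)
    then show ?thesis using system_apply_translate[OF fd True, of p 0] by simp
  next
    case False
    then show ?thesis by (simp add: system_apply_def pdo_apply_not_test fd)
  qed
qed

text \<open>Two kinds of multipliers annihilate \<open>system_fun p G\<close>: the symbols of those
  \<open>a\<close> with \<open>a *s p \<in> P\<close>, since \<open>G\<close> solves the system, and
  those annihilating every \<open>G j\<close>, since they commute with the operators
  \<open>p $ j\<close>. Together they have no common zero.\<close>

lemma system_fun_zero_if_multipliers:
  fixes p :: "('n::finite pdo)^'k::finite"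
  assumes G: "\<And>j. slow (G j)"
    and P: "\<And>m y. m \<in> P \<Longrightarrow> system_fun m G y = 0"
    and M: "\<And>m. m \<in> M \<Longrightarrow> smooth m"
    and kill: "\<And>m j \<phi>. m \<in> M \<Longrightarrow> \<phi> \<in> test_functions \<Longrightarrow> (LINT x|lborel. G j x * FT (\<lambda>\<xi>. m \<xi> * \<phi> \<xi>) x) = 0"
    and nz: "\<And>\<xi>. (\<exists>a. a *s p \<in> P \<and> symb a \<xi> \<noteq> 0) \<or> (\<exists>m\<in>M. m \<xi> \<noteq> 0)"
  shows "system_fun p G y = 0"
proof -
  have S: "slow (system_fun p G)"
    unfolding system_fun_def by (intro slow_sum slow_pdo_fun G)
  show ?thesis
  proof (rule zero_if_multipliers_nonvanishing[OF S, of "{symb a | a. a *s p \<in> P} \<union> M"])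
    show "smooth m" if "m \<in> {symb a | a. a *s p \<in> P} \<union> M" for m using that M smooth_symb by auto
    show "\<exists>m\<in>{symb a | a. a *s p \<in> P} \<union> M. m \<xi> \<noteq> 0" for \<xi> using nz[of \<xi>] by blast
    fix m and \<phi> :: "real^'n \<Rightarrow> complex"
    assume m: "m \<in> {symb a | a. a *s p \<in> P} \<union> M" and \<phi>: "\<phi> \<in> test_functions"
    from m show "(LINT x|lborel. system_fun p G x * FT (\<lambda>\<xi>. m \<xi> * \<phi> \<xi>) x) = 0"
    proof
      assume "m \<in> {symb a | a. a *s p \<in> P}"
      then obtain a where a: "m = symb a" "a *s p \<in> P" by blast
      have "pdo_fun a (system_fun p G) x = 0" for x
        using P[OF a(2), of x] by (simp add: system_fun_smult slowD G)
      then show ?thesis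
        using pairing_pdo_fun[OF S test_rapid[OF \<phi>], of a] by (simp add: a(1))
    next
      assume mM: "m \<in> M"
      have r: "rapid (\<lambda>\<xi>. m \<xi> * \<phi> \<xi>)" by (intro test_rapid test_mult \<phi> M mM)
      have "(LINT x|lborel. system_fun p G x * FT (\<lambda>\<xi>. m \<xi> * \<phi> \<xi>) x) =
          (\<Sum>j\<in>UNIV. (LINT x|lborel. pdo_fun (p $ j) (G j) x * FT (\<lambda>\<xi>. m \<xi> * \<phi> \<xi>) x))"
        unfolding system_fun_def sum_distrib_right
        by (intro Bochner_Integration.integral_sum slow_rapid_integrable slow_pdo_fun G rapid_FT r)
      also have "\<dots> = 0"
      proof (intro sum.neutral ballI)
        fix j
        have "(LINT x|lborel. pdo_fun (p $ j) (G j) x * FT (\<lambda>\<xi>. m \<xi> * \<phi> \<xi>) x) =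
            (LINT x|lborel. G j x * FT (\<lambda>\<xi>. m \<xi> * (symb (p $ j) \<xi> * \<phi> \<xi>)) x)"
          unfolding pairing_pdo_fun[OF G r] by (simp add: mult.left_commute)
        also have "\<dots> = 0" by (intro kill mM test_mult \<phi> smooth_symb)
        finally show "(LINT x|lborel. pdo_fun (p $ j) (G j) x * FT (\<lambda>\<xi>. m \<xi> * \<phi> \<xi>) x) = 0" .
      qed
      finally show ?thesis .
    qed
  qed
qed

text \<open>Derivatives of \<open>reg u \<phi>\<close> are, up to sign, regularisations with
  derivatives of \<open>\<phi>\<close>, so a bound on values for all test functions controls every
  derivative.\<close>

lemma slow_reg:
  assumes "u \<in> distributions" "\<And>\<phi>. \<phi> \<in> test_functions \<Longrightarrow> \<exists>C k. \<forall>y. norm (reg u \<phi> y) \<le> C * (1 + norm y) ^ k"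
    and "\<phi> \<in> test_functions"
  shows "slow (reg u \<phi>)"
  unfolding slow_def
proof (intro conjI allI smooth_reg assms(1,3))
  fix js
  show "\<exists>C k. \<forall>x. norm (foldr D_fun js (reg u \<phi>) x) \<le> C * (1 + norm x) ^ k"
    unfolding foldr_D_fun_reg[OF assms(1,3)] by (intro assms(2) test_cmult test_foldr assms(3))
qed

lemma rapid_reg:
  assumes "u \<in> distributions" "\<And>\<phi> k. \<phi> \<in> test_functions \<Longrightarrow> \<exists>C. \<forall>y. norm (reg u \<phi> y) * (1 + norm y) ^ k \<le> C"
    and "\<phi> \<in> test_functions"
  shows "rapid (reg u \<phi>)"
  unfolding rapid_def
proof (intro conjI allI smooth_reg assms(1,3))
  fix js k
  show "\<exists>C. \<forall>x. norm (foldr D_fun js (reg u \<phi>) x) * (1 + norm x) ^ k \<le> C"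
    unfolding foldr_D_fun_reg[OF assms(1,3)] by (intro assms(2) test_cmult test_foldr assms(3))
qed

subsection \<open>Distributions given by functions\<close>

lemma continuous_mult_test_integrable:
  fixes f :: "real^'n::finite \<Rightarrow> complex"
  assumes "continuous_on UNIV f" "\<phi> \<in> test_functions"
  shows "integrable lborel (\<lambda>x. f x * \<phi> x)"
proof -
  have "integrable lborel (\<lambda>x. indicator (supp \<phi>) x *\<^sub>R (f x * \<phi> x))"
    by (intro borel_integrable_compact test_functionsD assms continuous_intros smooth_continuous_on
        continuous_on_subset[OF assms(1)] subset_UNIV)
  moreover have "indicator (supp \<phi>) x *\<^sub>R (f x * \<phi> x) = f x * \<phi> x" for x
    using in_supp[of \<phi> x] by (cases "\<phi> x = 0") auto
  ultimately show ?thesis by simp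
qed

lemma distr_of_distribution:
  fixes f :: "real^'n::finite \<Rightarrow> complex"
  assumes "continuous_on UNIV f"
  shows "distr_of f \<in> distributions"
  unfolding distributions_def
proof (intro CollectI conjI allI impI)
  show "distr_of f \<phi> = 0" if "\<phi> \<notin> test_functions" for \<phi> using that by (simp add: distr_of_def)
  show "linear_functional_on test_functions (distr_of f)"
    unfolding linear_functional_on_def
  proof (intro conjI ballI allI)
    fix \<phi> \<psi> :: "real^'n \<Rightarrow> complex" assume "\<phi> \<in> test_functions" "\<psi> \<in> test_functions"
    then show "distr_of f (\<lambda>x. \<phi> x + \<psi> x) = distr_of f \<phi> + distr_of f \<psi>"
      by (simp add: distr_of_def test_add distrib_left continuous_mult_test_integrable assms)
  next
    fix c and \<phi> :: "real^'n \<Rightarrow> complex" assume "\<phi> \<in> test_functions"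
    then show "distr_of f (\<lambda>x. c * \<phi> x) = c * distr_of f \<phi>"
      by (simp add: distr_of_def test_cmult mult.left_commute[of _ c])
  qed
  fix K :: "(real^'n) set" assume K: "compact K"
  have int: "integrable lborel (\<lambda>x. indicator K x *\<^sub>R norm (f x))"
    by (intro borel_integrable_compact K continuous_intros continuous_on_subset[OF assms] subset_UNIV)
  have "norm (distr_of f \<phi>) \<le> (LINT x|lborel. indicator K x *\<^sub>R norm (f x)) * C_seminorm 0 \<phi>"
    if \<phi>: "\<phi> \<in> test_functions" "supp \<phi> \<subseteq> K" for \<phi>
  proof -
    have "norm (LINT x|lborel. f x * \<phi> x) \<le> (LINT x|lborel. (indicator K x *\<^sub>R norm (f x)) * C_seminorm 0 \<phi>)"
    proof (rule Bochner_Integration.integral_norm_bound_integral)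
      show "integrable lborel (\<lambda>x. f x * \<phi> x)" by (rule continuous_mult_test_integrable[OF assms \<phi>(1)])
      show "integrable lborel (\<lambda>x. (indicator K x *\<^sub>R norm (f x)) * C_seminorm 0 \<phi>)"
        by (intro integrable_mult_left int)
      fix x
      show "norm (f x * \<phi> x) \<le> (indicator K x *\<^sub>R norm (f x)) * C_seminorm 0 \<phi>"
      proof (cases "\<phi> x = 0")
        case True
        then show ?thesis using norm_le_C_seminorm[OF \<phi>(1), of x] by (auto intro!: mult_nonneg_nonneg)
      next
        case False
        then have "x \<in> K" using in_supp \<phi>(2) by blast
        then show ?thesis
          using mult_left_mono[OF norm_le_C_seminorm[OF \<phi>(1), of x], of "norm (f x)"] by (simp add: norm_mult)
      qed
    qed
    then show ?thesis by (simp add: distr_of_def \<phi>)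
  qed
  then show "\<exists>C N. \<forall>\<phi>\<in>test_functions. supp \<phi> \<subseteq> K \<longrightarrow> norm (distr_of f \<phi>) \<le> C * C_seminorm N \<phi>" by blast
qed

lemma D_distr_distr_of:
  fixes f :: "real^'n::finite \<Rightarrow> complex"
  assumes "smooth f"
  shows "D_distr j (distr_of f) = distr_of (D_fun j f)"
proof
  fix \<phi>
  show "D_distr j (distr_of f) \<phi> = distr_of (D_fun j f) \<phi>"
  proof (cases "\<phi> \<in> test_functions")
    case True
    have t: "(\<lambda>x. f x * \<phi> x) \<in> test_functions" by (rule test_mult[OF True assms])
    have "D_fun j (\<lambda>x. f x * \<phi> x) = (\<lambda>x. D_fun j f x * \<phi> x + f x * D_fun j \<phi> x)"
      by (rule ext, rule D_fun_mult) (intro smooth_differentiable assms test_functionsD(1)[OF True])+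
    then have "(LINT x|lborel. D_fun j f x * \<phi> x + f x * D_fun j \<phi> x) = 0"
      using rapid_integral_D_fun[OF test_rapid[OF t], of j] by simp
    then have "(LINT x|lborel. D_fun j f x * \<phi> x) + (LINT x|lborel. f x * D_fun j \<phi> x) = 0"
      by (subst (asm) Bochner_Integration.integral_add)
         (auto intro!: continuous_mult_test_integrable smooth_continuous_on smooth_D_fun assms True test_D_fun)
    then show ?thesis using True test_D_fun(1)[OF True] by (simp add: D_distr_def distr_of_def add_eq_0_iff)
  qed (simp add: D_distr_def distr_of_def)
qed

lemma foldr_D_distr_distr_of:
  "smooth f \<Longrightarrow> foldr D_distr js (distr_of f) = distr_of (foldr D_fun js f)"
  by (induction js) (auto simp: D_distr_distr_of smooth_foldr)

lemma pdo_apply_distr_of: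
  assumes "smooth f"
  shows "pdo_apply q (distr_of f) = distr_of (pdo_fun q f)"
proof
  fix \<phi>
  show "pdo_apply q (distr_of f) \<phi> = distr_of (pdo_fun q f) \<phi>"
  proof (cases "\<phi> \<in> test_functions")
    case True
    have "distr_of (pdo_fun q f) \<phi> = (LINT x|lborel. (\<Sum>\<alpha>\<in>Poly_Mapping.keys q. Poly_Mapping.lookup q \<alpha> * (iterate_multi D_fun \<alpha> f x * \<phi> x)))"
      using True by (simp add: distr_of_def pdo_fun_def lin_def sum_distrib_right mult.assoc)
    also have "\<dots> = (\<Sum>\<alpha>\<in>Poly_Mapping.keys q. (LINT x|lborel. Poly_Mapping.lookup q \<alpha> * (iterate_multi D_fun \<alpha> f x * \<phi> x)))"
      by (intro Bochner_Integration.integral_sum integrable_mult_right continuous_mult_test_integrable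
          smooth_continuous_on smooth_iterate_multi assms True)
    finally have "distr_of (pdo_fun q f) \<phi> = (\<Sum>\<alpha>\<in>Poly_Mapping.keys q. (LINT x|lborel. Poly_Mapping.lookup q \<alpha> * (iterate_multi D_fun \<alpha> f x * \<phi> x)))" .
    then show ?thesis
      unfolding pdo_apply_def iterate_multi_eq foldr_D_distr_distr_of[OF assms]
      using True by (simp add: distr_of_def)
  next
    case False
    then show ?thesis
      using pdo_apply_not_test[OF distr_of_distribution[OF smooth_continuous_on[OF assms]]] by (simp add: distr_of_def)
  qed
qed

lemma system_apply_distr_of:
  assumes "\<And>j. smooth (f j)"
  shows "system_apply q (\<chi> j. distr_of (f j)) = distr_of (system_fun q f)"
proof
  fix \<phi>
  show "system_apply q (\<chi> j. distr_of (f j)) \<phi> = distr_of (system_fun q f) \<phi>"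
  proof (cases "\<phi> \<in> test_functions")
    case True
    have "(LINT x|lborel. (\<Sum>j\<in>UNIV. pdo_fun (q $ j) (f j) x * \<phi> x)) = (\<Sum>j\<in>UNIV. (LINT x|lborel. pdo_fun (q $ j) (f j) x * \<phi> x))"
      by (intro Bochner_Integration.integral_sum continuous_mult_test_integrable smooth_continuous_on smooth_pdo_fun assms True)
    then show ?thesis
      using True by (simp add: system_apply_def pdo_apply_distr_of[OF assms])
        (simp add: distr_of_def system_fun_def sum_distrib_right)
  next
    case False
    then show ?thesis
      by (simp add: system_apply_def pdo_apply_distr_of[OF assms]) (simp add: distr_of_def)
  qed
qed

text \<open>Tested against \<open>cnj f\<close> times a bump at \<open>y\<close>, the integrand
  becomes nonnegative.\<close>

lemma distr_of_eq_0:
  fixes f :: "real^'n::finite \<Rightarrow> complex"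
  assumes "smooth f" "distr_of f = (\<lambda>_. 0)"
  shows "f y = 0"
proof -
  define b :: "real^'n \<Rightarrow> complex" where "b = bump 1 y (1\<^sup>2)"
  have b: "b \<in> test_functions" unfolding b_def by (rule bump_test) simp
  have t: "(\<lambda>x. cnj (f x) * b x) \<in> test_functions" by (intro test_mult b smooth_cnj assms)
  have eq: "f x * (cnj (f x) * b x) = of_real ((norm (f x))\<^sup>2 * norm (b x))" for x
    unfolding of_real_mult complex_norm_square by (simp add: b_def bump_real mult.assoc)
  have "distr_of f (\<lambda>x. cnj (f x) * b x) = 0" using assms(2) by simp
  then have "(LINT x|lborel. f x * (cnj (f x) * b x)) = 0" using t by (simp add: distr_of_def)
  then have "(LINT x|lborel. (norm (f x))\<^sup>2 * norm (b x)) = 0"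
    unfolding eq by (simp only: integral_complex_of_real of_real_eq_0_iff)
  moreover have "integrable lborel (\<lambda>x. (norm (f x))\<^sup>2 * norm (b x))"
    using continuous_mult_test_integrable[OF smooth_continuous_on[OF assms(1)] t]
    unfolding eq by (simp only: complex_of_real_integrable_eq)
  ultimately have "(norm (f y))\<^sup>2 * norm (b y) = 0"
    by (intro continuous_integral_zero[of "\<lambda>x. (norm (f x))\<^sup>2 * norm (b x)"])
       (auto intro!: continuous_intros smooth_continuous_on assms test_functionsD(1)[OF b])
  then show ?thesis using bump_center[of 1 y] by (simp add: b_def)
qed

lemma not_in_closureI:
  fixes f :: "'k::finite \<Rightarrow> real^'n::finite \<Rightarrow> complex"
  assumes "\<And>j. smooth (f j)" "\<And>j. distr_of (f j) \<in> F" "\<And>m y. m \<in> P \<Longrightarrow> system_fun m f y = 0" "system_fun p f y \<noteq> 0"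
  shows "p \<notin> closure_wrt F P"
proof
  assume "p \<in> closure_wrt F P"
  moreover have "(\<chi> j. distr_of (f j)) \<in> Ker F P"
  proof -
    have "system_fun m f = (\<lambda>_. 0)" if "m \<in> P" for m using assms(3)[OF that] by (rule ext)
    moreover have "distr_of (\<lambda>_. 0) = (\<lambda>_. 0 :: complex)" by (auto simp: distr_of_def)
    ultimately show ?thesis using assms(1,2) by (auto simp: Ker_def system_apply_distr_of)
  qed
  ultimately have "distr_of (system_fun p f) = (\<lambda>_. 0)"
    unfolding closure_wrt_def using system_apply_distr_of[of f p, OF assms(1)] by auto
  moreover have "smooth (system_fun p f)"
    unfolding system_fun_def by (intro smooth_sum smooth_pdo_fun assms)
  ultimately show False using distr_of_eq_0 assms(4) by blast
qed

subsection \<open>Exponential polynomial solutions\<close>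

text \<open>The powers of \<i> and the factorials are chosen so that \<open>D_fun\<close> lowers an
  exponent by 1 without any constant.\<close>

definition exp_monomial :: "('n::finite \<Rightarrow> nat) \<Rightarrow> real^'n \<Rightarrow> complex" where
  "exp_monomial \<alpha> x = (\<Prod>i\<in>UNIV. (\<i> * of_real (x $ i)) ^ \<alpha> i / fact (\<alpha> i))"

definition shifted_monomial :: "complex^'n::finite \<Rightarrow> ('n \<Rightarrow> nat) \<Rightarrow> 'n pdo" where
  "shifted_monomial \<xi> \<alpha> = (\<Prod>i\<in>UNIV. (pvar i - pconst (\<xi> $ i)) ^ \<alpha> i)"

definition exp_box :: "nat \<Rightarrow> ('n::finite \<Rightarrow> nat) set" where
  "exp_box s = {\<alpha>. \<forall>i. \<alpha> i < s}"

text \<open>The exponential polynomial \<open>\<mu> (e\<^bsup>i x \<cdot> y\<^esup>)\<close>, where the exponential is expanded in powers of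
  \<open>y - \<xi>\<close> and \<open>\<mu>\<close> is a functional on polynomials in \<open>y\<close> that vanishes on the ideal generated by the
  \<open>s\<close>-th powers of the \<open>y\<^sub>i - \<xi>\<^sub>i\<close>.\<close>

definition exp_poly :: "complex^'n::finite \<Rightarrow> nat \<Rightarrow> ('n pdo \<Rightarrow> complex) \<Rightarrow> real^'n \<Rightarrow> complex" where
  "exp_poly \<xi> s \<mu> x = (\<Sum>\<alpha>\<in>exp_box s. \<mu> (shifted_monomial \<xi> \<alpha>) * (exp_monomial \<alpha> x * cis_dot x \<xi>))"

definition local_functional :: "complex^'n::finite \<Rightarrow> nat \<Rightarrow> ('n pdo \<Rightarrow> complex) \<Rightarrow> bool" where
  "local_functional \<xi> s \<mu> \<longleftrightarrow> (\<forall>a b. \<mu> (a + b) = \<mu> a + \<mu> b) \<and> (\<forall>c a. \<mu> (pconst c * a) = c * \<mu> a) \<and>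
     (\<forall>i a. \<mu> ((pvar i - pconst (\<xi> $ i)) ^ s * a) = 0)"

lemma local_functional_mult:
  assumes "local_functional \<xi> s \<mu>" shows "local_functional \<xi> s (\<lambda>a. \<mu> (q * a))"
proof -
  have "\<mu> (q * (pconst c * a)) = c * \<mu> (q * a)" for c a
    using assms by (simp add: local_functional_def mult.left_commute[of q])
  moreover have "\<mu> (q * ((pvar i - pconst (\<xi> $ i)) ^ s * a)) = 0" for i a
    using assms by (simp add: local_functional_def mult.left_commute[of q])
  ultimately show ?thesis using assms by (simp add: local_functional_def distrib_left)
qed

lemma finite_exp_box: "finite (exp_box s :: ('n::finite \<Rightarrow> nat) set)"
proof -
  have "exp_box s = (PiE UNIV (\<lambda>_. {..<s}) :: ('n \<Rightarrow> nat) set)" by (auto simp: exp_box_def PiE_def)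
  then show ?thesis by (simp add: finite_PiE)
qed

lemma smooth_exp_factor: "smooth (\<lambda>x. (\<i> * of_real (x $ i)) ^ n / fact n)"
  using smooth_mult[OF smooth_power[OF smooth_mult[OF smooth_const smooth_coord], of \<i> i n] smooth_const[of "1 / fact n"]]
  by simp

lemma smooth_exp_monomial: "smooth (exp_monomial \<alpha>)"
  unfolding exp_monomial_def[abs_def] by (intro smooth_prod smooth_exp_factor)

lemma D_fun_exp_factor:
  "D_fun l (\<lambda>x. (\<i> * of_real (x $ i)) ^ n / fact n) =
    (\<lambda>x. if i = l \<and> n > 0 then (\<i> * of_real (x $ i)) ^ (n - 1) / fact (n - 1) else 0)"
proof
  fix x
  have "((\<lambda>x. (\<i> * of_real (x $ i)) ^ n / fact n) has_derivative
      (\<lambda>h. (of_nat n * (\<i> * of_real (h $ i)) * (\<i> * of_real (x $ i)) ^ (n - 1)) / fact n)) (at x)"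
    using has_derivative_mult_left[OF has_derivative_power[OF has_derivative_mult_right[OF has_derivative_coord[of i x], of \<i>], of n], of "1 / fact n"]
    by (simp add: mult_ac)
  from D_fun_eq[OF this, of l]
  show "D_fun l (\<lambda>x. (\<i> * of_real (x $ i)) ^ n / fact n) x =
      (if i = l \<and> n > 0 then (\<i> * of_real (x $ i)) ^ (n - 1) / fact (n - 1) else 0)"
    by (cases n) (simp_all add: axis_def del: of_nat_Suc)
qed

lemma D_fun_exp_monomial:
  "D_fun l (exp_monomial \<alpha>) = (\<lambda>x. if \<alpha> l = 0 then 0 else exp_monomial (\<alpha>(l := \<alpha> l - 1)) x)"
proof
  fix x
  let ?g = "\<lambda>i n x. (\<i> * complex_of_real (x $ i)) ^ n / fact n"
  have zero: "D_fun l (\<lambda>x. \<Prod>i\<in>I. ?g i (\<alpha> i) x) = (\<lambda>x. 0)" if "l \<notin> I" for I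
    using finite[of I] that
  proof (induction I rule: finite_induct)
    case (insert i I)
    have "D_fun l (\<lambda>x. ?g i (\<alpha> i) x * (\<Prod>i\<in>I. ?g i (\<alpha> i) x)) =
        (\<lambda>x. D_fun l (?g i (\<alpha> i)) x * (\<Prod>i\<in>I. ?g i (\<alpha> i) x) + ?g i (\<alpha> i) x * D_fun l (\<lambda>x. \<Prod>i\<in>I. ?g i (\<alpha> i) x) x)"
      by (rule ext, rule D_fun_mult) (intro smooth_differentiable smooth_exp_factor smooth_prod)+
    moreover have "i \<noteq> l" using insert.prems by auto
    ultimately show ?case using insert by (simp add: D_fun_exp_factor)
  qed simp
  have split: "exp_monomial \<beta> = (\<lambda>x. ?g l (\<beta> l) x * (\<Prod>i\<in>UNIV - {l}. ?g i (\<beta> i) x))" for \<beta>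
    unfolding exp_monomial_def by (rule ext, rule prod.remove) auto
  have "D_fun l (exp_monomial \<alpha>) x = D_fun l (?g l (\<alpha> l)) x * (\<Prod>i\<in>UNIV - {l}. ?g i (\<alpha> i) x) +
      ?g l (\<alpha> l) x * D_fun l (\<lambda>x. \<Prod>i\<in>UNIV - {l}. ?g i (\<alpha> i) x) x"
    unfolding split by (rule D_fun_mult) (intro smooth_differentiable smooth_exp_factor smooth_prod)+
  also have "\<dots> = (if \<alpha> l = 0 then 0 else exp_monomial (\<alpha>(l := \<alpha> l - 1)) x)"
    unfolding split by (simp add: zero D_fun_exp_factor)
  finally show "D_fun l (exp_monomial \<alpha>) x = (if \<alpha> l = 0 then 0 else exp_monomial (\<alpha>(l := \<alpha> l - 1)) x)" .
qed

lemma smooth_exp_poly: "smooth (exp_poly \<xi> s \<mu>)"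
  unfolding exp_poly_def[abs_def] by (intro smooth_sum smooth_mult smooth_const smooth_exp_monomial smooth_cis_dot)

text \<open>Differentiating a monomial shifts the index, which amounts to multiplication by
  \<open>pvar l - pconst (\<xi> $ l)\<close> inside \<open>\<mu>\<close>; the derivative of the
  exponential supplies the missing \<open>\<xi> $ l\<close>.\<close>

lemma D_fun_exp_poly:
  assumes \<mu>: "local_functional \<xi> s \<mu>"
  shows "D_fun l (exp_poly \<xi> s \<mu>) = exp_poly \<xi> s (\<lambda>a. \<mu> (pvar l * a))"
proof
  fix x
  let ?X = "shifted_monomial \<xi>" and ?Y = "pvar l - pconst (\<xi> $ l)"
  have step: "?X (\<alpha>(l := Suc (\<alpha> l))) = ?Y * ?X \<alpha>" for \<alpha>
  proof -
    have split: "?X \<beta> = (pvar l - pconst (\<xi> $ l)) ^ \<beta> l * (\<Prod>i\<in>UNIV - {l}. (pvar i - pconst (\<xi> $ i)) ^ \<beta> i)" for \<beta>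
      unfolding shifted_monomial_def by (rule prod.remove) auto
    show ?thesis unfolding split by (simp add: mult.assoc)
  qed
  \<comment> \<open>Indices pushed over the edge of the box carry an \<open>s\<close>-th power, on
    which \<open>\<mu>\<close> is 0, so the shifted sum again runs over the whole box.\<close>
  have vanish: "\<mu> (?Y * ?X \<beta>) = 0" if "Suc (\<beta> l) = s" for \<beta>
  proof -
    have "?Y * ?X \<beta> = ?Y ^ s * (\<Prod>i\<in>UNIV - {l}. (pvar i - pconst (\<xi> $ i)) ^ \<beta> i)"
      unfolding shifted_monomial_def that[symmetric] by (subst prod.remove[of UNIV l]) (auto simp: mult.assoc)
    then show ?thesis using \<mu> by (simp add: local_functional_def)
  qed
  have "(\<Sum>\<alpha>\<in>exp_box s. \<mu> (?X \<alpha>) * D_fun l (exp_monomial \<alpha>) x) =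
      (\<Sum>\<alpha>\<in>{\<alpha>\<in>exp_box s. \<alpha> l > 0}. \<mu> (?X \<alpha>) * exp_monomial (\<alpha>(l := \<alpha> l - 1)) x)"
    by (intro sum.mono_neutral_cong_right finite_exp_box) (auto simp: D_fun_exp_monomial)
  \<comment> \<open>Lowering the exponent at \<open>l\<close> is a bijection onto the indices that
    can still be raised within the box.\<close>
  also have "\<dots> = (\<Sum>\<beta>\<in>{\<beta>\<in>exp_box s. Suc (\<beta> l) < s}. \<mu> (?Y * ?X \<beta>) * exp_monomial \<beta> x)"
    by (rule sum.reindex_bij_witness[of _ "\<lambda>\<beta>. \<beta>(l := Suc (\<beta> l))" "\<lambda>\<alpha>. \<alpha>(l := \<alpha> l - 1)"])
       (auto simp: exp_box_def step[symmetric] less_imp_diff_less)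
  also have "\<dots> = (\<Sum>\<beta>\<in>exp_box s. \<mu> (?Y * ?X \<beta>) * exp_monomial \<beta> x)"
    by (intro sum.mono_neutral_left finite_exp_box) (auto simp: exp_box_def intro!: vanish Suc_lessI)
  finally have key: "(\<Sum>\<alpha>\<in>exp_box s. \<mu> (?X \<alpha>) * D_fun l (exp_monomial \<alpha>) x) =
      (\<Sum>\<beta>\<in>exp_box s. \<mu> (?Y * ?X \<beta>) * exp_monomial \<beta> x)" .
  have "D_fun l (exp_poly \<xi> s \<mu>) x = (\<Sum>\<alpha>\<in>exp_box s. \<mu> (?X \<alpha>) * D_fun l (\<lambda>x. exp_monomial \<alpha> x * cis_dot x \<xi>) x)"
    using foldr_D_fun_sum[of "exp_box s" "\<lambda>\<alpha> x. exp_monomial \<alpha> x * cis_dot x \<xi>" "[l]" "\<lambda>\<alpha>. \<mu> (?X \<alpha>)"]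
    by (simp add: exp_poly_def[abs_def] smooth_mult smooth_exp_monomial)
  also have "\<dots> = (\<Sum>\<alpha>\<in>exp_box s. (\<mu> (?X \<alpha>) * D_fun l (exp_monomial \<alpha>) x) * cis_dot x \<xi> +
      \<xi> $ l * (\<mu> (?X \<alpha>) * exp_monomial \<alpha> x) * cis_dot x \<xi>)"
    by (intro sum.cong refl, subst D_fun_mult)
       (auto simp: smooth_differentiable smooth_exp_monomial D_fun_cis_dot distrib_left mult_ac)
  also have "\<dots> = (\<Sum>\<beta>\<in>exp_box s. \<mu> (?Y * ?X \<beta>) * exp_monomial \<beta> x) * cis_dot x \<xi> +
      (\<Sum>\<beta>\<in>exp_box s. \<xi> $ l * (\<mu> (?X \<beta>) * exp_monomial \<beta> x)) * cis_dot x \<xi>"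
    unfolding sum.distrib sum_distrib_right[symmetric] key ..
  also have "\<dots> = (\<Sum>\<beta>\<in>exp_box s. (\<mu> (?Y * ?X \<beta>) + \<xi> $ l * \<mu> (?X \<beta>)) * (exp_monomial \<beta> x * cis_dot x \<xi>))"
    unfolding sum_distrib_right sum.distrib[symmetric] by (intro sum.cong) (auto simp: algebra_simps)
  also have "\<dots> = exp_poly \<xi> s (\<lambda>a. \<mu> (pvar l * a)) x"
    unfolding exp_poly_def
  proof (intro sum.cong refl)
    fix \<beta>
    have "\<mu> (pvar l * ?X \<beta>) = \<mu> (?Y * ?X \<beta> + pconst (\<xi> $ l) * ?X \<beta>)" by (simp add: algebra_simps)
    also have "\<dots> = \<mu> (?Y * ?X \<beta>) + \<xi> $ l * \<mu> (?X \<beta>)" using \<mu> by (simp add: local_functional_def)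
    finally show "(\<mu> (?Y * ?X \<beta>) + \<xi> $ l * \<mu> (?X \<beta>)) * (exp_monomial \<beta> x * cis_dot x \<xi>) =
        \<mu> (pvar l * ?X \<beta>) * (exp_monomial \<beta> x * cis_dot x \<xi>)" by simp
  qed
  finally show "D_fun l (exp_poly \<xi> s \<mu>) x = exp_poly \<xi> s (\<lambda>a. \<mu> (pvar l * a)) x" .
qed

lemma pdo_fun_exp_poly:
  assumes "local_functional \<xi> s \<mu>"
  shows "pdo_fun q (exp_poly \<xi> s \<mu>) = exp_poly \<xi> s (\<lambda>a. \<mu> (q * a))"
  using assms
proof (induction q arbitrary: \<mu> rule: pdo_induct)
  case (const c)
  then show ?case
    by (simp add: pdo_fun_pconst exp_poly_def[abs_def] local_functional_def sum_distrib_left mult.assoc)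
next
  case (var i) then show ?case by (simp add: pdo_fun_pvar smooth_exp_poly D_fun_exp_poly)
next
  case (add p q)
  have "pdo_fun (p + q) (exp_poly \<xi> s \<mu>) x = exp_poly \<xi> s (\<lambda>a. \<mu> (p * a)) x + exp_poly \<xi> s (\<lambda>a. \<mu> (q * a)) x" for x
    using add by (simp add: pdo_fun_add)
  also have "\<dots> x = exp_poly \<xi> s (\<lambda>a. \<mu> ((p + q) * a)) x" for x
    using add.prems by (simp add: exp_poly_def local_functional_def distrib_right sum.distrib)
  finally show ?case by (rule ext)
next
  case (mult p q)
  then show ?case
    by (simp add: pdo_fun_mult smooth_exp_poly local_functional_mult mult.left_commute[of q p] mult.assoc)
qed

lemma exp_poly_0:
  fixes \<xi> :: "complex^'n::finite"
  assumes "s > 0" shows "exp_poly \<xi> s \<mu> 0 = \<mu> 1"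
proof -
  have e: "exp_monomial \<alpha> 0 = (if \<alpha> = (\<lambda>_. 0) then 1 else 0)" for \<alpha> :: "'n \<Rightarrow> nat"
  proof (cases "\<alpha> = (\<lambda>_. 0)")
    case False
    then obtain i where "\<alpha> i \<noteq> 0" by auto
    then have "\<exists>i. (\<i> * complex_of_real ((0::real^'n) $ i)) ^ \<alpha> i / fact (\<alpha> i) = 0" by (intro exI[of _ i]) simp
    with False show ?thesis by (simp add: exp_monomial_def prod_zero_iff)
  qed (simp add: exp_monomial_def)
  have "exp_poly \<xi> s \<mu> 0 = (\<Sum>\<alpha>\<in>(exp_box s :: ('n \<Rightarrow> nat) set). if \<alpha> = (\<lambda>_. 0) then \<mu> (shifted_monomial \<xi> (\<lambda>_. 0)) else 0)"
    unfolding exp_poly_def by (intro sum.cong) (auto simp: e cis_dot_def)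
  also have "\<dots> = \<mu> 1"
    using assms by (subst sum.delta[OF finite_exp_box]) (simp add: exp_box_def shifted_monomial_def)
  finally show ?thesis .
qed

text \<open>With \<open>\<mu> j a = \<phi> (a *s axis j 1)\<close>, a row \<open>m\<close> turns the
  functionals into the one sending \<open>a\<close> to \<open>\<phi> (a *s m)\<close>. This is 0 for
  \<open>m\<close> in \<open>P\<close>, and for \<open>p\<close> the value at the origin is
  \<open>\<phi> p\<close>.\<close>

lemma exp_poly_solution:
  fixes P :: "(('n::finite pdo)^'k::finite) set"
  assumes P: "submodule P" and van: "\<And>a. a *s p \<in> P \<Longrightarrow> poly_eval a \<xi> = 0"
  obtains s \<mu> where "\<And>m y. m \<in> P \<Longrightarrow> system_fun m (\<lambda>j. exp_poly \<xi> s (\<mu> j)) y = 0"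
    "system_fun p (\<lambda>j. exp_poly \<xi> s (\<mu> j)) 0 \<noteq> 0"
proof -
  obtain L s where L: "submodule L" "P \<subseteq> L" "p \<notin> L" "\<And>i v. (pvar i - pconst (\<xi> $ i)) ^ s *s v \<in> L"
    using krull_separation[OF P van] by metis
  \<comment> \<open>The exponent 0 would put \<open>p\<close> itself into \<open>L\<close>; a
    positive one makes the box contain the zero index.\<close>
  have s: "s > 0"
  proof (rule ccontr)
    assume "\<not> s > 0"
    then have "p \<in> L" using L(4)[of undefined p] by simp
    with L(3) show False by blast
  qed
  obtain \<phi> :: "('n pdo)^'k \<Rightarrow> complex" where \<phi>: "\<And>x y. \<phi> (x + y) = \<phi> x + \<phi> y" "\<And>c x. \<phi> (pconst c *s x) = c * \<phi> x"
    "\<And>x. x \<in> L \<Longrightarrow> \<phi> x = 0" "\<phi> p \<noteq> 0"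
    using separating_functional[OF L(1,3)] by metis
  define \<mu> where "\<mu> j a = \<phi> (a *s axis j 1)" for j a
  have lf: "local_functional \<xi> s (\<mu> j)" for j
    unfolding local_functional_def \<mu>_def
  proof (intro conjI allI)
    show "\<phi> ((a + b) *s axis j 1) = \<phi> (a *s axis j 1) + \<phi> (b *s axis j 1)" for a b
      by (simp add: vector_sadd_rdistrib \<phi>(1))
    show "\<phi> ((pconst c * a) *s axis j 1) = c * \<phi> (a *s axis j 1)" for c a
      by (simp add: \<phi>(2) flip: vector_smult_assoc)
    show "\<phi> (((pvar i - pconst (\<xi> $ i)) ^ s * a) *s axis j 1) = 0" for i a
      using \<phi>(3)[OF L(4)] by (simp flip: vector_smult_assoc)
  qed
  have \<phi>0: "\<phi> 0 = 0" using \<phi>(3) submoduleD(1)[OF L(1)] by blast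
  have \<phi>_sum: "\<phi> (\<Sum>j\<in>I. f j) = (\<Sum>j\<in>I. \<phi> (f j))" for I and f :: "'k \<Rightarrow> ('n pdo)^'k"
    by (induction I rule: infinite_finite_induct) (auto simp: \<phi>(1) \<phi>0)
  have sys: "system_fun m (\<lambda>j. exp_poly \<xi> s (\<mu> j)) = exp_poly \<xi> s (\<lambda>a. \<phi> (a *s m))" for m
  proof
    fix y
    have expand: "a *s m = (\<Sum>j\<in>UNIV. (m $ j * a) *s axis j 1)" for a
      using basis_expansion[of "a *s m"] by (simp add: mult.commute)
    have "system_fun m (\<lambda>j. exp_poly \<xi> s (\<mu> j)) y = (\<Sum>j\<in>UNIV. exp_poly \<xi> s (\<lambda>a. \<mu> j (m $ j * a)) y)"
      unfolding system_fun_def pdo_fun_exp_poly[OF lf] ..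
    also have "\<dots> = exp_poly \<xi> s (\<lambda>a. \<phi> (a *s m)) y"
      unfolding exp_poly_def expand \<phi>_sum \<mu>_def sum_distrib_right by (rule sum.swap)
    finally show "system_fun m (\<lambda>j. exp_poly \<xi> s (\<mu> j)) y = exp_poly \<xi> s (\<lambda>a. \<phi> (a *s m)) y" .
  qed
  show ?thesis
  proof (rule that[of s \<mu>])
    fix m y assume "m \<in> P"
    then have "\<phi> (a *s m) = 0" for a using \<phi>(3) L(1,2) submoduleD(3) by blast
    then show "system_fun m (\<lambda>j. exp_poly \<xi> s (\<mu> j)) y = 0" unfolding sys by (simp add: exp_poly_def)
  next
    show "system_fun p (\<lambda>j. exp_poly \<xi> s (\<mu> j)) 0 \<noteq> 0"
      unfolding sys exp_poly_0[OF s] using \<phi>(4) by simp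
  qed
qed

lemma closure_wrt_lower:
  fixes P :: "(('n::finite pdo)^'k::finite) set"
  assumes "submodule P" "p \<in> closure_wrt F P" "\<And>s \<mu>. distr_of (exp_poly \<xi> s \<mu>) \<in> F"
  shows "\<exists>a. a *s p \<in> P \<and> poly_eval a \<xi> \<noteq> 0"
proof (rule ccontr)
  assume "\<not> ?thesis"
  then have van: "poly_eval a \<xi> = 0" if "a *s p \<in> P" for a using that by blast
  obtain s and \<mu> :: "'k \<Rightarrow> 'n pdo \<Rightarrow> complex" where
    "\<And>m y. m \<in> P \<Longrightarrow> system_fun m (\<lambda>j. exp_poly \<xi> s (\<mu> j)) y = 0"
    "system_fun p (\<lambda>j. exp_poly \<xi> s (\<mu> j)) 0 \<noteq> 0"
    using exp_poly_solution[OF assms(1) van] by metis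
  then have "p \<notin> closure_wrt F P"
    using assms(3) by (intro not_in_closureI[of "\<lambda>j. exp_poly \<xi> s (\<mu> j)"]) (auto simp: smooth_exp_poly)
  with assms(2) show False by blast
qed

lemma subset_closure_wrt: "P \<subseteq> closure_wrt F P"
  by (auto simp: closure_wrt_def Ker_def)

text \<open>When all complex frequencies are admissible, the point provided by
  \<open>nullstellensatz\<close> can always be used.\<close>

lemma closed_wrt_if_exp_poly:
  fixes P :: "(('n::finite pdo)^'k::finite) set"
  assumes "submodule P" "\<And>\<xi> s \<mu>. distr_of (exp_poly \<xi> s \<mu>) \<in> F"
  shows "closed_wrt F P"
proof -
  have "p \<in> P" if p: "p \<in> closure_wrt F P" for p
  proof (rule ccontr)
    assume "p \<notin> P"
    then obtain \<xi> where "\<And>a. a *s p \<in> P \<Longrightarrow> poly_eval a \<xi> = 0" using nullstellensatz[OF assms(1)] by blast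
    with closure_wrt_lower[OF assms(1) p assms(2)] show False by blast
  qed
  then show ?thesis using subset_closure_wrt[of P F] by (auto simp: closed_wrt_def)
qed

subsection \<open>Tempered distributions\<close>

lemma monomial_fun_0 [simp]: "monomial_fun 0 x = 1"
  by (simp add: monomial_fun_def)

lemma monomial_fun_add_single: "monomial_fun (\<beta> + Poly_Mapping.single i 1) x = monomial_fun \<beta> x * x $ i"
proof -
  have "(\<Prod>j\<in>UNIV. x $ j ^ Poly_Mapping.lookup (Poly_Mapping.single i 1) j) = (\<Prod>j\<in>UNIV. if j = i then x $ i else 1)"
    by (intro prod.cong) (auto simp: lookup_single when_def)
  then show ?thesis by (simp add: monomial_fun_def lookup_add power_add prod.distrib)
qed

lemma mdeg_add_single: "mdeg (\<beta> + Poly_Mapping.single i 1) = Suc (mdeg \<beta>)"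
  by (simp add: mdeg_def lookup_add sum.distrib lookup_single when_def)

text \<open>Each factor \<open>1 + norm x\<close> is replaced by 1 plus the sum of the moduli of the
  coordinates, which raises the degree of the monomials by one and costs the factor 1 plus the
  number of variables.\<close>

lemma weight_le_monomials:
  fixes g :: "real^'n::finite \<Rightarrow> complex"
  assumes "\<And>\<beta> x. mdeg \<beta> \<le> K \<Longrightarrow> norm (of_real (monomial_fun \<beta> x) * g x) \<le> B"
  shows "norm (g x) * (1 + norm x) ^ K \<le> (1 + real CARD('n)) ^ K * B"
  using assms
proof (induction K arbitrary: g)
  case 0
  show ?case using 0[of 0 x] by (simp add: mdeg_def)
next
  case (Suc K)
  have 1: "norm (g x) * (1 + norm x) ^ K \<le> (1 + real CARD('n)) ^ K * B"
    by (rule Suc.IH) (use Suc.prems in auto)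
  have 2: "norm (of_real (x $ i) * g x) * (1 + norm x) ^ K \<le> (1 + real CARD('n)) ^ K * B" for i
  proof (rule Suc.IH)
    show "norm (of_real (monomial_fun \<beta> x) * (of_real (x $ i) * g x)) \<le> B" if "mdeg \<beta> \<le> K" for \<beta> x
      using Suc.prems[of "\<beta> + Poly_Mapping.single i 1" x] that unfolding mdeg_add_single monomial_fun_add_single
      by (simp add: mult.assoc)
  qed
  have "norm (g x) * (1 + norm x) ^ Suc K = norm (g x) * (1 + norm x) ^ K * (1 + norm x)" by simp
  also have "\<dots> \<le> norm (g x) * (1 + norm x) ^ K * (1 + (\<Sum>i\<in>UNIV. \<bar>x $ i\<bar>))"
    by (intro mult_left_mono add_left_mono norm_le_l1_cart) auto
  also have "\<dots> = norm (g x) * (1 + norm x) ^ K + (\<Sum>i\<in>UNIV. norm (of_real (x $ i) * g x) * (1 + norm x) ^ K)"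
    by (simp add: norm_mult distrib_left sum_distrib_left mult_ac)
  also have "\<dots> \<le> (1 + real CARD('n)) ^ K * B + (\<Sum>i\<in>(UNIV::'n set). (1 + real CARD('n)) ^ K * B)"
    by (intro add_mono sum_mono 1 2)
  also have "\<dots> = (1 + real CARD('n)) ^ Suc K * B" by (simp add: algebra_simps)
  finally show ?case .
qed

lemma schwartz_functionsD: "\<phi> \<in> schwartz_functions \<Longrightarrow> smooth \<phi>"
  by (simp add: schwartz_functions_def)

lemma schwartz_sup:
  assumes "\<phi> \<in> schwartz_functions"
  shows "norm (of_real (monomial_fun \<beta> x) * iterate_multi D_fun \<alpha> \<phi> x) \<le>
    (SUP x. norm (of_real (monomial_fun \<beta> x) * iterate_multi D_fun \<alpha> \<phi> x))"
    "0 \<le> (SUP x. norm (of_real (monomial_fun \<beta> x) * iterate_multi D_fun \<alpha> \<phi> x))"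
proof -
  have "bdd_above (range (\<lambda>x. norm (of_real (monomial_fun \<beta> x) * iterate_multi D_fun \<alpha> \<phi> x)))"
    using assms by (fastforce simp: schwartz_functions_def bounded_iff bdd_above_def)
  from cSUP_upper[OF UNIV_I this]
  show *: "norm (of_real (monomial_fun \<beta> x) * iterate_multi D_fun \<alpha> \<phi> x) \<le>
    (SUP x. norm (of_real (monomial_fun \<beta> x) * iterate_multi D_fun \<alpha> \<phi> x))" for x .
  show "0 \<le> (SUP x. norm (of_real (monomial_fun \<beta> x) * iterate_multi D_fun \<alpha> \<phi> x))"
    using order_trans[OF norm_ge_zero *[of 0]] .
qed

lemma schwartz_weight:
  fixes \<phi> :: "real^'n::finite \<Rightarrow> complex"
  assumes \<phi>: "\<phi> \<in> schwartz_functions"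
  shows "norm (\<phi> x) * (1 + norm x) ^ K \<le> (1 + real CARD('n)) ^ K * schwartz_seminorm K \<phi>"
proof (rule weight_le_monomials)
  fix \<beta> :: "'n \<Rightarrow>\<^sub>0 nat" and x assume \<beta>: "mdeg \<beta> \<le> K"
  let ?t = "\<lambda>\<alpha> \<beta>. (SUP x. norm (of_real (monomial_fun \<beta> x) * iterate_multi D_fun \<alpha> \<phi> x))"
  have "norm (of_real (monomial_fun \<beta> x) * \<phi> x) \<le> ?t 0 \<beta>" using schwartz_sup(1)[OF \<phi>, of \<beta> x 0] by simp
  also have "\<dots> \<le> (\<Sum>\<beta> | mdeg \<beta> \<le> K. ?t 0 \<beta>)"
    by (rule member_le_sum[of \<beta> _ "?t 0"]) (use \<beta> schwartz_sup(2)[OF \<phi>, where \<alpha>=0] finite_mdeg in auto)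
  also have "\<dots> \<le> schwartz_seminorm K \<phi>"
    unfolding schwartz_seminorm_def
    by (rule member_le_sum[of 0 _ "\<lambda>\<alpha>. \<Sum>\<beta> | mdeg \<beta> \<le> K. ?t \<alpha> \<beta>"])
       (use schwartz_sup(2)[OF \<phi>] finite_mdeg[of K] in \<open>auto simp: mdeg_def intro!: sum_nonneg\<close>)
  finally show "norm (of_real (monomial_fun \<beta> x) * \<phi> x) \<le> schwartz_seminorm K \<phi>" .
qed

lemma smooth_monomial_fun: "smooth (\<lambda>x. of_real (monomial_fun \<beta> x))"
  unfolding monomial_fun_def of_real_prod of_real_power by (intro smooth_prod smooth_power smooth_coord)

lemma test_subset_schwartz: "test_functions \<subseteq> schwartz_functions"
proof
  fix \<phi> :: "real^'n::finite \<Rightarrow> complex" assume \<phi>: "\<phi> \<in> test_functions"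
  have "(\<lambda>x. of_real (monomial_fun \<beta> x) * iterate_multi D_fun \<alpha> \<phi> x) \<in> test_functions" for \<alpha> \<beta>
    unfolding iterate_multi_eq by (intro test_mult test_foldr \<phi> smooth_monomial_fun)
  then have "bounded (range (\<lambda>x. of_real (monomial_fun \<beta> x) * iterate_multi D_fun \<alpha> \<phi> x))" for \<alpha> \<beta>
    using test_bounded unfolding bounded_iff by blast
  then show "\<phi> \<in> schwartz_functions"
    using test_functionsD(1)[OF \<phi>] by (simp add: schwartz_functions_def)
qed

text \<open>The Schwartz seminorm has to absorb the growth of \<open>f\<close> and still leave an
  integrable weight, hence the order \<open>k + ?N\<close>.\<close>

lemma tempered_distr_of:
  fixes f :: "real^'n::finite \<Rightarrow> complex"
  assumes cont: "continuous_on UNIV f" and bound: "\<And>x. norm (f x) \<le> C * (1 + norm x) ^ k"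
  shows "distr_of f \<in> tempered_distributions"
proof -
  let ?N = "2 * CARD('n)" and ?v = "\<lambda>\<phi>. (LINT x|lborel. f x * \<phi> x)"
  let ?D = "\<lambda>\<phi>. C * ((1 + real CARD('n)) ^ (k + ?N) * schwartz_seminorm (k + ?N) \<phi>)"
  have [measurable]: "f \<in> borel_measurable borel" by (rule borel_measurable_continuous_onI[OF cont])
  have C0: "0 \<le> C" using order_trans[OF norm_ge_zero bound[of 0]] by simp
  have bd: "norm (f x * \<phi> x) * (1 + norm x) ^ ?N \<le> ?D \<phi>" if "\<phi> \<in> schwartz_functions" for \<phi> x
  proof -
    have "norm (f x * \<phi> x) * (1 + norm x) ^ ?N \<le> (C * (1 + norm x) ^ k) * norm (\<phi> x) * (1 + norm x) ^ ?N"
      unfolding norm_mult by (intro mult_right_mono bound) auto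
    also have "\<dots> = C * (norm (\<phi> x) * (1 + norm x) ^ (k + ?N))" by (simp add: power_add mult_ac)
    also have "\<dots> \<le> ?D \<phi>" by (intro mult_left_mono schwartz_weight[OF that] C0)
    finally show ?thesis .
  qed
  have int: "integrable lborel (\<lambda>x. f x * \<phi> x)" if "\<phi> \<in> schwartz_functions" for \<phi>
  proof (rule integrable_decay[OF _ bd[OF that]])
    have [measurable]: "\<phi> \<in> borel_measurable borel" by (rule smooth_measurable[OF schwartz_functionsD[OF that]])
    show "(\<lambda>x. f x * \<phi> x) \<in> borel_measurable borel" by measurable
  qed
  have "linear_functional_on schwartz_functions ?v"
    unfolding linear_functional_on_def
    by (simp add: distrib_left int mult.left_commute[of "f _"])
  moreover have "norm (?v \<phi>) \<le> ((LINT x|lborel. 1 / (1 + norm (x::real^'n)) ^ ?N) * C * (1 + real CARD('n)) ^ (k + ?N)) * schwartz_seminorm (k + ?N) \<phi>"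
    if \<phi>: "\<phi> \<in> schwartz_functions" for \<phi>
  proof -
    have "norm (?v \<phi>) \<le> (LINT x|lborel. ?D \<phi> * (1 / (1 + norm (x::real^'n)) ^ ?N))"
    proof (rule Bochner_Integration.integral_norm_bound_integral[OF int[OF \<phi>]])
      show "integrable lborel (\<lambda>x::real^'n. ?D \<phi> * (1 / (1 + norm x) ^ ?N))"
        by (intro integrable_mult_right integrable_weight)
      fix x :: "real^'n"
      have "norm (f x * \<phi> x) \<le> ?D \<phi> / (1 + norm x) ^ ?N"
        using bd[OF \<phi>, of x] by (subst pos_le_divide_eq) (auto intro!: zero_less_power add_pos_nonneg)
      then show "norm (f x * \<phi> x) \<le> ?D \<phi> * (1 / (1 + norm x) ^ ?N)" by simp
    qed
    also have "\<dots> = ?D \<phi> * (LINT x|lborel. 1 / (1 + norm (x::real^'n)) ^ ?N)"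
      by (rule integral_mult_right_zero)
    finally show ?thesis by (simp only: mult_ac)
  qed
  moreover have "distr_of f \<phi> = ?v \<phi>" if "\<phi> \<in> test_functions" for \<phi> using that by (simp add: distr_of_def)
  ultimately show ?thesis
    unfolding tempered_distributions_def using distr_of_distribution[OF cont] by blast
qed

lemma monomial_fun_le: "\<bar>monomial_fun \<beta> x\<bar> \<le> (1 + norm x) ^ mdeg \<beta>"
proof -
  have "\<bar>monomial_fun \<beta> x\<bar> = (\<Prod>i\<in>UNIV. \<bar>x $ i\<bar> ^ Poly_Mapping.lookup \<beta> i)"
    by (simp add: monomial_fun_def abs_prod power_abs)
  also have "\<dots> \<le> (\<Prod>i\<in>UNIV. (1 + norm x) ^ Poly_Mapping.lookup \<beta> i)"
    by (intro prod_mono conjI power_mono) (auto intro: order_trans[OF component_le_norm_cart])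
  also have "\<dots> = (1 + norm x) ^ mdeg \<beta>" by (simp add: mdeg_def power_sum)
  finally show ?thesis .
qed

text \<open>The Schwartz seminorm of order \<open>N\<close> of a translate grows at most like
  \<open>(1 + norm y) ^ N\<close>, because moving a monomial weight costs that factor.\<close>

lemma tempered_reg_bound:
  fixes u :: "'n::finite distr"
  assumes u: "u \<in> tempered_distributions" and \<phi>: "\<phi> \<in> test_functions"
  shows "\<exists>C k. \<forall>y. norm (reg u \<phi> y) \<le> C * (1 + norm y) ^ k"
proof -
  obtain v C N where v: "\<And>\<phi>. \<phi> \<in> schwartz_functions \<Longrightarrow> norm (v \<phi>) \<le> C * schwartz_seminorm N \<phi>"
    "\<And>\<phi>. \<phi> \<in> test_functions \<Longrightarrow> u \<phi> = v \<phi>"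
  proof -
    from u obtain v where "\<exists>C N. \<forall>\<phi>\<in>schwartz_functions. norm (v \<phi>) \<le> C * schwartz_seminorm N \<phi>"
      "\<forall>\<phi>\<in>test_functions. u \<phi> = v \<phi>"
      by (auto simp only: tempered_distributions_def mem_Collect_eq)
    then show ?thesis using that by metis
  qed
  have "\<forall>\<alpha>. \<exists>B. \<forall>x. norm (iterate_multi D_fun \<alpha> \<phi> x) * (1 + norm x) ^ N \<le> B"
    using test_rapid[OF \<phi>] unfolding rapid_def iterate_multi_eq by blast
  from choice[OF this] obtain B where B: "\<forall>\<alpha> x. norm (iterate_multi D_fun \<alpha> \<phi> x) * (1 + norm x) ^ N \<le> B \<alpha>" by blast
  define S where "S = (\<Sum>\<alpha> | mdeg (\<alpha>::'n \<Rightarrow>\<^sub>0 nat) \<le> N. \<Sum>\<beta> | mdeg (\<beta>::'n \<Rightarrow>\<^sub>0 nat) \<le> N. B \<alpha>)"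
  have "norm (reg u \<phi> y) \<le> (\<bar>C\<bar> * S) * (1 + norm y) ^ N" for y
  proof -
    have t: "(\<lambda>x. \<phi> (x - y)) \<in> test_functions" by (rule test_translate[OF \<phi>])
    then have sc: "(\<lambda>x. \<phi> (x - y)) \<in> schwartz_functions" using test_subset_schwartz by blast
    have it: "iterate_multi D_fun \<alpha> (\<lambda>x. \<phi> (x - y)) = (\<lambda>x. iterate_multi D_fun \<alpha> \<phi> (x - y))" for \<alpha>
      using foldr_D_fun_shift[OF test_functionsD(1)[OF \<phi>], of _ "- y"] by (simp add: iterate_multi_eq)
    have "schwartz_seminorm N (\<lambda>x. \<phi> (x - y)) \<le>
        (\<Sum>\<alpha> | mdeg (\<alpha>::'n \<Rightarrow>\<^sub>0 nat) \<le> N. \<Sum>\<beta> | mdeg (\<beta>::'n \<Rightarrow>\<^sub>0 nat) \<le> N. B \<alpha> * (1 + norm y) ^ N)"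
      unfolding schwartz_seminorm_def it
    proof (intro sum_mono cSUP_least)
      fix \<alpha> \<beta> :: "'n \<Rightarrow>\<^sub>0 nat" and x assume "\<beta> \<in> {\<beta>. mdeg \<beta> \<le> N}"
      then have "\<bar>monomial_fun \<beta> x\<bar> \<le> (1 + norm x) ^ N"
        using monomial_fun_le[of \<beta> x] power_increasing[of "mdeg \<beta>" N "1 + norm x"] by auto
      also have "\<dots> \<le> (1 + norm (x - y)) ^ N * (1 + norm y) ^ N"
        using weight_shift_power[of x N "- y"] by simp
      finally have "norm (of_real (monomial_fun \<beta> x) * iterate_multi D_fun \<alpha> \<phi> (x - y)) \<le>
          ((1 + norm (x - y)) ^ N * (1 + norm y) ^ N) * norm (iterate_multi D_fun \<alpha> \<phi> (x - y))"
        by (simp add: norm_mult mult_right_mono)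
      also have "\<dots> = (norm (iterate_multi D_fun \<alpha> \<phi> (x - y)) * (1 + norm (x - y)) ^ N) * (1 + norm y) ^ N" by (simp add: mult_ac)
      also have "\<dots> \<le> B \<alpha> * (1 + norm y) ^ N" using B by (intro mult_right_mono) auto
      finally show "norm (of_real (monomial_fun \<beta> x) * iterate_multi D_fun \<alpha> \<phi> (x - y)) \<le> B \<alpha> * (1 + norm y) ^ N" .
    qed simp
    also have "\<dots> = S * (1 + norm y) ^ N" by (simp only: S_def sum_distrib_right)
    finally have "\<bar>C\<bar> * schwartz_seminorm N (\<lambda>x. \<phi> (x - y)) \<le> \<bar>C\<bar> * (S * (1 + norm y) ^ N)"
      by (intro mult_left_mono) auto
    moreover have "0 \<le> schwartz_seminorm N (\<lambda>x. \<phi> (x - y))"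
      unfolding schwartz_seminorm_def by (intro sum_nonneg schwartz_sup(2)[OF sc])
    then have "C * schwartz_seminorm N (\<lambda>x. \<phi> (x - y)) \<le> \<bar>C\<bar> * schwartz_seminorm N (\<lambda>x. \<phi> (x - y))"
      by (intro mult_right_mono) auto
    ultimately show ?thesis using v(1)[OF sc] v(2)[OF t] by (simp add: reg_def mult.assoc)
  qed
  then show ?thesis by blast
qed

lemma exp_monomial_bound: "norm (exp_monomial \<alpha> x) \<le> (1 + norm x) ^ (\<Sum>i\<in>UNIV. \<alpha> i)"
proof -
  have "norm (exp_monomial \<alpha> x) = (\<Prod>i\<in>UNIV. \<bar>x $ i\<bar> ^ \<alpha> i / fact (\<alpha> i))"
    by (simp add: exp_monomial_def prod_norm[symmetric] norm_divide norm_power norm_mult)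
  also have "\<dots> \<le> (\<Prod>i\<in>UNIV. (1 + norm x) ^ \<alpha> i)"
  proof (intro prod_mono conjI)
    fix i
    have "\<bar>x $ i\<bar> ^ \<alpha> i / fact (\<alpha> i) \<le> \<bar>x $ i\<bar> ^ \<alpha> i / 1"
      by (intro divide_left_mono) (auto simp: fact_ge_1)
    also have "\<dots> \<le> (1 + norm x) ^ \<alpha> i"
      by (simp, intro power_mono) (auto intro: order_trans[OF component_le_norm_cart])
    finally show "\<bar>x $ i\<bar> ^ \<alpha> i / fact (\<alpha> i) \<le> (1 + norm x) ^ \<alpha> i" .
  qed auto
  also have "\<dots> = (1 + norm x) ^ (\<Sum>i\<in>UNIV. \<alpha> i)" by (simp add: power_sum)
  finally show ?thesis .
qed

lemma norm_cis_dot_real: "\<xi> \<in> real_points \<Longrightarrow> norm (cis_dot x \<xi>) = 1"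
proof -
  assume "\<xi> \<in> real_points"
  then have "\<xi> $ j = of_real (Re (\<xi> $ j))" for j by (simp add: real_points_def complex_is_Real_iff complex_eq_iff)
  then have "(\<Sum>j\<in>UNIV. of_real (x $ j) * \<xi> $ j) = of_real (\<Sum>j\<in>UNIV. x $ j * Re (\<xi> $ j))"
    by (metis (no_types, lifting) of_real_mult of_real_sum sum.cong)
  then show ?thesis unfolding cis_dot_def by (simp only: norm_exp_i_times)
qed

lemma exp_poly_tempered:
  fixes \<xi> :: "complex^'n::finite"
  assumes "\<xi> \<in> real_points"
  shows "distr_of (exp_poly \<xi> s \<mu>) \<in> tempered_distributions"
proof (rule tempered_distr_of[OF smooth_continuous_on[OF smooth_exp_poly]])
  \<comment> \<open>A crude common bound for the degrees in the box.\<close>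
  let ?k = "\<Sum>\<alpha>\<in>exp_box s. \<Sum>i\<in>(UNIV::'n set). \<alpha> i"
  fix x
  have "norm (exp_poly \<xi> s \<mu> x) \<le> (\<Sum>\<alpha>\<in>exp_box s. norm (\<mu> (shifted_monomial \<xi> \<alpha>)) * (1 + norm x) ^ ?k)"
    unfolding exp_poly_def
  proof (rule order_trans[OF norm_sum sum_mono])
    fix \<alpha> :: "'n \<Rightarrow> nat" assume "\<alpha> \<in> exp_box s"
    then have "(\<Sum>i\<in>UNIV. \<alpha> i) \<le> ?k"
      by (intro member_le_sum[of \<alpha> "exp_box s" "\<lambda>\<alpha>. \<Sum>i\<in>UNIV. \<alpha> i"] finite_exp_box) auto
    then have "norm (exp_monomial \<alpha> x) \<le> (1 + norm x) ^ ?k"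
      using exp_monomial_bound[of \<alpha> x] power_increasing[of "\<Sum>i\<in>UNIV. \<alpha> i" ?k "1 + norm x"] by auto
    then show "norm (\<mu> (shifted_monomial \<xi> \<alpha>) * (exp_monomial \<alpha> x * cis_dot x \<xi>)) \<le>
        norm (\<mu> (shifted_monomial \<xi> \<alpha>)) * (1 + norm x) ^ ?k"
      by (simp add: norm_mult norm_cis_dot_real[OF assms] mult_left_mono)
  qed
  then show "norm (exp_poly \<xi> s \<mu> x) \<le> (\<Sum>\<alpha>\<in>exp_box s. norm (\<mu> (shifted_monomial \<xi> \<alpha>))) * (1 + norm x) ^ ?k"
    by (simp add: sum_distrib_right)
qed

lemma closure_wrt_tempered:
  fixes P :: "(('n::finite pdo)^'k::finite) set"
  assumes "submodule P"
  shows "p \<in> closure_wrt tempered_distributions P \<longleftrightarrow> (\<forall>\<xi>\<in>real_points. \<exists>a. a *s p \<in> P \<and> poly_eval a \<xi> \<noteq> 0)"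
proof
  assume "p \<in> closure_wrt tempered_distributions P"
  then show "\<forall>\<xi>\<in>real_points. \<exists>a. a *s p \<in> P \<and> poly_eval a \<xi> \<noteq> 0"
    using closure_wrt_lower[OF assms] exp_poly_tempered by metis
next
  assume *: "\<forall>\<xi>\<in>real_points. \<exists>a. a *s p \<in> P \<and> poly_eval a \<xi> \<noteq> 0"
  show "p \<in> closure_wrt tempered_distributions P"
  proof (rule closure_wrtI)
    show sub: "tempered_distributions \<subseteq> (distributions :: 'n distr set)" by (auto simp: tempered_distributions_def)
    fix f :: "('n distr)^'k" and \<phi>
    assume f: "\<And>j. f $ j \<in> tempered_distributions" and \<phi>: "\<phi> \<in> test_functions"
      and P: "\<And>m y. m \<in> P \<Longrightarrow> system_fun m (\<lambda>j. reg (f $ j) \<phi>) y = 0"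
    show "system_fun p (\<lambda>j. reg (f $ j) \<phi>) 0 = 0"
    \<comment> \<open>By hypothesis the symbols from (P : p) alone have no common real zero, so
      \<open>M\<close> is empty.\<close>
    proof (rule system_fun_zero_if_multipliers[where M="{}", OF _ P])
      show "slow (reg (f $ j) \<phi>)" for j
        using f sub \<phi> by (intro slow_reg tempered_reg_bound) auto
      fix \<xi> :: "real^'n"
      have "(\<chi> i. of_real (\<xi> $ i)) \<in> real_points" by (simp add: real_points_def)
      with * show "(\<exists>a. a *s p \<in> P \<and> symb a \<xi> \<noteq> 0) \<or> (\<exists>m\<in>{}. m \<xi> \<noteq> 0)"
        by (auto simp: symb_def)
    qed auto
  qed
qed

subsection \<open>Polynomials with periodic coefficients\<close>

lemma diff_shift_pow_0: "(diff_shift v ^^ d) (\<lambda>_. 0) = (\<lambda>_. 0)"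
  by (induction d) (auto simp: diff_shift_def)

lemma diff_shift_pow_mono:
  assumes "(diff_shift v ^^ d) f = (\<lambda>_. 0)" "d \<le> e"
  shows "(diff_shift v ^^ e) f = (\<lambda>_. 0)"
proof -
  have "(diff_shift v ^^ ((e - d) + d)) f = (\<lambda>_. 0)"
    unfolding funpow_add comp_apply assms(1) by (rule diff_shift_pow_0)
  with assms(2) show ?thesis by simp
qed

lemma diff_shift_pow_add:
  "(diff_shift v ^^ d) (\<lambda>x. f x + g x) = (\<lambda>x. (diff_shift v ^^ d) f x + (diff_shift v ^^ d) g x)"
  by (induction d) (auto simp: diff_shift_def)

lemma diff_shift_pow_shift:
  "(diff_shift v ^^ d) (\<lambda>x. f (x + w)) = (\<lambda>x. (diff_shift v ^^ d) f (x + w))"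
  by (induction d) (auto simp: diff_shift_def ac_simps)

text \<open>Induction on \<open>a + b\<close> with the Leibniz rule for differences, in which one
  factor is translated; translation preserves the annihilating power.\<close>

lemma diff_shift_pow_mult:
  assumes "(diff_shift v ^^ a) f = (\<lambda>_. 0)" "(diff_shift v ^^ b) g = (\<lambda>_. 0)"
  shows "(diff_shift v ^^ (a + b)) (\<lambda>x. f x * g x) = (\<lambda>_. 0)"
  using assms
proof (induction "a + b" arbitrary: a b f g)
  case 0
  then show ?case by simp
next
  case (Suc n)
  show ?case
  proof (cases "a = 0 \<or> b = 0")
    case True
    \<comment> \<open>An exponent 0 says that the factor itself is zero.\<close>
    then have "f = (\<lambda>_. 0) \<or> g = (\<lambda>_. 0)" using Suc.prems by auto
    then have "(\<lambda>x. f x * g x) = (\<lambda>_. 0)" by auto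
    then show ?thesis by (simp add: diff_shift_pow_0)
  next
    case False
    then obtain a' b' where ab: "a = Suc a'" "b = Suc b'" by (metis not0_implies_Suc)
    have 1: "(diff_shift v ^^ (a' + b)) (\<lambda>x. diff_shift v f x * g (x + v)) = (\<lambda>_. 0)"
    proof (rule Suc.hyps(1))
      show "n = a' + b" using Suc.hyps(2) ab by simp
      show "(diff_shift v ^^ a') (diff_shift v f) = (\<lambda>_. 0)"
        using Suc.prems(1) unfolding ab funpow_Suc_right comp_apply .
      show "(diff_shift v ^^ b) (\<lambda>x. g (x + v)) = (\<lambda>_. 0)"
        using Suc.prems(2) by (simp add: diff_shift_pow_shift)
    qed
    have 2: "(diff_shift v ^^ (a + b')) (\<lambda>x. f x * diff_shift v g x) = (\<lambda>_. 0)"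
    proof (rule Suc.hyps(1))
      show "n = a + b'" using Suc.hyps(2) ab by simp
      show "(diff_shift v ^^ b') (diff_shift v g) = (\<lambda>_. 0)"
        using Suc.prems(2) unfolding ab funpow_Suc_right comp_apply .
    qed (rule Suc.prems(1))
    have "diff_shift v (\<lambda>x. f x * g x) = (\<lambda>x. diff_shift v f x * g (x + v) + f x * diff_shift v g x)"
      by (auto simp: diff_shift_def algebra_simps)
    moreover have "a + b = Suc (a' + b)" "a' + b = a + b'" using ab by simp_all
    ultimately show ?thesis
      using 1 2 by (simp only: funpow_Suc_right comp_apply diff_shift_pow_add) simp
  qed
qed

definition poly_bounded :: "(real^'n::finite \<Rightarrow> complex) \<Rightarrow> bool" where
  "poly_bounded f \<longleftrightarrow> (\<exists>C k. C \<ge> 0 \<and> (\<forall>x. norm (f x) \<le> C * (1 + norm x) ^ k))"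

lemma poly_bounded_add: assumes "poly_bounded f" "poly_bounded g" shows "poly_bounded (\<lambda>x. f x + g x)"
proof -
  obtain C k D l where b: "C \<ge> 0" "D \<ge> 0" "\<And>x. norm (f x) \<le> C * (1 + norm x) ^ k" "\<And>x. norm (g x) \<le> D * (1 + norm x) ^ l"
    using assms unfolding poly_bounded_def by metis
  have "norm (f x + g x) \<le> (C + D) * (1 + norm x) ^ (k + l)" for x
  proof -
    have "C * (1 + norm x) ^ k \<le> C * (1 + norm x) ^ (k + l)" "D * (1 + norm x) ^ l \<le> D * (1 + norm x) ^ (k + l)"
      by (intro mult_left_mono power_increasing b; simp)+
    with b(3,4)[of x] norm_triangle_ineq[of "f x" "g x"] show ?thesis unfolding distrib_right by linarith
  qed
  with b(1,2) show ?thesis unfolding poly_bounded_def by (intro exI[of _ "C + D"] exI[of _ "k + l"]) auto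
qed

lemma poly_bounded_mult: assumes "poly_bounded f" "poly_bounded g" shows "poly_bounded (\<lambda>x. f x * g x)"
proof -
  obtain C k D l where b: "C \<ge> 0" "D \<ge> 0" "\<And>x. norm (f x) \<le> C * (1 + norm x) ^ k" "\<And>x. norm (g x) \<le> D * (1 + norm x) ^ l"
    using assms unfolding poly_bounded_def by metis
  have "norm (f x * g x) \<le> (C * D) * (1 + norm x) ^ (k + l)" for x
    using mult_mono[OF b(3)[of x] b(4)[of x]] b(1,2) by (simp add: norm_mult power_add mult_ac)
  with b(1,2) show ?thesis unfolding poly_bounded_def by (intro exI[of _ "C * D"] exI[of _ "k + l"]) auto
qed

lemma periodic_bounded:
  fixes f :: "real^'n::finite \<Rightarrow> complex"
  assumes f: "f \<in> periodic_smooth N" and N: "N \<ge> 1"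
  shows "poly_bounded f"
proof -
  let ?L = "2 * pi * real N"
  let ?K = "cbox (0::real^'n) (\<chi> i. ?L)"
  have L: "?L > 0" using N by simp
  have sm: "smooth f" and per: "\<And>(m::'n \<Rightarrow> int) x. f (x + (\<chi> i. ?L * of_int (m i))) = f x"
    using f by (auto simp: periodic_smooth_def)
  have "compact (f ` ?K)" by (intro compact_continuous_image smooth_continuous_on sm compact_cbox)
  then obtain B where B: "\<And>x. x \<in> ?K \<Longrightarrow> norm (f x) \<le> B" by (meson bounded_iff compact_imp_bounded imageI)
  have "norm (f x) \<le> \<bar>B\<bar> * (1 + norm x) ^ 0" for x
  proof -
    \<comment> \<open>Moves \<open>x\<close> into the cell \<open>?K\<close>, where \<open>f\<close>
      is bounded by compactness.\<close>
    let ?m = "\<lambda>i. - \<lfloor>x $ i / ?L\<rfloor>"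
    let ?y = "x + (\<chi> i. ?L * of_int (?m i))"
    have "?y \<in> ?K"
    proof (subst mem_box_cart, intro allI conjI)
      fix i
      have "of_int \<lfloor>x $ i / ?L\<rfloor> \<le> x $ i / ?L" "x $ i / ?L \<le> of_int \<lfloor>x $ i / ?L\<rfloor> + 1" by linarith+
      then have "?L * of_int \<lfloor>x $ i / ?L\<rfloor> \<le> x $ i" "x $ i \<le> ?L * (of_int \<lfloor>x $ i / ?L\<rfloor> + 1)"
        using L by (simp_all only: pos_le_divide_eq pos_divide_le_eq mult.commute[of "of_int _"] mult.commute[of "_ + 1"])
      then show "(0::real^'n) $ i \<le> ?y $ i" "?y $ i \<le> (\<chi> i. ?L) $ i"
        by (simp_all add: algebra_simps)
    qed
    then have "norm (f ?y) \<le> B" by (rule B)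
    then show ?thesis unfolding per[of x ?m] by simp
  qed
  then show ?thesis unfolding poly_bounded_def by (intro exI[of _ "\<bar>B\<bar>"] exI[of _ 0]) auto
qed

definition period_shift :: "nat \<Rightarrow> 'n::finite \<Rightarrow> real^'n" where
  "period_shift N i = (2 * pi * real N) *\<^sub>R axis i 1"

text \<open>A single difference kills a periodic function and a double one kills a coordinate; for
  sums and products the exponents may be added.\<close>

lemma adjoin_periodic:
  fixes f :: "real^'n::finite \<Rightarrow> complex"
  assumes "f \<in> adjoin_coordinates (periodic_smooth N)" "N \<ge> 1"
  shows "smooth f \<and> poly_bounded f \<and> (\<exists>d. (diff_shift (period_shift N i) ^^ d) f = (\<lambda>_. 0))"
  using assms(1)
proof induction
  case (base f)
  have "f (x + period_shift N i) = f x" for x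
  proof -
    have "period_shift N i = (\<chi> j. 2 * pi * real N * of_int (if j = i then 1 else 0))"
      by (simp add: period_shift_def vec_eq_iff axis_def)
    with base show ?thesis by (auto simp: periodic_smooth_def)
  qed
  then have "(diff_shift (period_shift N i) ^^ 1) f = (\<lambda>_. 0)" by (simp add: diff_shift_def)
  then have "\<exists>d. (diff_shift (period_shift N i) ^^ d) f = (\<lambda>_. 0)" by (rule exI)
  then show ?case using base periodic_bounded[OF base assms(2)] by (simp add: periodic_smooth_def)
next
  case (coord j)
  have "(diff_shift (period_shift N i) ^^ 2) (\<lambda>x. complex_of_real (x $ j)) = (\<lambda>_. 0)"
    by (simp add: diff_shift_def numeral_2_eq_2)
  moreover have "poly_bounded (\<lambda>x. complex_of_real (x $ j))"
    unfolding poly_bounded_def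
    by (intro exI[of _ 1] exI[of _ "1::nat"]) (auto intro: order_trans[OF component_le_norm_cart])
  ultimately show ?case by (intro conjI smooth_coord exI)
next
  case (add f g)
  then obtain a b where ab: "(diff_shift (period_shift N i) ^^ a) f = (\<lambda>_. 0)"
    "(diff_shift (period_shift N i) ^^ b) g = (\<lambda>_. 0)" by blast
  then have "(diff_shift (period_shift N i) ^^ (a + b)) f = (\<lambda>_. 0)" "(diff_shift (period_shift N i) ^^ (a + b)) g = (\<lambda>_. 0)"
    by (auto intro: diff_shift_pow_mono)
  then have "(diff_shift (period_shift N i) ^^ (a + b)) (\<lambda>x. f x + g x) = (\<lambda>_. 0)"
    by (simp add: diff_shift_pow_add)
  with add show ?case by (intro conjI smooth_add poly_bounded_add exI) auto
next
  case (mult f g)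
  then obtain a b where ab: "(diff_shift (period_shift N i) ^^ a) f = (\<lambda>_. 0)"
    "(diff_shift (period_shift N i) ^^ b) g = (\<lambda>_. 0)" by blast
  from diff_shift_pow_mult[OF this] mult show ?case by (intro conjI smooth_mult poly_bounded_mult exI) auto
qed

lemma adjoin_mono: "B \<subseteq> B' \<Longrightarrow> adjoin_coordinates B \<subseteq> adjoin_coordinates B'"
proof
  fix f assume "B \<subseteq> B'" "f \<in> adjoin_coordinates B"
  from this(2,1) show "f \<in> adjoin_coordinates B'"
    by induction (auto intro: adjoin_coordinates.intros)
qed

lemma periodic_smooth_mult: "periodic_smooth N \<subseteq> periodic_smooth (N * M)"
proof
  fix f :: "real^'n::finite \<Rightarrow> complex" assume f: "f \<in> periodic_smooth N"
  have "f (x + (\<chi> i. 2 * pi * real (N * M) * of_int (m i))) = f x" for m :: "'n \<Rightarrow> int" and x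
  proof -
    have "(\<chi> i. 2 * pi * real (N * M) * of_int (m i)) = (\<chi> i. 2 * pi * real N * of_int (int M * m i))"
      by (simp add: vec_eq_iff)
    with f show ?thesis by (simp only: periodic_smooth_def mem_Collect_eq)
  qed
  with f show "f \<in> periodic_smooth (N * M)" by (simp add: periodic_smooth_def)
qed

lemma adjoin_periodic_dvd:
  "N dvd M \<Longrightarrow> adjoin_coordinates (periodic_smooth N) \<subseteq> adjoin_coordinates (periodic_smooth M)"
  by (elim dvdE) (simp add: adjoin_mono periodic_smooth_mult)

text \<open>Only finitely many periods occur in one element, and the product of their multiples
  \<open>N\<close> gives a common one.\<close>

lemma adjoin_smooth_PT:
  assumes "f \<in> adjoin_coordinates smooth_PT"
  shows "\<exists>N\<ge>1. f \<in> adjoin_coordinates (periodic_smooth N)"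
  using assms
proof induction
  case (base f)
  then show ?case by (auto simp: smooth_PT_def intro: adjoin_coordinates.base)
next
  case (coord i)
  then show ?case by (auto intro: adjoin_coordinates.coord)
next
  case (add f g)
  then obtain N M where "N \<ge> 1" "M \<ge> 1" "f \<in> adjoin_coordinates (periodic_smooth N)" "g \<in> adjoin_coordinates (periodic_smooth M)" by blast
  then have "N * M \<ge> 1" "f \<in> adjoin_coordinates (periodic_smooth (N * M))" "g \<in> adjoin_coordinates (periodic_smooth (N * M))"
    using adjoin_periodic_dvd[of N "N * M"] adjoin_periodic_dvd[of M "N * M"] by auto
  then show ?case by (intro exI[of _ "N * M"] conjI adjoin_coordinates.add)
next
  case (mult f g)
  then obtain N M where "N \<ge> 1" "M \<ge> 1" "f \<in> adjoin_coordinates (periodic_smooth N)" "g \<in> adjoin_coordinates (periodic_smooth M)" by blast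
  then have "N * M \<ge> 1" "f \<in> adjoin_coordinates (periodic_smooth (N * M))" "g \<in> adjoin_coordinates (periodic_smooth (N * M))"
    using adjoin_periodic_dvd[of N "N * M"] adjoin_periodic_dvd[of M "N * M"] by auto
  then show ?case by (intro exI[of _ "N * M"] conjI adjoin_coordinates.mult)
qed

section \<open>Regularisation of functions with growth or decay bounds\<close>

lemma reg_distr_of:
  assumes "continuous_on UNIV f" "\<phi> \<in> test_functions"
  shows "reg (distr_of f) \<phi> y = (LINT x|lborel. f (x + y) * \<phi> x)"
proof -
  have [measurable]: "f \<in> borel_measurable borel" "\<phi> \<in> borel_measurable borel"
    using assms by (auto intro: borel_measurable_continuous_onI smooth_measurable test_functionsD)
  have "reg (distr_of f) \<phi> y = (LINT x|lborel. f x * \<phi> (x - y))"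
    using test_translate[OF assms(2)] by (simp add: reg_def distr_of_def)
  also have "\<dots> = (LINT x|lborel. (\<lambda>x. f x * \<phi> (x - y)) (x + y))"
    by (rule lborel_integral_shift[symmetric]) measurable
  finally show ?thesis by simp
qed

lemma continuous_on_shift: "continuous_on UNIV f \<Longrightarrow> continuous_on UNIV (\<lambda>x. f (x + y :: 'a::real_normed_vector))"
  by (rule continuous_on_compose2[of UNIV f]) (auto intro!: continuous_intros)

text \<open>\<open>c\<close> is 1 when growth is estimated and a weight at \<open>y\<close> when
  decay is.\<close>

lemma reg_distr_of_bound:
  fixes f :: "real^'n::finite \<Rightarrow> complex"
  assumes cont: "continuous_on UNIV f" and \<phi>: "\<phi> \<in> test_functions"
    and b: "\<And>x. norm (f (x + y)) * c \<le> C * (1 + norm x) ^ k" and c: "c \<ge> 0"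
  shows "norm (reg (distr_of f) \<phi> y) * c \<le> C * (LINT x|lborel. (1 + norm x) ^ k * norm (\<phi> x))"
proof -
  have int: "integrable lborel (\<lambda>x. f (x + y) * \<phi> x)"
    by (intro continuous_mult_test_integrable continuous_on_shift cont \<phi>)
  have "norm (reg (distr_of f) \<phi> y) * c = norm (LINT x|lborel. of_real c * (f (x + y) * \<phi> x))"
    unfolding reg_distr_of[OF cont \<phi>] using c by (simp add: norm_mult)
  also have "\<dots> \<le> (LINT x|lborel. C * ((1 + norm x) ^ k * norm (\<phi> x)))"
  proof (rule Bochner_Integration.integral_norm_bound_integral)
    show "integrable lborel (\<lambda>x. of_real c * (f (x + y) * \<phi> x))" by (intro integrable_mult_right int)
    show "integrable lborel (\<lambda>x. C * ((1 + norm x) ^ k * norm (\<phi> x)))"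
      by (intro integrable_mult_right integrable_weight_rapid test_rapid \<phi>)
    fix x
    have "norm (f (x + y)) * c * norm (\<phi> x) \<le> C * (1 + norm x) ^ k * norm (\<phi> x)"
      by (intro mult_right_mono b) auto
    then show "norm (of_real c * (f (x + y) * \<phi> x)) \<le> C * ((1 + norm x) ^ k * norm (\<phi> x))"
      using c by (simp add: norm_mult mult_ac)
  qed
  finally show ?thesis by simp
qed

lemma slow_reg_distr_of:
  fixes f :: "real^'n::finite \<Rightarrow> complex"
  assumes cont: "continuous_on UNIV f" and b: "poly_bounded f" and \<phi>: "\<phi> \<in> test_functions"
  shows "slow (reg (distr_of f) \<phi>)"
proof (rule slow_reg[OF distr_of_distribution[OF cont] _ \<phi>])
  fix \<phi> :: "real^'n \<Rightarrow> complex" assume \<phi>: "\<phi> \<in> test_functions"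
  obtain C k where C: "C \<ge> 0" "\<And>x. norm (f x) \<le> C * (1 + norm x) ^ k" using b unfolding poly_bounded_def by blast
  have "norm (reg (distr_of f) \<phi> y) * 1 \<le> (C * (1 + norm y) ^ k) * (LINT x|lborel. (1 + norm x) ^ k * norm (\<phi> x))" for y
  proof (rule reg_distr_of_bound[OF cont \<phi>])
    fix x
    have "norm (f (x + y)) \<le> C * ((1 + norm x) ^ k * (1 + norm y) ^ k)"
      using C(2)[of "x + y"] mult_left_mono[OF weight_shift_power[of "x + y" k "- y"] C(1)] by simp
    then show "norm (f (x + y)) * 1 \<le> C * (1 + norm y) ^ k * (1 + norm x) ^ k" by (simp add: mult_ac)
  qed simp
  then have "norm (reg (distr_of f) \<phi> y) \<le> (C * (LINT x|lborel. (1 + norm x) ^ k * norm (\<phi> x))) * (1 + norm y) ^ k" for y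
    by (simp add: mult_ac)
  then show "\<exists>C k. \<forall>y. norm (reg (distr_of f) \<phi> y) \<le> C * (1 + norm y) ^ k" by blast
qed

lemma smooth_diff_shift: "smooth f \<Longrightarrow> smooth (diff_shift v f)"
  unfolding diff_shift_def by (intro smooth_diff smooth_shift)

lemma diff_shift_pow_reg:
  assumes "smooth f" "\<phi> \<in> test_functions"
  shows "(diff_shift v ^^ d) (reg (distr_of f) \<phi>) = reg (distr_of ((diff_shift v ^^ d) f)) \<phi>"
proof (induction d)
  case (Suc d)
  have sm: "smooth ((diff_shift v ^^ d) f)" by (induction d) (auto intro: assms smooth_diff_shift)
  have "diff_shift v (reg (distr_of g) \<phi>) y = reg (distr_of (diff_shift v g)) \<phi> y" if "smooth g" for g y
  proof -
    have c: "continuous_on UNIV g" "continuous_on UNIV (diff_shift v g)"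
      using that by (auto intro: smooth_continuous_on smooth_diff_shift)
    have "diff_shift v (reg (distr_of g) \<phi>) y = (LINT x|lborel. g (x + (y + v)) * \<phi> x) - (LINT x|lborel. g (x + y) * \<phi> x)"
      by (simp add: diff_shift_def reg_distr_of[OF c(1) assms(2)])
    also have "\<dots> = (LINT x|lborel. g (x + (y + v)) * \<phi> x - g (x + y) * \<phi> x)"
      by (intro Bochner_Integration.integral_diff[symmetric] continuous_mult_test_integrable continuous_on_shift c assms(2))
    also have "\<dots> = reg (distr_of (diff_shift v g)) \<phi> y"
      unfolding reg_distr_of[OF c(2) assms(2)] by (simp add: diff_shift_def left_diff_distrib add.assoc)
    finally show ?thesis .
  qed
  from this[OF sm] Suc show ?case by auto
qed simp

text \<open>The multipliers are powers of \<open>wave (- ?v i) \<xi> - 1\<close>. They vanish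
  together only where every \<open>real N * \<xi> $ i\<close> is an integer, and there the symbols
  take over by \<open>nz\<close>.\<close>

lemma system_fun_zero_periodic:
  fixes p :: "('n::finite pdo)^'k::finite"
  assumes f: "\<And>j. f j \<in> adjoin_coordinates (periodic_smooth N)" and N: "N \<ge> 1" and \<phi>: "\<phi> \<in> test_functions"
    and P: "\<And>m y. m \<in> P \<Longrightarrow> system_fun m (\<lambda>j. reg (distr_of (f j)) \<phi>) y = 0"
    and nz: "\<And>\<xi>. (\<And>i. real N * \<xi> $ i \<in> \<int>) \<Longrightarrow> \<exists>a. a *s p \<in> P \<and> symb a \<xi> \<noteq> 0"
  shows "system_fun p (\<lambda>j. reg (distr_of (f j)) \<phi>) y = 0"
proof -
  let ?v = "period_shift N :: 'n \<Rightarrow> real^'n"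
  have sm: "smooth (f j)" and pb: "poly_bounded (f j)" for j using adjoin_periodic[OF f N] by blast+
  have "\<forall>j i. \<exists>d. (diff_shift (?v i) ^^ d) (f j) = (\<lambda>_. 0)" using adjoin_periodic[OF f N] by blast
  then obtain d where d: "\<And>j i. (diff_shift (?v i) ^^ d j i) (f j) = (\<lambda>_. 0)" by metis
  \<comment> \<open>A common exponent for all components and directions.\<close>
  define D where "D = (\<Sum>j\<in>UNIV. \<Sum>i\<in>UNIV. d j i)"
  have "d j i \<le> D" for i j
  proof -
    have "d j i \<le> (\<Sum>i\<in>UNIV. d j i)" by (rule member_le_sum) auto
    also have "\<dots> \<le> D" unfolding D_def by (rule member_le_sum[of j UNIV "\<lambda>j. \<Sum>i\<in>UNIV. d j i"]) auto
    finally show ?thesis .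
  qed
  then have D: "(diff_shift (?v i) ^^ D) (f j) = (\<lambda>_. 0)" for i j using d diff_shift_pow_mono by blast
  have slow: "slow (reg (distr_of (f j)) \<phi>)" for j
    by (intro slow_reg_distr_of smooth_continuous_on sm pb \<phi>)
  show ?thesis
  proof (rule system_fun_zero_if_multipliers[where M="range (\<lambda>i \<xi>. (wave (- ?v i) \<xi> - 1) ^ D)", OF slow P])
    show "smooth m" if "m \<in> range (\<lambda>i \<xi>. (wave (- ?v i) \<xi> - 1) ^ D)" for m
      using that by (auto intro!: smooth_power smooth_diff)
    fix m j and \<psi> :: "real^'n \<Rightarrow> complex"
    assume m: "m \<in> range (\<lambda>i \<xi>. (wave (- ?v i) \<xi> - 1) ^ D)" and \<psi>: "\<psi> \<in> test_functions"
    from m obtain i where m: "m = (\<lambda>\<xi>. (wave (- ?v i) \<xi> - 1) ^ D)" by blast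
    have "(diff_shift (?v i) ^^ D) (reg (distr_of (f j)) \<phi>) x = 0" for x
      unfolding diff_shift_pow_reg[OF sm \<phi>] D by (simp add: reg_def distr_of_def)
    then show "(LINT x|lborel. reg (distr_of (f j)) \<phi> x * FT (\<lambda>\<xi>. m \<xi> * \<psi> \<xi>) x) = 0"
      using pairing_diff_shift_power[OF slow[of j] test_rapid[OF \<psi>], where v="?v i" and d=D] by (simp add: m)
  next
    fix \<xi> :: "real^'n"
    show "(\<exists>a. a *s p \<in> P \<and> symb a \<xi> \<noteq> 0) \<or> (\<exists>m\<in>range (\<lambda>i \<xi>. (wave (- ?v i) \<xi> - 1) ^ D). m \<xi> \<noteq> 0)"
    proof (cases "\<forall>i. real N * \<xi> $ i \<in> \<int>")
      case True
      then show ?thesis using nz by blast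
    next
      case False
      then obtain i where i: "real N * \<xi> $ i \<notin> \<int>" by blast
      have "wave (- ?v i) \<xi> \<noteq> 1"
      proof
        assume "wave (- ?v i) \<xi> = 1"
        then have "exp (\<i> * of_real (2 * pi * real N * \<xi> $ i)) = 1"
          by (simp add: wave_def period_shift_def inner_axis inner_commute[of "axis i 1"] mult.assoc)
        then obtain n :: int where "2 * pi * real N * \<xi> $ i = of_int (2 * n) * pi"
          by (auto simp: exp_eq_1)
        then have "real N * \<xi> $ i = of_int n" by simp
        with i show False by simp
      qed
      then show ?thesis by (intro disjI2 bexI[of _ "\<lambda>\<xi>. (wave (- ?v i) \<xi> - 1) ^ D"]) auto
    qed
  qed
qed

section \<open>Exponentials with integral and rational frequencies\<close>

lemma adjoin_const: assumes "\<And>c. (\<lambda>x. c) \<in> B" shows "(\<lambda>x. c) \<in> adjoin_coordinates B"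
  by (intro adjoin_coordinates.base assms)

lemma adjoin_sum:
  assumes "\<And>c. (\<lambda>x. c) \<in> B"
  shows "(\<And>i. i \<in> I \<Longrightarrow> f i \<in> adjoin_coordinates B) \<Longrightarrow> (\<lambda>x. \<Sum>i\<in>I. f i x) \<in> adjoin_coordinates B"
  by (induction I rule: infinite_finite_induct) (auto intro: adjoin_coordinates.add adjoin_const assms)

lemma adjoin_prod:
  assumes "\<And>c. (\<lambda>x. c) \<in> B"
  shows "(\<And>i. i \<in> I \<Longrightarrow> f i \<in> adjoin_coordinates B) \<Longrightarrow> (\<lambda>x. \<Prod>i\<in>I. f i x) \<in> adjoin_coordinates B"
  by (induction I rule: infinite_finite_induct) (auto intro: adjoin_coordinates.mult adjoin_const assms)

lemma adjoin_exp_poly: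
  assumes c: "\<And>c. (\<lambda>x. c) \<in> B" and e: "(\<lambda>x. cis_dot x \<xi>) \<in> B"
  shows "exp_poly \<xi> s \<mu> \<in> adjoin_coordinates B"
proof -
  have "(\<lambda>x. (\<i> * of_real (x $ i)) ^ n) \<in> adjoin_coordinates B" for i n
  proof (induction n)
    case (Suc n)
    then show ?case
      unfolding power_Suc by (intro adjoin_coordinates.mult adjoin_coordinates.coord adjoin_const c)
  qed (simp add: adjoin_const c)
  then have "(\<lambda>x. (\<i> * of_real (x $ i)) ^ n / fact n) \<in> adjoin_coordinates B" for i n
    unfolding divide_inverse by (intro adjoin_coordinates.mult adjoin_const c)
  then have "exp_monomial \<alpha> \<in> adjoin_coordinates B" for \<alpha>
    unfolding exp_monomial_def by (intro adjoin_prod c)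
  then show ?thesis
    unfolding exp_poly_def[abs_def]
    by (intro adjoin_sum c adjoin_coordinates.mult adjoin_const adjoin_coordinates.base[OF e])
qed

lemma const_periodic: "(\<lambda>x. c) \<in> periodic_smooth N"
  by (simp add: periodic_smooth_def)

lemma cis_dot_periodic:
  assumes "\<And>i. of_nat N * \<xi> $ i \<in> \<int>"
  shows "(\<lambda>x. cis_dot x \<xi>) \<in> periodic_smooth N"
proof -
  have "cis_dot (x + (\<chi> i. 2 * pi * real N * of_int (m i))) \<xi> = cis_dot x \<xi>" for m :: "'a \<Rightarrow> int" and x
  proof -
    have "\<forall>i. \<exists>n::int. of_nat N * \<xi> $ i = of_int n" using assms by (auto elim: Ints_cases)
    then obtain n :: "'a \<Rightarrow> int" where n: "\<And>i. of_nat N * \<xi> $ i = of_int (n i)" by metis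
    have "(\<Sum>i\<in>UNIV. of_real ((x + (\<chi> i. 2 * pi * real N * of_int (m i))) $ i) * \<xi> $ i) =
        (\<Sum>i\<in>UNIV. of_real (x $ i) * \<xi> $ i) + (\<Sum>i\<in>UNIV. of_real (2 * pi) * of_int (m i) * (of_nat N * \<xi> $ i))"
      unfolding sum.distrib[symmetric] by (intro sum.cong) (auto simp: algebra_simps)
    also have "(\<Sum>i\<in>UNIV. of_real (2 * pi) * of_int (m i) * (of_nat N * \<xi> $ i)) =
        complex_of_real (2 * pi) * of_int (\<Sum>i\<in>UNIV. m i * n i)"
      unfolding n by (simp add: sum_distrib_left mult.assoc)
    finally have "cis_dot (x + (\<chi> i. 2 * pi * real N * of_int (m i))) \<xi> =
        cis_dot x \<xi> * exp (\<i> * (complex_of_real (2 * pi) * of_int (\<Sum>i\<in>UNIV. m i * n i)))"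
      unfolding cis_dot_def by (simp only: distrib_left exp_add)
    also have "exp (\<i> * (complex_of_real (2 * pi) * of_int (\<Sum>i\<in>UNIV. m i * n i))) = 1"
      unfolding exp_eq_1 by (intro conjI exI[of _ "\<Sum>i\<in>UNIV. m i * n i"]) (simp_all add: mult.commute)
    finally show ?thesis by simp
  qed
  then show ?thesis by (simp add: periodic_smooth_def)
qed

lemma closure_wrt_T_poly:
  fixes P :: "(('n::finite pdo)^'k::finite) set"
  assumes "submodule P"
  shows "p \<in> closure_wrt T_poly_distributions P \<longleftrightarrow> (\<forall>\<xi>\<in>integral_points. \<exists>a. a *s p \<in> P \<and> poly_eval a \<xi> \<noteq> 0)"
proof
  assume p: "p \<in> closure_wrt T_poly_distributions P"
  show "\<forall>\<xi>\<in>integral_points. \<exists>a. a *s p \<in> P \<and> poly_eval a \<xi> \<noteq> 0"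
  proof
    fix \<xi> :: "complex^'n" assume "\<xi> \<in> integral_points"
    then have "exp_poly \<xi> s \<mu> \<in> adjoin_coordinates smooth_T" for s \<mu>
      unfolding smooth_T_def by (intro adjoin_exp_poly const_periodic cis_dot_periodic) (simp add: integral_points_def)
    then show "\<exists>a. a *s p \<in> P \<and> poly_eval a \<xi> \<noteq> 0"
      by (intro closure_wrt_lower[OF assms p]) (auto simp: T_poly_distributions_def)
  qed
next
  assume *: "\<forall>\<xi>\<in>integral_points. \<exists>a. a *s p \<in> P \<and> poly_eval a \<xi> \<noteq> 0"
  have per: "f \<in> adjoin_coordinates (periodic_smooth 1)" if "f \<in> adjoin_coordinates smooth_T" for f :: "real^'n \<Rightarrow> complex"
    using that by (simp add: smooth_T_def)
  show "p \<in> closure_wrt T_poly_distributions P"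
  proof (rule closure_wrtI)
    show "T_poly_distributions \<subseteq> (distributions :: 'n distr set)"
      unfolding T_poly_distributions_def using adjoin_periodic[OF per]
      by (auto intro!: distr_of_distribution smooth_continuous_on)
    fix f :: "('n distr)^'k" and \<phi>
    assume f: "\<And>j. f $ j \<in> T_poly_distributions" and \<phi>: "\<phi> \<in> test_functions"
      and P: "\<And>m y. m \<in> P \<Longrightarrow> system_fun m (\<lambda>j. reg (f $ j) \<phi>) y = 0"
    have "\<forall>j. \<exists>g. g \<in> adjoin_coordinates (periodic_smooth 1) \<and> f $ j = distr_of g"
      using f per unfolding T_poly_distributions_def by blast
    then obtain g where g: "\<And>j. g j \<in> adjoin_coordinates (periodic_smooth 1)" "\<And>j. f $ j = distr_of (g j)" by metis
    show "system_fun p (\<lambda>j. reg (f $ j) \<phi>) 0 = 0"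
      unfolding g(2)
    proof (rule system_fun_zero_periodic[OF g(1) _ \<phi> P[unfolded g(2)]])
      fix \<xi> :: "real^'n" assume "\<And>i. real 1 * \<xi> $ i \<in> \<int>"
      then have "(\<chi> i. of_real (\<xi> $ i)) \<in> integral_points"
        by (auto simp: integral_points_def elim!: Ints_cases)
      with * show "\<exists>a. a *s p \<in> P \<and> symb a \<xi> \<noteq> 0" by (simp add: symb_def)
    qed auto
  qed
qed

lemma rational_common_denominator:
  fixes \<xi> :: "complex^'n::finite"
  assumes "\<xi> \<in> rational_points"
  obtains N :: nat where "N \<ge> 1" "\<And>i. of_nat N * \<xi> $ i \<in> \<int>"
proof -
  have "\<forall>i. \<exists>N::nat. N \<ge> 1 \<and> of_nat N * \<xi> $ i \<in> \<int>"
  proof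
    fix i
    have "\<xi> $ i \<in> \<rat>" using assms by (simp add: rational_points_def)
    then obtain a b :: int where ab: "b > 0" "\<xi> $ i = of_int a / of_int b" by (rule Rats_cases') 
    then have "of_nat (nat b) * \<xi> $ i = of_int a" by simp
    with ab(1) show "\<exists>N::nat. N \<ge> 1 \<and> of_nat N * \<xi> $ i \<in> \<int>" by (intro exI[of _ "nat b"]) auto
  qed
  then obtain M :: "'n \<Rightarrow> nat" where M: "\<And>i. M i \<ge> 1" "\<And>i. of_nat (M i) * \<xi> $ i \<in> \<int>" by metis
  show ?thesis
  proof (rule that[of "\<Prod>i\<in>UNIV. M i"])
    show "(\<Prod>i\<in>UNIV. M i) \<ge> 1" using M(1) by (intro prod_ge_1) auto
    fix i
    have "of_nat (\<Prod>i\<in>UNIV. M i) * \<xi> $ i = of_nat (\<Prod>i\<in>UNIV - {i}. M i) * (of_nat (M i) * \<xi> $ i)"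
      by (subst prod.remove[of UNIV i]) auto
    also have "\<dots> \<in> \<int>" by (intro Ints_mult M(2)) auto
    finally show "of_nat (\<Prod>i\<in>UNIV. M i) * \<xi> $ i \<in> \<int>" .
  qed
qed

lemma closure_wrt_PT_poly:
  fixes P :: "(('n::finite pdo)^'k::finite) set"
  assumes "submodule P"
  shows "p \<in> closure_wrt PT_poly_distributions P \<longleftrightarrow> (\<forall>\<xi>\<in>rational_points. \<exists>a. a *s p \<in> P \<and> poly_eval a \<xi> \<noteq> 0)"
proof
  assume p: "p \<in> closure_wrt PT_poly_distributions P"
  show "\<forall>\<xi>\<in>rational_points. \<exists>a. a *s p \<in> P \<and> poly_eval a \<xi> \<noteq> 0"
  proof
    fix \<xi> :: "complex^'n" assume "\<xi> \<in> rational_points"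
    then obtain N where N: "N \<ge> 1" "\<And>i. of_nat N * \<xi> $ i \<in> \<int>"
      using rational_common_denominator by metis
    have "periodic_smooth N \<subseteq> smooth_PT" using N(1) by (auto simp: smooth_PT_def)
    then have "(\<lambda>x. c) \<in> smooth_PT" "(\<lambda>x. cis_dot x \<xi>) \<in> smooth_PT" for c
      using const_periodic[of c N] cis_dot_periodic[of N \<xi>, OF N(2)] by blast+
    then have "exp_poly \<xi> s \<mu> \<in> adjoin_coordinates smooth_PT" for s \<mu>
      by (intro adjoin_exp_poly)
    then show "\<exists>a. a *s p \<in> P \<and> poly_eval a \<xi> \<noteq> 0"
      by (intro closure_wrt_lower[OF assms p]) (auto simp: PT_poly_distributions_def)
  qed
next
  assume *: "\<forall>\<xi>\<in>rational_points. \<exists>a. a *s p \<in> P \<and> poly_eval a \<xi> \<noteq> 0"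
  show "p \<in> closure_wrt PT_poly_distributions P"
  proof (rule closure_wrtI)
    show "PT_poly_distributions \<subseteq> (distributions :: 'n distr set)"
    proof
      fix u :: "'n distr" assume "u \<in> PT_poly_distributions"
      then obtain g N where "u = distr_of g" "N \<ge> 1" "g \<in> adjoin_coordinates (periodic_smooth N)"
        using adjoin_smooth_PT unfolding PT_poly_distributions_def by blast
      then show "u \<in> distributions"
        using adjoin_periodic[of g N] by (auto intro!: distr_of_distribution smooth_continuous_on)
    qed
    fix f :: "('n distr)^'k" and \<phi>
    assume f: "\<And>j. f $ j \<in> PT_poly_distributions" and \<phi>: "\<phi> \<in> test_functions"
      and P: "\<And>m y. m \<in> P \<Longrightarrow> system_fun m (\<lambda>j. reg (f $ j) \<phi>) y = 0"
    have "\<forall>j. \<exists>g N. N \<ge> 1 \<and> g \<in> adjoin_coordinates (periodic_smooth N) \<and> f $ j = distr_of g"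
      using f adjoin_smooth_PT unfolding PT_poly_distributions_def by blast
    then obtain g M where g: "\<And>j. M j \<ge> 1" "\<And>j. g j \<in> adjoin_coordinates (periodic_smooth (M j))"
      "\<And>j. f $ j = distr_of (g j)" by metis
    \<comment> \<open>A common period of the components. It depends on \<open>f\<close>, so
      arbitrary denominators can occur, which is why the hypothesis ranges over all rational
      points.\<close>
    define N where "N = (\<Prod>j\<in>UNIV. M j)"
    have N: "N \<ge> 1" unfolding N_def using g(1) by (intro prod_ge_1) auto
    have gN: "g j \<in> adjoin_coordinates (periodic_smooth N)" for j
      using g(2)[of j] adjoin_periodic_dvd[of "M j" N] dvd_prodI[of UNIV j M] unfolding N_def by auto
    show "system_fun p (\<lambda>j. reg (f $ j) \<phi>) 0 = 0"
      unfolding g(3)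
    proof (rule system_fun_zero_periodic[OF gN N \<phi> P[unfolded g(3)]])
      fix \<xi> :: "real^'n" assume i: "\<And>i. real N * \<xi> $ i \<in> \<int>"
      have "complex_of_real (\<xi> $ i) \<in> \<rat>" for i
      proof -
        obtain n where "real N * \<xi> $ i = of_int n" using i[of i] by (auto elim: Ints_cases)
        then have "\<xi> $ i = of_int n / of_nat N" using N by (simp add: field_simps)
        then have "complex_of_real (\<xi> $ i) = of_int n / of_nat N" by simp
        then show ?thesis by simp
      qed
      then have "(\<chi> i. of_real (\<xi> $ i)) \<in> rational_points" by (simp add: rational_points_def)
      with * show "\<exists>a. a *s p \<in> P \<and> symb a \<xi> \<noteq> 0" by (simp add: symb_def)
    qed auto
  qed
qed

subsection \<open>Rapidly decreasing and compactly supported solutions\<close>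

lemma pdo_fun_sum_left: "pdo_fun (\<Sum>i\<in>I. p i) f x = (\<Sum>i\<in>I. pdo_fun (p i) f x)"
  by (simp add: pdo_fun_def lin_sum)

lemma test_pdo_fun: "f \<in> test_functions \<Longrightarrow> pdo_fun q f \<in> test_functions"
  unfolding pdo_fun_def lin_def iterate_multi_eq by (intro test_sum test_cmult test_foldr)

lemma rapid_sum_fun: assumes "\<And>j. rapid (G j)" shows "rapid (system_fun p G)"
  unfolding system_fun_def by (intro rapid_sum rapid_pdo_fun assms)

text \<open>All three spaces lie between \<open>test_distributions\<close> and
  \<open>distributions\<close> and have rapidly decreasing regularisations, which is all that the
  two directions use.\<close>

lemma closure_wrt_rapid:
  fixes P :: "(('n::finite pdo)^'k::finite) set"
  assumes P: "submodule P" and F: "F \<subseteq> distributions" "test_distributions \<subseteq> F"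
    and rapid: "\<And>u \<phi>. u \<in> F \<Longrightarrow> \<phi> \<in> test_functions \<Longrightarrow> rapid (reg u \<phi>)"
  shows "p \<in> closure_wrt F P \<longleftrightarrow> (\<exists>a. a \<noteq> 0 \<and> a *s p \<in> P)"
proof
  assume p: "p \<in> closure_wrt F P"
  show "\<exists>a. a \<noteq> 0 \<and> a *s p \<in> P"
  proof (rule ccontr)
    assume "\<not> ?thesis"
    then have na: "a *s p \<notin> P" if "a \<noteq> 0" for a using that by blast
    have "\<exists>q::('n pdo)^'k. (\<forall>v\<in>P. (\<Sum>j\<in>UNIV. q $ j * v $ j) = 0) \<and> (\<Sum>j\<in>UNIV. q $ j * p $ j) \<noteq> 0"
      using separating_row[OF finite[of UNIV] P, of p] na by auto
    then obtain q :: "('n pdo)^'k" where q: "\<forall>v\<in>P. (\<Sum>j\<in>UNIV. q $ j * v $ j) = 0"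
      "(\<Sum>j\<in>UNIV. q $ j * p $ j) \<noteq> 0" by (elim exE conjE)
    define h :: "real^'n \<Rightarrow> complex" where "h = bump 1 0 (1\<^sup>2)"
    have h: "h \<in> test_functions" unfolding h_def by (rule bump_test) simp
    \<comment> \<open>A potential for the system: a row \<open>m\<close> acts on it as the single
      operator with symbol the sum of the products \<open>q $ j * m $ j\<close>, applied to
      \<open>h\<close>. That operator is 0 for \<open>m\<close> in \<open>P\<close> and injective on
      \<open>rapid\<close> functions for \<open>p\<close>.\<close>
    let ?f = "\<lambda>j. pdo_fun (q $ j) h"
    have sys: "system_fun m ?f y = pdo_fun (\<Sum>j\<in>UNIV. q $ j * m $ j) h y" for m y
      unfolding system_fun_def pdo_fun_sum_left
      by (simp add: pdo_fun_mult[OF test_functionsD(1)[OF h], symmetric] mult.commute)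
    have "\<exists>y. pdo_fun (\<Sum>j\<in>UNIV. q $ j * p $ j) h y \<noteq> 0"
      using rapid_pdo_fun_injective[OF q(2) test_rapid[OF h], of 0] bump_center[of 1 "0::real^'n"]
      by (auto simp: h_def)
    then obtain y where y: "system_fun p ?f y \<noteq> 0" by (auto simp: sys)
    have "p \<notin> closure_wrt F P"
    proof (rule not_in_closureI[of ?f])
      show "smooth (?f j)" for j by (intro smooth_pdo_fun test_functionsD(1) h)
      show "distr_of (?f j) \<in> F" for j using test_pdo_fun[OF h] F(2) by (auto simp: test_distributions_def)
      show "system_fun m ?f y = 0" if "m \<in> P" for m y
        unfolding sys q(1)[rule_format, OF that] by (simp add: pdo_fun_def)
    qed (rule y)
    with p show False by blast
  qed
next
  assume "\<exists>a. a \<noteq> 0 \<and> a *s p \<in> P"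
  then obtain a where a: "a \<noteq> 0" "a *s p \<in> P" by blast
  show "p \<in> closure_wrt F P"
  proof (rule closure_wrtI[OF F(1)])
    fix f :: "('n distr)^'k" and \<phi>
    assume f: "\<And>j. f $ j \<in> F" and \<phi>: "\<phi> \<in> test_functions"
      and P: "\<And>m y. m \<in> P \<Longrightarrow> system_fun m (\<lambda>j. reg (f $ j) \<phi>) y = 0"
    have r: "rapid (reg (f $ j) \<phi>)" for j by (rule rapid[OF f \<phi>])
    show "system_fun p (\<lambda>j. reg (f $ j) \<phi>) 0 = 0"
    proof (rule rapid_pdo_fun_injective[OF a(1)])
      show "rapid (system_fun p (\<lambda>j. reg (f $ j) \<phi>))" by (rule rapid_sum_fun[OF r])
      show "pdo_fun a (system_fun p (\<lambda>j. reg (f $ j) \<phi>)) x = 0" for x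
        using P[OF a(2), of x] by (simp add: system_fun_smult rapidD r)
    qed
  qed
qed

lemma rapid_reg_distr_of:
  fixes f :: "real^'n::finite \<Rightarrow> complex"
  assumes cont: "continuous_on UNIV f" and b: "\<And>k. \<exists>C. \<forall>x. norm (f x) * (1 + norm x) ^ k \<le> C" and \<phi>: "\<phi> \<in> test_functions"
  shows "rapid (reg (distr_of f) \<phi>)"
proof (rule rapid_reg[OF distr_of_distribution[OF cont] _ \<phi>])
  fix \<phi> :: "real^'n \<Rightarrow> complex" and k assume \<phi>: "\<phi> \<in> test_functions"
  obtain C where C: "\<And>x. norm (f x) * (1 + norm x) ^ k \<le> C" using b[of k] by blast
  have "norm (reg (distr_of f) \<phi> y) * (1 + norm y) ^ k \<le> C * (LINT x|lborel. (1 + norm x) ^ k * norm (\<phi> x))" for y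
  proof (rule reg_distr_of_bound[OF cont \<phi>])
    fix x
    have "norm (f (x + y)) * (1 + norm y) ^ k \<le> norm (f (x + y)) * ((1 + norm (x + y)) ^ k * (1 + norm x) ^ k)"
      using weight_shift_power[of y k x] by (intro mult_left_mono) (auto simp: add.commute)
    also have "\<dots> \<le> C * (1 + norm x) ^ k"
      unfolding mult.assoc[symmetric] by (intro mult_right_mono C) auto
    finally show "norm (f (x + y)) * (1 + norm y) ^ k \<le> C * (1 + norm x) ^ k" .
  qed simp
  then show "\<exists>C. \<forall>y. norm (reg (distr_of f) \<phi> y) * (1 + norm y) ^ k \<le> C" by blast
qed

lemma rapid_reg_schwartz:
  fixes f :: "real^'n::finite \<Rightarrow> complex"
  assumes "f \<in> schwartz_functions" "\<phi> \<in> test_functions"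
  shows "rapid (reg (distr_of f) \<phi>)"
  using schwartz_weight[OF assms(1)] assms
  by (intro rapid_reg_distr_of smooth_continuous_on schwartz_functionsD) blast+

text \<open>The regularisation vanishes beyond the sum of the radii of the two supports, so
  boundedness on a ball is enough.\<close>

lemma rapid_reg_compact:
  fixes u :: "'n::finite distr"
  assumes u: "u \<in> compactly_supported_distributions" and \<phi>: "\<phi> \<in> test_functions"
  shows "rapid (reg u \<phi>)"
proof -
  have ud: "u \<in> distributions" using u by (simp add: compactly_supported_distributions_def)
  obtain K where K: "compact K" "\<And>\<phi>. \<phi> \<in> test_functions \<Longrightarrow> supp \<phi> \<inter> K = {} \<Longrightarrow> u \<phi> = 0"
    using u by (auto simp: compactly_supported_distributions_def)
  obtain R where R: "\<And>x. x \<in> K \<Longrightarrow> norm x \<le> R" using compact_imp_bounded[OF K(1)] by (auto simp: bounded_iff)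
  show ?thesis
  proof (rule rapid_reg[OF ud _ \<phi>])
    fix \<phi> :: "real^'n \<Rightarrow> complex" and k assume \<phi>: "\<phi> \<in> test_functions"
    obtain r where r: "\<And>x. x \<in> supp \<phi> \<Longrightarrow> norm x \<le> r"
      using compact_imp_bounded[OF test_functionsD(2)[OF \<phi>]] by (auto simp: bounded_iff)
    have zero: "reg u \<phi> y = 0" if y: "norm y > R + r" for y
      unfolding reg_def
    proof (rule K(2)[OF test_translate[OF \<phi>]])
      have "x \<notin> K" if "x \<in> supp (\<lambda>x. \<phi> (x - y))" for x
      proof
        assume x: "x \<in> K"
        have "x \<in> (\<lambda>x. x - (- y)) ` supp \<phi>" using that test_shift(2)[OF \<phi>, of "- y"] by auto
        then have "norm (x - y) \<le> r" using r by auto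
        then show False using R[OF x] y norm_triangle_ineq4[of x "x - y"] by simp
      qed
      then show "supp (\<lambda>x. \<phi> (x - y)) \<inter> K = {}" by blast
    qed
    have "compact (reg u \<phi> ` cball 0 (R + r))"
      by (intro compact_continuous_image smooth_continuous_on smooth_reg ud \<phi> compact_cball)
    then obtain B where B: "\<And>y. y \<in> cball 0 (R + r) \<Longrightarrow> norm (reg u \<phi> y) \<le> B"
      by (meson bounded_iff compact_imp_bounded imageI)
    have "norm (reg u \<phi> y) * (1 + norm y) ^ k \<le> \<bar>B\<bar> * (1 + \<bar>R + r\<bar>) ^ k" for y
    proof (cases "norm y > R + r")
      case False
      then show ?thesis using B[of y] by (intro mult_mono power_mono) auto
    qed (simp add: zero)
    then show "\<exists>C. \<forall>y. norm (reg u \<phi> y) * (1 + norm y) ^ k \<le> C" by blast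
  qed
qed

lemma test_distributions_subset:
  "(test_distributions :: 'n::finite distr set) \<subseteq> schwartz_distributions"
  "(test_distributions :: 'n::finite distr set) \<subseteq> compactly_supported_distributions"
proof -
  show "(test_distributions :: 'n distr set) \<subseteq> schwartz_distributions"
    unfolding test_distributions_def schwartz_distributions_def using test_subset_schwartz by blast
  show "(test_distributions :: 'n distr set) \<subseteq> compactly_supported_distributions"
  proof
    fix u :: "'n distr" assume "u \<in> test_distributions"
    then obtain f where f: "u = distr_of f" "f \<in> test_functions" by (auto simp: test_distributions_def)
    have "u \<in> distributions" unfolding f(1) by (intro distr_of_distribution smooth_continuous_on test_functionsD(1) f(2))
    moreover have "u \<phi> = 0" if "\<phi> \<in> test_functions" "supp \<phi> \<inter> supp f = {}" for \<phi>
    proof -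
      have "(\<lambda>x. f x * \<phi> x) = (\<lambda>_. 0)" using that(2) in_supp[of f] in_supp[of \<phi>] by fastforce
      then show ?thesis unfolding f(1) distr_of_def by simp
    qed
    ultimately show "u \<in> compactly_supported_distributions"
      using test_functionsD(2)[OF f(2)] unfolding compactly_supported_distributions_def by blast
  qed
qed

lemma closure_wrt_decaying:
  fixes P :: "(('n::finite pdo)^'k::finite) set"
  assumes P: "submodule P" and F: "F \<in> {test_distributions, compactly_supported_distributions, schwartz_distributions}"
  shows "p \<in> closure_wrt F P \<longleftrightarrow> (\<exists>a. a \<noteq> 0 \<and> a *s p \<in> P)"
proof -
  have s: "(schwartz_distributions :: 'n distr set) \<subseteq> distributions"
    unfolding schwartz_distributions_def by (auto intro!: distr_of_distribution smooth_continuous_on schwartz_functionsD)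
  have c: "(compactly_supported_distributions :: 'n distr set) \<subseteq> distributions"
    by (auto simp: compactly_supported_distributions_def)
  have rs: "rapid (reg u \<phi>)" if "u \<in> schwartz_distributions" "\<phi> \<in> test_functions" for u :: "'n distr" and \<phi>
    using that rapid_reg_schwartz by (auto simp: schwartz_distributions_def)
  from F consider "F = test_distributions" | "F = compactly_supported_distributions" | "F = schwartz_distributions" by blast
  then show ?thesis
  proof cases
    case 1
    then show ?thesis using s rs test_distributions_subset(1) by (intro closure_wrt_rapid[OF P]) blast+
  next
    case 2
    then show ?thesis using c rapid_reg_compact test_distributions_subset(2) by (intro closure_wrt_rapid[OF P]) blast+
  next
    case 3
    then show ?thesis using s rs test_distributions_subset(1) by (intro closure_wrt_rapid[OF P]) blast+
  qed
qed

text \<open>Every nonzero prime contains some \<open>a \<noteq> 0\<close>, a power of which maps the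
  whole module into its component; the product of these powers over \<open>i \<ge> 1\<close> carries
  \<open>Q 0\<close> into \<open>P\<close>. Modulo a 0-primary \<open>Q 0\<close>, a nonzero
  \<open>a\<close> is not a zero divisor.\<close>

lemma torsion_component:
  fixes P :: "(('n::finite pdo)^'k::finite) set"
  assumes nz: "\<forall>i\<in>{1..r}. \<pp> i \<noteq> {0}"
    and dec: "(\<pp> 0 = {0} \<and> irredundant_primary_decomposition P {0..r} Q \<pp>) \<or>
         (Q 0 = UNIV \<and> irredundant_primary_decomposition P {1..r} Q \<pp>)"
  shows "(\<exists>a. a \<noteq> 0 \<and> a *s p \<in> P) \<longleftrightarrow> p \<in> Q (0::nat)"
proof -
  have prim: "primary_submodule (\<pp> i) (Q i)" if "i \<in> {1..r}" for i
    using dec that by (auto simp: irredundant_primary_decomposition_def)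
  have P: "P = Q 0 \<inter> (\<Inter>i\<in>{1..r}. Q i)"
  proof -
    have "{0..r} = insert 0 {1..r}" by auto
    with dec show ?thesis by (auto simp: irredundant_primary_decomposition_def)
  qed
  have sub0: "submodule (Q 0)"
    using dec by (auto simp: irredundant_primary_decomposition_def primary_submodule_def submodule_iff)
  show ?thesis
  proof
    assume "\<exists>a. a \<noteq> 0 \<and> a *s p \<in> P"
    then obtain a where a: "a \<noteq> 0" "a *s p \<in> Q 0" by (auto simp: P)
    show "p \<in> Q 0"
      using dec
    proof
      assume d: "\<pp> 0 = {0} \<and> irredundant_primary_decomposition P {0..r} Q \<pp>"
      then have "\<forall>i\<in>{0..r}. primary_submodule (\<pp> i) (Q i)"
        unfolding irredundant_primary_decomposition_def by (elim conjE)
      then have "primary_submodule (\<pp> 0) (Q 0)" by (rule bspec) simp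
      with d show "p \<in> Q 0" using primary_zero_divisor[of "\<pp> 0" "Q 0" a p] a by auto
    qed simp
  next
    assume p: "p \<in> Q 0"
    have "\<exists>a. a \<noteq> 0 \<and> (\<forall>z. a *s z \<in> Q i)" if i: "i \<in> {1..r}" for i
    proof -
      have "prime_ideal (\<pp> i)" using prim[OF i] by (auto simp: primary_submodule_def Ass_quotient_def)
      then have "0 \<in> \<pp> i" by (simp add: prime_ideal_def ideal_iff)
      then obtain a where a: "a \<in> \<pp> i" "a \<noteq> 0" using nz i by blast
      obtain s where "\<forall>z. a ^ s *s z \<in> Q i" using primary_power[OF prim[OF i] a(1)] by blast
      then show ?thesis using pdo_power_nonzero[OF a(2)] by blast
    qed
    then obtain a where a: "\<And>i. i \<in> {1..r} \<Longrightarrow> a i \<noteq> 0" "\<And>i z. i \<in> {1..r} \<Longrightarrow> a i *s z \<in> Q i" by metis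
    have "(\<Prod>i\<in>{1..r}. a i) *s p \<in> Q i" if i: "i \<in> {1..r}" for i
    proof -
      have "(\<Prod>i\<in>{1..r}. a i) *s p = a i *s ((\<Prod>i\<in>{1..r} - {i}. a i) *s p)"
        using i by (simp add: prod.remove vector_smult_assoc)
      then show ?thesis using a(2)[OF i] by metis
    qed
    moreover have "(\<Prod>i\<in>{1..r}. a i) *s p \<in> Q 0" by (rule submoduleD(3)[OF sub0 p])
    ultimately have "(\<Prod>i\<in>{1..r}. a i) *s p \<in> P" by (simp add: P)
    moreover have "(\<Prod>i\<in>{1..r}. a i) \<noteq> 0" using a(1) by (intro pdo_prod_nonzero) auto
    ultimately show "\<exists>a. a \<noteq> 0 \<and> a *s p \<in> P" by blast
  qed
qed

text \<open>The closure is the intersection of the components whose varieties meet \<open>X\<close>;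
  the number \<open>q\<close> only fixes their order. By irredundance this intersection is
  \<open>P\<close> only if all components take part.\<close>

lemma closure_wrt_components:
  fixes P :: "(('n::finite pdo)^'k::finite) set"
  assumes dec: "irredundant_primary_decomposition P {1..r} Q \<pp>"
    and cl: "\<And>p. p \<in> closure_wrt F P \<longleftrightarrow> (\<forall>\<xi>\<in>X. \<exists>a. a *s p \<in> P \<and> poly_eval a \<xi> \<noteq> 0)"
  shows "(\<forall>q\<le>r. (\<forall>i\<in>{1..q}. variety (\<pp> i) \<inter> X \<noteq> {}) \<and> (\<forall>i\<in>{q+1..r}. variety (\<pp> i) \<inter> X = {}) \<longrightarrow>
      closure_wrt F P = (\<Inter>i\<in>{1..q}. Q i)) \<and>
    (closed_wrt F P \<longleftrightarrow> (\<forall>i\<in>{1..r}. variety (\<pp> i) \<inter> X \<noteq> {}))"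
proof -
  let ?J = "{i \<in> {1..r}. variety (\<pp> i) \<inter> X \<noteq> {}}"
  have eq: "closure_wrt F P = (\<Inter>i\<in>?J. Q i)"
    by (intro set_eqI) (rule trans[OF cl inter_components_iff[OF dec, symmetric]])
  show ?thesis
  proof (intro conjI allI impI)
    fix q assume "q \<le> r" and *: "(\<forall>i\<in>{1..q}. variety (\<pp> i) \<inter> X \<noteq> {}) \<and> (\<forall>i\<in>{q+1..r}. variety (\<pp> i) \<inter> X = {})"
    have "?J = {1..q}"
    proof (intro equalityI subsetI)
      fix i assume i: "i \<in> ?J"
      then have "i \<notin> {q+1..r}" using * by blast
      with i show "i \<in> {1..q}" by auto
    qed (use * \<open>q \<le> r\<close> in auto)
    then show "closure_wrt F P = (\<Inter>i\<in>{1..q}. Q i)" by (simp only: eq)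
  next
    have "closed_wrt F P \<longleftrightarrow> P = (\<Inter>i\<in>?J. Q i)" by (simp only: closed_wrt_def eq)
    also have "\<dots> \<longleftrightarrow> ?J = {1..r}"
    proof
      assume "P = (\<Inter>i\<in>?J. Q i)"
      then show "?J = {1..r}" by (intro irredundant_inter_eq[OF dec]) auto
    next
      assume "?J = {1..r}"
      then show "P = (\<Inter>i\<in>?J. Q i)" using dec by (simp only: irredundant_primary_decomposition_def)
    qed
    also have "\<dots> \<longleftrightarrow> (\<forall>i\<in>{1..r}. variety (\<pp> i) \<inter> X \<noteq> {})" by blast
    finally show "closed_wrt F P \<longleftrightarrow> (\<forall>i\<in>{1..r}. variety (\<pp> i) \<inter> X \<noteq> {})" .
  qed
qed

theorem theorem7p2:
  fixes P :: "(('n::finite pdo)^'k::finite) set"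
  assumes "module.subspace (*s) P"
  shows
    \<comment> \<open>(i)\<close>
    "(closed_wrt distributions P \<and> closed_wrt smooth_distributions P) \<and>
     (\<forall>(r::nat) Q \<pp>. irredundant_primary_decomposition P {1..r} Q \<pp> \<longrightarrow>
        \<comment> \<open>(ii)\<close>
        ((\<forall>q\<le>r.
            (\<forall>i\<in>{1..q}. variety (\<pp> i) \<inter> real_points \<noteq> {}) \<and>
            (\<forall>i\<in>{q+1..r}. variety (\<pp> i) \<inter> real_points = {}) \<longrightarrow>
            closure_wrt tempered_distributions P = (\<Inter>i\<in>{1..q}. Q i)) \<and>
         (closed_wrt tempered_distributions P \<longleftrightarrow>
            (\<forall>i\<in>{1..r}. variety (\<pp> i) \<inter> real_points \<noteq> {}))) \<and>
        \<comment> \<open>(iii)\<close>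
        ((\<forall>q\<le>r.
            (\<forall>i\<in>{1..q}. variety (\<pp> i) \<inter> rational_points \<noteq> {}) \<and>
            (\<forall>i\<in>{q+1..r}. variety (\<pp> i) \<inter> rational_points = {}) \<longrightarrow>
            closure_wrt PT_poly_distributions P = (\<Inter>i\<in>{1..q}. Q i)) \<and>
         (closed_wrt PT_poly_distributions P \<longleftrightarrow>
            (\<forall>i\<in>{1..r}. variety (\<pp> i) \<inter> rational_points \<noteq> {}))) \<and>
        \<comment> \<open>(iv)\<close>
        ((\<forall>q\<le>r.
            (\<forall>i\<in>{1..q}. variety (\<pp> i) \<inter> integral_points \<noteq> {}) \<and>
            (\<forall>i\<in>{q+1..r}. variety (\<pp> i) \<inter> integral_points = {}) \<longrightarrow>
            closure_wrt T_poly_distributions P = (\<Inter>i\<in>{1..q}. Q i)) \<and>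
         (closed_wrt T_poly_distributions P \<longleftrightarrow>
            (\<forall>i\<in>{1..r}. variety (\<pp> i) \<inter> integral_points \<noteq> {})))) \<and>
     \<comment> \<open>(v)\<close>
     (\<forall>F\<in>{test_distributions, compactly_supported_distributions, schwartz_distributions}.
      \<forall>(r::nat) Q \<pp>.
        (\<forall>i\<in>{1..r}. \<pp> i \<noteq> {0}) \<and>
        ((\<pp> 0 = {0} \<and> irredundant_primary_decomposition P {0..r} Q \<pp>) \<or>
         (Q 0 = UNIV \<and> irredundant_primary_decomposition P {1..r} Q \<pp>)) \<longrightarrow>
        closure_wrt F P = Q 0 \<and>
        (closed_wrt F P \<longleftrightarrow> torsion_free_quotient P))"
  (is "?I \<and> ?II \<and> ?V")
proof (intro conjI)
  show "closed_wrt distributions P"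
    by (rule closed_wrt_if_exp_poly[OF assms])
      (intro distr_of_distribution smooth_continuous_on smooth_exp_poly)
  show "closed_wrt smooth_distributions P"
    by (rule closed_wrt_if_exp_poly[OF assms]) (simp add: smooth_distributions_def smooth_exp_poly)
  show ?II
    by (intro allI impI, rule conjI[OF _ conjI])
      (rule closure_wrt_components closure_wrt_tempered[OF assms]
        closure_wrt_PT_poly[OF assms] closure_wrt_T_poly[OF assms] | assumption)+
  show ?V
  proof (intro ballI allI impI)
    fix F :: "'n distr set" and r :: nat and Q \<pp>
    assume F: "F \<in> {test_distributions, compactly_supported_distributions, schwartz_distributions}"
      and dec: "(\<forall>i\<in>{1..r}. \<pp> i \<noteq> {0}) \<and>
        ((\<pp> 0 = {0} \<and> irredundant_primary_decomposition P {0..r} Q \<pp>) \<or>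
         (Q 0 = UNIV \<and> irredundant_primary_decomposition P {1..r} Q \<pp>))"
    note cl = closure_wrt_decaying[OF assms F]
    have "closure_wrt F P = Q 0"
      by (intro set_eqI) (simp only: cl torsion_component[OF conjunct1[OF dec] conjunct2[OF dec]])
    \<comment> \<open>By \<open>cl\<close>, the closure is the preimage of the torsion of the
      quotient.\<close>
    moreover have "closed_wrt F P \<longleftrightarrow> torsion_free_quotient P"
      using cl subset_closure_wrt[of P F] unfolding closed_wrt_def torsion_free_quotient_def by blast
    ultimately show "closure_wrt F P = Q 0 \<and> (closed_wrt F P \<longleftrightarrow> torsion_free_quotient P)" ..
  qed
qed

end
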